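(* Let $C\subset\mathbb P^2$ be a reduced projective plane curve over $\mathbb C$ of degree $d$ with irreducible components $C_1,\dots,C_k$, and assume $\deg C_i=d_i\geq 2$ for all $i$. Let $\nu:\overline C\to C$ be the normalization and $f:Z\to\hat{\mathbb P}^2$ the dualizing covering for $C$. Then: (1) $Z$ is a non-singular surface consisting of $k$ irreducible components, and $f$ is a finite covering of degree $d$. (2) The branch locus of $f$ is $\overline B=\hat C\cup\hat L$, where $\hat L=\bigcup_{r_p\geq 2}L_p$, the union being taken over all $p\in\overline C$ for which the multiplicity $r_p\geq 2$, and $L_p\subset\hat{\mathbb P}^2$ is the line dual to the point $\nu(p)\in C$. (3) The ramification locus of $f$ is $\overline R=\widetilde C\cup\widetilde F$, where $\widetilde F=\bigcup_{r_p\geq 2}F_p$, the union being taken over all $p\in\overline C$ for which $r_p\geq 2$. (4) The local degree $\deg_q f$ of $f$ at a point $q=F_p\cap\widetilde C$ is equal to the tangent multiplicity $s_p$, and $\deg_q f=r_p$ at all points $q\in F_p\setminus\widetilde C$. For all points $q\in\widetilde C\setminus\widetilde F$ the local degree $\deg_q f=2$.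
   Context: For $p\in\overline C$ choose homogeneous coordinates $(x_1,x_2,x_3)$ in $\mathbb P^2$ with $\nu(p)=(0,0,1)$ and a local analytic parameter $t$ in a neighbourhood $U\subset\overline C$ of $p$ such that $\nu$ is given on $U$ by $x_1=\sum_{i\geq s_p}a_it^i$, $x_2=t^{r_p}$, $x_3=1$ with $a_{s_p}\neq 0$ and $s_p>r_p\geq 1$. The integer $r_p$ is the multiplicity of the germ $\nu(U)$ at $\nu(p)$, the integer $s_p$ is the tangent multiplicity of the germ, and the line $l_p=\{x_1=0\}$ is the tangent line to $C$ at $\nu(p)$ (for the branch $p$). $\hat{\mathbb P}^2$ is the dual plane, whose points are the lines in $\mathbb P^2$. The dual curve is $\hat C=\{l_p\mid p\in\overline C\}\subset\hat{\mathbb P}^2$. For $p\in\overline C$, $L_p\subset\hat{\mathbb P}^2$ is the line dual to $\nu(p)$, i.e. the set of lines through $\nu(p)$. Let $I=\{(P,l)\in\mathbb P^2\times\hat{\mathbb P}^2\mid P\in l\}$ and let $\mathrm{pr}_1,\mathrm{pr}_2$ be the projections of $\mathbb P^2\times\hat{\mathbb P}^2$ to its factors. Put $\check C=\{(\nu(p),l_p)\in I\mid p\in\overline C\}$, $X=\mathrm{pr}_1^{-1}(C)\cap I$, let $f':X\to\hat{\mathbb P}^2$ be the restriction of $\mathrm{pr}_2$, let $\nu':Z\to X$ be the normalization of $X$, and $f=f'\circ\nu'$; $f$ is called the dualizing covering for $C$. The surface $Z$ is isomorphic to the fibre product $\overline C\times_C X$ of $\nu$ and $\mathrm{pr}_1:X\to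 C$, i.e. $Z\simeq\{(p,l)\in\overline C\times\hat{\mathbb P}^2\mid\nu(p)\in l\}$. It carries the ruled structure $\rho:Z\to\overline C$, $(p,l)\mapsto p$, with fibres $F_p=\rho^{-1}(p)\simeq\mathbb P^1$ and $f(F_p)=L_p$. The curve $\widetilde C=\nu'^{-1}(\check C)\subset Z$ is a section of $\rho$, whose point over $p\in\overline C$ is $(p,l_p)$. The local degree $\deg_q f$ of $f$ at $q\in Z$ is the number of points in $V\cap f^{-1}(y)$, where $V$ is a sufficiently small connected neighbourhood of $q$ (a connected component of the preimage of a small neighbourhood of $f(q)$) and $y$ is a generic point close to $f(q)$. The ramification locus is the set of points where $f$ is not a local isomorphism, and the branch locus is its image.
   Formalization: The last sentence of (4), false at inflection points (r_p=1, s_p≥3, where deg_q f=s_p by the first sentence, e.g. flexes of a smooth cubic), is stated only for q in C~\F~ not over such points; these are also shown to be finitely many. *)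

theory Defs
  imports
    "HOL-Analysis.Analysis"
    "HOL-Computational_Algebra.Polynomial_Factorial"
    "HOL-Computational_Algebra.Squarefree"
begin

section \<open>The projective plane\<close>

typedef proj2 = "{L :: (complex^3) set. \<exists>v. v \<noteq> 0 \<and> L = range (\<lambda>c. c *s v)}"
  morphisms line_in_space Abs_proj2
  by (rule exI[of _ "range (\<lambda>c. c *s (axis 1 1 :: complex^3))"]) (auto simp: axis_eq_0_iff intro!: exI[of _ "axis 1 1"])

definition pt :: "complex^3 \<Rightarrow> proj2" where
  "pt v = Abs_proj2 (range (\<lambda>c. c *s v))"

definition hom_coords :: "proj2 \<Rightarrow> (complex^3) set" where
  "hom_coords P = line_in_space P - {0}"

lemma hom_coords_pt:
  assumes "v \<noteq> 0"
  shows "hom_coords (pt v) = {c *s v | c. c \<noteq> 0}"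
proof -
  have "line_in_space (pt v) = range (\<lambda>c. c *s v)"
    unfolding pt_def using assms by (intro Abs_proj2_inverse) auto
  then show ?thesis
    using assms by (auto simp: hom_coords_def)
qed

lemma pt_surj: "\<exists>v. v \<noteq> 0 \<and> P = pt v"
proof -
  obtain v where "v \<noteq> 0" "line_in_space P = range (\<lambda>c. c *s v)"
    using line_in_space[of P] by auto
  then show ?thesis
    by (metis line_in_space_inverse pt_def)
qed

lemma pt_scale: "c \<noteq> 0 \<Longrightarrow> pt (c *s v) = pt v"
proof -
  assume c: "c \<noteq> 0"
  have "range (\<lambda>a. a *s (c *s v)) = range (\<lambda>a. a *s v)"
  proof
    show "range (\<lambda>a. a *s v) \<subseteq> range (\<lambda>a. a *s (c *s v))"
    proof
      fix x assume "x \<in> range (\<lambda>a. a *s v)"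
      then obtain a where "x = a *s v" by auto
      then have "x = (a / c) *s (c *s v)" using c by simp
      then show "x \<in> range (\<lambda>a. a *s (c *s v))" by blast
    qed
  qed auto
  then show ?thesis by (simp add: pt_def)
qed

instantiation proj2 :: topological_space
begin

definition open_proj2 :: "proj2 set \<Rightarrow> bool" where
  "open_proj2 U \<longleftrightarrow> open {v. v \<noteq> 0 \<and> pt v \<in> U}"

instance
proof
  have "{v. v \<noteq> 0 \<and> pt v \<in> UNIV} = - {0}" by auto
  then show "open (UNIV :: proj2 set)" unfolding open_proj2_def by auto
next
  fix S T :: "proj2 set"
  assume "open S" "open T"
  then have "open ({v. v \<noteq> 0 \<and> pt v \<in> S} \<inter> {v. v \<noteq> 0 \<and> pt v \<in> T})"
    unfolding open_proj2_def by auto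
  moreover have "{v. v \<noteq> 0 \<and> pt v \<in> S} \<inter> {v. v \<noteq> 0 \<and> pt v \<in> T} = {v. v \<noteq> 0 \<and> pt v \<in> S \<inter> T}"
    by auto
  ultimately show "open (S \<inter> T)" unfolding open_proj2_def by simp
next
  fix K :: "proj2 set set"
  assume "\<forall>S\<in>K. open S"
  then have "open (\<Union>S\<in>K. {v. v \<noteq> 0 \<and> pt v \<in> S})"
    unfolding open_proj2_def by auto
  moreover have "(\<Union>S\<in>K. {v. v \<noteq> 0 \<and> pt v \<in> S}) = {v. v \<noteq> 0 \<and> pt v \<in> \<Union>K}"
    by auto
  ultimately show "open (\<Union>K)" unfolding open_proj2_def by simp
qed

end

instance proj2 :: t2_space
proof
  fix P Q :: proj2
  assume PQ: "P \<noteq> Q"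
  obtain v w where v: "v \<noteq> 0" "P = pt v" and w: "w \<noteq> 0" "Q = pt w"
    using pt_surj by metis
  define g :: "complex^3 \<Rightarrow> real" where
    "g x = (\<Sum>i\<in>UNIV. \<Sum>j\<in>UNIV. norm (v $ i * x $ j - v $ j * x $ i)) / norm x" for x
  have g_cont: "continuous_on (- {0}) g"
    unfolding g_def by (intro continuous_intros) auto
  have norm_scale: "norm (c *s x) = norm c * norm x" for c and x :: "complex^3"
    by (simp add: norm_vec_def L2_set_def norm_mult power_mult_distrib sum_distrib_left[symmetric] real_sqrt_mult)
  have g_scale: "g (c *s x) = g x" if c: "c \<noteq> 0" for c x
  proof -
    have "norm (v $ i * (c *s x) $ j - v $ j * (c *s x) $ i) = norm c * norm (v $ i * x $ j - v $ j * x $ i)" for i j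
    proof -
      have "v $ i * (c *s x) $ j - v $ j * (c *s x) $ i = c * (v $ i * x $ j - v $ j * x $ i)"
        by (simp add: algebra_simps)
      then show ?thesis by (simp add: norm_mult)
    qed
    then show ?thesis
      using c by (simp add: g_def norm_scale sum_distrib_left[symmetric])
  qed
  have g_eq: "g x = g y" if "x \<noteq> 0" "y \<noteq> 0" "pt x = pt y" for x y
  proof -
    have "y \<in> hom_coords (pt x)"
      using hom_coords_pt[of y] that by (auto intro!: exI[of _ 1])
    then show ?thesis using hom_coords_pt[of x] that g_scale by auto
  qed
  have gv: "g v = 0" by (simp add: g_def mult.commute)
  have gw: "g w > 0"
  proof (rule ccontr)
    assume neg: "\<not> g w > 0"
    have "g w \<ge> 0" by (auto simp: g_def intro!: divide_nonneg_nonneg sum_nonneg)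
    then have "g w = 0" using neg by simp
    then have z: "(\<Sum>i\<in>UNIV. \<Sum>j\<in>UNIV. norm (v $ i * w $ j - v $ j * w $ i)) = 0"
      using w by (simp add: g_def)
    then have cross: "v $ i * w $ j = v $ j * w $ i" for i j
      by (subst (asm) sum_nonneg_eq_0_iff) (auto simp: sum_nonneg sum_nonneg_eq_0_iff)
    obtain i where i: "v $ i \<noteq> 0" using v by (auto simp: vec_eq_iff)
    have wv: "w = (w $ i / v $ i) *s v"
      using i cross[of i] by (auto simp: vec_eq_iff field_simps)
    then have "w $ i / v $ i \<noteq> 0" using w(1) by (metis vector_smult_lzero)
    then show False using wv pt_scale v w PQ by metis
  qed
  define U where "U = {R. \<forall>x. x \<noteq> 0 \<and> pt x = R \<longrightarrow> g x < g w / 2}"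
  define V where "V = {R. \<forall>x. x \<noteq> 0 \<and> pt x = R \<longrightarrow> g x > g w / 2}"
  have U: "pt x \<in> U \<longleftrightarrow> g x < g w / 2" if "x \<noteq> 0" for x
    using that g_eq unfolding U_def mem_Collect_eq by metis
  have V: "pt x \<in> V \<longleftrightarrow> g x > g w / 2" if "x \<noteq> 0" for x
    using that g_eq unfolding V_def mem_Collect_eq by metis
  have "{x. x \<noteq> 0 \<and> pt x \<in> U} = (- {0}) \<inter> g -` {..<g w / 2}"
    using U by auto
  moreover have "{x. x \<noteq> 0 \<and> pt x \<in> V} = (- {0}) \<inter> g -` {g w / 2<..}"
    using V by auto
  moreover have "open ((- {0}) \<inter> g -` {..<g w / 2})" "open ((- {0}) \<inter> g -` {g w / 2<..})"
    using g_cont by (auto intro!: continuous_open_preimage)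
  ultimately have "open U" "open V" unfolding open_proj2_def by auto
  moreover have "P \<in> U" "Q \<in> V"
    using U V v w gv gw by simp_all
  moreover have "U \<inter> V = {}"
  proof (rule ccontr)
    assume "U \<inter> V \<noteq> {}"
    then obtain R where R: "R \<in> U" "R \<in> V" by auto
    obtain x where "x \<noteq> 0" "R = pt x" using pt_surj by metis
    then have "g x < g w / 2" "g x > g w / 2" using R U V by simp_all
    then show False by simp
  qed
  ultimately show "\<exists>U V. open U \<and> open V \<and> P \<in> U \<and> Q \<in> V \<and> U \<inter> V = {}" by blast
qed

text \<open>
  The dual plane is a second copy of \<^typ>\<open>proj2\<close>: the point with homogeneous coordinates
  \<open>(a\<^sub>1, a\<^sub>2, a\<^sub>3)\<close> is the line \<open>a\<^sub>1 x\<^sub>1 + a\<^sub>2 x\<^sub>2 + a\<^sub>3 x\<^sub>3 = 0\<close>.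
\<close>

definition incident :: "proj2 \<Rightarrow> proj2 \<Rightarrow> bool" where
  "incident P l \<longleftrightarrow> (\<forall>x\<in>hom_coords P. \<forall>a\<in>hom_coords l. (\<Sum>i\<in>UNIV. a $ i * x $ i) = 0)"


section \<open>Plane algebraic curves\<close>

text \<open>
  Polynomials in three variables are iterated univariate polynomials; the coefficient of
  \<open>x\<^sub>1\<^sup>i x\<^sub>2\<^sup>j x\<^sub>3\<^sup>k\<close> in \<open>F\<close> is \<open>coeff (coeff (coeff F i) j) k\<close>.
\<close>

type_synonym poly3 = "complex poly poly poly"

definition eval3 :: "poly3 \<Rightarrow> complex^3 \<Rightarrow> complex" where
  "eval3 F x = poly (poly (poly F [:[:x $ 1:]:]) [:x $ 2:]) (x $ 3)"

definition homogeneous :: "nat \<Rightarrow> poly3 \<Rightarrow> bool" where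
  "homogeneous n F \<longleftrightarrow> (\<forall>i j k. coeff (coeff (coeff F i) j) k \<noteq> 0 \<longrightarrow> i + j + k = n)"

definition zero_locus :: "poly3 \<Rightarrow> proj2 set" where
  "zero_locus F = {P. \<forall>x\<in>hom_coords P. eval3 F x = 0}"

text \<open>A reduced curve is identified with its set of points; its degree is the degree of a
  square-free equation.\<close>

definition reduced_plane_curve :: "proj2 set \<Rightarrow> nat \<Rightarrow> bool" where
  "reduced_plane_curve C d \<longleftrightarrow>
     d \<ge> 1 \<and> (\<exists>F. homogeneous d F \<and> squarefree F \<and> C = zero_locus F)"

definition zariski_closed :: "proj2 set \<Rightarrow> bool" where
  "zariski_closed S \<longleftrightarrow>
     (\<exists>\<F>. (\<forall>F\<in>\<F>. \<exists>n. homogeneous n F) \<and> S = (\<Inter>F\<in>\<F>. zero_locus F))"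

text \<open>Irreducibility with respect to a given notion of closed set (Zariski closed in the plane,
  analytic in a complex manifold).\<close>

definition irreducible_set :: "('a set \<Rightarrow> bool) \<Rightarrow> 'a set \<Rightarrow> bool" where
  "irreducible_set cl S \<longleftrightarrow>
     cl S \<and> S \<noteq> {} \<and> (\<forall>A B. cl A \<and> cl B \<and> S = A \<union> B \<longrightarrow> S = A \<or> S = B)"

definition irr_components :: "('a set \<Rightarrow> bool) \<Rightarrow> 'a set \<Rightarrow> 'a set set" where
  "irr_components cl S =
     {T. T \<subseteq> S \<and> irreducible_set cl T \<and>
         (\<forall>T'. irreducible_set cl T' \<and> T \<subseteq> T' \<and> T' \<subseteq> S \<longrightarrow> T' = T)}"


section \<open>Complex manifolds and holomorphic maps\<close>

text \<open>Used only for open \<open>S\<close>.\<close>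

definition hol :: "(complex^'n \<Rightarrow> complex) \<Rightarrow> (complex^'n) set \<Rightarrow> bool" where
  "hol f S \<longleftrightarrow>
     (\<forall>x\<in>S. \<exists>f'. (f has_derivative f') (at x) \<and> (\<forall>c v. f' (c *s v) = c * f' v))"

type_synonym ('a, 'n) atlas = "('a set \<times> ('a \<Rightarrow> complex^'n)) set"

definition mfd_points :: "('a, 'n) atlas \<Rightarrow> 'a set" where
  "mfd_points A = \<Union>(fst ` A)"

definition mopen :: "('a::topological_space, 'n) atlas \<Rightarrow> 'a set \<Rightarrow> bool" where
  "mopen A U \<longleftrightarrow> openin (top_of_set (mfd_points A)) U"

text \<open>The manifold is \<^term>\<open>mfd_points A\<close> with the subspace topology of the ambient type;
  its dimension is the cardinality of the index type \<open>'n\<close>.\<close>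

definition complex_manifold :: "('a::t2_space, 'n::finite) atlas \<Rightarrow> bool" where
  "complex_manifold A \<longleftrightarrow>
     (\<forall>(U, \<phi>)\<in>A. mopen A U \<and> open (\<phi> ` U) \<and> homeomorphism U (\<phi> ` U) \<phi> (inv_into U \<phi>)) \<and>
     (\<forall>(U, \<phi>)\<in>A. \<forall>(V, \<psi>)\<in>A. \<forall>j. hol (\<lambda>z. \<psi> (inv_into U \<phi> z) $ j) (\<phi> ` (U \<inter> V)))"

definition hol_fun :: "('a, 'n::finite) atlas \<Rightarrow> 'a set \<Rightarrow> ('a \<Rightarrow> complex) \<Rightarrow> bool" where
  "hol_fun A W h \<longleftrightarrow> (\<forall>(U, \<phi>)\<in>A. hol (\<lambda>z. h (inv_into U \<phi> z)) (\<phi> ` (U \<inter> W)))"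

definition hol_map ::
  "('a::topological_space, 'n::finite) atlas \<Rightarrow> ('b::topological_space, 'm::finite) atlas
     \<Rightarrow> 'a set \<Rightarrow> ('a \<Rightarrow> 'b) \<Rightarrow> bool" where
  "hol_map A B W f \<longleftrightarrow>
     continuous_on W f \<and> f ` W \<subseteq> mfd_points B \<and>
     (\<forall>(V, \<psi>)\<in>B. \<forall>j. hol_fun A (W \<inter> f -` V) (\<lambda>x. \<psi> (f x) $ j))"

definition biholomorphic ::
  "('a::topological_space, 'n::finite) atlas \<Rightarrow> ('b::topological_space, 'm::finite) atlas
     \<Rightarrow> 'a set \<Rightarrow> 'b set \<Rightarrow> ('a \<Rightarrow> 'b) \<Rightarrow> bool" where
  "biholomorphic A B U V f \<longleftrightarrow>
     mopen A U \<and> mopen B V \<and> bij_betw f U V \<and>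
     hol_map A B U f \<and> hol_map B A V (inv_into U f)"

definition local_isomorphism_at ::
  "('a::topological_space, 'n::finite) atlas \<Rightarrow> ('b::topological_space, 'm::finite) atlas
     \<Rightarrow> ('a \<Rightarrow> 'b) \<Rightarrow> 'a \<Rightarrow> bool" where
  "local_isomorphism_at A B f q \<longleftrightarrow> (\<exists>U V. q \<in> U \<and> biholomorphic A B U V f)"

definition std_atlas :: "(complex^'n, 'n) atlas" where
  "std_atlas = {(UNIV, \<lambda>z. z)}"

text \<open>The affine charts \<open>x\<^sub>i \<noteq> 0\<close>; the index arithmetic is modulo 3, and the choice of homogeneous
  coordinates is irrelevant.\<close>

definition proj2_atlas :: "(proj2, 2) atlas" where
  "proj2_atlas = range (\<lambda>i :: 3.
     ({P. \<forall>x\<in>hom_coords P. x $ i \<noteq> 0},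
      \<lambda>P. let x = (SOME x. x \<in> hom_coords P) in vector [x $ (i + 1) / x $ i, x $ (i + 2) / x $ i]))"

definition prod_atlas ::
  "('a, 'n::finite) atlas \<Rightarrow> ('b, 'm::finite) atlas \<Rightarrow> ('a \<times> 'b, 'n + 'm) atlas" where
  "prod_atlas A B =
     {(U \<times> V, \<lambda>(x, y). \<chi> k. case k of Inl i \<Rightarrow> \<phi> x $ i | Inr j \<Rightarrow> \<psi> y $ j) | U \<phi> V \<psi>.
        (U, \<phi>) \<in> A \<and> (V, \<psi>) \<in> B}"

text \<open>
  A subset \<open>Z\<close> of a manifold carries the functions that are locally restrictions of holomorphic
  functions on the manifold. The induced atlas consists of all biholomorphic identifications of
  relatively open subsets of \<open>Z\<close> with open subsets of \<open>\<complex>\<^sup>m\<close>. So \<^term>\<open>mfd_points (induced_atlas A Z)\<close>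
  is the set of points near which \<open>Z\<close> is a nonsingular analytic set of dimension \<open>m\<close>.
\<close>

definition induced_atlas ::
  "('a::topological_space, 'n::finite) atlas \<Rightarrow> 'a set \<Rightarrow> ('a, 'm::finite) atlas" where
  "induced_atlas A Z =
     {(U, \<phi>). openin (top_of_set Z) U \<and> open (\<phi> ` U) \<and> inj_on \<phi> U \<and>
        (\<forall>x\<in>U. \<exists>W h. mopen A W \<and> x \<in> W \<and> hol_map A std_atlas W h \<and> (\<forall>y\<in>W \<inter> U. \<phi> y = h y)) \<and>
        hol_map std_atlas A (\<phi> ` U) (inv_into U \<phi>)}"

definition analytic_subset ::
  "('a::topological_space, 'n::finite) atlas \<Rightarrow> 'a set \<Rightarrow> 'a set \<Rightarrow> bool" where
  "analytic_subset A W N \<longleftrightarrow>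
     mopen A W \<and> N \<subseteq> W \<and>
     (\<forall>x\<in>W. \<exists>U H. mopen A U \<and> x \<in> U \<and> U \<subseteq> W \<and> finite H \<and> (\<forall>h\<in>H. hol_fun A U h) \<and>
        N \<inter> U = {y \<in> U. \<forall>h\<in>H. h y = 0})"

definition finite_map :: "'a::topological_space set \<Rightarrow> 'b::topological_space set \<Rightarrow> ('a \<Rightarrow> 'b) \<Rightarrow> bool" where
  "finite_map S X f \<longleftrightarrow>
     proper_map (top_of_set S) (top_of_set X) f \<and> (\<forall>y\<in>X. finite {x \<in> S. f x = y})"

text \<open>
  A complex manifold \<^term>\<open>mfd_points A\<close> with a map \<open>n\<close> is a normalization of the reduced analytic
  subset \<open>X\<close> of \<^term>\<open>mfd_points B\<close>: the map is finite and surjective and, away from a thin analytic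
  subset with nowhere dense preimage, biholomorphic onto its image. Holomorphy of the inverse is
  meant with respect to the structure of \<open>X\<close> as a subset, i.e. locally it extends to a holomorphic
  map on an open subset of the ambient manifold. (In general the source is a normal space;
  manifolds are normal, and normalizations are unique up to isomorphism.)
\<close>

definition is_normalization ::
  "('a::t2_space, 'n::finite) atlas \<Rightarrow> ('b::topological_space, 'm::finite) atlas
     \<Rightarrow> 'b set \<Rightarrow> ('a \<Rightarrow> 'b) \<Rightarrow> bool" where
  "is_normalization A B X n \<longleftrightarrow>
     complex_manifold A \<and> hol_map A B (mfd_points A) n \<and> n ` mfd_points A = X \<and> finite_map (mfd_points A) X n \<and>
     (\<exists>N. analytic_subset B (mfd_points B) N \<and> N \<subseteq> X \<and>
        X \<subseteq> closure (X - N) \<and> mfd_points A \<subseteq> closure (mfd_points A - n -` N) \<and>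
        (\<forall>x\<in>X - N. \<exists>W g. mopen B W \<and> x \<in> W \<and> hol_map B A W g \<and>
           (\<forall>q\<in>mfd_points A - n -` N. n q \<in> W \<longrightarrow> g (n q) = q)))"

text \<open>Finite (ramified) coverings: outside a thin analytic subset of the base, the map is
  unramified with \<open>d\<close> sheets.\<close>

definition finite_covering ::
  "('a::topological_space, 'n::finite) atlas \<Rightarrow> ('b::topological_space, 'm::finite) atlas
     \<Rightarrow> ('a \<Rightarrow> 'b) \<Rightarrow> nat \<Rightarrow> bool" where
  "finite_covering A B f d \<longleftrightarrow>
     hol_map A B (mfd_points A) f \<and> f ` mfd_points A = mfd_points B \<and> finite_map (mfd_points A) (mfd_points B) f \<and>
     (\<exists>T. analytic_subset B (mfd_points B) T \<and>
        mfd_points B \<subseteq> closure (mfd_points B - T) \<and> mfd_points A \<subseteq> closure (mfd_points A - f -` T) \<and>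
        (\<forall>q\<in>mfd_points A - f -` T. local_isomorphism_at A B f q) \<and>
        (\<forall>y\<in>mfd_points B - T. card {q \<in> mfd_points A. f q = y} = d))"

definition ramification_locus ::
  "('a::topological_space, 'n::finite) atlas \<Rightarrow> ('b::topological_space, 'm::finite) atlas
     \<Rightarrow> ('a \<Rightarrow> 'b) \<Rightarrow> 'a set" where
  "ramification_locus A B f = {q \<in> mfd_points A. \<not> local_isomorphism_at A B f q}"

definition branch_locus ::
  "('a::topological_space, 'n::finite) atlas \<Rightarrow> ('b::topological_space, 'm::finite) atlas
     \<Rightarrow> ('a \<Rightarrow> 'b) \<Rightarrow> 'b set" where
  "branch_locus A B f = f ` ramification_locus A B f"

text \<open>``Generic'' means outside a thin analytic subset of the small neighbourhood \<open>W\<close>.\<close>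

definition has_local_degree ::
  "('a::topological_space, 'n::finite) atlas \<Rightarrow> ('b::topological_space, 'm::finite) atlas
     \<Rightarrow> ('a \<Rightarrow> 'b) \<Rightarrow> 'a \<Rightarrow> nat \<Rightarrow> bool" where
  "has_local_degree A B f q n \<longleftrightarrow>
     (\<exists>W\<^sub>0. mopen B W\<^sub>0 \<and> f q \<in> W\<^sub>0 \<and>
       (\<forall>W. mopen B W \<and> connected W \<and> f q \<in> W \<and> W \<subseteq> W\<^sub>0 \<longrightarrow>
         (\<exists>T. analytic_subset B W T \<and> W \<subseteq> closure (W - T) \<and>
           (\<forall>y\<in>W - T. card {x \<in> connected_component_set (mfd_points A \<inter> f -` W) q. f x = y} = n))))"


section \<open>Branches of a parametrized plane curve\<close>

definition local_parameter :: "('a::topological_space, 1) atlas \<Rightarrow> 'a \<Rightarrow> 'a set \<Rightarrow> ('a \<Rightarrow> complex) \<Rightarrow> bool" where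
  "local_parameter A p U t \<longleftrightarrow>
     p \<in> U \<and> t p = 0 \<and>
     biholomorphic A std_atlas U ((\<lambda>u. vec (t u)) ` U) (\<lambda>u. vec (t u) :: complex^1)"

text \<open>
  In the homogeneous coordinates \<open>G *v y\<close> the map \<open>\<nu>\<close> is given near \<open>p\<close> by
  \<open>x\<^sub>1 = \<Sum>i\<ge>s. a\<^sub>i t\<^sup>i\<close>, \<open>x\<^sub>2 = t\<^sup>r\<close>, \<open>x\<^sub>3 = 1\<close>; the line \<open>x\<^sub>1 = 0\<close> has the first row of \<open>G\<close> as its
  coefficients.
\<close>

definition branch_form ::
  "('a::topological_space, 1) atlas \<Rightarrow> ('a \<Rightarrow> proj2) \<Rightarrow> 'a \<Rightarrow> nat \<Rightarrow> nat \<Rightarrow> proj2 \<Rightarrow> bool" where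
  "branch_form A \<nu> p r s l \<longleftrightarrow>
     1 \<le> r \<and> r < s \<and>
     (\<exists>(G :: complex^3^3) U t a. invertible G \<and> local_parameter A p U t \<and>
        a s \<noteq> 0 \<and> (\<forall>i<s. a i = 0) \<and> l = pt (G $ 1) \<and>
        (\<forall>u\<in>U. \<exists>y. \<nu> u = pt y \<and>
           (\<lambda>i. a i * t u ^ i) sums ((G *v y) $ 1) \<and> (G *v y) $ 2 = t u ^ r \<and> (G *v y) $ 3 = 1))"

definition branch_mult :: "('a::topological_space, 1) atlas \<Rightarrow> ('a \<Rightarrow> proj2) \<Rightarrow> 'a \<Rightarrow> nat" where
  "branch_mult A \<nu> p = (THE r. \<exists>s l. branch_form A \<nu> p r s l)"

definition tangent_mult :: "('a::topological_space, 1) atlas \<Rightarrow> ('a \<Rightarrow> proj2) \<Rightarrow> 'a \<Rightarrow> nat" where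
  "tangent_mult A \<nu> p = (THE s. \<exists>r l. branch_form A \<nu> p r s l)"

definition tangent_line :: "('a::topological_space, 1) atlas \<Rightarrow> ('a \<Rightarrow> proj2) \<Rightarrow> 'a \<Rightarrow> proj2" where
  "tangent_line A \<nu> p = (THE l. \<exists>r s. branch_form A \<nu> p r s l)"


section \<open>The dualizing covering\<close>

definition incidence_surface :: "proj2 set \<Rightarrow> (proj2 \<times> proj2) set" where
  "incidence_surface C = {(P, l). P \<in> C \<and> incident P l}"

text \<open>The normalization of the incidence surface is realized as the fibre product of \<open>\<nu>\<close> and the
  first projection.\<close>

definition dc_space :: "('a \<Rightarrow> proj2) \<Rightarrow> ('a \<times> proj2) set" where
  "dc_space \<nu> = {(p, l). incident (\<nu> p) l}"

definition dc_normalization :: "('a \<Rightarrow> proj2) \<Rightarrow> 'a \<times> proj2 \<Rightarrow> proj2 \<times> proj2" where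
  "dc_normalization \<nu> = (\<lambda>(p, l). (\<nu> p, l))"

definition dc_atlas :: "('a::topological_space, 1) atlas \<Rightarrow> ('a \<Rightarrow> proj2) \<Rightarrow> ('a \<times> proj2, 2) atlas" where
  "dc_atlas A \<nu> = induced_atlas (prod_atlas A proj2_atlas) (dc_space \<nu>)"

definition dualizing_covering :: "('a \<Rightarrow> proj2) \<Rightarrow> 'a \<times> proj2 \<Rightarrow> proj2" where
  "dualizing_covering \<nu> = snd \<circ> dc_normalization \<nu>"

definition dual_curve :: "('a::topological_space, 1) atlas \<Rightarrow> ('a \<Rightarrow> proj2) \<Rightarrow> proj2 set" where
  "dual_curve A \<nu> = range (tangent_line A \<nu>)"

definition dual_line :: "('a \<Rightarrow> proj2) \<Rightarrow> 'a \<Rightarrow> proj2 set" where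
  "dual_line \<nu> p = {l. incident (\<nu> p) l}"

definition dc_fibre :: "('a \<Rightarrow> proj2) \<Rightarrow> 'a \<Rightarrow> ('a \<times> proj2) set" where
  "dc_fibre \<nu> p = {q \<in> dc_space \<nu>. fst q = p}"

text \<open>The section \<open>p \<mapsto> (p, l\<^sub>p)\<close>. Over a point of the curve with several branches it is smaller
  than the full preimage of \<open>{(\<nu>(p), l\<^sub>p)}\<close>, which may contain further isolated points
  \<open>(p, l\<^sub>p\<^sub>')\<close> with \<open>\<nu>(p) = \<nu>(p')\<close>.\<close>

definition dc_section :: "('a::topological_space, 1) atlas \<Rightarrow> ('a \<Rightarrow> proj2) \<Rightarrow> ('a \<times> proj2) set" where
  "dc_section A \<nu> = range (\<lambda>p. (p, tangent_line A \<nu> p))"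

definition singular_dual_lines :: "('a::topological_space, 1) atlas \<Rightarrow> ('a \<Rightarrow> proj2) \<Rightarrow> proj2 set" where
  "singular_dual_lines A \<nu> = (\<Union>p\<in>{p. branch_mult A \<nu> p \<ge> 2}. dual_line \<nu> p)"

definition singular_fibres :: "('a::topological_space, 1) atlas \<Rightarrow> ('a \<Rightarrow> proj2) \<Rightarrow> ('a \<times> proj2) set" where
  "singular_fibres A \<nu> = (\<Union>p\<in>{p. branch_mult A \<nu> p \<ge> 2}. dc_fibre \<nu> p)"

text \<open>Smooth branches of which the tangent line has contact of order at least 3.\<close>

definition inflection_points :: "('a::topological_space, 1) atlas \<Rightarrow> ('a \<Rightarrow> proj2) \<Rightarrow> 'a set" where
  "inflection_points A \<nu> = {p. branch_mult A \<nu> p = 1 \<and> tangent_mult A \<nu> p \<ge> 3}"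

end

theory Submission
  imports Defs "HOL-Complex_Analysis.Complex_Analysis" "Subresultants.Subresultant_Gcd"
    "HOL-Computational_Algebra.Field_as_Ring" "HOL-Computational_Algebra.Fundamental_Theorem_Algebra"
begin

text \<open>
  Near a point \<open>(p, l)\<close> write \<open>\<nu>(t) = (u(t) : w(t) : 1)\<close> in coordinates with \<open>\<nu>(p) = (0 : 0 : 1)\<close> and
  \<open>l = (1 : m\<^sub>0 : 0)\<close>. Then \<open>Z\<close> has the coordinates \<open>(t, m)\<close>, and the dualizing covering is
  \<open>(t, m) \<mapsto> (1 : m : - u(t) - m w(t))\<close>. Its fibres near \<open>(p, l)\<close> are the zeros of a small perturbation
  of \<open>u + m\<^sub>0 w\<close>, so by Rouche's theorem the local degree is the order of \<open>u + m\<^sub>0 w\<close> at 0: it is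
  \<open>s\<^sub>p\<close> for the tangent line and \<open>r\<^sub>p\<close> for every other line through \<open>\<nu>(p)\<close>. The map is a local
  isomorphism exactly where this order is 1.

  The lines that meet \<open>C\<close> in fewer than \<open>d\<close> points are the zeros of a discriminant, and all other
  lines are transversal to every branch; this gives the degree. The irreducible components of \<open>C\<close>
  correspond to the connected components \<open>S\<close> of the normalization: over a generic pencil of lines,
  the coefficients of \<open>\<Prod>(g - g\<^sub>i(x))\<close>, taken over the sheets in \<open>S\<close>, are holomorphic functions of
  polynomial growth, hence polynomials, so that up to finitely many points \<open>\<nu>(S)\<close> is the
  intersection of \<open>C\<close> with the zero set of one homogeneous polynomial.
\<close>

no_notation Matrix.vec_index (infixl "$" 100)
no_notation Matrix.mult_mat_vec (infixl "*\<^sub>v" 70)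
no_notation fps_nth (infixl "$" 75)
hide_const (open) Matrix.vec Matrix.mat Matrix.row Matrix.rows Determinant.det module.smult
hide_fact (open) Matrix.vec_eq_iff

section \<open>Ternary polynomials as functions\<close>

text \<open>The invariants r, s and l are defined by definite description over coordinate choices.
  They are tied to a coordinate free notion: the orders of contact of the branch with lines form the
  set {0, r, s}, and only the tangent line has order s. These orders exist because no component is a
  line, which is where d_i >= 2 enters.

  The normalization is given abstractly and is known to be injective only off a thin set. On a line
  with d distinct points this is repaired: there the curve is a graph, and a second preimage or a
  higher order of contact would give two generic points with one image.

  The local degree refers to a connected component, about which a count of zeros says nothing. But f
  is open and Z is compact, so a nonempty clopen piece of the preimage of a connected W maps onto W;
  hence a clopen piece with one point over f(q) is connected.

  On the section with r_p = 1 the local degree is s_p, which is 2 only away from inflection points.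
  The formal statement therefore asserts degree 2 off the inflection points and adds that they are
  finite in number.\<close>

definition monom3 :: "complex \<Rightarrow> nat \<Rightarrow> nat \<Rightarrow> nat \<Rightarrow> poly3" where
  "monom3 c i j k = monom (monom (monom c k) j) i"

lemma eval3_monom3: "eval3 (monom3 c i j k) x = c * x $ 1 ^ i * x $ 2 ^ j * x $ 3 ^ k"
  by (simp add: eval3_def monom3_def poly_monom poly_mult poly_power mult_ac)

lemma coeff_monom3:
  "coeff (coeff (coeff (monom3 c i j k) i') j') k' = (if i = i' \<and> j = j' \<and> k = k' then c else 0)"
  by (auto simp: monom3_def)

lemma eval3_0 [simp]: "eval3 0 x = 0"
  and eval3_1 [simp]: "eval3 1 x = 1"
  and eval3_add: "eval3 (F + G) x = eval3 F x + eval3 G x"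
  and eval3_diff: "eval3 (F - G) x = eval3 F x - eval3 G x"
  and eval3_mult: "eval3 (F * G) x = eval3 F x * eval3 G x"
  by (simp_all add: eval3_def)

lemma eval3_sum: "eval3 (sum g I) x = (\<Sum>i\<in>I. eval3 (g i) x)"
  by (induction I rule: infinite_finite_induct) (simp_all add: eval3_add)

lemma eval3_power: "eval3 (F ^ n) x = eval3 F x ^ n"
  by (induction n) (simp_all add: eval3_mult)

lemma poly3_as_sum:
  "F = (\<Sum>i\<le>degree F. \<Sum>j\<le>degree (coeff F i). \<Sum>k\<le>degree (coeff (coeff F i) j).
          monom3 (coeff (coeff (coeff F i) j) k) i j k)"
proof -
  have m: "monom (sum g J) n = (\<Sum>j\<in>J. monom (g j) n)" for g :: "nat \<Rightarrow> 'b::comm_monoid_add" and J n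
    by (induction J rule: infinite_finite_induct) (simp_all add: add_monom[symmetric])
  have "F = (\<Sum>i\<le>degree F. monom (coeff F i) i)"
    by (rule poly_as_sum_of_monoms[symmetric])
  also have "\<dots> = (\<Sum>i\<le>degree F. monom (\<Sum>j\<le>degree (coeff F i). monom (\<Sum>k\<le>degree (coeff (coeff F i) j).
          monom (coeff (coeff (coeff F i) j) k) k) j) i)"
    by (simp add: poly_as_sum_of_monoms)
  finally show ?thesis
    by (simp add: monom3_def m)
qed

lemma poly3_induct [case_names monom add]:
  assumes "\<And>c i j k. P (monom3 c i j k)" and "\<And>F G. P F \<Longrightarrow> P G \<Longrightarrow> P (F + G)"
  shows "P (F :: poly3)"
proof -
  have z: "P 0" using assms(1)[of 0 0 0 0] by (simp add: monom3_def)
  have s: "P (sum g I)" if "\<And>i. i \<in> I \<Longrightarrow> P (g i)" for g and I :: "nat set"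
    using that by (induction I rule: infinite_finite_induct) (auto intro: z assms(2))
  show ?thesis
    by (subst poly3_as_sum) (intro s assms(1))
qed

text \<open>A nonzero polynomial over an integral domain has finitely many roots, while the
  constants already give infinitely many. This is applied to one variable after the other.\<close>

lemma eval3_eq_0D:
  assumes "\<And>x. eval3 F x = 0"
  shows "F = 0"
proof -
  have "poly F [:[:a:]:] = 0" for a
  proof -
    have "poly (poly F [:[:a:]:]) [:b:] = 0" for b
    proof -
      have "poly (poly (poly F [:[:a:]:]) [:b:]) c = 0" for c
        using assms[of "vector [a, b, c]"] by (simp add: eval3_def)
      then show ?thesis by (simp flip: poly_all_0_iff_0)
    qed
    then have "range (\<lambda>b. [:b:]) \<subseteq> {x. poly (poly F [:[:a:]:]) x = 0}" by auto
    moreover have "infinite (range (\<lambda>b::complex. [:b:]))"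
      by (subst finite_image_iff) (auto simp: inj_def infinite_UNIV_char_0)
    ultimately show ?thesis by (metis finite_subset poly_roots_finite)
  qed
  then have "range (\<lambda>b. [:[:b:]:]) \<subseteq> {x. poly F x = 0}" by auto
  moreover have "infinite (range (\<lambda>b::complex. [:[:b:]:]))"
    by (subst finite_image_iff) (auto simp: inj_def infinite_UNIV_char_0)
  ultimately show ?thesis by (metis finite_subset poly_roots_finite)
qed

lemma eval3_inject:
  assumes "\<And>x. eval3 F x = eval3 G x"
  shows "F = G"
  using eval3_eq_0D[of "F - G"] assms by (simp add: eval3_diff)

lemma homogeneous_eval3:
  assumes "homogeneous n F"
  shows "eval3 F (c *s x) = c ^ n * eval3 F x"
proof -
  have "eval3 (monom3 (coeff (coeff (coeff F i) j) k) i j k) (c *s x)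
      = c ^ n * eval3 (monom3 (coeff (coeff (coeff F i) j) k) i j k) x" for i j k
  proof (cases "coeff (coeff (coeff F i) j) k = 0")
    case False
    then have "n = i + j + k" using assms by (auto simp: homogeneous_def)
    then show ?thesis by (simp add: eval3_monom3 power_add power_mult_distrib)
  qed (simp add: eval3_monom3)
  then show ?thesis
    by (subst (1 2) poly3_as_sum[of F]) (simp add: eval3_sum sum_distrib_left)
qed

text \<open>Scaling by 2 alone decides it: it multiplies the coefficient at (i, j, k) by 2^(i + j +
  k), and comparing with 2^n F and taking norms gives i + j + k = n. Later proofs of homogeneity
  thereby reduce to computing values.\<close>

lemma homogeneousI:
  assumes "\<And>c x. eval3 F (c *s x) = c ^ n * eval3 F x"
  shows "homogeneous n F"
proof -
  have "\<exists>G. (\<forall>x. eval3 G x = eval3 F (2 *s x)) \<and>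
     (\<forall>i j k. coeff (coeff (coeff G i) j) k = 2 ^ (i + j + k) * coeff (coeff (coeff F i) j) k)" for F
  proof (induction F rule: poly3_induct)
    case (monom c i j k)
    show ?case
      by (rule exI[of _ "monom3 (2 ^ (i + j + k) * c) i j k"])
         (auto simp: eval3_monom3 coeff_monom3 power_add power_mult_distrib)
  next
    case (add F G)
    then obtain F' G' where "\<forall>x. eval3 F' x = eval3 F (2 *s x)"
      "\<forall>i j k. coeff (coeff (coeff F' i) j) k = 2 ^ (i + j + k) * coeff (coeff (coeff F i) j) k"
      "\<forall>x. eval3 G' x = eval3 G (2 *s x)"
      "\<forall>i j k. coeff (coeff (coeff G' i) j) k = 2 ^ (i + j + k) * coeff (coeff (coeff G i) j) k"
      by blast
    then show ?case
      by (intro exI[of _ "F' + G'"]) (simp add: eval3_add algebra_simps)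
  qed
  then obtain G where G: "\<And>x. eval3 G x = eval3 F (2 *s x)"
    "\<And>i j k. coeff (coeff (coeff G i) j) k = 2 ^ (i + j + k) * coeff (coeff (coeff F i) j) k"
    by blast
  have "G = monom3 (2 ^ n) 0 0 0 * F"
    by (rule eval3_inject) (simp add: G assms eval3_mult eval3_monom3)
  then have "coeff (coeff (coeff G i) j) k = 2 ^ n * coeff (coeff (coeff F i) j) k" for i j k
    by (simp add: monom3_def monom_0)
  then have "(2::complex) ^ (i + j + k) = 2 ^ n" if "coeff (coeff (coeff F i) j) k \<noteq> 0" for i j k
    using G(2)[of i j k] that by simp
  then have "norm ((2::complex) ^ (i + j + k)) = norm ((2::complex) ^ n)"
    if "coeff (coeff (coeff F i) j) k \<noteq> 0" for i j k
    using that by simp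
  then show ?thesis
    by (auto simp: homogeneous_def norm_power)
qed

lemma homogeneous_mult: "homogeneous m F \<Longrightarrow> homogeneous n G \<Longrightarrow> homogeneous (m + n) (F * G)"
  by (rule homogeneousI) (simp add: homogeneous_eval3 eval3_mult power_add)

lemma homogeneous_eval3_0:
  assumes "homogeneous n F" "n \<ge> 1"
  shows "eval3 F 0 = 0"
  using homogeneous_eval3[OF assms(1), of 0 0] assms(2) by (simp add: power_0_left)

text \<open>Regularity of polynomial expressions is proved once for any class of functions closed
  under the ring operations. The locale is instantiated with holomorphic, continuous and pointwise
  differentiable functions, and in \<open>eval3_subst3\<close> with the polynomial functions
  themselves.\<close>

locale function_ring =
  fixes R :: "('b \<Rightarrow> complex) \<Rightarrow> bool"
  assumes const: "R (\<lambda>_. c)"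
    and add: "R f \<Longrightarrow> R g \<Longrightarrow> R (\<lambda>b. f b + g b)"
    and mult: "R f \<Longrightarrow> R g \<Longrightarrow> R (\<lambda>b. f b * g b)"
begin

lemma if_fun: "R f \<Longrightarrow> R g \<Longrightarrow> R (\<lambda>b. if c then f b else g b)"
  by (cases c) simp_all

lemma sum: "(\<And>i. i \<in> I \<Longrightarrow> R (f i)) \<Longrightarrow> R (\<lambda>b. \<Sum>i\<in>I. f i b)"
  by (induction I rule: infinite_finite_induct) (simp_all add: const add)

lemma prod: "(\<And>i. i \<in> I \<Longrightarrow> R (f i)) \<Longrightarrow> R (\<lambda>b. \<Prod>i\<in>I. f i b)"
  by (induction I rule: infinite_finite_induct) (simp_all add: const mult)

lemma uminus: "R f \<Longrightarrow> R (\<lambda>b. - f b)"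
  using mult[OF const[of "-1"]] by simp

lemma diff: "R f \<Longrightarrow> R g \<Longrightarrow> R (\<lambda>b. f b - g b)"
  using add[OF _ uminus] by simp

lemma power: "R f \<Longrightarrow> R (\<lambda>b. f b ^ n)"
  by (induction n) (simp_all add: const mult)

lemma eval3: "(\<And>i. R (\<lambda>b. X b $ i)) \<Longrightarrow> R (\<lambda>b. eval3 F (X b))"
  by (subst poly3_as_sum) (simp add: eval3_sum eval3_monom3 sum mult power const)

end

section \<open>Linear substitutions in ternary polynomials\<close>

definition subst3 :: "complex^3^3 \<Rightarrow> poly3 \<Rightarrow> poly3" where
  "subst3 M F = (SOME G. \<forall>x. eval3 F (M *v x) = eval3 G x)"

text \<open>The functions of the form \<open>eval3 G\<close> are a function ring that contains the
  coordinates of \<open>M *v x\<close>, hence also the composite. This replaces a recursion over the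
  nested polynomials; by \<open>eval3_inject\<close> the chosen polynomial is unique.\<close>

lemma eval3_subst3: "eval3 (subst3 M F) x = eval3 F (M *v x)"
proof -
  interpret function_ring "\<lambda>f. \<exists>G. \<forall>x. f x = eval3 G x"
  proof
    show "\<exists>G. \<forall>x. c = eval3 G x" for c by (rule exI[of _ "monom3 c 0 0 0"]) (simp add: eval3_monom3)
    fix f g :: "complex^3 \<Rightarrow> complex" assume "\<exists>G. \<forall>x. f x = eval3 G x" "\<exists>G. \<forall>x. g x = eval3 G x"
    then obtain G H where "\<forall>x. f x = eval3 G x" "\<forall>x. g x = eval3 H x" by blast
    then show "\<exists>G. \<forall>x. f x + g x = eval3 G x" "\<exists>G. \<forall>x. f x * g x = eval3 G x"
      by (auto intro: exI[of _ "G + H"] exI[of _ "G * H"] simp: eval3_add eval3_mult)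
  qed
  have "\<exists>G. \<forall>x. x $ i = eval3 G x" for i
    using exhaust_3[of i] eval3_monom3[of 1 1 0 0] eval3_monom3[of 1 0 1 0] eval3_monom3[of 1 0 0 1]
    by (metis mult.right_neutral mult_1 power_0 power_one_right)
  then have "\<exists>G. \<forall>x. (M *v x) $ i = eval3 G x" for i
    unfolding matrix_vector_mult_def vec_lambda_beta by (intro sum mult const)
  from eval3[OF this] have "\<exists>G. \<forall>x. eval3 F (M *v x) = eval3 G x" .
  then have "\<forall>x. eval3 F (M *v x) = eval3 (subst3 M F) x"
    unfolding subst3_def by (rule someI_ex)
  then show ?thesis by simp
qed

lemma homogeneous_subst3: "homogeneous n F \<Longrightarrow> homogeneous n (subst3 M F)"
  by (rule homogeneousI) (simp only: eval3_subst3 homogeneous_eval3 vector_scalar_commute)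

text \<open>Substituting the inverse matrix carries a square divisor of the new polynomial back to
  one of F, and the inverse of the resulting unit is carried forward again. All identities are
  checked on values.\<close>

lemma squarefree_subst3:
  assumes M: "invertible M" and F: "squarefree F"
  shows "squarefree (subst3 M F)"
proof (rule squarefreeI)
  fix G assume "G ^ 2 dvd subst3 M F"
  then obtain H where H: "subst3 M F = G ^ 2 * H" by (elim dvdE)
  obtain N where N: "M ** N = mat 1" "N ** M = mat 1" using M by (auto simp: invertible_def)
  have MN: "M *v (N *v x) = x" and NM: "N *v (M *v x) = x" for x
    by (simp_all add: matrix_vector_mul_assoc N)
  have "F = subst3 N G ^ 2 * subst3 N H"
  proof (rule eval3_inject)
    fix x
    have "eval3 F x = eval3 (subst3 M F) (N *v x)" by (simp add: eval3_subst3 MN)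
    also have "\<dots> = eval3 G (N *v x) ^ 2 * eval3 H (N *v x)"
      by (simp only: H eval3_mult eval3_power)
    finally show "eval3 F x = eval3 (subst3 N G ^ 2 * subst3 N H) x"
      by (simp only: eval3_mult eval3_power eval3_subst3)
  qed
  then have "subst3 N G ^ 2 dvd F" by (rule dvdI)
  then have "subst3 N G dvd 1" by (rule squarefreeD[OF F])
  then obtain K where K: "1 = subst3 N G * K" by (elim dvdE)
  have "1 = G * subst3 M K"
  proof (rule eval3_inject)
    fix x
    have "eval3 1 x = eval3 (subst3 N G * K) (M *v x)" by (subst K[symmetric]) simp
    also have "\<dots> = eval3 G x * eval3 K (M *v x)"
      by (simp only: eval3_mult eval3_subst3 NM)
    finally show "eval3 1 x = eval3 (G * subst3 M K) x"
      by (simp only: eval3_mult eval3_subst3)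
  qed
  then show "G dvd 1" by (rule dvdI)
qed

section \<open>Discriminants\<close>

lemma coeff_mult_degree_le:
  assumes "degree p \<le> m" "degree q \<le> n"
  shows "coeff (p * q) (m + n) = coeff p m * coeff q n"
proof -
  have "coeff (p * q) (m + n) = (\<Sum>i\<le>m + n. coeff p i * coeff q (m + n - i))"
    by (rule coeff_mult)
  also have "\<dots> = (\<Sum>i\<in>{m}. coeff p i * coeff q (m + n - i))"
  proof (rule sum.mono_neutral_right)
    show "\<forall>i\<in>{..m + n} - {m}. coeff p i * coeff q (m + n - i) = 0"
    proof
      fix i assume "i \<in> {..m + n} - {m}"
      then consider "i > m" | "m + n - i > n" by force
      then show "coeff p i * coeff q (m + n - i) = 0"
        using assms by cases (simp_all add: coeff_eq_0)
    qed
  qed auto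
  finally show ?thesis by simp
qed

lemma coeff_power_degree_le:
  assumes "degree p \<le> 1"
  shows "degree (p ^ n) \<le> n" "coeff (p ^ n) n = coeff p 1 ^ n"
proof -
  have d: "degree (p ^ n) \<le> n" for n
    using degree_power_le[of p n] mult_right_mono[OF assms, of n] by (metis mult_1 order_trans zero_le)
  show "degree (p ^ n) \<le> n" by (rule d)
  show "coeff (p ^ n) n = coeff p 1 ^ n"
  proof (induction n)
    case (Suc n)
    then show ?case using coeff_mult_degree_le[OF assms d[of n]] by simp
  qed simp
qed

text \<open>Over a factorial ring a gcd of degree 0 need not be a unit, so only primes of positive
  degree matter. Such a prime P dividing G = P H and its derivative divides H P'; it cannot divide
  P', which is nonzero of smaller degree, so P divides H and its square divides G.\<close>

lemma degree_gcd_pderiv_squarefree: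
  fixes G :: "'a::{factorial_ring_gcd,semiring_gcd_mult_normalize,ring_char_0} poly"
  assumes "squarefree G"
  shows "degree (gcd G (pderiv G)) = 0"
proof (rule ccontr)
  assume deg: "degree (gcd G (pderiv G)) \<noteq> 0"
  define D where "D = gcd G (pderiv G)"
  have G0: "G \<noteq> 0" using assms by auto
  have D0: "D \<noteq> 0" using G0 by (simp add: D_def)
  \<comment> \<open>If all prime factors of D had degree 0, so would their product, which D
    divides.\<close>
  have "\<exists>P. prime P \<and> P dvd D \<and> degree P \<noteq> 0"
  proof (rule ccontr)
    assume *: "\<not> ?thesis"
    have "degree P = 0" if "P \<in># prime_factorization D" for P
      using that * by (auto simp: in_prime_factors_iff)
    moreover have "degree (prod_mset B) = 0" if "\<forall>P\<in>#B. degree P = 0" for B :: "'a poly multiset"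
      using that
    proof (induction B)
      case (add y B)
      then show ?case using degree_mult_le[of y "prod_mset B"] by simp
    qed simp
    ultimately have "degree (prod_mset (prime_factorization D)) = 0" by blast
    moreover have "D dvd prod_mset (prime_factorization D)"
      using prod_mset_prime_factorization_weak[OF D0] by (metis associatedD1)
    moreover have "prod_mset (prime_factorization D) \<noteq> 0"
      by (simp add: prod_mset_zero_iff in_prime_factors_iff)
    ultimately have "degree D = 0"
      by (metis dvd_imp_degree_le le_zero_eq)
    then show False using deg by (simp add: D_def)
  qed
  then obtain P where P: "prime P" "P dvd D" "degree P \<noteq> 0" by blast
  obtain H where H: "G = P * H" using P(2) unfolding D_def by (meson dvdE gcd_dvd1 dvd_trans)
  have pd: "pderiv P \<noteq> 0" using P(3) by (simp add: pderiv_eq_0_iff)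
  have "P dvd pderiv G" using P(2) by (simp add: D_def)
  moreover have "pderiv G = P * pderiv H + H * pderiv P" by (simp add: H pderiv_mult)
  ultimately have "P dvd H * pderiv P"
    by (metis dvd_add_right_iff dvd_triv_left)
  moreover have "\<not> P dvd pderiv P"
  proof
    assume "P dvd pderiv P"
    then have "degree P \<le> degree (pderiv P)" using pd by (rule dvd_imp_degree_le)
    then show False using P(3) by (simp add: degree_pderiv)
  qed
  ultimately have "P dvd H" using P(1) prime_dvd_mult_iff by blast
  then have "P ^ 2 dvd G" by (simp add: H power2_eq_square)
  then have "P dvd 1" by (rule squarefreeD[OF assms])
  then show False using P(1) by auto
qed

lemma resultant_pderiv_squarefree:
  fixes G :: "'a::{factorial_ring_gcd,semiring_gcd_mult_normalize,ring_char_0} poly"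
  shows "squarefree G \<Longrightarrow> resultant G (pderiv G) \<noteq> 0"
  by (simp add: resultant_0_gcd degree_gcd_pderiv_squarefree)

text \<open>The degree is the sum of the orders of the roots, each at least 1, so equality means
  that all roots are simple. Then the gcd with the derivative has no root, and by the fundamental
  theorem of algebra it is constant.\<close>

lemma card_roots_eq_degree_iff:
  fixes P :: "complex poly"
  assumes "P \<noteq> 0"
  shows "card {z. poly P z = 0} = degree P \<longleftrightarrow> resultant P (pderiv P) \<noteq> 0"
proof -
  have fin: "finite {z. poly P z = 0}" using assms by (rule poly_roots_finite)
  have "degree P = degree (smult (lead_coeff P) (\<Prod>z | poly P z = 0. [:-z, 1:] ^ order z P))"
    by (simp only: complex_poly_decompose)
  also have "\<dots> = degree (\<Prod>z | poly P z = 0. [:-z, 1:] ^ order z P)"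
    using assms by simp
  also have "\<dots> = (\<Sum>z | poly P z = 0. order z P)"
    by (subst degree_prod_eq_sum_degree) (auto simp: degree_power_eq)
  finally have deg: "degree P = (\<Sum>z | poly P z = 0. order z P)" .
  have ord: "order z P \<ge> 1" if "poly P z = 0" for z
    using that assms by (metis One_nat_def Suc_leI order_root neq0_conv)
  have "card {z. poly P z = 0} = degree P \<longleftrightarrow> (\<forall>z. poly P z = 0 \<longrightarrow> order z P = 1)"
  proof
    assume "card {z. poly P z = 0} = degree P"
    then have "(\<Sum>z | poly P z = 0. 1) = (\<Sum>z | poly P z = 0. order z P)" using deg by simp
    from sum_mono_inv[OF this _ _ fin] show "\<forall>z. poly P z = 0 \<longrightarrow> order z P = 1"
      using ord by fastforce
  qed (simp add: deg)
  also have "\<dots> \<longleftrightarrow> (\<forall>z. \<not> (poly P z = 0 \<and> poly (pderiv P) z = 0))"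
    unfolding rsquarefree_roots[symmetric] rsquarefree_def
    using assms by (metis order_root)
  also have "\<dots> \<longleftrightarrow> (\<forall>z. poly (gcd P (pderiv P)) z \<noteq> 0)"
    by (simp add: poly_eq_0_iff_dvd)
  also have "\<dots> \<longleftrightarrow> degree (gcd P (pderiv P)) = 0"
  proof
    assume "\<forall>z. poly (gcd P (pderiv P)) z \<noteq> 0"
    then show "degree (gcd P (pderiv P)) = 0"
      by (metis fundamental_theorem_of_algebra_alt degree_pCons_0)
  next
    assume "degree (gcd P (pderiv P)) = 0"
    then obtain c where "gcd P (pderiv P) = [:c:]" by (metis degree_eq_zeroE)
    moreover have "gcd P (pderiv P) \<noteq> 0" using assms by simp
    ultimately show "\<forall>z. poly (gcd P (pderiv P)) z \<noteq> 0" by simp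
  qed
  finally show ?thesis by (simp add: resultant_0_gcd)
qed

text \<open>The value at (1, 0, 0) is the coefficient of the pure power of the first variable. If it
  is nonzero, F is monic up to a scalar in that variable, so specializing the other two does not
  lower the degree.\<close>

lemma homogeneous_coeff_degree:
  assumes F: "homogeneous d F" and F1: "eval3 F (axis 1 1) \<noteq> 0"
  shows "degree F = d" "\<exists>c. c \<noteq> 0 \<and> coeff F d = [:[:c:]:]"
proof -
  have z: "coeff F i = 0" if "i > d" for i
    using that F unfolding homogeneous_def
    by (intro poly_eqI) (metis add.assoc coeff_0 le_add1 linorder_not_less)
  have l: "degree F \<le> d" using z by (intro degree_le) auto
  have "coeff (coeff (coeff F d) j) k = 0" if "j \<noteq> 0 \<or> k \<noteq> 0" for j k
    using F that unfolding homogeneous_def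
    by (metis add.assoc add_cancel_right_right add_eq_0_iff_both_eq_0)
  then have c: "coeff F d = [:[:coeff (coeff (coeff F d) 0) 0:]:]"
    by (intro poly_eqI) (auto simp: coeff_pCons split: nat.split)
  have "eval3 F (axis 1 1) = (\<Sum>i\<le>d. poly (poly (coeff F i) 0) 0)"
  proof -
    have "poly F 1 = (\<Sum>i\<le>d. coeff F i)"
      unfolding poly_altdef using l by (simp add: sum.mono_neutral_left[of "{..d}" "{..degree F}"] coeff_eq_0)
    then show ?thesis
      by (simp add: eval3_def axis_def poly_sum flip: one_pCons)
  qed
  also have "\<dots> = (\<Sum>i\<in>{d}. poly (poly (coeff F i) 0) 0)"
  proof (rule sum.mono_neutral_right)
    show "\<forall>i\<in>{..d} - {d}. poly (poly (coeff F i) 0) 0 = 0"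
    proof
      fix i assume "i \<in> {..d} - {d}"
      then have "coeff (coeff (coeff F i) 0) 0 = 0" using F unfolding homogeneous_def by (metis DiffD2 add.right_neutral singletonI)
      then show "poly (poly (coeff F i) 0) 0 = 0" by (simp add: poly_0_coeff_0)
    qed
  qed auto
  finally have "coeff (coeff (coeff F d) 0) 0 \<noteq> 0" using F1 by (simp add: poly_0_coeff_0)
  then show "\<exists>c. c \<noteq> 0 \<and> coeff F d = [:[:c:]:]" using c by blast
  then show "degree F = d" using l by (metis coeff_0 degree_0 le_antisym le_degree pCons_eq_0_iff)
qed

section \<open>Coordinates in which almost every line of a pencil meets the curve in
  \<open>d\<close> points\<close>

lemma matrix_vector_3: "((M :: complex^3^3) *v x) $ i = M $ i $ 1 * x $ 1 + M $ i $ 2 * x $ 2 + M $ i $ 3 * x $ 3"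
  by (simp add: matrix_vector_mult_def sum_3)

lemma exists_invertible_column:
  fixes v :: "complex^3"
  assumes "v \<noteq> 0"
  shows "\<exists>M :: complex^3^3. invertible M \<and> M *v axis 1 1 = v"
proof -
  obtain i where i: "v $ i \<noteq> 0" using assms by (auto simp: vec_eq_iff)
  define M :: "complex^3^3" where
    "M = (if i = 1 then vector [vector [v $ 1, 0, 0], vector [v $ 2, 1, 0], vector [v $ 3, 0, 1]]
          else if i = 2 then vector [vector [v $ 1, 1, 0], vector [v $ 2, 0, 0], vector [v $ 3, 0, 1]]
          else vector [vector [v $ 1, 0, 1], vector [v $ 2, 1, 0], vector [v $ 3, 0, 0]])"
  have "i = 1 \<or> i = 2 \<or> i = 3" by (rule exhaust_3)
  then have "det M \<noteq> 0"
    using i by (auto simp: M_def det_3)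
  then have "invertible M" by (simp add: invertible_det_nz)
  moreover have "M *v axis 1 1 = v"
    using i \<open>i = 1 \<or> i = 2 \<or> i = 3\<close>
    by (auto simp: matrix_vector_3 axis_def vec_eq_iff forall_3 M_def)
  ultimately show ?thesis by blast
qed

text \<open>The centre of the pencil is placed off the curve. The discriminant in the first variable
  is then a nonzero polynomial in the other two; it stays nonzero when the third variable is fixed
  suitably, and D is the set of its roots in the second.\<close>

lemma generic_pencil:
  assumes hom: "homogeneous d F" and sq: "squarefree F" and d: "d \<ge> 1"
  obtains M :: "complex^3^3" and D where "invertible M" "finite D" "eval3 F (M *v axis 1 1) \<noteq> 0"
    "\<And>x. x \<notin> D \<Longrightarrow> card {g. eval3 F (M *v vector [g, x, 1]) = 0} = d"
proof -
  have "F \<noteq> 0" using sq by auto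
  then obtain v where v: "eval3 F v \<noteq> 0" using eval3_eq_0D by blast
  have "v \<noteq> 0" using homogeneous_eval3_0[OF hom d] v by auto
  then obtain N :: "complex^3^3" where N: "invertible N" "N *v axis 1 1 = v"
    using exists_invertible_column by blast
  define G where "G = subst3 N F"
  have evG: "eval3 G x = eval3 F (N *v x)" for x by (simp add: G_def eval3_subst3)
  have G1: "eval3 G (axis 1 1) \<noteq> 0" by (simp add: evG N v)
  have Gh: "homogeneous d G" unfolding G_def by (rule homogeneous_subst3[OF hom])
  have Gsq: "squarefree G" unfolding G_def by (rule squarefree_subst3[OF N(1) sq])
  note dG = homogeneous_coeff_degree[OF Gh G1]
  define r where "r = resultant G (pderiv G)"
  have r0: "r \<noteq> 0" unfolding r_def by (rule resultant_pderiv_squarefree[OF Gsq])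
  obtain j where j: "coeff r j \<noteq> 0" using r0 by (metis leading_coeff_0_iff)
  \<comment> \<open>The value \<open>b\<close> must keep one coefficient of the discriminant
    nonzero, and must itself be nonzero so that rescaling the third coordinate from \<open>b\<close>
    to 1 is invertible.\<close>
  have "finite ({b. poly (coeff r j) b = 0} \<union> {0})" using j by (simp add: poly_roots_finite)
  then obtain b where b: "b \<noteq> 0" "poly (coeff r j) b \<noteq> 0"
    using ex_new_if_finite[OF infinite_UNIV_char_0] by blast
  define h where "h x q = poly (poly q [:x:]) b" for x q
  define r1 where "r1 = map_poly (\<lambda>c. poly c b) r"
  have r1: "h x r = poly r1 x" for x
  proof -
    have "poly (poly q [:x:]) b = poly (map_poly (\<lambda>c. poly c b) q) x" for q
      by (induction q) (simp_all add: map_poly_pCons)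
    then show ?thesis by (simp add: h_def r1_def)
  qed
  have "r1 \<noteq> 0" using b by (metis r1_def coeff_0 coeff_map_poly poly_0)
  then have finD: "finite {x. poly r1 x = 0}" by (rule poly_roots_finite)
  have card: "card {g. eval3 G (vector [g, x, b]) = 0} = d" if x: "poly r1 x \<noteq> 0" for x
  proof -
    interpret hom: idom_hom "h x"
      by unfold_locales (simp_all add: h_def)
    define P where "P = map_poly (h x) G"
    obtain c where c: "c \<noteq> 0" "coeff G d = [:[:c:]:]" using dG by blast
    have cP: "coeff P d = c" by (simp add: P_def coeff_map_poly c h_def)
    have dP: "degree P = d"
      using cP c by (metis P_def dG(1) degree_map_poly_le le_antisym le_degree)
    have P': "pderiv P = map_poly (h x) (pderiv G)"
      unfolding P_def by (rule hom.map_poly_pderiv[symmetric])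
    \<comment> \<open>The resultant is compatible with the homomorphism \<open>h x\<close> because
      neither degree drops.\<close>
    have dP': "degree (pderiv P) = degree (pderiv G)"
      by (simp add: degree_pderiv dP dG)
    have "resultant (map_poly (h x) G) (map_poly (h x) (pderiv G)) = h x r"
      unfolding r_def
      by (rule hom.resultant_map_poly) (simp_all only: P_def[symmetric] P'[symmetric] dP dP' dG(1))
    then have "resultant P (pderiv P) = h x r" unfolding P' unfolding P_def .
    then have "resultant P (pderiv P) \<noteq> 0" using x r1 by simp
    moreover have "P \<noteq> 0" using cP c by auto
    ultimately have "card {z. poly P z = 0} = d" using card_roots_eq_degree_iff dP by blast
    moreover have "poly P g = eval3 G (vector [g, x, b])" for g
    proof -
      have "poly (map_poly (h x) Q) g = poly (poly (poly Q [:[:g:]:]) [:x:]) b" for Q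
        by (induction Q) (simp_all add: map_poly_pCons h_def)
      then show ?thesis by (simp add: P_def eval3_def)
    qed
    ultimately show ?thesis by simp
  qed
  define B :: "complex^3^3" where "B = vector [vector [1, 0, 0], vector [0, 1, 0], vector [0, 0, b]]"
  have "det B \<noteq> 0" using b by (simp add: B_def det_3)
  then have B: "invertible B" by (simp add: invertible_det_nz)
  have Bv: "B *v vector [g, x, 1] = vector [g, x, b]" for g x
    by (simp add: vec_eq_iff forall_3 B_def matrix_vector_mult_def sum_3)
  have B1: "B *v axis 1 1 = axis 1 1"
    by (simp add: vec_eq_iff forall_3 B_def matrix_vector_mult_def sum_3 axis_def)
  define M where "M = N ** B"
  have Mv: "M *v v = N *v (B *v v)" for v
    unfolding M_def by (rule matrix_vector_mul_assoc[symmetric])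
  have evM: "eval3 F (M *v vector [g, x, 1]) = eval3 G (vector [g, x, b])" for g x
    unfolding Mv Bv evG by (rule refl)
  have M1: "invertible M" unfolding M_def using N(1) B by (rule invertible_mult)
  have M2: "eval3 F (M *v axis 1 1) \<noteq> 0"
    unfolding Mv B1 N(2) by (rule v)
  have M3: "card {g. eval3 F (M *v vector [g, x, 1]) = 0} = d" if "x \<notin> {x. poly r1 x = 0}" for x
    unfolding evM by (rule card) (use that in blast)
  show ?thesis by (rule that[OF M1 finD M2 M3])
qed

text \<open>Restriction of F to the line through x with direction v. It is expanded into monomials
  so that its coefficients are visibly polynomial in x and v, as \<open>coeff_lineP\<close>
  requires.\<close>

definition lineP :: "poly3 \<Rightarrow> complex^3 \<Rightarrow> complex^3 \<Rightarrow> complex poly" where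
  "lineP F x v = (\<Sum>i\<le>degree F. \<Sum>j\<le>degree (coeff F i). \<Sum>k\<le>degree (coeff (coeff F i) j).
      [:coeff (coeff (coeff F i) j) k:] *
        ([:x $ 1, v $ 1:] ^ i * ([:x $ 2, v $ 2:] ^ j * [:x $ 3, v $ 3:] ^ k)))"

lemma poly_lineP: "poly (lineP F x v) z = eval3 F (x + z *s v)"
  by (subst (2) poly3_as_sum) (simp add: lineP_def poly_sum eval3_sum eval3_monom3 mult_ac)

lemma lineP_homogeneous:
  assumes "homogeneous d F"
  shows "degree (lineP F x v) \<le> d" "coeff (lineP F x v) d = eval3 F v"
proof -
  define T where "T i j k = [:coeff (coeff (coeff F i) j) k:] *
        ([:x $ 1, v $ 1:] ^ i * ([:x $ 2, v $ 2:] ^ j * [:x $ 3, v $ 3:] ^ k))" for i j k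
  have T: "degree (T i j k) \<le> d \<and> coeff (T i j k) d = eval3 (monom3 (coeff (coeff (coeff F i) j) k) i j k) v" for i j k
  proof (cases "coeff (coeff (coeff F i) j) k = 0")
    case False
    then have d: "d = i + (j + k)" using assms unfolding homogeneous_def by (metis add.assoc)
    have l: "degree [:a, b:] \<le> 1" for a b :: complex by simp
    note c = coeff_power_degree_le[OF l]
    have 1: "degree ([:x $ 2, v $ 2:] ^ j * [:x $ 3, v $ 3:] ^ k) \<le> j + k"
      by (rule order_trans[OF degree_mult_le add_mono[OF c(1) c(1)]])
    have 2: "degree ([:x $ 1, v $ 1:] ^ i * ([:x $ 2, v $ 2:] ^ j * [:x $ 3, v $ 3:] ^ k)) \<le> i + (j + k)"
      by (rule order_trans[OF degree_mult_le add_mono[OF c(1) 1]])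
    have "coeff ([:x $ 1, v $ 1:] ^ i * ([:x $ 2, v $ 2:] ^ j * [:x $ 3, v $ 3:] ^ k)) (i + (j + k))
        = v $ 1 ^ i * (v $ 2 ^ j * v $ 3 ^ k)"
      by (simp only: coeff_mult_degree_le[OF c(1) 1] coeff_mult_degree_le[OF c(1) c(1)] c(2)) simp
    then show ?thesis using 2 by (simp add: T_def d eval3_monom3 mult_ac)
  qed (simp add: T_def eval3_monom3)
  have L: "lineP F x v = (\<Sum>i\<le>degree F. \<Sum>j\<le>degree (coeff F i). \<Sum>k\<le>degree (coeff (coeff F i) j). T i j k)"
    by (simp add: lineP_def T_def)
  show "degree (lineP F x v) \<le> d" unfolding L by (intro degree_sum_le) (simp_all add: T)
  show "coeff (lineP F x v) d = eval3 F v"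
    unfolding L by (subst (4) poly3_as_sum) (simp add: coeff_sum T eval3_sum)
qed

context function_ring
begin

lemma coeff_mult: "(\<And>n. R (\<lambda>b. coeff (P b) n)) \<Longrightarrow> (\<And>n. R (\<lambda>b. coeff (Q b) n)) \<Longrightarrow> R (\<lambda>b. coeff (P b * Q b) n)"
  unfolding Polynomial.coeff_mult by (intro sum mult)

lemma coeff_power: "(\<And>n. R (\<lambda>b. coeff (P b) n)) \<Longrightarrow> R (\<lambda>b. coeff (P b ^ m) n)"
  by (induction m arbitrary: n) (simp_all add: const coeff_mult)

lemma coeff_pCons:
  "R f \<Longrightarrow> (\<And>n. R (\<lambda>b. coeff (P b) n)) \<Longrightarrow> R (\<lambda>b. coeff (pCons (f b) (P b)) n)"
  by (cases n) simp_all

lemma coeff_lineP: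
  assumes "\<And>i. R (\<lambda>b. X b $ i)" "\<And>i. R (\<lambda>b. V b $ i)"
  shows "R (\<lambda>b. coeff (lineP F (X b) (V b)) n)"
  unfolding lineP_def coeff_sum
  by (intro sum coeff_mult coeff_power coeff_pCons assms) (simp_all add: const)

end

text \<open>The Sylvester determinant for the nominal degrees d and d - 1. Unlike the resultant,
  whose size follows the actual degrees, it is one fixed polynomial expression in the coefficients
  and so inherits holomorphy.\<close>

definition discr :: "nat \<Rightarrow> complex poly \<Rightarrow> complex" where
  "discr d P = Determinant.det (sylvester_mat_sub d (d - 1) P (pderiv P))"

lemma discr_eq_resultant: "degree P = d \<Longrightarrow> discr d P = resultant P (pderiv P)"
  by (simp add: discr_def resultant_def sylvester_mat_def degree_pderiv)

lemma (in function_ring) discr: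
  assumes "\<And>n. R (\<lambda>b. coeff (P b) n)"
  shows "R (\<lambda>b. discr d (P b))"
proof -
  have "R (\<lambda>b. sylvester_mat_sub d (d - 1) (P b) (pderiv (P b)) $$ (i, j))"
    if "i < d + (d - 1)" "j < d + (d - 1)" for i j
    using that by (simp add: sylvester_mat_sub_def coeff_pderiv if_fun assms const mult)
  then show ?thesis
    unfolding discr_def Determinant.det_def
    by (auto simp: sylvester_mat_sub_def permutes_def intro!: sum mult const prod)
qed

text \<open>The point v of the line is off the curve, so the restriction has degree exactly d and
  every intersection is a value of the parameter. With d distinct roots the gcd with the derivative
  is constant, so each root is simple.\<close>

lemma card_line_eq_iff:
  assumes "homogeneous d F" "eval3 F v \<noteq> 0"
  shows "finite {z. eval3 F (x + z *s v) = 0}" "card {z. eval3 F (x + z *s v) = 0} \<le> d"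
    "card {z. eval3 F (x + z *s v) = 0} = d \<longleftrightarrow> discr d (lineP F x v) \<noteq> 0"
    "card {z. eval3 F (x + z *s v) = 0} = d \<Longrightarrow> eval3 F (x + z *s v) = 0 \<Longrightarrow> poly (pderiv (lineP F x v)) z \<noteq> 0"
proof -
  have deg: "degree (lineP F x v) = d" and nz: "lineP F x v \<noteq> 0"
    using lineP_homogeneous[OF assms(1), of x v] assms(2) by (auto intro: le_antisym le_degree simp: le_degree)
  show "finite {z. eval3 F (x + z *s v) = 0}"
    using poly_roots_finite[OF nz] by (simp add: poly_lineP)
  show "card {z. eval3 F (x + z *s v) = 0} \<le> d"
    using poly_roots_degree[OF nz] by (simp add: poly_lineP deg)
  show 1: "card {z. eval3 F (x + z *s v) = 0} = d \<longleftrightarrow> discr d (lineP F x v) \<noteq> 0"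
    using card_roots_eq_degree_iff[OF nz] by (simp add: poly_lineP deg discr_eq_resultant)
  assume "card {z. eval3 F (x + z *s v) = 0} = d" and 0: "eval3 F (x + z *s v) = 0"
  then have "degree (gcd (lineP F x v) (pderiv (lineP F x v))) = 0"
    using 1 by (simp add: deg discr_eq_resultant resultant_0_gcd)
  then obtain c where c: "gcd (lineP F x v) (pderiv (lineP F x v)) = [:c:]" by (metis degree_eq_zeroE)
  then have "c \<noteq> 0" using nz by auto
  show "poly (pderiv (lineP F x v)) z \<noteq> 0"
  proof
    assume "poly (pderiv (lineP F x v)) z = 0"
    then have "[:-z, 1:] dvd gcd (lineP F x v) (pderiv (lineP F x v))"
      using 0 by (metis gcd_greatest poly_eq_0_iff_dvd poly_lineP)
    then have "poly [:c:] z = 0" unfolding c by (metis poly_eq_0_iff_dvd)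
    then show False using \<open>c \<noteq> 0\<close> by simp
  qed
qed

section \<open>Holomorphic functions of several variables\<close>

text \<open>The pointwise condition inside \<open>hol\<close>, separated so that it can be
  propagated at a single point.\<close>

definition cdiff :: "(complex^'n \<Rightarrow> complex) \<Rightarrow> complex^'n \<Rightarrow> bool" where
  "cdiff f x \<longleftrightarrow> (\<exists>f'. (f has_derivative f') (at x) \<and> (\<forall>c v. f' (c *s v) = c * f' v))"

lemma hol_iff_cdiff: "hol f S \<longleftrightarrow> (\<forall>x\<in>S. cdiff f x)"
  by (simp add: hol_def cdiff_def)

lemma cdiff_const: "cdiff (\<lambda>x. c) x"
  unfolding cdiff_def by (rule exI[of _ "\<lambda>_. 0"]) auto

lemma cdiff_component: "cdiff (\<lambda>x. x $ i) x"
  unfolding cdiff_def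
  by (rule exI[of _ "\<lambda>x. x $ i"]) (auto intro: bounded_linear_imp_has_derivative)

lemma cdiff_add_mult:
  assumes "cdiff f x" "cdiff g x"
  shows cdiff_add: "cdiff (\<lambda>x. f x + g x) x" and cdiff_mult: "cdiff (\<lambda>x. f x * g x) x"
proof -
  obtain f' g' where D: "(f has_derivative f') (at x)" "\<And>c v. f' (c *s v) = c * f' v"
    "(g has_derivative g') (at x)" "\<And>c v. g' (c *s v) = c * g' v"
    using assms by (auto simp: cdiff_def)
  show "cdiff (\<lambda>x. f x + g x) x"
    using D unfolding cdiff_def
    by (intro exI[of _ "\<lambda>v. f' v + g' v"] conjI has_derivative_add) (auto simp: algebra_simps)
  show "cdiff (\<lambda>x. f x * g x) x"
    using D unfolding cdiff_def
    by (intro exI[of _ "\<lambda>v. f x * g' v + f' v * g x"] conjI has_derivative_mult) (auto simp: algebra_simps)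
qed

lemma cdiff_field:
  assumes "cdiff f x" "(g has_field_derivative g') (at (f x))"
  shows "cdiff (\<lambda>x. g (f x)) x"
proof -
  obtain f' where f: "(f has_derivative f') (at x)" "\<And>c v. f' (c *s v) = c * f' v"
    using assms by (auto simp: cdiff_def)
  have "(g has_derivative (*) g') (at (f x))"
    using assms(2) by (simp add: has_field_derivative_def)
  from has_derivative_compose[OF f(1) this] show ?thesis
    unfolding cdiff_def using f(2) by (intro exI[of _ "\<lambda>v. g' * f' v"]) (auto simp: algebra_simps)
qed

lemma cdiff_inverse:
  assumes "cdiff f x" "f x \<noteq> 0"
  shows "cdiff (\<lambda>x. inverse (f x)) x"
  by (rule cdiff_field[OF assms(1), of inverse])
     (rule DERIV_inverse[OF assms(2)])

lemma cdiff_divide: "cdiff f x \<Longrightarrow> cdiff g x \<Longrightarrow> g x \<noteq> 0 \<Longrightarrow> cdiff (\<lambda>x. f x / g x) x"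
  unfolding divide_inverse by (intro cdiff_mult cdiff_inverse)

lemma cdiff_ring: "function_ring (\<lambda>f. cdiff f x)"
  by unfold_locales (simp_all add: cdiff_const cdiff_add cdiff_mult)

lemma has_derivative_vecI:
  fixes F :: "'a::real_normed_vector \<Rightarrow> complex^'n"
  assumes "\<And>i. ((\<lambda>z. F z $ i) has_derivative (\<lambda>v. D v $ i)) (at x)"
  shows "(F has_derivative D) (at x)"
proof -
  have "((\<lambda>z. F z \<bullet> b) has_derivative (\<lambda>v. D v \<bullet> b)) (at x)" if "b \<in> Basis" for b
  proof -
    obtain i u where b: "b = axis i u" using \<open>b \<in> Basis\<close> unfolding Basis_vec_def by blast
    have "((\<lambda>z. F z $ i \<bullet> u) has_derivative (\<lambda>v. D v $ i \<bullet> u)) (at x)"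
      by (rule bounded_linear.has_derivative[OF bounded_linear_inner_left assms])
    then show ?thesis by (simp add: b inner_axis)
  qed
  then show ?thesis
    by (subst has_derivative_componentwise_within) blast
qed

lemma cdiff_compose:
  fixes F :: "complex^'n \<Rightarrow> complex^'m"
  assumes "\<And>j. cdiff (\<lambda>z. F z $ j) x" "cdiff g (F x)"
  shows "cdiff (\<lambda>z. g (F z)) x"
proof -
  obtain D where D: "\<And>j. ((\<lambda>z. F z $ j) has_derivative D j) (at x)" "\<And>j c v. D j (c *s v) = c * D j v"
    using assms(1) unfolding cdiff_def by metis
  obtain g' where g: "(g has_derivative g') (at (F x))" "\<And>c v. g' (c *s v) = c * g' v"
    using assms(2) by (auto simp: cdiff_def)
  have "(F has_derivative (\<lambda>v. \<chi> j. D j v)) (at x)"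
    by (rule has_derivative_vecI) (simp add: D)
  from has_derivative_compose[OF this g(1)]
  show ?thesis unfolding cdiff_def
  proof (intro exI conjI allI)
    fix c v
    have "(\<chi> j. D j (c *s v)) = c *s (\<chi> j. D j v)" by (simp add: vec_eq_iff D)
    then show "g' (\<chi> j. D j (c *s v)) = c * g' (\<chi> j. D j v)" by (simp add: g)
  qed
qed

text \<open>The derivative of g is returned together with its homogeneity: a curve with velocity 0
  then yields derivative 0 whatever g is, which is how ramification is detected later.\<close>

lemma cdiff_curve:
  fixes c :: "complex \<Rightarrow> complex^'m"
  assumes "\<And>j. ((\<lambda>z. c z $ j) has_field_derivative d $ j) (at z)" "cdiff g (c z)"
  obtains g' where "\<And>a v. g' (a *s v) = a * g' v" "((\<lambda>z. g (c z)) has_field_derivative g' d) (at z)"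
proof -
  obtain g' where g: "(g has_derivative g') (at (c z))" "\<And>c v. g' (c *s v) = c * g' v"
    using assms(2) by (auto simp: cdiff_def)
  have "(c has_derivative (\<lambda>v. v *s d)) (at z)"
    using assms(1) by (intro has_derivative_vecI) (simp add: has_field_derivative_def mult.commute[of _ "d $ _"])
  from has_derivative_compose[OF this g(1)]
  have "((\<lambda>z. g (c z)) has_derivative (\<lambda>v. v * g' d)) (at z)" by (simp add: g)
  then show ?thesis
    by (intro that[of g'] g) (simp add: has_field_derivative_def mult.commute[of _ "g' d"])
qed

lemma field_differentiable_curve:
  fixes c :: "complex \<Rightarrow> complex^'m"
  assumes c: "\<And>j. (\<lambda>z. c z $ j) field_differentiable at z" and g: "cdiff g (c z)"
  shows "(\<lambda>z. g (c z)) field_differentiable at z"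
proof -
  define d :: "complex^'m" where "d = (\<chi> j. deriv (\<lambda>z. c z $ j) z)"
  have d: "((\<lambda>z. c z $ j) has_field_derivative d $ j) (at z)" for j
    using c by (simp add: field_differentiable_derivI d_def)
  show ?thesis
  proof (rule cdiff_curve[where c = c and d = d and z = z and g = g])
    fix g' assume "((\<lambda>z. g (c z)) has_field_derivative g' d) (at z)"
    then show ?thesis unfolding field_differentiable_def by (rule exI)
  qed (fact d g)+
qed

lemma cdiff_cong:
  assumes "open S" "x \<in> S" "\<And>y. y \<in> S \<Longrightarrow> f y = g y" "cdiff f x"
  shows "cdiff g x"
  using assms unfolding cdiff_def by (metis has_derivative_transform_within_open)

lemma cdiff_isCont: "cdiff f x \<Longrightarrow> isCont f x"
  unfolding cdiff_def by (metis has_derivative_continuous)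

section \<open>Holomorphic functions and maps on manifolds\<close>

text \<open>Pointwise form of \<open>hol_fun\<close>. The condition is imposed in every chart at x;
  on the target side of a map, \<open>holat_compose_chart\<close> and \<open>hol_mapI\<close> reduce
  the work to one chart.\<close>

definition holat :: "('a, 'n::finite) atlas \<Rightarrow> ('a \<Rightarrow> complex) \<Rightarrow> 'a \<Rightarrow> bool" where
  "holat A h x \<longleftrightarrow> (\<forall>U \<phi>. (U, \<phi>) \<in> A \<longrightarrow> x \<in> U \<longrightarrow> cdiff (\<lambda>z. h (inv_into U \<phi> z)) (\<phi> x))"

lemma hol_fun_iff: "hol_fun A W h \<longleftrightarrow> (\<forall>x\<in>W. holat A h x)"
  unfolding hol_fun_def holat_def hol_iff_cdiff by fastforce

lemma hol_map_iff:
  "hol_map A B W f \<longleftrightarrow> continuous_on W f \<and> f ` W \<subseteq> mfd_points B \<and>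
     (\<forall>x\<in>W. \<forall>V \<psi> j. (V, \<psi>) \<in> B \<longrightarrow> f x \<in> V \<longrightarrow> holat A (\<lambda>y. \<psi> (f y) $ j) x)"
  unfolding hol_map_def hol_fun_iff by fastforce

lemma hol_map_subset: "hol_map A B W f \<Longrightarrow> W' \<subseteq> W \<Longrightarrow> hol_map A B W' f"
  unfolding hol_map_iff by (auto intro: continuous_on_subset)

lemma holat_ring: "function_ring (\<lambda>f. holat A f x)"
  unfolding holat_def by unfold_locales (auto intro: cdiff_const cdiff_add cdiff_mult)

lemma holat_divide: "holat A f x \<Longrightarrow> holat A g x \<Longrightarrow> g x \<noteq> 0 \<Longrightarrow> complex_manifold A \<Longrightarrow> holat A (\<lambda>x. f x / g x) x"
  unfolding holat_def complex_manifold_def homeomorphism_def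
  by (auto 0 3 intro!: cdiff_divide)

context
  fixes A :: "('a::t2_space, 'n::finite) atlas"
  assumes A: "complex_manifold A"
begin

lemma chartD:
  assumes "(U, \<phi>) \<in> A"
  shows "openin (top_of_set (mfd_points A)) U" "open (\<phi> ` U)"
    "homeomorphism U (\<phi> ` U) \<phi> (inv_into U \<phi>)" "U \<subseteq> mfd_points A"
proof -
  show "openin (top_of_set (mfd_points A)) U" "open (\<phi> ` U)" "homeomorphism U (\<phi> ` U) \<phi> (inv_into U \<phi>)"
    using A assms unfolding complex_manifold_def mopen_def by auto
  then show "U \<subseteq> mfd_points A" by (meson openin_imp_subset)
qed

lemma chart_inv:
  assumes "(U, \<phi>) \<in> A" "x \<in> U"
  shows "inv_into U \<phi> (\<phi> x) = x"
  using chartD(3)[OF assms(1)] assms(2) by (simp add: homeomorphism_def)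

lemma chart_ex:
  assumes "x \<in> mfd_points A"
  obtains U \<phi> where "(U, \<phi>) \<in> A" "x \<in> U"
  using assms by (auto simp: mfd_points_def)

lemma chart_image_open:
  assumes "(U, \<phi>) \<in> A" "mopen A W"
  shows "open (\<phi> ` (U \<inter> W))"
proof -
  have "openin (top_of_set U) (U \<inter> W)"
    by (rule openin_subset_trans[OF openin_Int[OF chartD(1)[OF assms(1)] assms(2)[unfolded mopen_def]]])
       (use chartD(4)[OF assms(1)] in auto)
  then have "openin (top_of_set (\<phi> ` U)) (\<phi> ` (U \<inter> W))"
    using homeomorphism_imp_open_map[OF chartD(3)[OF assms(1)]] by blast
  then show ?thesis using chartD(2)[OF assms(1)] openin_open_trans by blast
qed

lemma chart_inv_continuous:
  assumes "(U, \<phi>) \<in> A" shows "continuous_on (\<phi> ` U) (inv_into U \<phi>)"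
  using chartD(3)[OF assms] by (simp add: homeomorphism_def)

lemma holat_cong:
  assumes W: "mopen A W" "x \<in> W" "\<And>y. y \<in> W \<Longrightarrow> h y = h' y" and h: "holat A h x"
  shows "holat A h' x"
  unfolding holat_def
proof clarify
  fix U \<phi> assume U: "(U, \<phi>) \<in> A" "x \<in> U"
  show "cdiff (\<lambda>z. h' (inv_into U \<phi> z)) (\<phi> x)"
  proof (rule cdiff_cong[OF chart_image_open[OF U(1) W(1)]])
    show "\<phi> x \<in> \<phi> ` (U \<inter> W)" using U W by blast
    show "cdiff (\<lambda>z. h (inv_into U \<phi> z)) (\<phi> x)" using h U by (auto simp: holat_def)
    show "h (inv_into U \<phi> z) = h' (inv_into U \<phi> z)" if "z \<in> \<phi> ` (U \<inter> W)" for z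
      using that W(3) chart_inv[OF U(1)] by auto
  qed
qed

lemma holat_chart_coord:
  assumes "(U, \<phi>) \<in> A" "x \<in> U"
  shows "holat A (\<lambda>y. \<phi> y $ j) x"
  unfolding holat_def
proof clarify
  fix V \<psi> assume V: "(V, \<psi>) \<in> A" "x \<in> V"
  have "hol (\<lambda>z. \<phi> (inv_into V \<psi> z) $ j) (\<psi> ` (V \<inter> U))"
    using A V(1) assms(1) unfolding complex_manifold_def by fast
  then show "cdiff (\<lambda>z. \<phi> (inv_into V \<psi> z) $ j) (\<psi> x)"
    using V assms by (auto simp: hol_iff_cdiff)
qed

lemma holat_continuous_on:
  assumes W: "mopen A W" and h: "\<And>x. x \<in> W \<Longrightarrow> holat A h x"
  shows "continuous_on W h"
proof -
  have "continuous (at x within W) h" if x: "x \<in> W" for x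
  proof -
    have WA: "W \<subseteq> mfd_points A" using W by (simp add: mopen_def openin_imp_subset)
    obtain U \<phi> where U: "(U, \<phi>) \<in> A" "x \<in> U" by (rule chart_ex[of x]) (use x WA in auto)
    have "isCont (\<lambda>z. h (inv_into U \<phi> z)) (\<phi> y)" if "y \<in> U \<inter> W" for y
      using h[of y] U(1) that by (intro cdiff_isCont) (auto simp: holat_def)
    then have 1: "continuous_on (\<phi> ` (U \<inter> W)) (\<lambda>z. h (inv_into U \<phi> z))"
      by (intro continuous_at_imp_continuous_on) auto
    have "continuous_on U \<phi>" using chartD(3)[OF U(1)] by (simp add: homeomorphism_def)
    then have "continuous_on (U \<inter> W) \<phi>" by (rule continuous_on_subset) auto
    then have "continuous_on (U \<inter> W) (\<lambda>y. h (inv_into U \<phi> (\<phi> y)))"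
      by (rule continuous_on_compose2[OF 1]) auto
    then have "continuous_on (U \<inter> W) h"
      by (rule continuous_on_eq) (simp add: chart_inv[OF U(1)])
    then have 3: "continuous (at x within (U \<inter> W)) h"
      using U(2) x by (simp add: continuous_on_eq_continuous_within)
    obtain O' where O': "open O'" "U = mfd_points A \<inter> O'" using chartD(1)[OF U(1)] by (auto simp: openin_open)
    have "at x within (U \<inter> W) = at x within W"
      by (rule at_within_nhd[of x O']) (use O' U WA in auto)
    then show ?thesis using 3 by simp
  qed
  then show ?thesis by (simp add: continuous_on_eq_continuous_within)
qed

end

context
  fixes A :: "('a::t2_space, 'n::finite) atlas"
  assumes A: "complex_manifold A"
begin

text \<open>On the open set of points that f sends into V, the composite is f read in the chart V
  followed by h read in the same chart.\<close>

lemma holat_compose_chart: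
  fixes B :: "('b::t2_space, 'm::finite) atlas"
  assumes B: "complex_manifold B" and W: "mopen A W" "x \<in> W"
    and f: "continuous_on W f" "f ` W \<subseteq> mfd_points B"
    and V: "(V, \<psi>) \<in> B" "f x \<in> V" "\<And>j. holat A (\<lambda>y. \<psi> (f y) $ j) x"
    and h: "holat B h (f x)"
  shows "holat A (\<lambda>y. h (f y)) x"
  unfolding holat_def
proof clarify
  fix U \<phi> assume U: "(U, \<phi>) \<in> A" "x \<in> U"
  have "openin (top_of_set (mfd_points B)) V" by (rule chartD(1)[OF B V(1)])
  then have "openin (top_of_set W) (W \<inter> f -` V)"
    using f by (intro continuous_openin_preimage[of W f "mfd_points B"]) auto
  then have W': "mopen A (W \<inter> f -` V)"
    using W(1) unfolding mopen_def by (rule openin_trans)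
  have 1: "cdiff (\<lambda>z. \<psi> (f (inv_into U \<phi> z)) $ j) (\<phi> x)" for j
    using V(3)[of j] U by (auto simp: holat_def)
  have 2: "cdiff (\<lambda>w. h (inv_into V \<psi> w)) (\<psi> (f (inv_into U \<phi> (\<phi> x))))"
    using h V chart_inv[OF A U] by (auto simp: holat_def)
  have 3: "cdiff (\<lambda>z. h (inv_into V \<psi> (\<psi> (f (inv_into U \<phi> z))))) (\<phi> x)"
    by (rule cdiff_compose[OF 1 2])
  show "cdiff (\<lambda>z. h (f (inv_into U \<phi> z))) (\<phi> x)"
  proof (rule cdiff_cong[OF chart_image_open[OF A U(1) W'] _ _ 3])
    show "\<phi> x \<in> \<phi> ` (U \<inter> (W \<inter> f -` V))" using U W V by blast
    have "inv_into V \<psi> (\<psi> v) = v" if "v \<in> V" for v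
      using that by (rule chart_inv[OF B V(1)])
    then show "h (inv_into V \<psi> (\<psi> (f (inv_into U \<phi> z)))) = h (f (inv_into U \<phi> z))"
      if "z \<in> \<phi> ` (U \<inter> (W \<inter> f -` V))" for z
      using that chart_inv[OF A U(1)] by auto
  qed
qed

lemma holat_compose:
  fixes B :: "('b::t2_space, 'm::finite) atlas"
  assumes B: "complex_manifold B" and W: "mopen A W" "x \<in> W"
    and f: "hol_map A B W f" and h: "holat B h (f x)"
  shows "holat A (\<lambda>y. h (f y)) x"
proof -
  have f': "continuous_on W f" "f ` W \<subseteq> mfd_points B"
    "\<And>V \<psi> j. (V, \<psi>) \<in> B \<Longrightarrow> f x \<in> V \<Longrightarrow> holat A (\<lambda>y. \<psi> (f y) $ j) x"
    using f W(2) unfolding hol_map_iff by auto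
  obtain V \<psi> where V: "(V, \<psi>) \<in> B" "f x \<in> V" using f'(2) W(2) by (auto simp: mfd_points_def)
  show ?thesis
    by (rule holat_compose_chart[OF B W f'(1,2) V f'(3)[OF V] h])
qed

text \<open>The coordinates of any other chart at f x are holomorphic functions on B, so composing
  them through the one given chart handles all charts.\<close>

lemma hol_mapI:
  fixes B :: "('b::t2_space, 'm::finite) atlas"
  assumes B: "complex_manifold B" and W: "mopen A W"
    and f: "continuous_on W f"
    and V: "\<And>x. x \<in> W \<Longrightarrow> \<exists>V \<psi>. (V, \<psi>) \<in> B \<and> f x \<in> V \<and> (\<forall>j. holat A (\<lambda>y. \<psi> (f y) $ j) x)"
  shows "hol_map A B W f"
proof -
  have fB: "f ` W \<subseteq> mfd_points B"
  proof clarify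
    fix x assume "x \<in> W"
    from V[OF this] show "f x \<in> mfd_points B" unfolding mfd_points_def by force
  qed
  show ?thesis unfolding hol_map_iff
  proof (intro conjI f fB ballI, clarify)
    fix x V \<psi> j assume x: "x \<in> W" and V': "(V, \<psi>) \<in> B" "f x \<in> V"
    obtain V1 \<psi>1 where V1: "(V1, \<psi>1) \<in> B" "f x \<in> V1" "\<And>j. holat A (\<lambda>y. \<psi>1 (f y) $ j) x"
      using V[OF x] by blast
    have "holat B (\<lambda>y. \<psi> y $ j) (f x)" by (rule holat_chart_coord[OF B V'])
    then show "holat A (\<lambda>y. \<psi> (f y) $ j) x"
      by (rule holat_compose_chart[OF B W x f fB V1])
  qed
qed

lemma hol_map_compose:
  fixes B :: "('b::t2_space, 'm::finite) atlas" and C :: "('c::topological_space, 'k::finite) atlas"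
  assumes B: "complex_manifold B" and W: "mopen A W"
    and f: "hol_map A B W f" and g: "hol_map B C W' g" "f ` W \<subseteq> W'"
  shows "hol_map A C W (\<lambda>x. g (f x))"
  unfolding hol_map_iff
proof (intro conjI ballI)
  show "continuous_on W (\<lambda>x. g (f x))"
    using f g by (auto simp: hol_map_iff intro: continuous_on_compose2)
  show "(\<lambda>x. g (f x)) ` W \<subseteq> mfd_points C" using g by (auto simp: hol_map_iff)
  fix x assume x: "x \<in> W"
  show "\<forall>V \<psi> j. (V, \<psi>) \<in> C \<longrightarrow> g (f x) \<in> V \<longrightarrow> holat A (\<lambda>y. \<psi> (g (f y)) $ j) x"
  proof (intro allI impI)
    fix V \<psi> j assume "(V, \<psi>) \<in> C" "g (f x) \<in> V"
    then have "holat B (\<lambda>y. \<psi> (g y) $ j) (f x)"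
      using g x unfolding hol_map_iff by blast
    then show "holat A (\<lambda>y. \<psi> (g (f y)) $ j) x" by (rule holat_compose[OF B W x f])
  qed
qed

end

subsection \<open>Affine space\<close>

lemma mfd_points_std [simp]: "mfd_points std_atlas = UNIV"
  by (simp add: mfd_points_def std_atlas_def)

lemma holat_std: "holat std_atlas h x \<longleftrightarrow> cdiff h x"
proof -
  have "inv_into UNIV (\<lambda>z::complex^'n. z) = (\<lambda>z. z)" by (simp add: fun_eq_iff inv_into_f_f[of "\<lambda>z. z" UNIV, simplified])
  then show ?thesis by (simp add: holat_def std_atlas_def)
qed

lemma complex_manifold_std: "complex_manifold (std_atlas :: (complex^'n, 'n) atlas)"
proof -
  have "inv_into UNIV (\<lambda>z::complex^'n. z) = (\<lambda>z. z)" by (simp add: fun_eq_iff inv_into_f_f[of "\<lambda>z. z" UNIV, simplified])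
  then show ?thesis
    by (auto simp: complex_manifold_def std_atlas_def mopen_def mfd_points_def hol_iff_cdiff
        cdiff_component homeomorphism_def)
qed

lemma hol_map_std_iff:
  "hol_map A (std_atlas :: (complex^'m, 'm) atlas) W f \<longleftrightarrow> continuous_on W f \<and> (\<forall>x\<in>W. \<forall>j. holat A (\<lambda>y. f y $ j) x)"
  by (simp add: hol_map_iff mfd_points_std) (simp add: std_atlas_def)

section \<open>The projective plane as a complex manifold\<close>

lemma pt_eq_iff:
  assumes "x \<noteq> 0" "y \<noteq> 0"
  shows "pt x = pt y \<longleftrightarrow> (\<exists>c. c \<noteq> 0 \<and> y = c *s x)"
proof
  assume "pt x = pt y"
  then have "y \<in> hom_coords (pt x)" using hom_coords_pt[OF assms(2)] by (auto intro!: exI[of _ 1])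
  then show "\<exists>c. c \<noteq> 0 \<and> y = c *s x" using hom_coords_pt[OF assms(1)] by auto
qed (auto simp: pt_scale)

lemma pt_cases:
  obtains v where "v \<noteq> 0" "P = pt v"
  using pt_surj by blast

lemma open_proj2_iff: "open U \<longleftrightarrow> open {v. v \<noteq> 0 \<and> pt v \<in> U}"
  by (simp add: open_proj2_def)

lemma continuous_on_pt: "continuous_on (- {0}) pt"
  unfolding continuous_on_open_vimage[OF open_Compl[OF closed_singleton]]
proof clarify
  fix B :: "proj2 set" assume "open B"
  then have "open {v. v \<noteq> 0 \<and> pt v \<in> B}" by (simp add: open_proj2_iff)
  moreover have "{v. v \<noteq> 0 \<and> pt v \<in> B} = pt -` B \<inter> - {0}" by auto
  ultimately show "open (pt -` B \<inter> - {0})" by simp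
qed

lemma continuous_on_proj2I:
  assumes U: "open U" and f: "continuous_on {v. v \<noteq> 0 \<and> pt v \<in> U} (\<lambda>v. f (pt v))"
  shows "continuous_on U f"
  unfolding continuous_on_open_vimage[OF U]
proof clarify
  fix B :: "'a set" assume "open B"
  moreover have o: "open {v. v \<noteq> 0 \<and> pt v \<in> U}" using U by (simp add: open_proj2_iff)
  ultimately have "open ((\<lambda>v. f (pt v)) -` B \<inter> {v. v \<noteq> 0 \<and> pt v \<in> U})"
    using f continuous_on_open_vimage[OF o] by blast
  moreover have "(\<lambda>v. f (pt v)) -` B \<inter> {v. v \<noteq> 0 \<and> pt v \<in> U} = {v. v \<noteq> 0 \<and> pt v \<in> f -` B \<inter> U}"
    by auto
  ultimately show "open (f -` B \<inter> U)" by (simp add: open_proj2_iff)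
qed

text \<open>The unit sphere maps onto the plane.\<close>

lemma compact_UNIV_proj2: "compact (UNIV :: proj2 set)"
proof -
  have "pt ` sphere 0 1 = UNIV"
  proof -
    have "P \<in> pt ` sphere 0 1" for P
    proof -
      obtain v where v: "v \<noteq> 0" "P = pt v" by (rule pt_cases)
      define c :: complex where "c = of_real (1 / norm v)"
      have "norm (c *s v) = norm c * norm v"
        by (simp add: norm_vec_def L2_set_def norm_mult power_mult_distrib sum_distrib_left[symmetric] real_sqrt_mult)
      then have "norm (c *s v) = 1" using v by (simp add: c_def norm_divide)
      moreover have "pt (c *s v) = P" using v by (simp add: pt_scale c_def)
      ultimately show ?thesis by (intro image_eqI[of _ _ "c *s v"]) auto
    qed
    then show ?thesis by auto
  qed
  moreover have "compact (pt ` sphere 0 1)"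
    by (rule compact_continuous_image[OF continuous_on_subset[OF continuous_on_pt]]) auto
  ultimately show ?thesis by simp
qed

section \<open>The three affine charts\<close>

definition pdom :: "3 \<Rightarrow> proj2 set" where
  "pdom i = {P. \<forall>x\<in>hom_coords P. x $ i \<noteq> 0}"

definition pchart :: "3 \<Rightarrow> proj2 \<Rightarrow> complex^2" where
  "pchart i P = (let x = (SOME x. x \<in> hom_coords P) in vector [x $ (i + 1) / x $ i, x $ (i + 2) / x $ i])"

text \<open>The normalized lift of an affine chart: coordinate i is 1, and \<open>pt\<close> after
  \<open>psec i\<close> inverts \<open>pchart i\<close>. With this lift the chart changes become
  quotients of coordinates.\<close>

definition psec :: "3 \<Rightarrow> complex^2 \<Rightarrow> complex^3" where
  "psec i z = (\<chi> j. if j = i then 1 else if j = i + 1 then z $ 1 else z $ 2)"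

lemma proj2_atlas_eq: "proj2_atlas = range (\<lambda>i. (pdom i, pchart i))"
  by (simp add: proj2_atlas_def pdom_def pchart_def[abs_def])

lemma pdom_pt: "x \<noteq> 0 \<Longrightarrow> pt x \<in> pdom i \<longleftrightarrow> x $ i \<noteq> 0"
  by (auto simp: pdom_def hom_coords_pt intro: exI[of _ 1])

lemma pchart_pt:
  assumes "x \<noteq> 0"
  shows "pchart i (pt x) = vector [x $ (i + 1) / x $ i, x $ (i + 2) / x $ i]"
proof -
  have "(SOME y. y \<in> hom_coords (pt x)) \<in> hom_coords (pt x)"
    by (rule someI[of _ x]) (auto simp: hom_coords_pt assms intro!: exI[of _ 1])
  then obtain c where c: "c \<noteq> 0" "(SOME y. y \<in> hom_coords (pt x)) = c *s x"
    by (auto simp: hom_coords_pt assms)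
  show ?thesis unfolding pchart_def Let_def c(2) using c(1) by simp
qed

lemma index3: "(i::3) + 1 \<noteq> i" "i + 2 \<noteq> i" "i + 2 \<noteq> i + 1" "j \<noteq> i \<Longrightarrow> j \<noteq> i + 1 \<Longrightarrow> j = i + 2"
  using exhaust_3[of i] exhaust_3[of j] by auto

lemma psec_nz: "psec i z \<noteq> 0"
  by (auto simp: vec_eq_iff psec_def intro!: exI[of _ i])

lemma psec_simps [simp]: "psec i z $ i = 1" "psec i z $ (i + 1) = z $ 1" "psec i z $ (i + 2) = z $ 2"
  by (simp_all add: psec_def index3)

lemma pchart_psec: "pchart i (pt (psec i z)) = z"
  unfolding pchart_pt[OF psec_nz] by (simp add: vec_eq_iff forall_2)

lemma psec_pchart:
  assumes "x \<noteq> 0" "x $ i \<noteq> 0"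
  shows "psec i (pchart i (pt x)) = (1 / x $ i) *s x"
proof -
  have "psec i (pchart i (pt x)) $ j = (1 / x $ i) * x $ j" for j
    using assms index3(4)[of j i] by (cases "j = i"; cases "j = i + 1") (simp_all add: pchart_pt)
  then show ?thesis by (simp add: vec_eq_iff)
qed

lemma pt_psec_pchart: "P \<in> pdom i \<Longrightarrow> pt (psec i (pchart i P)) = P"
  by (metis pt_cases pdom_pt psec_pchart pt_scale divide_eq_0_iff zero_neq_one)

lemma psec_in_pdom: "pt (psec i z) \<in> pdom i"
  by (simp add: pdom_pt psec_nz)

lemma pchart_image: "pchart i ` pdom i = UNIV"
  using pchart_psec psec_in_pdom by (metis surjI image_eqI UNIV_eq_I)

lemma inv_into_pchart: "inv_into (pdom i) (pchart i) z = pt (psec i z)"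
proof -
  have "inj_on (pchart i) (pdom i)" by (rule inj_on_inverseI) (rule pt_psec_pchart)
  from inv_into_f_f[OF this psec_in_pdom] show ?thesis by (simp add: pchart_psec)
qed

lemma mfd_points_proj2 [simp]: "mfd_points proj2_atlas = UNIV"
proof -
  have "P \<in> \<Union> (range pdom)" for P
  proof -
    obtain v where v: "v \<noteq> 0" "P = pt v" by (rule pt_cases)
    then obtain i where "v $ i \<noteq> 0" by (auto simp: vec_eq_iff)
    then show ?thesis using v by (auto simp: pdom_pt)
  qed
  then show ?thesis by (auto simp: mfd_points_def proj2_atlas_eq image_image)
qed

lemma mopen_proj2 [simp]: "mopen proj2_atlas U \<longleftrightarrow> open U"
  by (simp add: mopen_def)

lemma open_pdom: "open (pdom i)"
proof -
  have "{v. v \<noteq> 0 \<and> pt v \<in> pdom i} = {v. v $ i \<noteq> 0}"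
    using pdom_pt[of _ i] by (metis (no_types, lifting) zero_index)
  moreover have "open {v::complex^3. v $ i \<noteq> 0}" by (intro open_Collect_neq continuous_intros)
  ultimately show ?thesis by (simp add: open_proj2_iff)
qed

lemma continuous_on_vecI: "(\<And>i. continuous_on S (\<lambda>x. f x $ i)) \<Longrightarrow> continuous_on S f"
  using continuous_on_vec_lambda[of S "\<lambda>i x. f x $ i"] by simp

lemma continuous_on_psec: "continuous_on S (\<lambda>z. psec i z)"
proof -
  have "continuous_on S (\<lambda>z. if j = i then 1 else if j = i + 1 then z $ 1 else z $ 2 :: complex)" for j
    by (cases "j = i"; cases "j = i + 1") (simp_all add: continuous_intros)
  then show ?thesis unfolding psec_def by (intro continuous_on_vec_lambda)
qed

lemma cdiff_psec: "cdiff (\<lambda>z. psec i z $ j) x"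
  by (cases "j = i"; cases "j = i + 1") (simp_all add: psec_def cdiff_component cdiff_const)

lemma continuous_on_vector_2:
  assumes "continuous_on S f" "continuous_on S g"
  shows "continuous_on S (\<lambda>x. vector [f x, g x] :: complex^2)"
proof -
  have "vector [f x, g x] = (\<chi> j::2. if j = 1 then f x else g x)" for x
    by (simp add: vec_eq_iff forall_2)
  moreover have "continuous_on S (\<lambda>x. if j = 1 then f x else g x)" for j :: 2
    using assms by (cases "j = 1") simp_all
  ultimately show ?thesis by (simp add: continuous_on_vec_lambda)
qed

lemma continuous_on_pchart: "continuous_on (pdom i) (pchart i)"
proof (rule continuous_on_proj2I[OF open_pdom])
  have "continuous_on {v. v \<noteq> 0 \<and> pt v \<in> pdom i} (\<lambda>v. vector [v $ (i + 1) / v $ i, v $ (i + 2) / v $ i] :: complex^2)"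
    by (intro continuous_on_vector_2 continuous_intros) (auto simp: pdom_pt)
  then show "continuous_on {v. v \<noteq> 0 \<and> pt v \<in> pdom i} (\<lambda>v. pchart i (pt v))"
    by (rule continuous_on_eq) (simp add: pchart_pt)
qed

lemma complex_manifold_proj2: "complex_manifold proj2_atlas"
proof -
  have "mopen proj2_atlas (pdom i) \<and> open (pchart i ` pdom i) \<and>
    homeomorphism (pdom i) (pchart i ` pdom i) (pchart i) (inv_into (pdom i) (pchart i))" for i
  proof (intro conjI)
    show "homeomorphism (pdom i) (pchart i ` pdom i) (pchart i) (inv_into (pdom i) (pchart i))"
    proof (rule homeomorphismI)
      have "continuous_on UNIV (\<lambda>z. pt (psec i z))"
        by (rule continuous_on_compose2[OF continuous_on_pt continuous_on_psec]) (auto simp: psec_nz)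
      then show "continuous_on (pchart i ` pdom i) (inv_into (pdom i) (pchart i))"
        by (simp add: pchart_image inv_into_pchart[abs_def])
    qed (auto simp: continuous_on_pchart inv_into_pchart psec_in_pdom pt_psec_pchart pchart_psec)
  qed (simp_all add: open_pdom pchart_image)
  moreover have "hol (\<lambda>z. pchart k (inv_into (pdom i) (pchart i) z) $ j) (pchart i ` (pdom i \<inter> pdom k))" for i j k
    unfolding hol_iff_cdiff inv_into_pchart
  proof clarify
    fix P assume P: "P \<in> pdom i" "P \<in> pdom k"
    have nz: "psec i (pchart i P) $ k \<noteq> 0"
      using P pdom_pt[OF psec_nz] by (metis pt_psec_pchart)
    have "cdiff (\<lambda>z. psec i z $ m / psec i z $ k) (pchart i P)" for m
      by (intro cdiff_divide cdiff_psec nz)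
    then show "cdiff (\<lambda>z. pchart k (pt (psec i z)) $ j) (pchart i P)"
      using exhaust_2[of j] by (auto simp: pchart_pt psec_nz)
  qed
  ultimately show ?thesis
    unfolding complex_manifold_def proj2_atlas_eq by auto
qed

text \<open>Every inverse chart lifts to homogeneous coordinates through \<open>psec\<close>, so a
  function on the plane that comes from a differentiable H upstairs is differentiable in each
  chart.\<close>

lemma holat_proj2:
  assumes "x \<noteq> 0" "open U" "pt x \<in> U"
    and H: "\<And>y. y \<noteq> 0 \<Longrightarrow> pt y \<in> U \<Longrightarrow> h (pt y) = H y \<and> cdiff H y"
  shows "holat proj2_atlas h (pt x)"
  unfolding holat_def
proof (intro allI impI)
  fix V \<phi> assume "(V, \<phi>) \<in> proj2_atlas" "pt x \<in> V"
  then obtain i where i: "V = pdom i" "\<phi> = pchart i" "x $ i \<noteq> 0"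
    using assms(1) by (auto simp: proj2_atlas_eq pdom_pt)
  define S where "S = (\<lambda>z. pt (psec i z)) -` U"
  have c: "continuous_on UNIV (\<lambda>z. pt (psec i z))"
    by (rule continuous_on_compose2[OF continuous_on_pt continuous_on_psec]) (auto simp: psec_nz)
  have S: "open S" unfolding S_def by (rule open_vimage[OF assms(2) c])
  have P: "pt (psec i (pchart i (pt x))) = pt x"
    using i assms(1) by (intro pt_psec_pchart) (simp add: pdom_pt)
  have "cdiff (\<lambda>z. h (pt (psec i z))) (pchart i (pt x))"
  proof (rule cdiff_cong[OF S])
    show "pchart i (pt x) \<in> S" using assms(3) by (simp add: S_def P)
    show "H (psec i z) = h (pt (psec i z))" if "z \<in> S" for z
      using that H[of "psec i z"] by (simp add: S_def psec_nz)
    show "cdiff (\<lambda>z. H (psec i z)) (pchart i (pt x))"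
      by (rule cdiff_compose[OF cdiff_psec]) (use H[OF psec_nz, of i] assms(3) P in auto)
  qed
  then show "cdiff (\<lambda>z. h (inv_into V \<phi> z)) (\<phi> (pt x))"
    by (simp add: i inv_into_pchart)
qed

text \<open>At each point some homogeneous coordinate is nonzero, and the chart coordinates are
  quotients by it.\<close>

lemma hol_map_pt:
  fixes A :: "('a::t2_space, 'n::finite) atlas"
  assumes A: "complex_manifold A" and W: "mopen A W"
    and y: "\<And>p i. p \<in> W \<Longrightarrow> holat A (\<lambda>p. y p $ i) p" "\<And>p. p \<in> W \<Longrightarrow> y p \<noteq> 0"
  shows "hol_map A proj2_atlas W (\<lambda>p. pt (y p))"
proof (rule hol_mapI[OF A complex_manifold_proj2 W])
  have "continuous_on W (\<lambda>p. \<chi> i. y p $ i)"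
    by (intro continuous_on_vec_lambda holat_continuous_on[OF A W] y)
  then have "continuous_on W y" by simp
  then show "continuous_on W (\<lambda>p. pt (y p))"
    by (rule continuous_on_compose2[OF continuous_on_pt]) (use y in auto)
  fix p assume p: "p \<in> W"
  obtain i where i: "y p $ i \<noteq> 0" using y(2)[OF p] by (auto simp: vec_eq_iff)
  have "holat A (\<lambda>q. pchart i (pt (y q)) $ j) p" for j
  proof (rule holat_cong[OF A W p])
    define k where "k = (if j = 1 then i + 1 else i + 2)"
    show "holat A (\<lambda>q. y q $ k / y q $ i) p"
      by (intro holat_divide[OF _ _ _ A] y p i)
    show "y q $ k / y q $ i = pchart i (pt (y q)) $ j" if "q \<in> W" for q
      using exhaust_2[of j] y(2)[OF that] by (auto simp: pchart_pt k_def)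
  qed
  then show "\<exists>V \<psi>. (V, \<psi>) \<in> proj2_atlas \<and> pt (y p) \<in> V \<and> (\<forall>j. holat A (\<lambda>q. \<psi> (pt (y q)) $ j) p)"
    using i y(2)[OF p] by (intro exI[of _ "pdom i"] exI[of _ "pchart i"]) (auto simp: proj2_atlas_eq pdom_pt)
qed

lemma holat_proj2_cdiff:
  assumes h: "holat proj2_atlas h (pt x)" and x: "x \<noteq> 0"
  shows "cdiff (\<lambda>y. h (pt y)) x"
proof -
  have "hol_map std_atlas proj2_atlas (- {0}) (\<lambda>x. pt x)"
    by (rule hol_map_pt[OF complex_manifold_std]) (auto simp: mopen_def holat_std cdiff_component)
  from holat_compose[OF complex_manifold_std complex_manifold_proj2 _ _ this h] x
  show ?thesis by (simp add: mopen_def holat_std open_Compl)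
qed

text \<open>Complex bilinear, without conjugation: the incidence form of a line and a point, not an
  inner product.\<close>

definition bil :: "complex^3 \<Rightarrow> complex^3 \<Rightarrow> complex" where
  "bil a x = (\<Sum>i\<in>UNIV. a $ i * x $ i)"

lemma bil_3: "bil a x = a $ 1 * x $ 1 + a $ 2 * x $ 2 + a $ 3 * x $ 3"
  by (simp add: bil_def sum_3)

lemma bil_linear: "bil (a + b) x = bil a x + bil b x" "bil a (x + y) = bil a x + bil a y"
  "bil (a - b) x = bil a x - bil b x" "bil a (x - y) = bil a x - bil a y"
  "bil (c *s a) x = c * bil a x" "bil a (c *s x) = c * bil a x" "bil 0 x = 0" "bil a 0 = 0"
  by (simp_all add: bil_3 algebra_simps)

lemma incident_pt:
  assumes "x \<noteq> 0" "a \<noteq> 0"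
  shows "incident (pt x) (pt a) \<longleftrightarrow> bil a x = 0"
proof -
  have "incident (pt x) (pt a) \<longleftrightarrow> (\<forall>y\<in>hom_coords (pt x). \<forall>b\<in>hom_coords (pt a). bil b y = 0)"
    by (simp add: incident_def bil_def)
  also have "\<dots> \<longleftrightarrow> (\<forall>c d. c \<noteq> 0 \<longrightarrow> d \<noteq> 0 \<longrightarrow> c * (d * bil a x) = 0)"
    using assms by (fastforce simp: hom_coords_pt bil_linear)
  also have "\<dots> \<longleftrightarrow> bil a x = 0" by (metis mult_eq_0_iff zero_neq_one)
  finally show ?thesis .
qed

lemma bil_nondegenerate: "(\<And>x. bil a x = 0) \<Longrightarrow> a = 0"
  using bil_3[of a "axis 1 1"] bil_3[of a "axis 2 1"] bil_3[of a "axis 3 1"]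
  by (simp add: vec_eq_iff forall_3 axis_def)

text \<open>A row b in the coordinates \<open>G *v y\<close> is the line \<open>b v* G\<close> in
  the original ones. Changes of coordinates for lines go through this rule.\<close>

lemma bil_vector_matrix: "bil (b v* G) y = bil b (G *v y)"
  by (simp add: bil_3 vector_matrix_mult_def matrix_vector_mult_def sum_3 algebra_simps)

section \<open>Products and submanifolds\<close>

definition prod_chart :: "('a \<Rightarrow> complex^'n) \<Rightarrow> ('b \<Rightarrow> complex^'m) \<Rightarrow> 'a \<times> 'b \<Rightarrow> complex^('n + 'm)" where
  "prod_chart \<phi> \<psi> = (\<lambda>(x, y). \<chi> k. case k of Inl i \<Rightarrow> \<phi> x $ i | Inr j \<Rightarrow> \<psi> y $ j)"

lemma prod_chart_simps [simp]: "prod_chart \<phi> \<psi> z $ Inl i = \<phi> (fst z) $ i" "prod_chart \<phi> \<psi> z $ Inr j = \<psi> (snd z) $ j"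
  by (simp_all add: prod_chart_def split: prod.split)

lemma prod_atlas_eq: "prod_atlas A B = {(U \<times> V, prod_chart \<phi> \<psi>) | U \<phi> V \<psi>. (U, \<phi>) \<in> A \<and> (V, \<psi>) \<in> B}"
  by (simp add: prod_atlas_def prod_chart_def)

lemma prod_atlas_iff: "(W, \<chi>') \<in> prod_atlas A B \<longleftrightarrow> (\<exists>U \<phi> V \<psi>. W = U \<times> V \<and> \<chi>' = prod_chart \<phi> \<psi> \<and> (U, \<phi>) \<in> A \<and> (V, \<psi>) \<in> B)"
  by (simp add: prod_atlas_eq)

lemma mfd_points_prod: "mfd_points (prod_atlas A B) = mfd_points A \<times> mfd_points B"
  by (force simp: mfd_points_def prod_atlas_eq)

context
  fixes A :: "('a::t2_space, 'n::finite) atlas" and B :: "('b::t2_space, 'm::finite) atlas"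
  assumes A: "complex_manifold A" and B: "complex_manifold B"
begin

lemma inv_into_prod_chart:
  assumes U: "(U, \<phi>) \<in> A" and V: "(V, \<psi>) \<in> B" and x: "x \<in> U" "y \<in> V"
    and z: "\<And>i. z $ Inl i = \<phi> x $ i" "\<And>j. z $ Inr j = \<psi> y $ j"
  shows "inv_into (U \<times> V) (prod_chart \<phi> \<psi>) z = (x, y)"
proof -
  have inj: "inj_on (prod_chart \<phi> \<psi>) (U \<times> V)"
  proof (rule inj_onI, clarsimp)
    fix a b c d assume *: "a \<in> U" "b \<in> V" "c \<in> U" "d \<in> V" "prod_chart \<phi> \<psi> (a, b) = prod_chart \<phi> \<psi> (c, d)"
    then have "\<phi> a $ i = \<phi> c $ i" "\<psi> b $ j = \<psi> d $ j" for i j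
      by (metis fst_conv snd_conv prod_chart_simps)+
    then have "\<phi> a = \<phi> c" "\<psi> b = \<psi> d" by (simp_all add: vec_eq_iff)
    then show "a = c \<and> b = d" using * chart_inv[OF A U] chart_inv[OF B V] by metis
  qed
  have "z $ k = prod_chart \<phi> \<psi> (x, y) $ k" for k
    by (cases k) (simp_all add: z)
  then have "z = prod_chart \<phi> \<psi> (x, y)" by (simp add: vec_eq_iff)
  then show ?thesis using inv_into_f_f[OF inj, of "(x, y)"] x by simp
qed

lemma inv_into_prod_chart':
  assumes U: "(U, \<phi>) \<in> A" and V: "(V, \<psi>) \<in> B" and z: "z \<in> prod_chart \<phi> \<psi> ` (U \<times> V)"
  shows "inv_into (U \<times> V) (prod_chart \<phi> \<psi>) z = (inv_into U \<phi> (\<chi> i. z $ Inl i), inv_into V \<psi> (\<chi> j. z $ Inr j))"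
proof -
  obtain x y where xy: "x \<in> U" "y \<in> V" "z = prod_chart \<phi> \<psi> (x, y)" using z by auto
  then have "(\<chi> i. z $ Inl i) = \<phi> x" "(\<chi> j. z $ Inr j) = \<psi> y" by (simp_all add: vec_eq_iff)
  then show ?thesis
    using inv_into_prod_chart[OF U V xy(1,2), of z] xy chart_inv[OF A U] chart_inv[OF B V] by simp
qed

lemma prod_chart_image:
  assumes U: "(U, \<phi>) \<in> A" and V: "(V, \<psi>) \<in> B"
  shows "prod_chart \<phi> \<psi> ` (U \<times> V) = {z. (\<chi> i. z $ Inl i) \<in> \<phi> ` U \<and> (\<chi> j. z $ Inr j) \<in> \<psi> ` V}"
proof (intro equalityI subsetI)
  fix z assume "z \<in> prod_chart \<phi> \<psi> ` (U \<times> V)"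
  then obtain x y where xy: "x \<in> U" "y \<in> V" "z = prod_chart \<phi> \<psi> (x, y)" by auto
  then have "(\<chi> i. z $ Inl i) = \<phi> x" "(\<chi> j. z $ Inr j) = \<psi> y" by (simp_all add: vec_eq_iff)
  then show "z \<in> {z. (\<chi> i. z $ Inl i) \<in> \<phi> ` U \<and> (\<chi> j. z $ Inr j) \<in> \<psi> ` V}" using xy by auto
next
  fix z :: "complex^('n + 'm)" assume "z \<in> {z. (\<chi> i. z $ Inl i) \<in> \<phi> ` U \<and> (\<chi> j. z $ Inr j) \<in> \<psi> ` V}"
  then obtain x y where xy: "x \<in> U" "y \<in> V" "(\<chi> i. z $ Inl i) = \<phi> x" "(\<chi> j. z $ Inr j) = \<psi> y" by auto
  have "z $ k = prod_chart \<phi> \<psi> (x, y) $ k" for k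
    using xy(3,4) by (cases k) (auto simp: vec_eq_iff)
  then have "z = prod_chart \<phi> \<psi> (x, y)" by (simp add: vec_eq_iff)
  then show "z \<in> prod_chart \<phi> \<psi> ` (U \<times> V)" using xy by blast
qed

lemma complex_manifold_prod: "complex_manifold (prod_atlas A B)"
proof -
  have cproj: "continuous_on S (\<lambda>z::complex^('n + 'm). \<chi> i. z $ Inl i)"
    "continuous_on S (\<lambda>z::complex^('n + 'm). \<chi> i. z $ Inr i)" for S
    by (intro continuous_intros)+
  have 1: "mopen (prod_atlas A B) (U \<times> V) \<and> open (prod_chart \<phi> \<psi> ` (U \<times> V)) \<and>
     homeomorphism (U \<times> V) (prod_chart \<phi> \<psi> ` (U \<times> V)) (prod_chart \<phi> \<psi>) (inv_into (U \<times> V) (prod_chart \<phi> \<psi>))"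
    if U: "(U, \<phi>) \<in> A" and V: "(V, \<psi>) \<in> B" for U \<phi> V \<psi>
  proof (intro conjI)
    show "mopen (prod_atlas A B) (U \<times> V)"
      using chartD(1)[OF A U] chartD(1)[OF B V]
      by (simp add: mopen_def mfd_points_prod openin_Times)
    have "open ((\<lambda>z::complex^('n + 'm). \<chi> i. z $ Inl i) -` (\<phi> ` U) \<inter> (\<lambda>z. \<chi> i. z $ Inr i) -` (\<psi> ` V))"
      by (intro open_Int open_vimage cproj chartD(2)[OF A U] chartD(2)[OF B V])
    then show "open (prod_chart \<phi> \<psi> ` (U \<times> V))"
      unfolding prod_chart_image[OF U V] by (simp add: vimage_def Collect_conj_eq)
    show "homeomorphism (U \<times> V) (prod_chart \<phi> \<psi> ` (U \<times> V)) (prod_chart \<phi> \<psi>) (inv_into (U \<times> V) (prod_chart \<phi> \<psi>))"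
    proof (rule homeomorphismI)
      have c: "continuous_on U \<phi>" "continuous_on V \<psi>"
        using chartD(3)[OF A U] chartD(3)[OF B V] by (simp_all add: homeomorphism_def)
      have "continuous_on (U \<times> V) (\<lambda>z. \<phi> (fst z))" "continuous_on (U \<times> V) (\<lambda>z. \<psi> (snd z))"
        by (auto intro!: continuous_on_compose2[OF c(1)] continuous_on_compose2[OF c(2)] continuous_intros)
      then have "continuous_on (U \<times> V) (\<lambda>z. prod_chart \<phi> \<psi> z $ k)" for k
        by (cases k) (auto intro!: continuous_intros)
      from continuous_on_vecI[OF this] show "continuous_on (U \<times> V) (prod_chart \<phi> \<psi>)" .
      have "continuous_on (prod_chart \<phi> \<psi> ` (U \<times> V)) (\<lambda>z. (inv_into U \<phi> (\<chi> i. z $ Inl i), inv_into V \<psi> (\<chi> j. z $ Inr j)))"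
        unfolding prod_chart_image[OF U V]
        by (intro continuous_on_Pair continuous_on_compose2[OF chart_inv_continuous[OF A U] cproj(1)]
            continuous_on_compose2[OF chart_inv_continuous[OF B V] cproj(2)]) auto
      then show "continuous_on (prod_chart \<phi> \<psi> ` (U \<times> V)) (inv_into (U \<times> V) (prod_chart \<phi> \<psi>))"
        by (rule continuous_on_eq) (rule inv_into_prod_chart'[OF U V, symmetric])
      show "inv_into (U \<times> V) (prod_chart \<phi> \<psi>) (prod_chart \<phi> \<psi> x) = x" if "x \<in> U \<times> V" for x
        using that inv_into_prod_chart[OF U V] by (cases x) auto
      then show "prod_chart \<phi> \<psi> (inv_into (U \<times> V) (prod_chart \<phi> \<psi>) y) = y" if "y \<in> prod_chart \<phi> \<psi> ` (U \<times> V)" for y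
        using that by auto
      show "inv_into (U \<times> V) (prod_chart \<phi> \<psi>) ` (prod_chart \<phi> \<psi> ` (U \<times> V)) \<subseteq> U \<times> V"
        by (metis image_subsetI inv_into_into)
    qed auto
  qed
  have 2: "hol (\<lambda>z. prod_chart \<phi>' \<psi>' (inv_into (U \<times> V) (prod_chart \<phi> \<psi>) z) $ k) (prod_chart \<phi> \<psi> ` (U \<times> V \<inter> U' \<times> V'))"
    if U: "(U, \<phi>) \<in> A" and V: "(V, \<psi>) \<in> B" and U': "(U', \<phi>') \<in> A" and V': "(V', \<psi>') \<in> B" for U \<phi> V \<psi> U' \<phi>' V' \<psi>' k
    unfolding hol_iff_cdiff
  proof clarify
    fix x y assume xy: "x \<in> U" "y \<in> V" "x \<in> U'" "y \<in> V'"
    define p where "p = prod_chart \<phi> \<psi> (x, y)"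
    have p: "(\<chi> i. p $ Inl i) = \<phi> x" "(\<chi> j. p $ Inr j) = \<psi> y" by (simp_all add: vec_eq_iff p_def)
    have op: "open (prod_chart \<phi> \<psi> ` (U \<times> V))" using 1[OF U V] by blast
    have pin: "p \<in> prod_chart \<phi> \<psi> ` (U \<times> V)" using xy by (auto simp: p_def)
    have "cdiff (\<lambda>z. \<phi>' (inv_into U \<phi> z) $ i) (\<chi> i. p $ Inl i)" for i
      using holat_chart_coord[OF A U' xy(3)] U xy(1) by (auto simp: holat_def p)
    then have a: "cdiff (\<lambda>z. \<phi>' (inv_into U \<phi> (\<chi> i. z $ Inl i)) $ i) p" for i
      by (intro cdiff_compose[where F = "\<lambda>z. \<chi> i. z $ Inl i" and g = "\<lambda>z. \<phi>' (inv_into U \<phi> z) $ i"])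
         (simp_all add: cdiff_component)
    have "cdiff (\<lambda>z. \<psi>' (inv_into V \<psi> z) $ i) (\<chi> i. p $ Inr i)" for i
      using holat_chart_coord[OF B V' xy(4)] V xy(2) by (auto simp: holat_def p)
    then have b: "cdiff (\<lambda>z. \<psi>' (inv_into V \<psi> (\<chi> i. z $ Inr i)) $ i) p" for i
      by (intro cdiff_compose[where F = "\<lambda>z. \<chi> i. z $ Inr i" and g = "\<lambda>z. \<psi>' (inv_into V \<psi> z) $ i"])
         (simp_all add: cdiff_component)
    show "cdiff (\<lambda>z. prod_chart \<phi>' \<psi>' (inv_into (U \<times> V) (prod_chart \<phi> \<psi>) z) $ k) p"
    proof (cases k)
      case (Inl i)
      then show ?thesis
        by (intro cdiff_cong[OF op pin _ a[of i]]) (simp add: inv_into_prod_chart'[OF U V])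
    next
      case (Inr i)
      then show ?thesis
        by (intro cdiff_cong[OF op pin _ b[of i]]) (simp add: inv_into_prod_chart'[OF U V])
    qed
  qed
  show ?thesis
    unfolding complex_manifold_def
  proof (intro conjI ballI; clarify)
    fix W \<chi>' assume "(W, \<chi>') \<in> prod_atlas A B"
    then show "mopen (prod_atlas A B) W \<and> open (\<chi>' ` W) \<and> homeomorphism W (\<chi>' ` W) \<chi>' (inv_into W \<chi>')"
      using 1 unfolding prod_atlas_iff by blast
  next
    fix W \<chi>' W2 \<chi>2 j assume "(W, \<chi>') \<in> prod_atlas A B" "(W2, \<chi>2) \<in> prod_atlas A B"
    then show "hol (\<lambda>z. \<chi>2 (inv_into W \<chi>' z) $ j) (\<chi>' ` (W \<inter> W2))"
      using 2 unfolding prod_atlas_iff by blast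
  qed
qed

lemma hol_map_fst_snd:
  shows hol_map_fst: "hol_map (prod_atlas A B) A (mfd_points (prod_atlas A B)) fst"
    and hol_map_snd: "hol_map (prod_atlas A B) B (mfd_points (prod_atlas A B)) snd"
proof -
  have *: "(\<exists>V \<psi>. (V, \<psi>) \<in> A \<and> fst x \<in> V \<and> (\<forall>j. holat (prod_atlas A B) (\<lambda>y. \<psi> (fst y) $ j) x)) \<and>
      (\<exists>V \<psi>. (V, \<psi>) \<in> B \<and> snd x \<in> V \<and> (\<forall>j. holat (prod_atlas A B) (\<lambda>y. \<psi> (snd y) $ j) x))"
    if "x \<in> mfd_points (prod_atlas A B)" for x
  proof -
    have "fst x \<in> mfd_points A" "snd x \<in> mfd_points B" using that by (auto simp: mfd_points_prod)
    then obtain U \<phi> V \<psi> where U: "(U, \<phi>) \<in> A" "fst x \<in> U" and V: "(V, \<psi>) \<in> B" "snd x \<in> V"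
      by (auto simp: mfd_points_def)
    have "(U \<times> V, prod_chart \<phi> \<psi>) \<in> prod_atlas A B" "x \<in> U \<times> V" using U V by (auto simp: prod_atlas_eq mem_Times_iff)
    from holat_chart_coord[OF complex_manifold_prod this, of "Inl _"] holat_chart_coord[OF complex_manifold_prod this, of "Inr _"]
    show ?thesis using U V by auto
  qed
  show "hol_map (prod_atlas A B) A (mfd_points (prod_atlas A B)) fst"
    by (rule hol_mapI[OF complex_manifold_prod A]) (use * in \<open>auto simp: mopen_def intro: continuous_intros\<close>)
  show "hol_map (prod_atlas A B) B (mfd_points (prod_atlas A B)) snd"
    by (rule hol_mapI[OF complex_manifold_prod B]) (use * in \<open>auto simp: mopen_def intro: continuous_intros\<close>)
qed

lemma hol_map_Pair:
  fixes D :: "('d::t2_space, 'k::finite) atlas"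
  assumes D: "complex_manifold D" and W: "mopen D W"
    and f: "hol_map D A W f" and g: "hol_map D B W g"
  shows "hol_map D (prod_atlas A B) W (\<lambda>x. (f x, g x))"
proof (rule hol_mapI[OF D complex_manifold_prod W])
  show "continuous_on W (\<lambda>x. (f x, g x))"
    using f g by (auto simp: hol_map_iff intro: continuous_on_Pair)
  fix x assume x: "x \<in> W"
  then have "f x \<in> mfd_points A" "g x \<in> mfd_points B" using f g by (auto simp: hol_map_iff)
  then obtain U \<phi> V \<psi> where U: "(U, \<phi>) \<in> A" "f x \<in> U" and V: "(V, \<psi>) \<in> B" "g x \<in> V"
    by (auto simp: mfd_points_def)
  have "holat D (\<lambda>y. prod_chart \<phi> \<psi> (f y, g y) $ k) x" for k
    using f g x U V by (cases k) (simp_all add: hol_map_iff)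
  then show "\<exists>W' \<chi>'. (W', \<chi>') \<in> prod_atlas A B \<and> (f x, g x) \<in> W' \<and> (\<forall>j. holat D (\<lambda>y. \<chi>' (f y, g y) $ j) x)"
    using U V by (intro exI[of _ "U \<times> V"] exI[of _ "prod_chart \<phi> \<psi>"]) (auto simp: prod_atlas_eq)
qed

end

section \<open>Submanifolds with the induced complex structure\<close>

context
  fixes A :: "('a::t2_space, 'n::finite) atlas" and Z :: "'a set" and IA :: "('a, 'm::finite) atlas"
  assumes A: "complex_manifold A" and AU: "mfd_points A = UNIV"
    and IA: "IA = induced_atlas A Z" and Z: "mfd_points IA = Z"
begin

lemma induced_chartD:
  assumes "(U, \<phi>) \<in> IA"
  shows "openin (top_of_set Z) U" "open (\<phi> ` U)" "inj_on \<phi> U"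
    "\<And>x. x \<in> U \<Longrightarrow> \<exists>W h. mopen A W \<and> x \<in> W \<and> hol_map A std_atlas W h \<and> (\<forall>y\<in>W \<inter> U. \<phi> y = h y)"
    "hol_map std_atlas A (\<phi> ` U) (inv_into U \<phi>)"
  using assms by (auto simp: IA induced_atlas_def)

lemma induced_chart_continuous: "(U, \<phi>) \<in> IA \<Longrightarrow> continuous_on U \<phi>"
proof -
  assume U: "(U, \<phi>) \<in> IA"
  have "continuous (at x within U) \<phi>" if x: "x \<in> U" for x
  proof -
    obtain W h where W: "mopen A W" "x \<in> W" "hol_map A std_atlas W h" "\<And>y. y \<in> W \<inter> U \<Longrightarrow> \<phi> y = h y"
      using induced_chartD(4)[OF U x] by blast
    have "open W" using W(1) by (simp add: mopen_def AU)
    have "continuous_on (W \<inter> U) h" using W(3) by (auto simp: hol_map_iff intro: continuous_on_subset)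
    then have "continuous_on (W \<inter> U) \<phi>" by (rule continuous_on_eq) (simp add: W(4))
    then have "continuous (at x within (W \<inter> U)) \<phi>" using x W(2) by (simp add: continuous_on_eq_continuous_within)
    moreover have "at x within (W \<inter> U) = at x within U"
      by (rule at_within_nhd[OF W(2) \<open>open W\<close>]) auto
    ultimately show ?thesis by simp
  qed
  then show ?thesis by (simp add: continuous_on_eq_continuous_within)
qed

lemma holat_induced:
  assumes q: "q \<in> Z" and h: "holat A h q"
  shows "holat IA h q"
  unfolding holat_def
proof (intro allI impI)
  fix U \<phi> assume U: "(U, \<phi>) \<in> IA" "q \<in> U"
  note c = induced_chartD[OF U(1)]
  have "mopen std_atlas (\<phi> ` U)" using c(2) by (simp add: mopen_def)
  moreover have "holat A h (inv_into U \<phi> (\<phi> q))" using U(2) c(3) h by simp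
  ultimately have "holat std_atlas (\<lambda>z. h (inv_into U \<phi> z)) (\<phi> q)"
    using holat_compose[OF complex_manifold_std A _ _ c(5)] U(2) by blast
  then show "cdiff (\<lambda>z. h (inv_into U \<phi> z)) (\<phi> q)" by (simp add: holat_std)
qed

text \<open>An induced chart is locally the restriction of an ambient holomorphic map h, and h after
  f is holomorphic on B.\<close>

lemma hol_map_into_induced:
  fixes B :: "('b::t2_space, 'k::finite) atlas"
  assumes B: "complex_manifold B" and W: "mopen B W" and f: "hol_map B A W f" "f ` W \<subseteq> Z"
  shows "hol_map B IA W f"
  unfolding hol_map_iff
proof (intro conjI ballI allI impI)
  show "continuous_on W f" using f by (simp add: hol_map_iff)
  show "f ` W \<subseteq> mfd_points IA" using f by (simp add: Z)
  fix x V \<psi> j assume x: "x \<in> W" and V: "(V, \<psi>) \<in> IA" "f x \<in> V"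
  note d = induced_chartD[OF V(1)]
  obtain W' h where W': "mopen A W'" "f x \<in> W'" "hol_map A std_atlas W' h" "\<And>y. y \<in> W' \<inter> V \<Longrightarrow> \<psi> y = h y"
    using d(4)[OF V(2)] by blast
  have "holat A (\<lambda>y. h y $ j) (f x)" using W'(2,3) by (simp add: hol_map_std_iff)
  from holat_compose[OF B A W x f(1) this] have 1: "holat B (\<lambda>y. h (f y) $ j) x" .
  obtain V' where V': "open V'" "V = Z \<inter> V'" using d(1) by (auto simp: openin_open)
  have "open (W' \<inter> V')" using W'(1) V' by (simp add: mopen_def AU open_Int)
  then have "openin (top_of_set W) (W \<inter> f -` (W' \<inter> V'))"
    using f(1) by (intro continuous_openin_preimage_gen) (simp_all add: hol_map_iff)
  then have m: "mopen B (W \<inter> f -` (W' \<inter> V'))"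
    using W unfolding mopen_def by (rule openin_trans)
  show "holat B (\<lambda>y. \<psi> (f y) $ j) x"
  proof (rule holat_cong[OF B m _ _ 1])
    show "x \<in> W \<inter> f -` (W' \<inter> V')" using x W'(2) V(2) V' by auto
    show "h (f y) $ j = \<psi> (f y) $ j" if "y \<in> W \<inter> f -` (W' \<inter> V')" for y
      using that W'(4)[of "f y"] V' f(2) by auto
  qed
qed

text \<open>A change of charts is the inverse of one chart, which is a holomorphic map into Z,
  followed by the other chart.\<close>

lemma complex_manifold_induced: "complex_manifold IA"
  unfolding complex_manifold_def
proof (intro conjI ballI; clarify)
  fix U \<phi> assume U: "(U, \<phi>) \<in> IA"
  note c = induced_chartD[OF U]
  have "homeomorphism U (\<phi> ` U) \<phi> (inv_into U \<phi>)"
    using c(3,5) induced_chart_continuous[OF U]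
    by (intro homeomorphismI) (auto simp: hol_map_iff inv_into_into f_inv_into_f)
  then show "mopen IA U \<and> open (\<phi> ` U) \<and> homeomorphism U (\<phi> ` U) \<phi> (inv_into U \<phi>)"
    using c by (simp add: mopen_def Z)
next
  fix U \<phi> V \<psi> j assume U: "(U, \<phi>) \<in> IA" and V: "(V, \<psi>) \<in> IA"
  note c = induced_chartD[OF U]
  have m: "mopen std_atlas (\<phi> ` U)" using c(2) by (simp add: mopen_def)
  have "inv_into U \<phi> ` \<phi> ` U \<subseteq> Z" using c(1,3) openin_imp_subset by fastforce
  from hol_map_into_induced[OF complex_manifold_std m c(5) this]
  have "holat std_atlas (\<lambda>z. \<psi> (inv_into U \<phi> z) $ j) (\<phi> x)" if "x \<in> U" "x \<in> V" for x
    using V c(3) that unfolding hol_map_iff by (metis imageI inv_into_f_f)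
  then show "hol (\<lambda>z. \<psi> (inv_into U \<phi> z) $ j) (\<phi> ` (U \<inter> V))"
    by (auto simp: hol_iff_cdiff holat_std)
qed

lemma hol_map_from_induced:
  fixes B :: "('b::t2_space, 'k::finite) atlas"
  assumes B: "complex_manifold B" and W: "mopen A W" and f: "hol_map A B W f"
  shows "hol_map IA B (W \<inter> Z) f"
proof -
  have "openin (top_of_set Z) (W \<inter> Z)" using W by (auto simp: mopen_def AU openin_open)
  then have m: "mopen IA (W \<inter> Z)" by (simp add: mopen_def Z)
  show ?thesis unfolding hol_map_iff
    using f holat_induced by (auto simp: hol_map_iff intro: continuous_on_subset)
qed

end

section \<open>Vanishing orders\<close>

text \<open>Order of vanishing at 0 as a limit over punctured neighbourhoods. It presupposes no
  holomorphy and ignores the value at 0, so it can be transported through products and changes of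
  parameter without conditions on domains.\<close>

definition hasord :: "(complex \<Rightarrow> complex) \<Rightarrow> nat \<Rightarrow> bool" where
  "hasord f n \<longleftrightarrow> (\<exists>c. c \<noteq> 0 \<and> ((\<lambda>z. f z / z ^ n) \<longlongrightarrow> c) (at 0))"

lemma hasord_cong:
  assumes "eventually (\<lambda>z. f z = g z) (at 0)"
  shows "hasord f n \<longleftrightarrow> hasord g n"
proof -
  have "eventually (\<lambda>z. f z / z ^ n = g z / z ^ n) (at 0)"
    using assms by eventually_elim simp
  from tendsto_cong[OF this] show ?thesis unfolding hasord_def by simp
qed

lemma hasord_mult:
  assumes "hasord f m" "hasord g n"
  shows "hasord (\<lambda>z. f z * g z) (m + n)"
proof -
  obtain c d where "c \<noteq> 0" "((\<lambda>z. f z / z ^ m) \<longlongrightarrow> c) (at 0)" "d \<noteq> 0" "((\<lambda>z. g z / z ^ n) \<longlongrightarrow> d) (at 0)"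
    using assms by (auto simp: hasord_def)
  moreover from this have "((\<lambda>z. f z / z ^ m * (g z / z ^ n)) \<longlongrightarrow> c * d) (at 0)"
    by (intro tendsto_mult)
  ultimately show ?thesis
    unfolding hasord_def by (intro exI[of _ "c * d"]) (simp add: power_add)
qed

lemma hasord_limit_0:
  assumes "hasord f n" "m < n"
  shows "((\<lambda>z. f z / z ^ m) \<longlongrightarrow> 0) (at 0)"
proof -
  obtain c where c: "((\<lambda>z. f z / z ^ n) \<longlongrightarrow> c) (at 0)" using assms(1) by (auto simp: hasord_def)
  have "((\<lambda>z. f z / z ^ n * z ^ (n - m)) \<longlongrightarrow> c * 0 ^ (n - m)) (at 0)"
    by (intro tendsto_intros c)
  moreover have "eventually (\<lambda>z. f z / z ^ n * z ^ (n - m) = f z / z ^ m) (at (0::complex))"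
    using eventually_at_filter[THEN iffD2, OF always_eventually]
    by (auto simp: eventually_at_filter power_diff assms(2) less_imp_le)
  ultimately show ?thesis using assms(2) by (simp add: tendsto_cong power_0_left)
qed

lemma hasord_unique:
  assumes "hasord f m" "hasord f n"
  shows "m = n"
proof -
  have "\<not> m < n" if fm: "hasord f m" and fn: "hasord f n" for m n
  proof
    assume "m < n"
    from hasord_limit_0[OF fn this] have "((\<lambda>z. f z / z ^ m) \<longlongrightarrow> 0) (at 0)" .
    moreover obtain c where "c \<noteq> 0" "((\<lambda>z. f z / z ^ m) \<longlongrightarrow> c) (at 0)" using fm by (auto simp: hasord_def)
    ultimately show False using tendsto_unique[of "at (0::complex)"] by auto
  qed
  then show ?thesis using assms by (meson linorder_neqE_nat)
qed

lemma hasord_add: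
  assumes "hasord f m" "hasord g n" "m < n"
  shows "hasord (\<lambda>z. f z + g z) m"
proof -
  obtain c where c: "c \<noteq> 0" "((\<lambda>z. f z / z ^ m) \<longlongrightarrow> c) (at 0)" using assms(1) by (auto simp: hasord_def)
  from tendsto_add[OF c(2) hasord_limit_0[OF assms(2,3)]] show ?thesis
    using c unfolding hasord_def by (intro exI[of _ c]) (simp add: add_divide_distrib)
qed

lemma hasord_cmult: "hasord f n \<Longrightarrow> a \<noteq> 0 \<Longrightarrow> hasord (\<lambda>z. a * f z) n"
proof -
  assume "hasord f n" "a \<noteq> 0"
  then obtain c where c: "c \<noteq> 0" "((\<lambda>z. f z / z ^ n) \<longlongrightarrow> c) (at 0)" by (auto simp: hasord_def)
  from tendsto_mult_left[OF c(2), of a] show ?thesis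
    using c(1) \<open>a \<noteq> 0\<close> unfolding hasord_def by (intro exI[of _ "a * c"]) simp
qed

lemma hasord_0I: "isCont f 0 \<Longrightarrow> f 0 \<noteq> 0 \<Longrightarrow> hasord f 0"
  unfolding hasord_def isCont_def by auto

lemma hasord_power: "hasord (\<lambda>z. z ^ n) n"
  unfolding hasord_def
  by (rule exI[of _ 1]) (auto intro!: tendsto_eventually simp: eventually_at_filter)

lemma hasord_eventually_nonzero:
  assumes "hasord f n"
  shows "eventually (\<lambda>z. f z \<noteq> 0) (at 0)"
proof -
  obtain c where c: "c \<noteq> 0" "((\<lambda>z. f z / z ^ n) \<longlongrightarrow> c) (at 0)" using assms by (auto simp: hasord_def)
  from tendsto_imp_eventually_ne[OF c(2,1)] show ?thesis by eventually_elim auto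
qed

text \<open>A change of parameter with leading coefficient d multiplies the leading coefficient c of
  f by d^n, which is nonzero.\<close>

lemma hasord_compose:
  assumes f: "hasord f n" and s: "hasord s 1"
  shows "hasord (\<lambda>z. f (s z)) n"
proof -
  obtain c where c: "c \<noteq> 0" "((\<lambda>z. f z / z ^ n) \<longlongrightarrow> c) (at 0)" using f by (auto simp: hasord_def)
  obtain d where d: "d \<noteq> 0" "((\<lambda>z. s z / z ^ 1) \<longlongrightarrow> d) (at 0)" using s by (auto simp: hasord_def)
  have "(s \<longlongrightarrow> 0) (at 0)" using hasord_limit_0[OF s, of 0] by simp
  then have "filterlim s (at 0) (at 0)"
    using hasord_eventually_nonzero[OF s] by (simp add: filterlim_at)
  from filterlim_compose[OF c(2) this] tendsto_power[OF d(2), of n]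
  have "((\<lambda>z. f (s z) / s z ^ n * (s z / z ^ 1) ^ n) \<longlongrightarrow> c * d ^ n) (at 0)"
    by (rule tendsto_mult)
  moreover have "eventually (\<lambda>z. f (s z) / s z ^ n * (s z / z ^ 1) ^ n = f (s z) / z ^ n) (at 0)"
    using hasord_eventually_nonzero[OF s] by eventually_elim (simp add: power_divide)
  ultimately have "((\<lambda>z. f (s z) / z ^ n) \<longlongrightarrow> c * d ^ n) (at 0)" by (simp add: tendsto_cong)
  then show ?thesis using c(1) d(1) unfolding hasord_def by (intro exI[of _ "c * d ^ n"]) simp
qed

lemma hasord_derivI:
  assumes "(s has_field_derivative d) (at 0)" "s 0 = 0" "d \<noteq> 0"
  shows "hasord s 1"
  using assms(3) assms(1) unfolding hasord_def has_field_derivative_iff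
  by (intro exI[of _ d]) (simp add: assms(2))

lemma hasord_1D:
  assumes "hasord f 1" "f field_differentiable at 0"
  shows "f 0 = 0" "deriv f 0 \<noteq> 0"
proof -
  have "(f \<longlongrightarrow> 0) (at 0)" using hasord_limit_0[OF assms(1), of 0] by simp
  moreover have "(f \<longlongrightarrow> f 0) (at 0)"
    using field_differentiable_imp_continuous_at[OF assms(2)] by (simp add: isCont_def)
  ultimately show f0: "f 0 = 0" using tendsto_unique[of "at (0::complex)"] by auto
  have "((\<lambda>z. f z / z) \<longlongrightarrow> deriv f 0) (at 0)"
    using field_differentiable_derivI[OF assms(2)] by (simp add: has_field_derivative_iff f0)
  moreover obtain c where "c \<noteq> 0" "((\<lambda>z. f z / z) \<longlongrightarrow> c) (at 0)" using assms(1) by (auto simp: hasord_def)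
  ultimately show "deriv f 0 \<noteq> 0" using tendsto_unique[of "at (0::complex)"] by auto
qed

lemma hasord_pos_0:
  assumes "hasord f n" "n \<ge> 1" "isCont f 0"
  shows "f 0 = 0"
proof -
  have "(f \<longlongrightarrow> 0) (at 0)" using hasord_limit_0[OF assms(1), of 0] assms(2) by simp
  moreover have "(f \<longlongrightarrow> f 0) (at 0)" using assms(3) by (simp add: isCont_def)
  ultimately show ?thesis using tendsto_unique[of "at (0::complex)"] by auto
qed

lemma holomorphic_isCont_0: "f holomorphic_on ball 0 \<rho> \<Longrightarrow> \<rho> > 0 \<Longrightarrow> isCont f 0"
  by (metis centre_in_ball continuous_on_eq_continuous_at holomorphic_on_imp_continuous_on open_ball)

lemma hasord_0D: "hasord f 0 \<Longrightarrow> isCont f 0 \<Longrightarrow> f 0 \<noteq> 0"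
  unfolding hasord_def isCont_def using tendsto_unique[of "at (0::complex)" f] by auto

lemma holomorphic_factor_cases:
  assumes f: "f holomorphic_on ball 0 \<rho>" and \<rho>: "\<rho> > 0" and nz: "\<exists>z\<in>ball 0 \<rho>. f z \<noteq> 0"
  obtains n r g where "0 < r" "r \<le> \<rho>" "g holomorphic_on ball 0 r"
    "\<And>z. z \<in> ball 0 r \<Longrightarrow> f z = z ^ n * g z" "\<And>z. z \<in> ball 0 r \<Longrightarrow> g z \<noteq> 0"
proof (cases "f 0 = 0")
  case False
  from continuous_at_avoid[OF holomorphic_isCont_0[OF f \<rho>] False] obtain e where e: "e > 0" "\<And>y. dist 0 y < e \<Longrightarrow> f y \<noteq> 0" by blast
  show ?thesis
    by (rule that[of "min e \<rho>" f 0]) (use e \<rho> f in \<open>auto intro: holomorphic_on_subset\<close>)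
next
  case True
  have "\<not> f constant_on ball 0 \<rho>"
    using True nz \<rho> unfolding constant_on_def by (metis centre_in_ball)
  then obtain g r n where g: "0 < n" "0 < r" "ball (0::complex) r \<subseteq> ball 0 \<rho>" "g holomorphic_on ball 0 r"
      "\<And>w. w \<in> ball 0 r \<Longrightarrow> f w = (w - 0) ^ n * g w" "\<And>w. w \<in> ball 0 r \<Longrightarrow> g w \<noteq> 0"
    by (rule holomorphic_factor_zero_nonconstant[OF f open_ball connected_ball _ True, rotated]) (use \<rho> in auto)
  have "r \<le> \<rho>" using g(2,3) \<rho> by (simp add: ball_subset_ball_iff)
  show ?thesis by (rule that[OF g(2) \<open>r \<le> \<rho>\<close> g(4), of n]) (use g in auto)
qed

lemma hasord_factorI:
  assumes "0 < r" "g holomorphic_on ball 0 r" "\<And>z. z \<in> ball 0 r \<Longrightarrow> f z = z ^ n * g z" "g 0 \<noteq> 0"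
  shows "hasord f n"
proof -
  have "isCont g 0" by (rule holomorphic_isCont_0[OF assms(2,1)])
  then have "hasord (\<lambda>z. z ^ n * g z) (n + 0)" by (intro hasord_mult hasord_power hasord_0I assms(4))
  moreover have "eventually (\<lambda>z. f z = z ^ n * g z) (at 0)"
    using assms(1,3) by (auto simp: eventually_at intro!: exI[of _ r])
  ultimately show ?thesis by (simp add: hasord_cong)
qed

lemma hasord_exists:
  assumes "f holomorphic_on ball 0 \<rho>" "\<rho> > 0" "\<exists>z\<in>ball 0 \<rho>. f z \<noteq> 0"
  shows "\<exists>n. hasord f n"
  by (rule holomorphic_factor_cases[OF assms]) (metis hasord_factorI centre_in_ball)

lemma hasord_factor:
  assumes "f holomorphic_on ball 0 \<rho>" "\<rho> > 0" "hasord f n"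
  obtains r g where "0 < r" "r \<le> \<rho>" "g holomorphic_on ball 0 r"
    "\<And>z. z \<in> ball 0 r \<Longrightarrow> f z = z ^ n * g z" "\<And>z. z \<in> ball 0 r \<Longrightarrow> g z \<noteq> 0"
proof -
  have "\<exists>z\<in>ball 0 \<rho>. f z \<noteq> 0"
  proof -
    obtain d where d: "d > 0" "\<forall>z. z \<noteq> 0 \<and> dist z 0 < d \<longrightarrow> f z \<noteq> 0"
      using hasord_eventually_nonzero[OF assms(3)] by (auto simp: eventually_at)
    define z :: complex where "z = of_real (min d \<rho> / 2)"
    have "z \<noteq> 0" "norm z < d" "norm z < \<rho>" using d(1) assms(2) by (auto simp: z_def)
    then show ?thesis using d(2) by (intro bexI[of _ z]) auto
  qed
  from holomorphic_factor_cases[OF assms(1,2) this] obtain m r g where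
    g: "0 < r" "r \<le> \<rho>" "g holomorphic_on ball 0 r"
    "\<And>z. z \<in> ball 0 r \<Longrightarrow> f z = z ^ m * g z" "\<And>z. z \<in> ball 0 r \<Longrightarrow> g z \<noteq> 0" by metis
  then have "hasord f m" by (intro hasord_factorI[of r g]) auto
  then have "m = n" using assms(3) by (rule hasord_unique)
  then show ?thesis using that g by blast
qed

section \<open>Local parametrizations\<close>

text \<open>A coordinate disc at p, given by the parametrization \<psi> and the coordinate \<tau>
  inverse to it. The last clause pulls holomorphic functions on the curve back to functions of one
  complex variable, so that classical function theory applies.\<close>

definition disc :: "('a::topological_space, 1) atlas \<Rightarrow> 'a \<Rightarrow> real \<Rightarrow> (complex \<Rightarrow> 'a) \<Rightarrow> ('a \<Rightarrow> complex) \<Rightarrow> bool" where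
  "disc A p \<rho> \<psi> \<tau> \<longleftrightarrow> \<rho> > 0 \<and> \<psi> 0 = p \<and> open (\<psi> ` ball 0 \<rho>) \<and> continuous_on (ball 0 \<rho>) \<psi> \<and>
     (\<forall>z\<in>ball 0 \<rho>. \<tau> (\<psi> z) = z \<and> holat A \<tau> (\<psi> z)) \<and>
     (\<forall>z\<in>ball 0 \<rho>. \<forall>h. holat A h (\<psi> z) \<longrightarrow> (\<lambda>w. h (\<psi> w)) field_differentiable at z)"

lemma discD:
  assumes "disc A p \<rho> \<psi> \<tau>"
  shows "\<rho> > 0" "\<psi> 0 = p" "open (\<psi> ` ball 0 \<rho>)" "continuous_on (ball 0 \<rho>) \<psi>"
    "z \<in> ball 0 \<rho> \<Longrightarrow> \<tau> (\<psi> z) = z" "z \<in> ball 0 \<rho> \<Longrightarrow> holat A \<tau> (\<psi> z)"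
    "z \<in> ball 0 \<rho> \<Longrightarrow> holat A h (\<psi> z) \<Longrightarrow> (\<lambda>w. h (\<psi> w)) field_differentiable at z"
  using assms unfolding disc_def by blast+

lemma disc_centre: "disc A p \<rho> \<psi> \<tau> \<Longrightarrow> p \<in> \<psi> ` ball 0 \<rho>"
  using discD(1,2) by (metis centre_in_ball imageI)

lemma vec_1 [simp]: "vec (x $ 1) = (x :: complex^1)"
  by (simp add: vec_eq_iff forall_1)

lemma vec_component [simp]: "(vec a :: complex^1) $ i = a"
  by (simp add: vec_def)

lemma holat_field:
  assumes A: "complex_manifold A" and h: "holat A h x" and g: "(g has_field_derivative g') (at (h x))"
  shows "holat A (\<lambda>x. g (h x)) x"
  unfolding holat_def
proof (intro allI impI)
  fix U \<phi> assume U: "(U, \<phi>) \<in> A" "x \<in> U"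
  show "cdiff (\<lambda>z. g (h (inv_into U \<phi> z))) (\<phi> x)"
    by (rule cdiff_field[of "\<lambda>z. h (inv_into U \<phi> z)" "\<phi> x" g g'])
      (use h g U chart_inv[OF A U] in \<open>auto simp: holat_def\<close>)
qed

context
  fixes A :: "('a::t2_space, 1) atlas"
  assumes A: "complex_manifold A" and AU: "mfd_points A = UNIV"
begin

lemma mopen_iff_open: "mopen A W \<longleftrightarrow> open W"
  by (simp add: mopen_def AU)

lemma chart_open: "(U, \<phi>) \<in> A \<Longrightarrow> open U"
  using chartD(1)[OF A] by (simp add: AU)

lemma continuous_vec: "continuous_on S (\<lambda>z. vec (f z) :: complex^1)" if "continuous_on S f" for S f
  by (rule continuous_on_vecI) (simp add: that)

text \<open>Serves two sources of coordinates at once: the charts of the atlas in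
  \<open>disc_exists\<close> and an arbitrary local parameter in
  \<open>local_parameter_disc\<close>. The coordinate is translated to vanish at p and restricted to
  a ball in its image.\<close>

lemma coordinate_disc:
  fixes f :: "'a \<Rightarrow> complex^1"
  assumes p: "p \<in> U" and oU: "open U" and oV: "open (f ` U)" and inj: "inj_on f U"
    and ci: "continuous_on (f ` U) (inv_into U f)" and hf: "\<And>x. x \<in> U \<Longrightarrow> holat A (\<lambda>x. f x $ 1) x"
    and hd: "\<And>x h. x \<in> U \<Longrightarrow> holat A h x \<Longrightarrow> cdiff (\<lambda>y. h (inv_into U f y)) (f x)"
  obtains \<rho> \<psi> where "disc A p \<rho> \<psi> (\<lambda>x. f x $ 1 - f p $ 1)" "\<psi> ` ball 0 \<rho> \<subseteq> U"
proof -
  define c0 where "c0 = f p $ 1"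
  define \<tau> where "\<tau> x = f x $ 1 - c0" for x
  define \<psi> where "\<psi> z = inv_into U f (vec (c0 + z))" for z
  define S where "S = (\<lambda>z. vec (c0 + z)) -` (f ` U)"
  have cv: "continuous_on UNIV (\<lambda>z. vec (c0 + z) :: complex^1)"
    by (intro continuous_vec continuous_intros)
  have S: "open S" unfolding S_def by (rule open_vimage[OF oV cv])
  have "0 \<in> S" using p by (simp add: S_def c0_def)
  then obtain \<rho> where \<rho>: "\<rho> > 0" "ball 0 \<rho> \<subseteq> S" using S open_contains_ball by blast
  have \<psi>U: "\<psi> z \<in> U" "f (\<psi> z) = vec (c0 + z)" if "z \<in> ball 0 \<rho>" for z
    using that \<rho>(2) by (auto simp: \<psi>_def S_def inv_into_into f_inv_into_f)
  have \<tau>\<psi>: "\<tau> (\<psi> z) = z" if "z \<in> ball 0 \<rho>" for z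
    using \<psi>U[OF that] by (simp add: \<tau>_def)
  have \<psi>\<tau>: "\<psi> (\<tau> x) = x" if "x \<in> U" for x using inj that by (simp add: \<psi>_def \<tau>_def)
  have h\<tau>: "holat A \<tau> x" if "x \<in> U" for x
  proof -
    interpret R: function_ring "\<lambda>f. holat A f x" by (rule holat_ring)
    show ?thesis unfolding \<tau>_def by (intro R.diff R.const hf[OF that])
  qed
  have c\<tau>: "continuous_on U \<tau>"
    by (rule holat_continuous_on[OF A]) (use h\<tau> oU in \<open>auto simp: mopen_iff_open\<close>)
  have im: "\<psi> ` ball 0 \<rho> = \<tau> -` ball 0 \<rho> \<inter> U"
  proof (intro equalityI subsetI)
    fix x assume "x \<in> \<tau> -` ball 0 \<rho> \<inter> U"
    then show "x \<in> \<psi> ` ball 0 \<rho>" using \<psi>\<tau> by (metis IntE imageI vimageE)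
  qed (use \<psi>U \<tau>\<psi> in auto)
  have "disc A p \<rho> \<psi> \<tau>"
    unfolding disc_def
  proof (intro conjI ballI allI impI)
    show "\<psi> 0 = p" using \<psi>\<tau>[OF p] by (simp add: \<tau>_def c0_def)
    show "open (\<psi> ` ball 0 \<rho>)" unfolding im
      using continuous_on_open_vimage[OF oU, of \<tau>] c\<tau> open_ball by blast
    show "continuous_on (ball 0 \<rho>) \<psi>" unfolding \<psi>_def
      by (rule continuous_on_compose2[OF ci continuous_on_subset[OF cv]]) (use \<rho>(2) in \<open>auto simp: S_def\<close>)
    fix z :: complex assume z: "z \<in> ball 0 \<rho>"
    show "holat A \<tau> (\<psi> z)" by (rule h\<tau>[OF \<psi>U(1)[OF z]])
    fix h assume "holat A h (\<psi> z)"
    then have "cdiff (\<lambda>z. h (inv_into U f z)) (vec (c0 + z))" using hd[of "\<psi> z" h] \<psi>U[OF z] by simp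
    then show "(\<lambda>w. h (\<psi> w)) field_differentiable at z"
      unfolding \<psi>_def
      by (intro field_differentiable_curve[where c = "\<lambda>z. vec (c0 + z)" and g = "\<lambda>z. h (inv_into U f z)"])
         (auto intro: derivative_intros)
  qed (auto simp: \<rho> \<tau>\<psi>)
  moreover have "\<psi> ` ball 0 \<rho> \<subseteq> U" using \<psi>U by auto
  ultimately show ?thesis using that by (simp add: \<tau>_def[abs_def] c0_def)
qed

lemma disc_exists:
  obtains \<rho> \<psi> \<tau> where "disc A p \<rho> \<psi> \<tau>"
proof -
  obtain U \<phi> where U: "(U, \<phi>) \<in> A" "p \<in> U" using chart_ex[OF A, of p] AU by auto
  note c = chartD[OF A U(1)] chart_inv[OF A U(1)]
  have inj: "inj_on \<phi> U" using c(5) by (rule inj_on_inverseI)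
  have hd: "cdiff (\<lambda>y. h (inv_into U \<phi> y)) (\<phi> x)" if "x \<in> U" "holat A h x" for x h
    using U(1) that unfolding holat_def by blast
  show ?thesis
    by (rule coordinate_disc[OF U(2) chart_open[OF U(1)] c(2) inj chart_inv_continuous[OF A U(1)] _ hd])
       (auto intro: that holat_chart_coord[OF A U(1)])
qed

lemma disc_inj:
  assumes "disc A p \<rho> \<psi> \<tau>" shows "inj_on \<psi> (ball 0 \<rho>)"
  using discD(5)[OF assms] by (metis inj_onI)

lemma disc_continuous_inverse:
  assumes "disc A p \<rho> \<psi> \<tau>" shows "continuous_on (\<psi> ` ball 0 \<rho>) \<tau>"
  using discD(3,6)[OF assms] by (intro holat_continuous_on[OF A]) (auto simp: mopen_iff_open)

lemma disc_open_image:
  assumes d: "disc A p \<rho> \<psi> \<tau>" and S: "open S" "S \<subseteq> ball 0 \<rho>"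
  shows "open (\<psi> ` S)"
proof -
  have "\<psi> ` S = \<tau> -` S \<inter> \<psi> ` ball 0 \<rho>" using S(2) discD(5)[OF d] by force
  then show ?thesis
    using continuous_on_open_vimage[OF discD(3)[OF d], of \<tau>] disc_continuous_inverse[OF d] S(1) by simp
qed

lemma disc_shrink:
  assumes d: "disc A p \<rho> \<psi> \<tau>" and "0 < r" "r \<le> \<rho>"
  shows "disc A p r \<psi> \<tau>"
proof -
  have "ball 0 r \<subseteq> ball (0::complex) \<rho>" using assms by auto
  then show ?thesis
    using d assms disc_open_image[OF d open_ball, of 0 r] unfolding disc_def
    by (auto intro: continuous_on_subset)
qed

text \<open>Precomposition with an injective holomorphic g. The new coordinate is k after \<tau>,
  where k is the inverse of g, holomorphic on the open image of g.\<close>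

lemma disc_reparam:
  assumes d: "disc A p \<rho> \<psi> \<tau>" and g: "g holomorphic_on ball 0 r" "inj_on g (ball 0 r)"
    "g ` ball 0 r \<subseteq> ball 0 \<rho>" "r > 0"
  obtains k where "disc A (\<psi> (g 0)) r (\<lambda>z. \<psi> (g z)) (\<lambda>x. k (\<tau> x))" "\<And>z. z \<in> ball 0 r \<Longrightarrow> k (g z) = z"
    "k holomorphic_on g ` ball 0 r"
proof -
  obtain k where k: "k holomorphic_on g ` ball 0 r" "\<And>z. z \<in> ball 0 r \<Longrightarrow> k (g z) = z"
    using holomorphic_has_inverse[OF g(1) open_ball g(2)] by metis
  have og: "open (g ` ball 0 r)" by (rule open_mapping_thm3[OF g(1) open_ball g(2)])
  have "disc A (\<psi> (g 0)) r (\<lambda>z. \<psi> (g z)) (\<lambda>x. k (\<tau> x))"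
    unfolding disc_def
  proof (intro conjI ballI allI impI)
    show "open ((\<lambda>z. \<psi> (g z)) ` ball 0 r)"
      using disc_open_image[OF d og g(3)] by (simp add: image_image)
    show "continuous_on (ball 0 r) (\<lambda>z. \<psi> (g z))"
      by (rule continuous_on_compose2[OF discD(4)[OF d] holomorphic_on_imp_continuous_on[OF g(1)] g(3)])
    fix z :: complex assume z: "z \<in> ball 0 r"
    have gz: "g z \<in> ball 0 \<rho>" using g(3) z by blast
    show "k (\<tau> (\<psi> (g z))) = z" using discD(5)[OF d gz] k(2)[OF z] by simp
    have "(k has_field_derivative deriv k (g z)) (at (g z))"
      using k(1) og z by (intro holomorphic_derivI) auto
    then show "holat A (\<lambda>x. k (\<tau> x)) (\<psi> (g z))"
      using discD(5,6)[OF d gz] by (intro holat_field[OF A, where h = \<tau> and g = k]) auto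
    fix h assume "holat A h (\<psi> (g z))"
    then have "(\<lambda>w. h (\<psi> w)) field_differentiable at (g z)" by (rule discD(7)[OF d gz])
    moreover have "g field_differentiable at z"
      using g(1) z by (intro holomorphic_on_imp_differentiable_at[OF g(1)]) auto
    ultimately show "(\<lambda>w. h (\<psi> (g w))) field_differentiable at z"
      using field_differentiable_compose[of g z "\<lambda>w. h (\<psi> w)"] by (simp add: o_def)
  qed (use g in auto)
  then show ?thesis using that k by blast
qed

lemma local_parameter_disc:
  assumes "local_parameter A p U t"
  obtains \<rho> \<psi> where "disc A p \<rho> \<psi> t" "\<psi> ` ball 0 \<rho> \<subseteq> U"
proof -
  define f where "f = (\<lambda>u. vec (t u) :: complex^1)"
  have p: "p \<in> U" "t p = 0" and bi: "biholomorphic A std_atlas U (f ` U) f"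
    using assms by (auto simp: local_parameter_def f_def)
  have oU: "open U" and oV: "open (f ` U)" and inj: "inj_on f U"
    and h1: "hol_map A std_atlas U f" and h2: "hol_map std_atlas A (f ` U) (inv_into U f)"
    using bi by (auto simp: biholomorphic_def mopen_def AU bij_betw_def)
  have hf: "holat A (\<lambda>x. f x $ 1) x" if "x \<in> U" for x using h1 that by (auto simp: hol_map_std_iff)
  have hd: "cdiff (\<lambda>y. h (inv_into U f y)) (f x)" if "x \<in> U" "holat A h x" for x h
    using holat_compose[OF complex_manifold_std A _ _ h2, of "f x" h] that inj oV by (simp add: mopen_def holat_std)
  have ci: "continuous_on (f ` U) (inv_into U f)" using h2 by (simp add: hol_map_iff)
  have t: "(\<lambda>x. f x $ 1 - f p $ 1) = t" by (simp add: f_def p(2))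
  show ?thesis
    by (rule coordinate_disc[OF p(1) oU oV inj ci _ hd]) (auto intro: hf that simp: t)
qed

lemma disc_local_parameter:
  assumes d: "disc A p \<rho> \<psi> \<tau>"
  shows "local_parameter A p (\<psi> ` ball 0 \<rho>) \<tau>"
proof -
  define U where "U = \<psi> ` ball 0 \<rho>"
  define f where "f = (\<lambda>u. vec (\<tau> u) :: complex^1)"
  have pU: "p \<in> U" "\<tau> p = 0"
    using discD[OF d] discD(5)[OF d, of 0] by (auto simp: U_def intro!: image_eqI[of _ _ 0])
  have V: "f ` U = (\<lambda>w. w $ 1) -` ball 0 \<rho>"
  proof (intro equalityI subsetI)
    fix w :: "complex^1" assume "w \<in> (\<lambda>w. w $ 1) -` ball 0 \<rho>"
    then have "w = f (\<psi> (w $ 1))" "\<psi> (w $ 1) \<in> U" using discD(5)[OF d] by (auto simp: f_def U_def)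
    then show "w \<in> f ` U" by blast
  qed (use discD(5)[OF d] in \<open>auto simp: f_def U_def\<close>)
  have oV: "open (f ` U)" unfolding V by (intro open_vimage continuous_intros) auto
  have inj: "inj_on f U" using discD(5)[OF d] by (auto simp: f_def U_def vec_eq_iff inj_on_def)
  have inv: "inv_into U f w = \<psi> (w $ 1)" if "w \<in> f ` U" for w
  proof -
    from that have "w = f (\<psi> (w $ 1))" "\<psi> (w $ 1) \<in> U" using discD(5)[OF d] by (auto simp: f_def U_def)
    then show ?thesis using inj by (metis inv_into_f_f)
  qed
  have "biholomorphic A std_atlas U (f ` U) f"
    unfolding biholomorphic_def
  proof (intro conjI)
    show "mopen A U" using discD(3)[OF d] by (simp add: mopen_iff_open U_def)
    show "mopen std_atlas (f ` U)" using oV by (simp add: mopen_def)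
    show "bij_betw f U (f ` U)" using inj by (simp add: bij_betw_def)
    show "hol_map A std_atlas U f"
      using disc_continuous_inverse[OF d] discD(6)[OF d]
      by (auto simp: hol_map_std_iff f_def U_def intro!: continuous_vec)
    show "hol_map std_atlas A (f ` U) (inv_into U f)"
    proof (rule hol_mapI[OF complex_manifold_std A])
      show "mopen std_atlas (f ` U)" using oV by (simp add: mopen_def)
      have "continuous_on (f ` U) (\<lambda>w. \<psi> (w $ 1))"
        by (rule continuous_on_compose2[OF discD(4)[OF d]]) (auto simp: V intro!: continuous_intros)
      then show "continuous_on (f ` U) (inv_into U f)"
        by (rule continuous_on_eq) (simp add: inv)
      fix w assume w: "w \<in> f ` U"
      obtain W \<phi> where W: "(W, \<phi>) \<in> A" "\<psi> (w $ 1) \<in> W" using chart_ex[OF A, of "\<psi> (w $ 1)"] AU by auto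
      have w1: "w $ 1 \<in> ball 0 \<rho>" using w by (simp add: V)
      have "cdiff (\<lambda>y. \<phi> (inv_into U f y) $ j) w" for j
      proof (rule cdiff_cong[OF oV w])
        have "(\<lambda>z. \<phi> (\<psi> z) $ j) field_differentiable at (w $ 1)"
          by (rule discD(7)[OF d w1 holat_chart_coord[OF A W]])
        then show "cdiff (\<lambda>w. \<phi> (\<psi> (w $ 1)) $ j) w"
          unfolding field_differentiable_def
          using cdiff_field[OF cdiff_component, of "\<lambda>z. \<phi> (\<psi> z) $ j" _ w 1] by blast
      qed (simp add: inv)
      then show "\<exists>V \<theta>. (V, \<theta>) \<in> A \<and> inv_into U f w \<in> V \<and> (\<forall>j. holat std_atlas (\<lambda>y. \<theta> (inv_into U f y) $ j) w)"
        using W inv[OF w] by (auto simp: holat_std)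
    qed
  qed
  then show ?thesis using pU by (simp add: local_parameter_def U_def f_def)
qed

end

section \<open>Invertible matrices as projective coordinate systems\<close>

lemma matrix_inv:
  assumes "invertible (G :: complex^3^3)"
  shows "G ** matrix_inv G = mat 1" "matrix_inv G ** G = mat 1"
    "G *v (matrix_inv G *v x) = x" "matrix_inv G *v (G *v x) = x" "invertible (matrix_inv G)"
proof -
  have "\<exists>A'. G ** A' = mat 1 \<and> A' ** G = mat 1" using assms by (simp add: invertible_def)
  from someI_ex[OF this] show *: "G ** matrix_inv G = mat 1" "matrix_inv G ** G = mat 1"
    by (simp_all add: matrix_inv_def)
  then show "G *v (matrix_inv G *v x) = x" "matrix_inv G *v (G *v x) = x"
    by (simp_all add: matrix_vector_mul_assoc)
  show "invertible (matrix_inv G)" using * by (auto simp: invertible_def)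
qed

lemma invertible_mult_0:
  assumes "invertible (G :: complex^3^3)" shows "G *v x = 0 \<longleftrightarrow> x = 0"
  using matrix_inv(4)[OF assms, of x] by auto

lemma matrix_vector_row: "((G :: complex^3^3) *v x) $ i = bil (G $ i) x"
  by (simp add: bil_def matrix_vector_mult_def)

lemma vector_matrix_inv:
  assumes "invertible (G :: complex^3^3)"
  shows "(b v* matrix_inv G) v* G = b" "(b v* G) v* matrix_inv G = b"
  using matrix_inv(1,2)[OF assms] by (simp_all add: vector_matrix_mul_assoc)

lemma vector_matrix_mult_0:
  assumes "invertible (G :: complex^3^3)" shows "b v* G = 0 \<longleftrightarrow> b = 0"
  using vector_matrix_inv(2)[OF assms, of b] by auto

text \<open>The inverse of a matrix with first column x: its first row is a line missing the point
  x, and the other two are independent lines through it.\<close>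

lemma coordinate_rows:
  assumes "x \<noteq> 0"
  obtains N :: "complex^3^3" where "invertible N" "det N \<noteq> 0" "N *v x = axis 1 1"
    "bil (N $ 1) x = 1" "bil (N $ 2) x = 0" "bil (N $ 3) x = 0"
proof -
  obtain M :: "complex^3^3" where M: "invertible M" "M *v axis 1 1 = x"
    using exists_invertible_column[OF assms] by blast
  have N: "matrix_inv M *v x = axis 1 1" using matrix_inv(4)[OF M(1)] M(2) by auto
  have "bil (matrix_inv M $ i) x = axis 1 1 $ i" for i by (simp only: N flip: matrix_vector_row)
  then show ?thesis using that[OF matrix_inv(5)[OF M(1)] _ N] matrix_inv(5)[OF M(1)]
    by (simp add: invertible_det_nz axis_def)
qed

lemma DERIV_shift_left:
  "(h has_field_derivative D) (at (t + z)) \<Longrightarrow> ((\<lambda>z. h (t + z)) has_field_derivative D) (at z)"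
  using DERIV_shift[of h D z t] by (simp add: add.commute)

text \<open>The chain rule applied to t (k z) = z gives t' k' = 1.\<close>

lemma hasord_left_inverse:
  assumes t: "(t has_field_derivative t') (at 0)" and k: "(k has_field_derivative k') (at 0)"
    and S: "open S" "0 \<in> S" "\<And>z. z \<in> S \<Longrightarrow> t (k z) = z" and k0: "k 0 = 0"
  shows "hasord k 1"
proof -
  have "((\<lambda>z. t (k z)) has_field_derivative t' * k') (at 0)" using DERIV_chain2[of t t' k 0 k'] t k k0 by simp
  moreover have "((\<lambda>z. t (k z)) has_field_derivative 1) (at 0)"
    by (rule has_field_derivative_transform_within_open[OF DERIV_ident S(1,2)]) (simp add: S(3))
  ultimately have "k' \<noteq> 0" using DERIV_unique by fastforce
  then show ?thesis by (rule hasord_derivI[OF k k0])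
qed

lemma row_vector_matrix: "G $ i = axis i 1 v* (G :: complex^3^3)"
  using exhaust_3[of i] by (auto simp: vec_eq_iff vector_matrix_mult_def axis_def sum_3)

section \<open>Affine coordinate functions on the complement of a line\<close>

definition rep :: "proj2 \<Rightarrow> complex^3" where
  "rep P = (SOME x. x \<noteq> 0 \<and> P = pt x)"

lemma rep: "rep P \<noteq> 0" "pt (rep P) = P"
proof -
  have "\<exists>x. x \<noteq> 0 \<and> P = pt x" using pt_surj by blast
  from someI_ex[OF this] show "rep P \<noteq> 0" "pt (rep P) = P" by (auto simp: rep_def)
qed

lemma rep_pt: "x \<noteq> 0 \<Longrightarrow> \<exists>c. c \<noteq> 0 \<and> rep (pt x) = c *s x"
  using pt_eq_iff[of x "rep (pt x)"] rep by auto

text \<open>Independent of the representative chosen by \<open>rep\<close>, as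
  \<open>ratio_pt\<close> shows; on \<open>offline c\<close> it is an affine coordinate
  function.\<close>

definition ratio :: "complex^3 \<Rightarrow> complex^3 \<Rightarrow> proj2 \<Rightarrow> complex" where
  "ratio b c P = bil b (rep P) / bil c (rep P)"

lemma ratio_pt: "x \<noteq> 0 \<Longrightarrow> ratio b c (pt x) = bil b x / bil c x"
  using rep_pt[of x] by (auto simp: ratio_def bil_linear)

definition offline :: "complex^3 \<Rightarrow> proj2 set" where
  "offline c = {P. bil c (rep P) \<noteq> 0}"

lemma offline_pt: "x \<noteq> 0 \<Longrightarrow> pt x \<in> offline c \<longleftrightarrow> bil c x \<noteq> 0"
  using rep_pt[of x] by (auto simp: offline_def bil_linear)

lemma continuous_on_bil: "continuous_on S f \<Longrightarrow> continuous_on S (\<lambda>x. bil c (f x))"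
  unfolding bil_3 by (intro continuous_intros)

lemma open_offline: "open (offline c)"
proof -
  have "x \<noteq> 0" if "bil c x \<noteq> 0" for x using that by (auto simp: bil_linear)
  then have "{x. x \<noteq> 0 \<and> pt x \<in> offline c} = {x. bil c x \<noteq> 0}" by (auto simp: offline_pt)
  moreover have "open {x. bil c x \<noteq> 0}"
    by (intro open_Collect_neq continuous_on_bil continuous_intros)
  ultimately show ?thesis by (simp add: open_proj2_iff)
qed

lemma cdiff_bil: "cdiff (bil c) x"
proof -
  interpret R: function_ring "\<lambda>f. cdiff f x" by (rule cdiff_ring)
  show ?thesis unfolding bil_def[abs_def] by (intro R.sum R.mult R.const cdiff_component)
qed

lemma holat_ratio:
  assumes "P \<in> offline c" shows "holat proj2_atlas (ratio b c) P"
proof -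
  obtain x where x: "x \<noteq> 0" "P = pt x" by (rule pt_cases)
  show ?thesis unfolding x(2)
    by (rule holat_proj2[OF x(1) open_offline, of c _ "\<lambda>x. bil b x / bil c x"])
       (use assms x in \<open>auto simp: offline_pt ratio_pt intro!: cdiff_divide cdiff_bil\<close>)
qed

lemma frame_coords:
  fixes G :: "complex^3^3"
  assumes G: "invertible G" and P: "P \<in> offline (G $ 3)"
  shows "P = pt (matrix_inv G *v vector [ratio (G $ 1) (G $ 3) P, ratio (G $ 2) (G $ 3) P, 1])"
proof -
  obtain x where x: "x \<noteq> 0" "P = pt x" by (rule pt_cases)
  have c: "bil (G $ 3) x \<noteq> 0" using P x by (simp add: offline_pt)
  have "G *v ((1 / bil (G $ 3) x) *s x) = vector [ratio (G $ 1) (G $ 3) P, ratio (G $ 2) (G $ 3) P, 1]"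
    using c unfolding x(2) ratio_pt[OF x(1)] by (simp add: vec_eq_iff forall_3 matrix_vector_row bil_linear)
  then have "matrix_inv G *v vector [ratio (G $ 1) (G $ 3) P, ratio (G $ 2) (G $ 3) P, 1] = (1 / bil (G $ 3) x) *s x"
    using matrix_inv(4)[OF G] by metis
  then show ?thesis using c x by (simp add: pt_scale)
qed

text \<open>Writing w = z^r g with g nonvanishing, an r-th root of g exists through a holomorphic
  logarithm. Then t = z g^(1/r) satisfies t^r = w and has nonzero derivative at 0, and k is its
  local inverse.\<close>

lemma power_coordinate:
  assumes w: "w holomorphic_on ball 0 \<rho>" and \<rho>: "\<rho> > 0" and o: "hasord w r" and r: "1 \<le> r"
  obtains r2 k where "r2 > 0" "k holomorphic_on ball 0 r2" "inj_on k (ball 0 r2)" "k ` ball 0 r2 \<subseteq> ball 0 \<rho>"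
    "k 0 = 0" "hasord k 1" "\<forall>z\<in>ball 0 r2. w (k z) = z ^ r"
proof -
  obtain r0 g where g: "0 < r0" "r0 \<le> \<rho>" "g holomorphic_on ball 0 r0" "\<And>z. z \<in> ball 0 r0 \<Longrightarrow> w z = z ^ r * g z"
    "\<And>z. z \<in> ball 0 r0 \<Longrightarrow> g z \<noteq> 0" using hasord_factor[OF w \<rho> o] by metis
  obtain h where h: "h holomorphic_on ball 0 r0" "\<And>z. z \<in> ball 0 r0 \<Longrightarrow> g z = exp (h z)"
    using contractible_imp_holomorphic_log[OF g(3) convex_imp_contractible[OF convex_ball] g(5)] by metis
  define t where "t z = z * exp (h z / of_nat r)" for z
  have tr: "t z ^ r = w z" if "z \<in> ball 0 r0" for z
  proof -
    have "exp (h z / of_nat r) ^ r = exp (h z)" using r by (simp add: exp_of_nat_mult[symmetric])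
    then show ?thesis using g(4) h(2) that by (simp add: t_def power_mult_distrib)
  qed
  have ht: "t holomorphic_on ball 0 r0" unfolding t_def by (intro holomorphic_intros h(1)) (use r in auto)
  have t0: "t 0 = 0" by (simp add: t_def)
  have "(t has_field_derivative exp (h 0 / of_nat r)) (at 0)"
  proof -
    have "(h has_field_derivative deriv h 0) (at 0)"
      using h(1) g(1) by (intro holomorphic_derivI[of h "ball 0 r0"]) auto
    then show ?thesis unfolding t_def using r by (auto intro!: derivative_eq_intros)
  qed
  then have "deriv t 0 \<noteq> 0" by (metis DERIV_imp_deriv exp_not_eq_zero)
  then obtain r1 where r1: "r1 > 0" "ball (0::complex) r1 \<subseteq> ball 0 r0" "open (t ` ball 0 r1)" "inj_on t (ball 0 r1)"
    using has_complex_derivative_locally_invertible[OF ht _ open_ball, of 0] g(1) by auto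
  have ht1: "t holomorphic_on ball 0 r1" using ht r1(2) by (rule holomorphic_on_subset)
  obtain k where k: "k holomorphic_on t ` ball 0 r1" "\<And>z. z \<in> ball 0 r1 \<Longrightarrow> k (t z) = z"
    using holomorphic_has_inverse[OF ht1 open_ball r1(4)] by metis
  have "0 \<in> t ` ball 0 r1" using r1(1) t0 by (metis centre_in_ball image_eqI)
  then obtain r2 where r2: "r2 > 0" "ball 0 r2 \<subseteq> t ` ball 0 r1" using r1(3) open_contains_ball by blast
  have k1: "k z \<in> ball 0 r1" "t (k z) = z" if "z \<in> ball 0 r2" for z
    using that r2(2) k(2) by auto
  have hk: "k holomorphic_on ball 0 r2" using k(1) r2(2) by (rule holomorphic_on_subset)
  have kinj: "inj_on k (ball 0 r2)" using k1(2) by (metis inj_onI)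
  have kim: "k ` ball 0 r2 \<subseteq> ball 0 \<rho>"
  proof clarify
    fix z :: complex assume "z \<in> ball 0 r2"
    then have "k z \<in> ball 0 r0" using k1(1) r1(2) by blast
    then show "k z \<in> ball 0 \<rho>" using g(2) by simp
  qed
  have k0: "k 0 = 0" using k(2)[of 0] r1(1) t0 by simp
  have dk: "(k has_field_derivative deriv k 0) (at 0)"
    using hk r2(1) by (intro holomorphic_derivI[of k "ball 0 r2"]) auto
  have "(t has_field_derivative deriv t 0) (at 0)"
    using ht g(1) by (intro holomorphic_derivI[of t "ball 0 r0"]) auto
  from hasord_left_inverse[OF this dk open_ball[of 0 r2] _ k1(2) k0] have ko: "hasord k 1" using r2(1) by simp
  have "\<forall>z\<in>ball 0 r2. w (k z) = z ^ r"
    using tr k1 r1(2) by (metis subsetD)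
  then show ?thesis by (rule that[OF r2(1) hk kinj kim k0 ko])
qed

section \<open>Lifts, frames and branches of a parametrized curve\<close>

definition lift :: "('a::topological_space, 1) atlas \<Rightarrow> ('a \<Rightarrow> proj2) \<Rightarrow> 'a \<Rightarrow> real \<Rightarrow> (complex \<Rightarrow> 'a) \<Rightarrow> ('a \<Rightarrow> complex)
    \<Rightarrow> (complex \<Rightarrow> complex^3) \<Rightarrow> bool" where
  "lift A \<nu> p \<rho> \<psi> \<tau> y \<longleftrightarrow> disc A p \<rho> \<psi> \<tau> \<and> (\<forall>i. (\<lambda>z. y z $ i) holomorphic_on ball 0 \<rho>) \<and>
     (\<forall>z\<in>ball 0 \<rho>. y z \<noteq> 0 \<and> \<nu> (\<psi> z) = pt (y z))"

text \<open>Order of contact of the branch at p with the line b, that is, their local intersection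
  multiplicity. One lift is asked for; \<open>lift_transfer\<close> shows that the choice is
  immaterial.\<close>

definition vord :: "('a::topological_space, 1) atlas \<Rightarrow> ('a \<Rightarrow> proj2) \<Rightarrow> 'a \<Rightarrow> complex^3 \<Rightarrow> nat \<Rightarrow> bool" where
  "vord A \<nu> p b n \<longleftrightarrow> (\<exists>\<rho> \<psi> \<tau> y. lift A \<nu> p \<rho> \<psi> \<tau> y \<and> hasord (\<lambda>z. bil b (y z)) n)"

text \<open>A lift in the coordinates G, normalized to third coordinate 1, so that orders of contact
  with lines become orders of linear combinations of u, w and 1.\<close>

definition frame :: "('a::topological_space, 1) atlas \<Rightarrow> ('a \<Rightarrow> proj2) \<Rightarrow> 'a \<Rightarrow> real \<Rightarrow> (complex \<Rightarrow> 'a) \<Rightarrow> ('a \<Rightarrow> complex)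
    \<Rightarrow> complex^3^3 \<Rightarrow> (complex \<Rightarrow> complex) \<Rightarrow> (complex \<Rightarrow> complex) \<Rightarrow> bool" where
  "frame A \<nu> p \<rho> \<psi> \<tau> G u w \<longleftrightarrow> disc A p \<rho> \<psi> \<tau> \<and> invertible G \<and>
     u holomorphic_on ball 0 \<rho> \<and> w holomorphic_on ball 0 \<rho> \<and>
     (\<forall>z\<in>ball 0 \<rho>. \<nu> (\<psi> z) = pt (matrix_inv G *v vector [u z, w z, 1]))"

text \<open>The analytic content of \<open>branch_form\<close>: a condition on orders in place of
  the power series, with the disc and the coordinates G made explicit.\<close>

definition nframe :: "('a::topological_space, 1) atlas \<Rightarrow> ('a \<Rightarrow> proj2) \<Rightarrow> 'a \<Rightarrow> real \<Rightarrow> (complex \<Rightarrow> 'a) \<Rightarrow> ('a \<Rightarrow> complex)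
    \<Rightarrow> complex^3^3 \<Rightarrow> (complex \<Rightarrow> complex) \<Rightarrow> nat \<Rightarrow> nat \<Rightarrow> bool" where
  "nframe A \<nu> p \<rho> \<psi> \<tau> G u r s \<longleftrightarrow> frame A \<nu> p \<rho> \<psi> \<tau> G u (\<lambda>z. z ^ r) \<and> 1 \<le> r \<and> r < s \<and> hasord u s"

lemma vector3_nz: "vector [a, b, 1] \<noteq> (0 :: complex^3)"
  by (simp add: vec_eq_iff exI[of _ 3])

lemma frameD:
  assumes "frame A \<nu> p \<rho> \<psi> \<tau> G u w"
  shows "disc A p \<rho> \<psi> \<tau>" "invertible G" "u holomorphic_on ball 0 \<rho>" "w holomorphic_on ball 0 \<rho>"
    "z \<in> ball 0 \<rho> \<Longrightarrow> \<nu> (\<psi> z) = pt (matrix_inv G *v vector [u z, w z, 1])"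
    "matrix_inv G *v vector [u z, w z, 1] \<noteq> 0"
  using assms invertible_mult_0[OF matrix_inv(5)] vector3_nz by (auto simp: frame_def)

lemma frame_bil:
  assumes "frame A \<nu> p \<rho> \<psi> \<tau> G u w"
  shows "bil (b v* G) (matrix_inv G *v vector [u z, w z, 1]) = b $ 1 * u z + b $ 2 * w z + b $ 3"
  unfolding bil_vector_matrix matrix_inv(3)[OF frameD(2)[OF assms]] by (simp add: bil_3)

lemma frame_incident:
  assumes f: "frame A \<nu> p \<rho> \<psi> \<tau> G u w" and z: "z \<in> ball 0 \<rho>" and b: "b \<noteq> 0"
  shows "incident (\<nu> (\<psi> z)) (pt (b v* G)) \<longleftrightarrow> b $ 1 * u z + b $ 2 * w z + b $ 3 = 0"
proof -
  have "b v* G \<noteq> 0" using vector_matrix_mult_0[OF frameD(2)[OF f]] b by simp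
  then show ?thesis unfolding frameD(5)[OF f z]
    by (simp add: incident_pt[OF frameD(6)[OF f]] frame_bil[OF f])
qed

lemma holomorphic_on_vector_3:
  assumes "u holomorphic_on S" "w holomorphic_on S"
  shows "(\<lambda>z. ((M :: complex^3^3) *v vector [u z, w z, 1]) $ i) holomorphic_on S"
  unfolding matrix_vector_3 vector_3 by (intro holomorphic_intros assms)

lemma frame_lift:
  assumes "frame A \<nu> p \<rho> \<psi> \<tau> G u w"
  shows "lift A \<nu> p \<rho> \<psi> \<tau> (\<lambda>z. matrix_inv G *v vector [u z, w z, 1])"
  using frameD[OF assms] unfolding lift_def
  by (auto intro!: holomorphic_on_vector_3)

locale rcurve =
  fixes A :: "('a::t2_space, 1) atlas" and \<nu> :: "'a \<Rightarrow> proj2"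
  assumes A: "complex_manifold A" and AU: "mfd_points A = UNIV" and hol_\<nu>: "hol_map A proj2_atlas UNIV \<nu>"
begin

abbreviation "lft \<equiv> lift A \<nu>"
abbreviation "frm \<equiv> frame A \<nu>"

lemma continuous_\<nu>: "continuous_on UNIV \<nu>"
  using hol_\<nu> by (simp add: hol_map_iff)

lemma frame_shrink:
  assumes "frm p \<rho> \<psi> \<tau> G u w" "0 < r" "r \<le> \<rho>"
  shows "frm p r \<psi> \<tau> G u w"
  using assms disc_shrink[OF A AU] unfolding frame_def
  by (auto intro: holomorphic_on_subset)

lemma frame_reparam:
  assumes f: "frm p \<rho> \<psi> \<tau> G u w" and g: "g holomorphic_on ball 0 r" "inj_on g (ball 0 r)"
    "g ` ball 0 r \<subseteq> ball 0 \<rho>" "r > 0"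
  obtains \<tau>' where "frm (\<psi> (g 0)) r (\<lambda>z. \<psi> (g z)) \<tau>' G (\<lambda>z. u (g z)) (\<lambda>z. w (g z))"
proof -
  obtain k where d: "disc A (\<psi> (g 0)) r (\<lambda>z. \<psi> (g z)) (\<lambda>x. k (\<tau> x))"
    by (rule disc_reparam[OF A AU frameD(1)[OF f] g])
  have "(\<lambda>z. v (g z)) holomorphic_on ball 0 r" if "v holomorphic_on ball 0 \<rho>" for v
    using holomorphic_on_compose_gen[OF g(1) that g(3)] by (simp add: o_def)
  then have "frm (\<psi> (g 0)) r (\<lambda>z. \<psi> (g z)) (\<lambda>x. k (\<tau> x)) G (\<lambda>z. u (g z)) (\<lambda>z. w (g z))"
    using d frameD[OF f] g(3) unfolding frame_def by blast
  then show ?thesis by (rule that)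
qed

lemma frame_exists:
  assumes d: "disc A p \<rho>0 \<psi> \<tau>" and G: "invertible G" and p: "\<nu> p \<in> offline (G $ 3)"
  obtains \<rho> u w where "\<rho> \<le> \<rho>0" "frm p \<rho> \<psi> \<tau> G u w"
    "\<And>z. u z = ratio (G $ 1) (G $ 3) (\<nu> (\<psi> z))" "\<And>z. w z = ratio (G $ 2) (G $ 3) (\<nu> (\<psi> z))"
proof -
  have c: "continuous_on (ball 0 \<rho>0) (\<lambda>z. \<nu> (\<psi> z))"
    by (rule continuous_on_compose2[OF continuous_\<nu> discD(4)[OF d]]) auto
  define S where "S = (\<lambda>z. \<nu> (\<psi> z)) -` offline (G $ 3) \<inter> ball 0 \<rho>0"
  have "open S" unfolding S_def using continuous_on_open_vimage[OF open_ball] c open_offline by blast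
  moreover have "0 \<in> S" using p discD(1,2)[OF d] by (simp add: S_def)
  ultimately obtain \<rho> where \<rho>: "\<rho> > 0" "ball 0 \<rho> \<subseteq> S" using open_contains_ball by blast
  have \<rho>0: "ball 0 \<rho> \<subseteq> ball (0::complex) \<rho>0" using \<rho>(2) by (auto simp: S_def)
  then have \<rho>le: "\<rho> \<le> \<rho>0" using \<rho>(1) by (simp add: ball_subset_ball_iff)
  have hol: "(\<lambda>z. ratio (G $ i) (G $ 3) (\<nu> (\<psi> z))) holomorphic_on ball 0 \<rho>" for i
  proof (rule holomorphic_onI)
    fix z :: complex assume z: "z \<in> ball 0 \<rho>"
    then have "\<nu> (\<psi> z) \<in> offline (G $ 3)" using \<rho>(2) by (auto simp: S_def)
    then have "holat proj2_atlas (ratio (G $ i) (G $ 3)) (\<nu> (\<psi> z))" by (rule holat_ratio)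
    then have "holat A (\<lambda>x. ratio (G $ i) (G $ 3) (\<nu> x)) (\<psi> z)"
      by (intro holat_compose[OF A complex_manifold_proj2 _ _ hol_\<nu>]) (auto simp: mopen_def AU)
    then have "(\<lambda>z. ratio (G $ i) (G $ 3) (\<nu> (\<psi> z))) field_differentiable at z"
      by (rule discD(7)[OF d, where h = "\<lambda>x. ratio (G $ i) (G $ 3) (\<nu> x)", rotated]) (use z \<rho>0 in auto)
    then show "(\<lambda>z. ratio (G $ i) (G $ 3) (\<nu> (\<psi> z))) field_differentiable at z within ball 0 \<rho>"
      by (rule field_differentiable_at_within)
  qed
  have "frm p \<rho> \<psi> \<tau> G (\<lambda>z. ratio (G $ 1) (G $ 3) (\<nu> (\<psi> z))) (\<lambda>z. ratio (G $ 2) (G $ 3) (\<nu> (\<psi> z)))"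
    unfolding frame_def using disc_shrink[OF A AU d \<rho>(1) \<rho>le] G hol \<rho>(2) frame_coords[OF G]
    by (auto simp: S_def)
  then show ?thesis using that[OF \<rho>le] by blast
qed

text \<open>The two discs at p are related by s = \<tau> \<circ> \<psi>', which has order 1, and at
  corresponding points the two lifts are proportional with a factor that is continuous and nonzero
  at 0. Neither changes an order of vanishing.\<close>

lemma lift_transfer:
  assumes l: "lft p \<rho> \<psi> \<tau> y" and l': "lft p \<rho>' \<psi>' \<tau>' y'" and h: "hasord (\<lambda>z. bil b (y z)) n"
  shows "hasord (\<lambda>z. bil b (y' z)) n"
proof -
  have d: "disc A p \<rho> \<psi> \<tau>" and d': "disc A p \<rho>' \<psi>' \<tau>'" using l l' by (auto simp: lift_def)
  have \<rho>: "\<rho> > 0" "\<rho>' > 0" using discD(1)[OF d] discD(1)[OF d'] by auto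
  define s where "s z = \<tau> (\<psi>' z)" for z
  have c: "continuous_on (ball 0 \<rho>') \<psi>'" by (rule discD(4)[OF d'])
  define S where "S = \<psi>' -` (\<psi> ` ball 0 \<rho>) \<inter> ball 0 \<rho>'"
  have S: "open S" unfolding S_def using continuous_on_open_vimage[OF open_ball] c discD(3)[OF d] by blast
  have S0: "0 \<in> S" using discD(2)[OF d] discD(2)[OF d'] \<rho> by (auto simp: S_def intro!: image_eqI[of _ _ 0])
  have s: "s z \<in> ball 0 \<rho>" "\<psi> (s z) = \<psi>' z" if "z \<in> S" for z
    using that discD(5)[OF d] by (auto simp: S_def s_def)
  have s0: "s 0 = 0" using discD(2)[OF d] discD(2)[OF d'] discD(5)[OF d, of 0] \<rho> by (simp add: s_def)
  have ev: "eventually (\<lambda>z. z \<in> S) (at 0)" using S S0 by (auto simp: eventually_at_topological)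
  have sd: "(s has_field_derivative deriv s 0) (at 0)"
    unfolding s_def
  proof (intro field_differentiable_derivI discD(7)[OF d'])
    show "holat A \<tau> (\<psi>' 0)" using discD(2)[OF d] discD(2)[OF d'] discD(6)[OF d, of 0] \<rho> by simp
  qed (use \<rho> in auto)
  have td: "((\<lambda>z. \<tau>' (\<psi> z)) has_field_derivative deriv (\<lambda>z. \<tau>' (\<psi> z)) 0) (at 0)"
  proof (intro field_differentiable_derivI discD(7)[OF d])
    show "holat A \<tau>' (\<psi> 0)" using discD(2)[OF d] discD(2)[OF d'] discD(6)[OF d', of 0] \<rho> by simp
  qed (use \<rho> in auto)
  have so: "hasord s 1"
    by (rule hasord_left_inverse[OF td sd S S0 _ s0]) (use s discD(5)[OF d'] in \<open>auto simp: S_def\<close>)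
  have y: "y z \<noteq> 0" "\<nu> (\<psi> z) = pt (y z)" if "z \<in> ball 0 \<rho>" for z using l that by (auto simp: lift_def)
  have y': "y' z \<noteq> 0" "\<nu> (\<psi>' z) = pt (y' z)" if "z \<in> ball 0 \<rho>'" for z using l' that by (auto simp: lift_def)
  \<comment> \<open>A coordinate that is nonzero at the centre stays nonzero nearby; the quotient of
    the two lifts in this coordinate is the factor of proportionality.\<close>
  obtain i where i: "y 0 $ i \<noteq> 0" using y(1)[of 0] \<rho> by (auto simp: vec_eq_iff)
  have scal: "y' z = (y' z $ i / y (s z) $ i) *s y (s z)" "y (s z) $ i \<noteq> 0 \<Longrightarrow> y' z $ i \<noteq> 0"
    if "z \<in> S" "y (s z) $ i \<noteq> 0" for z
  proof -
    have z: "z \<in> ball 0 \<rho>'" using that(1) by (simp add: S_def)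
    have "pt (y (s z)) = pt (y' z)"
      using s(2)[OF that(1)] y(2)[OF s(1)[OF that(1)]] y'(2)[OF z] by simp
    then have "\<exists>k. k \<noteq> 0 \<and> y' z = k *s y (s z)"
      using pt_eq_iff[OF y(1)[OF s(1)[OF that(1)]] y'(1)[OF z]] by blast
    then obtain k where "k \<noteq> 0" "y' z = k *s y (s z)" by blast
    then show "y' z = (y' z $ i / y (s z) $ i) *s y (s z)" "y' z $ i \<noteq> 0" using that(2) by simp_all
  qed
  have cy: "isCont (\<lambda>z. y z $ i) 0" "isCont (\<lambda>z. y' z $ i) 0"
    using l l' \<rho> unfolding lift_def by (auto intro: holomorphic_isCont_0)
  have cs: "isCont s 0" using sd by (rule DERIV_isCont)
  have cys: "isCont (\<lambda>z. y (s z) $ i) 0"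
    by (rule continuous_at_compose[of 0 s "\<lambda>z. y z $ i", unfolded o_def]) (use cs cy s0 in auto)
  have "hasord (\<lambda>z. y' z $ i / y (s z) $ i) 0"
    using scal(2)[OF S0] i s0 by (intro hasord_0I isCont_divide cy cys) auto
  then have H: "hasord (\<lambda>z. y' z $ i / y (s z) $ i * bil b (y (s z))) (0 + n)"
    by (rule hasord_mult) (rule hasord_compose[OF h so])
  have E: "eventually (\<lambda>z. y' z $ i / y (s z) $ i * bil b (y (s z)) = bil b (y' z)) (at 0)"
  proof -
    have "eventually (\<lambda>z. y (s z) $ i \<noteq> 0) (at 0)"
      using cys i s0 unfolding isCont_def by (intro tendsto_imp_eventually_ne) auto
    with ev show ?thesis
    proof eventually_elim
      case (elim z)
      have "bil b (y' z) = bil b ((y' z $ i / y (s z) $ i) *s y (s z))"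
        using scal(1)[OF elim] by simp
      then show ?case by (simp only: bil_linear)
    qed
  qed
  show ?thesis using H unfolding hasord_cong[OF E] add_0 .
qed

lemma vord_iff: "lft p \<rho> \<psi> \<tau> y \<Longrightarrow> vord A \<nu> p b n \<longleftrightarrow> hasord (\<lambda>z. bil b (y z)) n"
  unfolding vord_def using lift_transfer by blast

lemma vord_frame:
  assumes "frm p \<rho> \<psi> \<tau> G u w"
  shows "vord A \<nu> p (b v* G) n \<longleftrightarrow> hasord (\<lambda>z. b $ 1 * u z + b $ 2 * w z + b $ 3) n"
  using vord_iff[OF frame_lift[OF assms]] frame_bil[OF assms] by simp

lemma vord_row:
  assumes f: "frm p \<rho> \<psi> \<tau> G u w"
  shows "vord A \<nu> p (G $ 1) n \<longleftrightarrow> hasord u n" "vord A \<nu> p (G $ 2) n \<longleftrightarrow> hasord w n"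
  using vord_frame[OF f, of "axis 1 1"] vord_frame[OF f, of "axis 2 1"] unfolding row_vector_matrix[symmetric]
  by (simp_all add: axis_def)

lemma frame_at:
  obtains G \<rho> \<psi> \<tau> u w where "frm p \<rho> \<psi> \<tau> G u w"
proof -
  obtain x where x: "x \<noteq> 0" "\<nu> p = pt x" by (rule pt_cases)
  obtain N :: "complex^3^3" where N: "det N \<noteq> 0" "bil (N $ 1) x = 1" by (rule coordinate_rows[OF x(1)])
  define G :: "complex^3^3" where "G = vector [N $ 2, N $ 3, N $ 1]"
  have "det G = det N" by (simp add: G_def det_3 algebra_simps)
  then have G: "invertible G" using N(1) by (simp add: invertible_det_nz)
  have p: "\<nu> p \<in> offline (G $ 3)" using x N(2) by (simp add: offline_pt G_def)
  obtain \<rho>0 \<psi> \<tau> where d: "disc A p \<rho>0 \<psi> \<tau>" by (rule disc_exists[OF A AU])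
  show ?thesis by (rule frame_exists[OF d G p]) (rule that)
qed

lemma vord_unique:
  assumes "vord A \<nu> p b m" "vord A \<nu> p b n" shows "m = n"
proof -
  obtain G \<rho> \<psi> \<tau> u w where f: "frm p \<rho> \<psi> \<tau> G u w" by (rule frame_at)
  show ?thesis
    using assms unfolding vord_iff[OF frame_lift[OF f]] by (rule hasord_unique)
qed

lemma nframe_0:
  assumes "nframe A \<nu> p \<rho> \<psi> \<tau> G u r s" shows "u 0 = 0" "(0 :: complex) ^ r = 0"
proof -
  have f: "frm p \<rho> \<psi> \<tau> G u (\<lambda>z. z ^ r)" and rs: "1 \<le> r" "r < s" and u: "hasord u s"
    using assms by (auto simp: nframe_def)
  have "isCont u 0" by (rule holomorphic_isCont_0[OF frameD(3)[OF f] discD(1)[OF frameD(1)[OF f]]])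
  then show "u 0 = 0" "(0 :: complex) ^ r = 0" using hasord_pos_0[OF u] rs by simp_all
qed

text \<open>On the branch the line b restricts to b1 u + b2 z^r + b3. The three terms have the
  distinct orders s, r and 0, so the smallest order with a nonzero coefficient wins.\<close>

lemma nframe_vord:
  assumes n: "nframe A \<nu> p \<rho> \<psi> \<tau> G u r s" and b: "b \<noteq> 0"
  shows "vord A \<nu> p (b v* G) (if b $ 3 \<noteq> 0 then 0 else if b $ 2 \<noteq> 0 then r else s)"
proof -
  have f: "frm p \<rho> \<psi> \<tau> G u (\<lambda>z. z ^ r)" and rs: "1 \<le> r" "r < s" and u: "hasord u s"
    using n by (auto simp: nframe_def)
  have cu: "isCont u 0" by (rule holomorphic_isCont_0[OF frameD(3)[OF f] discD(1)[OF frameD(1)[OF f]]])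
  note u0 = nframe_0(1)[OF n]
  have "hasord (\<lambda>z. b $ 1 * u z + b $ 2 * z ^ r + b $ 3) (if b $ 3 \<noteq> 0 then 0 else if b $ 2 \<noteq> 0 then r else s)"
  proof (cases "b $ 3 = 0")
    case False
    then have "hasord (\<lambda>z. b $ 1 * u z + b $ 2 * z ^ r + b $ 3) 0"
      using u0 rs by (intro hasord_0I continuous_intros cu) (simp add: power_0_left)
    then show ?thesis using False by simp
  next
    case 3: True
    show ?thesis
    proof (cases "b $ 2 = 0")
      case True
      then have "b $ 1 \<noteq> 0" using b 3 by (auto simp: vec_eq_iff forall_3)
      then show ?thesis using hasord_cmult[OF u] 3 True by simp
    next
      case 2: False
      have "hasord (\<lambda>z. b $ 2 * z ^ r + b $ 1 * u z) r"
      proof (cases "b $ 1 = 0")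
        case True
        then show ?thesis using hasord_cmult[OF hasord_power 2] by simp
      next
        case False
        show ?thesis by (rule hasord_add[OF hasord_cmult[OF hasord_power 2] hasord_cmult[OF u False] rs(2)])
      qed
      then show ?thesis using 2 3 by (simp add: add.commute)
    qed
  qed
  then show ?thesis by (simp only: vord_frame[OF f])
qed

lemma nframe_vord_values:
  assumes n: "nframe A \<nu> p \<rho> \<psi> \<tau> G u r s" and b: "b \<noteq> 0" "vord A \<nu> p b n"
  shows "n \<in> {0, r, s}"
proof -
  have G: "invertible G" using n frameD(2) by (auto simp: nframe_def)
  define \<beta> where "\<beta> = b v* matrix_inv G"
  have \<beta>: "b = \<beta> v* G" "\<beta> \<noteq> 0"
    using vector_matrix_inv(1)[OF G, of b] vector_matrix_mult_0[OF matrix_inv(5)[OF G], of b] b(1) by (auto simp: \<beta>_def)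
  show ?thesis using vord_unique[OF b(2)] nframe_vord[OF n \<beta>(2)] \<beta>(1) by auto
qed

section \<open>Multiplicities and tangent line as invariants of the branch\<close>

lemma power_series_of_order:
  assumes u: "u holomorphic_on ball 0 \<rho>" and o: "hasord u s" and \<rho>: "\<rho> > 0"
  obtains a r where "0 < r" "r \<le> \<rho>" "a s \<noteq> 0" "\<forall>i<s. a i = 0" "\<forall>z\<in>ball 0 r. (\<lambda>i. a i * z ^ i) sums u z"
proof -
  obtain r g where g: "0 < r" "r \<le> \<rho>" "g holomorphic_on ball 0 r" "\<And>z. z \<in> ball 0 r \<Longrightarrow> u z = z ^ s * g z"
    "\<And>z. z \<in> ball 0 r \<Longrightarrow> g z \<noteq> 0" using hasord_factor[OF u \<rho> o] by metis
  define b where "b i = (deriv ^^ i) g 0 / fact i" for i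
  define a where "a i = (if i < s then 0 else b (i - s))" for i
  have "(\<lambda>i. a i * z ^ i) sums u z" if "z \<in> ball 0 r" for z
  proof -
    have "(\<lambda>i. b i * z ^ i) sums g z" using holomorphic_power_series[OF g(3) that] by (simp add: b_def)
    then have "(\<lambda>i. z ^ s * (b i * z ^ i)) sums (z ^ s * g z)" by (rule sums_mult)
    then have "(\<lambda>i. a (i + s) * z ^ (i + s)) sums u z"
      using g(4)[OF that] by (simp add: a_def power_add mult_ac)
    then have "(\<lambda>i. a i * z ^ i) sums (u z + (\<Sum>i<s. a i * z ^ i))"
      using sums_iff_shift[of "\<lambda>i. a i * z ^ i" s "u z"] by simp
    moreover have "(\<Sum>i<s. a i * z ^ i) = 0" by (rule sum.neutral) (simp add: a_def)
    ultimately show ?thesis by simp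
  qed
  moreover have "b 0 \<noteq> 0" using g(1,5) by (simp add: b_def)
  ultimately show ?thesis using that[of r a] g by (simp add: a_def)
qed

lemma nframe_branch_form:
  assumes n: "nframe A \<nu> p \<rho> \<psi> \<tau> G u r s"
  shows "branch_form A \<nu> p r s (pt (G $ 1))"
proof -
  have f0: "frm p \<rho> \<psi> \<tau> G u (\<lambda>z. z ^ r)" and rs: "1 \<le> r" "r < s" and u: "hasord u s"
    using n by (auto simp: nframe_def)
  obtain a r0 where a0: "0 < r0" "r0 \<le> \<rho>" and a: "a s \<noteq> 0" "\<forall>i<s. a i = 0" "\<forall>z\<in>ball 0 r0. (\<lambda>i. a i * z ^ i) sums u z"
    by (rule power_series_of_order[OF frameD(3)[OF f0] u discD(1)[OF frameD(1)[OF f0]]])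
  have f: "frm p r0 \<psi> \<tau> G u (\<lambda>z. z ^ r)" by (rule frame_shrink[OF f0 a0])
  have d: "disc A p r0 \<psi> \<tau>" by (rule frameD(1)[OF f])
  show ?thesis
    unfolding branch_form_def
  proof (intro conjI rs exI)
    show "invertible G" by (rule frameD(2)[OF f])
    show "local_parameter A p (\<psi> ` ball 0 r0) \<tau>" by (rule disc_local_parameter[OF A AU d])
    show "\<forall>x\<in>\<psi> ` ball 0 r0. \<exists>y. \<nu> x = pt y \<and> (\<lambda>i. a i * \<tau> x ^ i) sums (G *v y) $ 1 \<and> (G *v y) $ 2 = \<tau> x ^ r \<and> (G *v y) $ 3 = 1"
    proof clarify
      fix z :: complex assume z: "z \<in> ball 0 r0"
      show "\<exists>y. \<nu> (\<psi> z) = pt y \<and> (\<lambda>i. a i * \<tau> (\<psi> z) ^ i) sums (G *v y) $ 1 \<and> (G *v y) $ 2 = \<tau> (\<psi> z) ^ r \<and> (G *v y) $ 3 = 1"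
        by (rule exI[of _ "matrix_inv G *v vector [u z, z ^ r, 1]"])
           (use frameD(5)[OF f z] matrix_inv(3)[OF frameD(2)[OF f]] discD(5)[OF d z] a(3) z in simp)
    qed
  qed (use a in auto)
qed

text \<open>Dividing the series of u by z^s leaves a convergent series with constant term
  \<open>a s\<close>, so u has order s. The homogeneous representative is forced by its third
  coordinate 1 in the coordinates G.\<close>

lemma branch_form_nframe:
  assumes b: "branch_form A \<nu> p r s l"
  obtains \<rho> \<psi> \<tau> G u where "nframe A \<nu> p \<rho> \<psi> \<tau> G u r s" "l = pt (G $ 1)"
proof -
  obtain G :: "complex^3^3" and U t a where rs: "1 \<le> r" "r < s" and G: "invertible G" and lp: "local_parameter A p U t"
    and a: "a s \<noteq> 0" "\<And>i. i < s \<Longrightarrow> a i = 0" and l: "l = pt (G $ 1)"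
    and y: "\<And>x. x \<in> U \<Longrightarrow> \<exists>y. \<nu> x = pt y \<and> (\<lambda>i. a i * t x ^ i) sums ((G *v y) $ 1) \<and> (G *v y) $ 2 = t x ^ r \<and> (G *v y) $ 3 = 1"
    using b unfolding branch_form_def by auto
  obtain \<rho> \<psi> where d: "disc A p \<rho> \<psi> t" "\<psi> ` ball 0 \<rho> \<subseteq> U" by (rule local_parameter_disc[OF A AU lp])
  define u where "u z = (\<Sum>i. a i * z ^ i)" for z
  have Y: "\<nu> (\<psi> z) = pt (matrix_inv G *v vector [u z, z ^ r, 1]) \<and> (\<lambda>i. a i * z ^ i) sums u z"
    if z: "z \<in> ball 0 \<rho>" for z
  proof -
    obtain x where x: "\<nu> (\<psi> z) = pt x" "(\<lambda>i. a i * z ^ i) sums ((G *v x) $ 1)" "(G *v x) $ 2 = z ^ r" "(G *v x) $ 3 = 1"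
      using y[OF subsetD[OF d(2) imageI[OF z]]] discD(5)[OF d(1) z] by auto
    have u: "u z = (G *v x) $ 1" using x(2) by (simp add: u_def sums_iff)
    then have "G *v x = vector [u z, z ^ r, 1]" using x by (simp add: vec_eq_iff forall_3)
    then have "x = matrix_inv G *v vector [u z, z ^ r, 1]" using matrix_inv(4)[OF G] by metis
    then show ?thesis using x u by simp
  qed
  have hu: "u holomorphic_on ball 0 \<rho>"
    by (rule power_series_holomorphic[of 0 \<rho> a]) (use Y in auto)
  define g where "g z = (\<Sum>i. a (i + s) * z ^ i)" for z
  have gs: "(\<lambda>i. a (i + s) * z ^ i) sums g z \<and> u z = z ^ s * g z" if z: "z \<in> ball 0 \<rho>" for z
  proof (cases "z = 0")
    case True
    have "(\<lambda>i. a (i + s) * 0 ^ i) sums a s" using powser_sums_zero[of "\<lambda>i. a (i + s)"] by simp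
    moreover have "(\<lambda>i. a i * 0 ^ i) sums a 0" using powser_sums_zero[of a] by simp
    ultimately show ?thesis using True Y[OF z] a(2)[of 0] rs by (auto simp: g_def u_def sums_iff)
  next
    case False
    have "(\<lambda>i. a (i + s) * z ^ (i + s)) sums u z"
      using Y[OF z] a(2) sums_iff_shift[of "\<lambda>i. a i * z ^ i" s "u z"] by simp
    then have "(\<lambda>i. a (i + s) * z ^ (i + s) / z ^ s) sums (u z / z ^ s)" by (rule sums_divide)
    then have "(\<lambda>i. a (i + s) * z ^ i) sums (u z / z ^ s)" using False by (simp add: power_add)
    then show ?thesis using False by (auto simp: g_def sums_iff)
  qed
  have hg: "g holomorphic_on ball 0 \<rho>"
    by (rule power_series_holomorphic[of 0 \<rho> "\<lambda>i. a (i + s)"]) (use gs in auto)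
  have "g 0 = a s" using powser_sums_zero[of "\<lambda>i. a (i + s)"] by (simp add: g_def sums_iff)
  then have "hasord u s"
    using gs a discD(1)[OF d(1)] by (intro hasord_factorI[OF _ hg]) auto
  moreover have "frm p \<rho> \<psi> t G u (\<lambda>z. z ^ r)"
    using d(1) G hu Y by (auto simp: frame_def intro!: holomorphic_intros)
  ultimately have "nframe A \<nu> p \<rho> \<psi> t G u r s" using rs by (simp add: nframe_def)
  then show ?thesis using l by (rule that)
qed

text \<open>The set of contact orders of the branch with all lines is {0, r, s} and does not refer
  to coordinates; with 1 \<le> r < s it determines r and s. The first row of G has order s, and in
  the other frame only multiples of the first row do. This gives meaning to the definite
  descriptions of \<open>branch_mult\<close>, \<open>tangent_mult\<close> and
  \<open>tangent_line\<close>.\<close>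

lemma nframe_unique:
  assumes 1: "nframe A \<nu> p \<rho> \<psi> \<tau> G u r s" and 2: "nframe A \<nu> p \<rho>' \<psi>' \<tau>' G' u' r' s'"
  shows "r = r'" "s = s'" "pt (G $ 1) = pt (G' $ 1)"
proof -
  have set: "{n. \<exists>b. b \<noteq> 0 \<and> vord A \<nu> p b n} = {0, r, s}" if n: "nframe A \<nu> p \<rho> \<psi> \<tau> G u r s" for \<rho> \<psi> \<tau> G u r s
  proof -
    have G: "invertible G" using n frameD(2) by (auto simp: nframe_def)
    note sub = nframe_vord_values[OF n]
    have ex: "\<exists>b. b \<noteq> 0 \<and> vord A \<nu> p b (if \<beta> $ 3 \<noteq> 0 then 0 else if \<beta> $ 2 \<noteq> 0 then r else s)" if "\<beta> \<noteq> 0" for \<beta> :: "complex^3"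
      using nframe_vord[OF n that] vector_matrix_mult_0[OF G] that by blast
    have ax: "axis i (1::complex) \<noteq> 0" for i :: 3 by simp
    show ?thesis
      using sub ex[OF ax[of 3]] ex[OF ax[of 2]] ex[OF ax[of 1]] by (auto simp: axis_def)
  qed
  have rs: "1 \<le> r" "r < s" "1 \<le> r'" "r' < s'" using 1 2 by (auto simp: nframe_def)
  have e: "{0, r, s} = {0, r', s'}" using set[OF 1] set[OF 2] by simp
  have "s \<in> {0, r', s'}" "r \<in> {0, r', s'}" "s' \<in> {0, r, s}" "r' \<in> {0, r, s}"
    using e by blast+
  then show rr: "r = r'" and ss: "s = s'" using rs by auto
  have G: "invertible G" "invertible G'" using 1 2 frameD(2) by (auto simp: nframe_def)
  have ax: "axis (1::3) (1::complex) $ 3 = 0" "axis (1::3) (1::complex) $ 2 = 0" "axis (1::3) (1::complex) \<noteq> 0"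
    by (simp_all add: axis_def[of "1::3" "1::complex"], simp add: axis_eq_0_iff flip: axis_def)
  have "vord A \<nu> p (axis 1 1 v* G) s" using nframe_vord[OF 1 ax(3)] by (simp add: ax)
  then have v1: "vord A \<nu> p (G $ 1) s" by (simp only: row_vector_matrix[of G 1])
  define \<beta> where "\<beta> = (G $ 1) v* matrix_inv G'"
  have G1: "G $ 1 \<noteq> 0"
    unfolding row_vector_matrix[of G 1] vector_matrix_mult_0[OF G(1)] by (rule ax(3))
  have \<beta>: "G $ 1 = \<beta> v* G'" unfolding \<beta>_def by (rule vector_matrix_inv(1)[OF G(2), symmetric])
  have "\<beta> \<noteq> 0" unfolding \<beta>_def vector_matrix_mult_0[OF matrix_inv(5)[OF G(2)]] by (rule G1)
  note \<beta> = \<beta> this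
  have "vord A \<nu> p (G $ 1) (if \<beta> $ 3 \<noteq> 0 then 0 else if \<beta> $ 2 \<noteq> 0 then r' else s')"
    using nframe_vord[OF 2 \<beta>(2)] by (simp only: \<beta>(1))
  from vord_unique[OF v1 this] have \<beta>0: "\<beta> $ 3 = 0" "\<beta> $ 2 = 0"
    using rs rr ss by (auto split: if_splits)
  have G1\<beta>: "G $ 1 = \<beta> $ 1 *s G' $ 1"
    unfolding \<beta>(1) by (simp add: vec_eq_iff vector_matrix_mult_def sum_3 \<beta>0)
  have "\<beta> $ 1 \<noteq> 0"
  proof
    assume "\<beta> $ 1 = 0"
    then have "\<beta> = 0" using \<beta>0 by (simp add: vec_eq_iff forall_3)
    then show False using \<beta>(2) by simp
  qed
  then show "pt (G $ 1) = pt (G' $ 1)" unfolding G1\<beta> by (rule pt_scale)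
qed

end

text \<open>The orders of a branch along lines exist as soon as no branch lies on a line.\<close>

locale ndcurve = rcurve +
  assumes vord_ex: "b \<noteq> 0 \<Longrightarrow> \<exists>n. vord A \<nu> p b n"
begin

text \<open>Two independent lines through \<open>\<nu> p\<close> are compared. If their orders
  differ they already serve; if they agree, a combination that cancels the leading coefficients has
  larger order.\<close>

lemma ord_frame_exists:
  obtains \<rho> \<psi> \<tau> G u w r s where "frm p \<rho> \<psi> \<tau> G u w" "1 \<le> r" "r < s" "hasord u s" "hasord w r"
proof -
  obtain x where x: "x \<noteq> 0" "\<nu> p = pt x" by (rule pt_cases)
  obtain N :: "complex^3^3" where dN: "det N \<noteq> 0" and bx: "bil (N $ 1) x = 1" "bil (N $ 2) x = 0" "bil (N $ 3) x = 0"
    by (rule coordinate_rows[OF x(1)])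
  note result = that
  \<comment> \<open>Two independent lines through the point with orders r < s, completed by a line
    missing the point, are the rows of the frame. The order r is positive because w vanishes at
    0.\<close>
  have key: thesis if b: "det (vector [b1, b2, N $ 1] :: complex^3^3) \<noteq> 0" "bil b1 x = 0" "bil b2 x = 0"
      "vord A \<nu> p b1 s" "vord A \<nu> p b2 r" "r < s" for b1 b2 r s
  proof -
    define G :: "complex^3^3" where "G = vector [b1, b2, N $ 1]"
    have Gr: "G $ 1 = b1" "G $ 2 = b2" "G $ 3 = N $ 1" by (simp_all add: G_def)
    have G: "invertible G" using b(1) by (simp add: G_def invertible_det_nz)
    have p: "\<nu> p \<in> offline (G $ 3)" using x(1) bx by (simp add: x(2) offline_pt Gr)
    obtain \<rho>0 \<psi> \<tau> where d: "disc A p \<rho>0 \<psi> \<tau>" by (rule disc_exists[OF A AU])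
    obtain \<rho> u w where f: "frm p \<rho> \<psi> \<tau> G u w" by (rule frame_exists[OF d G p])
    have u: "hasord u s" and w: "hasord w r" using b(4,5) vord_row[OF f] by (simp_all add: Gr)
    have \<rho>: "\<rho> > 0" by (rule discD(1)[OF frameD(1)[OF f]])
    have "bil (G $ 2) (matrix_inv G *v vector [u 0, w 0, 1]) = w 0"
      using matrix_inv(3)[OF G, of "vector [u 0, w 0, 1]"] by (simp flip: matrix_vector_row)
    moreover have "pt (matrix_inv G *v vector [u 0, w 0, 1]) = pt x"
      using frameD(5)[OF f, of 0] \<rho> discD(2)[OF d] x(2) by simp
    then obtain c where "c \<noteq> 0" "x = c *s (matrix_inv G *v vector [u 0, w 0, 1])"
      using pt_eq_iff[OF frameD(6)[OF f] x(1)] by blast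
    ultimately have "w 0 = 0" using b(3) by (simp add: Gr bil_linear)
    then have "r \<noteq> 0" using hasord_0D[OF _ holomorphic_isCont_0[OF frameD(4)[OF f] \<rho>]] w by metis
    then show thesis using result[OF f _ b(6) u w] by simp
  qed
  have nz: "N $ 2 \<noteq> 0" "N $ 3 \<noteq> 0" using dN by (auto simp: det_3)
  obtain n2 n3 where n: "vord A \<nu> p (N $ 2) n2" "vord A \<nu> p (N $ 3) n3"
    using vord_ex[OF nz(1)] vord_ex[OF nz(2)] by blast
  consider "n3 < n2" | "n2 < n3" | "n2 = n3" by linarith
  then show thesis
  proof cases
    case 1
    then show thesis using key[OF _ bx(2,3) n] dN by (simp add: det_3 algebra_simps)
  next
    case 2
    have "det (vector [N $ 3, N $ 2, N $ 1] :: complex^3^3) = - det N" by (simp add: det_3 algebra_simps)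
    then show thesis using key[OF _ bx(3,2) n(2,1)] dN 2 by simp
  next
    case 3
    obtain \<rho> \<psi> \<tau> G u w where f: "frm p \<rho> \<psi> \<tau> G u w" by (rule frame_at)
    note v = vord_iff[OF frame_lift[OF f]]
    define y where "y z = matrix_inv G *v vector [u z, w z, 1]" for z
    obtain c2 where c2: "c2 \<noteq> 0" "((\<lambda>z. bil (N $ 2) (y z) / z ^ n2) \<longlongrightarrow> c2) (at 0)"
      using n(1) unfolding v hasord_def y_def by blast
    obtain c3 where c3: "c3 \<noteq> 0" "((\<lambda>z. bil (N $ 3) (y z) / z ^ n2) \<longlongrightarrow> c3) (at 0)"
      using n(2) unfolding v hasord_def y_def 3 by blast
    \<comment> \<open>The quotient of the leading coefficients, so that
      \<open>N $ 2 - c *s N $ 3\<close> has no term of order n2.\<close>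
    define c where "c = c2 / c3"
    define b where "b = N $ 2 - c *s N $ 3"
    have db: "det (vector [b, N $ 3, N $ 1] :: complex^3^3) = det N" by (simp add: b_def det_3 algebra_simps)
    have "b \<noteq> 0"
    proof
      assume "b = 0"
      then have "det (vector [b, N $ 3, N $ 1] :: complex^3^3) = 0" by (simp add: det_3)
      then show False using db dN by simp
    qed
    then obtain m where m: "vord A \<nu> p b m" using vord_ex by blast
    have "((\<lambda>z. bil (N $ 2) (y z) / z ^ n2 - c * (bil (N $ 3) (y z) / z ^ n2)) \<longlongrightarrow> c2 - c * c3) (at 0)"
      by (intro tendsto_intros c2 c3)
    then have lim0: "((\<lambda>z. bil b (y z) / z ^ n2) \<longlongrightarrow> 0) (at 0)"
      using c3(1) by (simp add: b_def bil_linear c_def diff_divide_distrib)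
    \<comment> \<open>If m were at most n2, the quotient by z^m would tend to 0 as well, although
      its limit is nonzero by the choice of m.\<close>
    have "n2 < m"
    proof (rule ccontr)
      assume "\<not> n2 < m"
      then have le: "m \<le> n2" by simp
      have "((\<lambda>z. bil b (y z) / z ^ n2 * z ^ (n2 - m)) \<longlongrightarrow> 0 * 0 ^ (n2 - m)) (at 0)"
        by (intro tendsto_intros lim0)
      moreover have "eventually (\<lambda>z. bil b (y z) / z ^ n2 * z ^ (n2 - m) = bil b (y z) / z ^ m) (at (0::complex))"
        by (auto simp: eventually_at_filter power_diff le)
      ultimately have "((\<lambda>z. bil b (y z) / z ^ m) \<longlongrightarrow> 0) (at 0)" by (simp add: tendsto_cong)
      moreover obtain k where "k \<noteq> 0" "((\<lambda>z. bil b (y z) / z ^ m) \<longlongrightarrow> k) (at 0)"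
        using m unfolding v hasord_def y_def by blast
      ultimately show False using tendsto_unique[of "at (0::complex)"] by auto
    qed
    moreover have "bil b x = 0" by (simp add: b_def bil_linear bx)
    ultimately show thesis using key[OF _ _ bx(3) m n(2)] db dN 3 by simp
  qed
qed

text \<open>The change of parameter from \<open>power_coordinate\<close> turns w into z^r and keeps
  the order of u.\<close>

lemma nframe_exists:
  obtains \<rho> \<psi> \<tau> G u r s where "nframe A \<nu> p \<rho> \<psi> \<tau> G u r s"
proof -
  obtain \<rho> \<psi> \<tau> G u w r s where f: "frm p \<rho> \<psi> \<tau> G u w" and rs: "1 \<le> r" "r < s" and u: "hasord u s" and w: "hasord w r"
    by (rule ord_frame_exists)
  have d: "disc A p \<rho> \<psi> \<tau>" by (rule frameD(1)[OF f])
  obtain r2 k where r2: "r2 > 0" and hk: "k holomorphic_on ball 0 r2" and kinj: "inj_on k (ball 0 r2)"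
    and kim: "k ` ball 0 r2 \<subseteq> ball 0 \<rho>" and k0: "k 0 = 0" and ko: "hasord k 1" and wk: "\<forall>z\<in>ball 0 r2. w (k z) = z ^ r"
    by (rule power_coordinate[OF frameD(4)[OF f] discD(1)[OF d] w rs(1)])
  obtain \<tau>' where f': "frm (\<psi> (k 0)) r2 (\<lambda>z. \<psi> (k z)) \<tau>' G (\<lambda>z. u (k z)) (\<lambda>z. w (k z))"
    by (rule frame_reparam[OF f hk kinj kim r2])
  have "\<psi> (k 0) = p" using k0 discD(2)[OF d] by simp
  then have "frm p r2 (\<lambda>z. \<psi> (k z)) \<tau>' G (\<lambda>z. u (k z)) (\<lambda>z. z ^ r)"
    using f' wk unfolding frame_def by (auto intro!: holomorphic_intros)
  moreover have "hasord (\<lambda>z. u (k z)) s" by (rule hasord_compose[OF u ko])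
  ultimately have "nframe A \<nu> p r2 (\<lambda>z. \<psi> (k z)) \<tau>' G (\<lambda>z. u (k z)) r s"
    using rs by (simp add: nframe_def)
  then show ?thesis by (rule that)
qed

lemma branch_unique:
  assumes n: "nframe A \<nu> p \<rho> \<psi> \<tau> G u r s" and b: "branch_form A \<nu> p r' s' l"
  shows "r' = r" "s' = s" "l = pt (G $ 1)"
proof -
  obtain \<rho>' \<psi>' \<tau>' G' u' where n': "nframe A \<nu> p \<rho>' \<psi>' \<tau>' G' u' r' s'" "l = pt (G' $ 1)"
    by (rule branch_form_nframe[OF b])
  show "r' = r" "s' = s" "l = pt (G $ 1)" using nframe_unique[OF n n'(1)] n'(2) by simp_all
qed

lemma nframe_invariants:
  assumes n: "nframe A \<nu> p \<rho> \<psi> \<tau> G u r s"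
  shows "branch_mult A \<nu> p = r" "tangent_mult A \<nu> p = s" "tangent_line A \<nu> p = pt (G $ 1)"
proof -
  note b = nframe_branch_form[OF n] and u = branch_unique[OF n]
  show "branch_mult A \<nu> p = r" unfolding branch_mult_def by (rule the_equality) (use b u(1) in blast)+
  show "tangent_mult A \<nu> p = s" unfolding tangent_mult_def by (rule the_equality) (use b u(2) in blast)+
  show "tangent_line A \<nu> p = pt (G $ 1)" unfolding tangent_line_def by (rule the_equality) (use b u(3) in blast)+
qed

lemma nframe_at:
  obtains \<rho> \<psi> \<tau> G u where "nframe A \<nu> p \<rho> \<psi> \<tau> G u (branch_mult A \<nu> p) (tangent_mult A \<nu> p)"
    "tangent_line A \<nu> p = pt (G $ 1)"
proof -
  obtain \<rho> \<psi> \<tau> G u r s where n: "nframe A \<nu> p \<rho> \<psi> \<tau> G u r s" by (rule nframe_exists)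
  note i = nframe_invariants[OF n]
  show ?thesis by (rule that[of \<rho> \<psi> \<tau> G u]) (use n i in simp_all)
qed

end

section \<open>The normalization of a plane curve\<close>

lemma finite_isolated:
  assumes "compact S" "E \<subseteq> S" "\<And>p. p \<in> S \<Longrightarrow> \<exists>U. open U \<and> p \<in> U \<and> U \<inter> E \<subseteq> {p}"
  shows "finite E"
proof (rule ccontr)
  assume "infinite E"
  then obtain x where x: "x \<in> S" "x islimpt E"
    using Heine_Borel_imp_Bolzano_Weierstrass[OF assms(1) _ assms(2)] by blast
  obtain U where U: "open U" "x \<in> U" "U \<inter> E \<subseteq> {x}" using assms(3)[OF x(1)] by blast
  show False by (rule islimptE[OF x(2) U(2,1)]) (use U(3) in blast)
qed

lemma zero_locus_pt:
  assumes "homogeneous n F" "x \<noteq> 0"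
  shows "pt x \<in> zero_locus F \<longleftrightarrow> eval3 F x = 0"
  using assms by (auto simp: zero_locus_def hom_coords_pt homogeneous_eval3 intro: exI[of _ 1])

lemma adapted_matrix:
  assumes b: "b \<noteq> 0" and x: "x \<noteq> 0" and bx: "bil b x = 0"
  obtains G :: "complex^3^3" where "invertible G" "G $ 1 = b" "G *v x = vector [0, 0, 1]"
proof -
  obtain N :: "complex^3^3" where N: "invertible N" "det N \<noteq> 0" "N *v x = axis 1 1"
    and rows: "bil (N $ 1) x = 1" "bil (N $ 2) x = 0" "bil (N $ 3) x = 0" by (rule coordinate_rows[OF x])
  define c where "c = b v* matrix_inv N"
  have bc: "b = c v* N" unfolding c_def by (rule vector_matrix_inv(1)[OF N(1), symmetric])
  have c1: "c $ 1 = 0" using bx unfolding bc bil_vector_matrix N(3) by (simp add: bil_3 axis_def)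
  have "c \<noteq> 0" using b bc by auto
  then have c23: "c $ 2 \<noteq> 0 \<or> c $ 3 \<noteq> 0" using c1 by (auto simp: vec_eq_iff forall_3)
  have b_eq: "b = c $ 2 *s N $ 2 + c $ 3 *s N $ 3"
    unfolding bc by (simp add: vec_eq_iff vector_matrix_mult_def sum_3 c1)
  \<comment> \<open>Since b is a combination of \<open>N $ 2\<close> and \<open>N $ 3\<close>, it
    replaces one of them that enters with nonzero coefficient; this keeps the determinant
    nonzero.\<close>
  define G :: "complex^3^3" where "G = vector [b, if c $ 2 \<noteq> 0 then N $ 3 else N $ 2, N $ 1]"
  have "det G = (if c $ 2 \<noteq> 0 then c $ 2 * det N else - c $ 3 * det N)"
    by (simp add: G_def det_3 b_eq algebra_simps)
  then have "invertible G" using N(2) c23 by (simp add: invertible_det_nz)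
  moreover have "G *v x = vector [0, 0, 1]"
    by (simp add: vec_eq_iff forall_3 matrix_vector_row G_def rows bx)
  ultimately show ?thesis by (intro that[of G]) (simp_all add: G_def)
qed

locale plane_curve = rcurve A \<nu>
  for A :: "('a::t2_space, 1) atlas" and \<nu> :: "'a \<Rightarrow> proj2" +
  fixes C :: "proj2 set" and d :: nat and F :: poly3
  assumes hom: "homogeneous d F" and sq: "squarefree F" and d: "d \<ge> 1" and C: "C = zero_locus F"
    and norm: "is_normalization A proj2_atlas C \<nu>"
begin

lemma range_\<nu>: "range \<nu> = C"
  using norm by (simp add: is_normalization_def AU)

lemma finite_fibre: "finite {p. \<nu> p = P}"
proof (cases "P \<in> C")
  case True
  then show ?thesis using norm by (simp add: is_normalization_def AU finite_map_def)
next
  case False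
  then have "{p. \<nu> p = P} = {}" using range_\<nu> by blast
  then show ?thesis by simp
qed

text \<open>The local left inverse that belongs to the normalization recovers both p and q from
  their common image.\<close>

lemma generic_injectivity:
  obtains N where "closure (- \<nu> -` N) = UNIV" "\<forall>p q. \<nu> p \<notin> N \<longrightarrow> \<nu> q = \<nu> p \<longrightarrow> q = p"
proof -
  obtain N where N: "UNIV \<subseteq> closure (UNIV - \<nu> -` N)"
    and g: "\<forall>x\<in>C - N. \<exists>W g. mopen proj2_atlas W \<and> x \<in> W \<and> hol_map proj2_atlas A W g \<and>
           (\<forall>q\<in>UNIV - \<nu> -` N. \<nu> q \<in> W \<longrightarrow> g (\<nu> q) = q)"
    using norm unfolding is_normalization_def AU by auto
  show ?thesis
  proof (rule that)
    show "closure (- \<nu> -` N) = UNIV" using N by (auto simp: Compl_eq_Diff_UNIV)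
    show "\<forall>p q. \<nu> p \<notin> N \<longrightarrow> \<nu> q = \<nu> p \<longrightarrow> q = p"
    proof (intro allI impI)
      fix p q assume p: "\<nu> p \<notin> N" and q: "\<nu> q = \<nu> p"
      have "\<nu> p \<in> C - N" using p range_\<nu> by auto
      from bspec[OF g this] obtain W h
        where W: "\<nu> p \<in> W" "\<forall>q\<in>UNIV - \<nu> -` N. \<nu> q \<in> W \<longrightarrow> h (\<nu> q) = q"
        by auto
      have "h (\<nu> p) = p" using W(2)[rule_format, of p] W(1) p by auto
      moreover have "h (\<nu> q) = q" using W(2)[rule_format, of q] W(1) p q by auto
      ultimately show "q = p" using q by simp
    qed
  qed
qed

lemma generic_in_open:
  assumes "closure (- \<nu> -` N) = UNIV" "open U" "U \<noteq> {}"
  obtains p where "p \<in> U" "\<nu> p \<notin> N"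
proof -
  have "U \<inter> closure (- \<nu> -` N) \<noteq> {}" using assms(1,3) by simp
  then have "U \<inter> - \<nu> -` N \<noteq> {}" using open_Int_closure_eq_empty[OF assms(2)] by blast
  then show ?thesis using that by blast
qed

lemma closed_C: "closed C"
proof -
  have "{v. v \<noteq> 0 \<and> pt v \<in> - C} = {v. eval3 F v \<noteq> 0}"
  proof -
    have "v \<noteq> 0" if "eval3 F v \<noteq> 0" for v using homogeneous_eval3_0[OF hom d] that by auto
    then show ?thesis by (auto simp: C zero_locus_pt[OF hom])
  qed
  moreover have "open {v. eval3 F v \<noteq> 0}"
  proof -
    interpret R: function_ring "\<lambda>f :: complex^3 \<Rightarrow> complex. continuous_on UNIV f"
      by unfold_locales (auto intro: continuous_intros)
    have "continuous_on UNIV (\<lambda>v. eval3 F v)" by (rule R.eval3) (intro continuous_intros)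
    then show ?thesis by (intro open_Collect_neq continuous_on_const)
  qed
  ultimately have "open (- C)" by (simp add: open_proj2_iff)
  then show ?thesis by (simp add: closed_def)
qed

text \<open>The normalization map is proper, and C is closed in the compact plane.\<close>

lemma compact_UNIV: "compact (UNIV :: 'a set)"
proof -
  have "proper_map (top_of_set UNIV) (top_of_set C) \<nu>"
    using norm by (simp add: is_normalization_def AU finite_map_def)
  moreover have "compact C"
    using compact_UNIV_proj2 closed_C by (metis compact_Int_closed inf_top.left_neutral)
  ultimately have "compactin (top_of_set UNIV) {x \<in> topspace (top_of_set UNIV). \<nu> x \<in> C}"
    by (intro compactin_proper_map_preimage) (auto simp: compactin_subtopology)
  moreover have "{x \<in> topspace (top_of_set (UNIV::'a set)). \<nu> x \<in> C} = UNIV" using range_\<nu> by auto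
  ultimately show ?thesis by simp
qed

section \<open>Zeros of forms along the normalization\<close>

lemma infinite_open:
  assumes "open U" "p \<in> U" shows "infinite (U :: 'a set)"
proof
  assume "finite U"
  obtain \<rho> \<psi> \<tau> where dp: "disc A p \<rho> \<psi> \<tau>" by (rule disc_exists[OF A AU])
  define S where "S = \<psi> -` U \<inter> ball 0 \<rho>"
  have "open S" unfolding S_def using continuous_on_open_vimage[OF open_ball] discD(4)[OF dp] assms(1) by blast
  moreover have "0 \<in> S" using discD(1,2)[OF dp] assms(2) by (simp add: S_def)
  ultimately have "infinite S" using finite_imp_not_open by blast
  moreover have "\<psi> ` S \<subseteq> U" "inj_on \<psi> S"
    using disc_inj[OF A AU dp] by (auto simp: S_def intro: inj_on_subset)
  ultimately show False using \<open>finite U\<close> finite_subset inj_on_finite by metis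
qed

text \<open>In a disc the form becomes a holomorphic function of one variable, which vanishes
  identically or has near the centre no zero other than the centre.\<close>

lemma vanishing_dichotomy:
  assumes P: "homogeneous m P"
  obtains U where "open U" "p \<in> U" "(\<forall>q\<in>U. \<nu> q \<in> zero_locus P) \<or> (\<forall>q\<in>U. \<nu> q \<in> zero_locus P \<longrightarrow> q = p)"
proof -
  obtain G \<rho> \<psi> \<tau> u w where f: "frm p \<rho> \<psi> \<tau> G u w" by (rule frame_at)
  define y where "y z = matrix_inv G *v vector [u z, w z, 1]" for z
  have dp: "disc A p \<rho> \<psi> \<tau>" by (rule frameD(1)[OF f])
  have \<rho>: "\<rho> > 0" by (rule discD(1)[OF dp])
  have hy: "(\<lambda>z. y z $ i) holomorphic_on ball 0 \<rho>" for i
    unfolding y_def by (rule holomorphic_on_vector_3[OF frameD(3,4)[OF f]])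
  interpret R: function_ring "\<lambda>f. f holomorphic_on ball 0 \<rho>"
    by unfold_locales (auto intro: holomorphic_intros)
  have hf: "(\<lambda>z. eval3 P (y z)) holomorphic_on ball 0 \<rho>" by (rule R.eval3[OF hy])
  have iff: "\<nu> (\<psi> z) \<in> zero_locus P \<longleftrightarrow> eval3 P (y z) = 0" if "z \<in> ball 0 \<rho>" for z
    using frameD(5)[OF f that] zero_locus_pt[OF P frameD(6)[OF f]] by (simp add: y_def)
  show ?thesis
  proof (cases "\<exists>z\<in>ball 0 \<rho>. eval3 P (y z) \<noteq> 0")
    case False
    show ?thesis
      by (rule that[OF discD(3)[OF dp]])
         (use False iff discD(2)[OF dp] \<rho> in \<open>auto intro!: image_eqI[of _ _ 0]\<close>)
  next
    case True
    obtain n r g where g: "0 < r" "r \<le> \<rho>" "g holomorphic_on ball 0 r"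
      "\<And>z. z \<in> ball 0 r \<Longrightarrow> eval3 P (y z) = z ^ n * g z" "\<And>z. z \<in> ball 0 r \<Longrightarrow> g z \<noteq> 0"
      using holomorphic_factor_cases[OF hf \<rho> True] by metis
    have "open (\<psi> ` ball 0 r)" using g(1,2) by (intro disc_open_image[OF A AU dp]) auto
    moreover have "p \<in> \<psi> ` ball 0 r" using discD(2)[OF dp] g(1) by (auto intro!: image_eqI[of _ _ 0])
    moreover have "\<forall>q\<in>\<psi> ` ball 0 r. \<nu> q \<in> zero_locus P \<longrightarrow> q = p"
    proof clarify
      fix z :: complex assume z: "z \<in> ball 0 r" and "\<nu> (\<psi> z) \<in> zero_locus P"
      then have "z ^ n * g z = 0" using iff[of z] g(2,4) by auto
      then have "z = 0" using g(5)[OF z] by auto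
      then show "\<psi> z = p" using discD(2)[OF dp] by simp
    qed
    ultimately show ?thesis using that by blast
  qed
qed

text \<open>The interior I of the zero set is also closed: near a point outside I the zeros are
  isolated, and a neighbourhood meeting I would contain a finite nonempty open set, which
  \<open>infinite_open\<close> excludes.\<close>

lemma vanishing_connected:
  assumes P: "homogeneous m P" and S: "connected S"
  shows "(\<forall>q\<in>S. \<nu> q \<in> zero_locus P) \<or> (\<forall>p\<in>S. \<exists>U. open U \<and> p \<in> U \<and> (\<forall>q\<in>U. \<nu> q \<in> zero_locus P \<longrightarrow> q = p))"
proof -
  define I where "I = interior (\<nu> -` zero_locus P)"
  have Isub: "\<nu> q \<in> zero_locus P" if "q \<in> I" for q
    using that interior_subset[of "\<nu> -` zero_locus P"] by (auto simp: I_def)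
  have I: "p \<in> I \<or> (\<exists>U. open U \<and> p \<in> U \<and> (\<forall>q\<in>U. \<nu> q \<in> zero_locus P \<longrightarrow> q = p) \<and> U \<inter> I = {})" for p
  proof -
    obtain U where U: "open U" "p \<in> U" "(\<forall>q\<in>U. \<nu> q \<in> zero_locus P) \<or> (\<forall>q\<in>U. \<nu> q \<in> zero_locus P \<longrightarrow> q = p)"
      by (rule vanishing_dichotomy[OF P])
    from U(3) show ?thesis
    proof
      assume "\<forall>q\<in>U. \<nu> q \<in> zero_locus P"
      then have "p \<in> I" unfolding I_def using U(1,2) by (intro interiorI[of U]) auto
      then show ?thesis ..
    next
      assume *: "\<forall>q\<in>U. \<nu> q \<in> zero_locus P \<longrightarrow> q = p"
      have "U \<inter> I \<subseteq> {p}" using * Isub by blast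
      then have "finite (U \<inter> I)" using finite_subset by blast
      moreover have "open (U \<inter> I)" using U(1) by (simp add: I_def open_Int)
      ultimately have "U \<inter> I = {}" using infinite_open by blast
      then show ?thesis using U * by blast
    qed
  qed
  have "\<exists>T. open T \<and> x \<in> T \<and> T \<subseteq> - I" if x: "x \<in> - I" for x
  proof -
    obtain U where "open U" "x \<in> U" "U \<inter> I = {}" using I[of x] x by auto
    then show ?thesis by (intro exI[of _ U]) auto
  qed
  then have "open (- I)" unfolding open_subopen[of "- I"] by simp
  moreover have "open I" by (simp add: I_def)
  ultimately have "S \<subseteq> I \<or> S \<subseteq> - I"
    using S connectedD[of S I "- I"] by blast
  then show ?thesis
  proof
    assume "S \<subseteq> I"
    then show ?thesis using Isub by blast
  next
    assume SI: "S \<subseteq> - I"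
    have "\<exists>U. open U \<and> p \<in> U \<and> (\<forall>q\<in>U. \<nu> q \<in> zero_locus P \<longrightarrow> q = p)" if p: "p \<in> S" for p
    proof -
      have "p \<notin> I" using p SI by auto
      then show ?thesis using I[of p] by auto
    qed
    then show ?thesis by simp
  qed
qed

lemma vanishing_finite:
  assumes P: "homogeneous m P" and S: "connected S" "closed S" and q: "q \<in> S" "\<nu> q \<notin> zero_locus P"
  shows "finite {p \<in> S. \<nu> p \<in> zero_locus P}"
proof -
  have *: "\<forall>p\<in>S. \<exists>U. open U \<and> p \<in> U \<and> (\<forall>q\<in>U. \<nu> q \<in> zero_locus P \<longrightarrow> q = p)"
    using vanishing_connected[OF P S(1)] q by auto
  have "compact S" using compact_UNIV S(2) by (metis compact_Int_closed inf_top.left_neutral)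
  then show ?thesis
  proof (rule finite_isolated)
    fix p assume "p \<in> S"
    then obtain U where "open U" "p \<in> U" "\<forall>q\<in>U. \<nu> q \<in> zero_locus P \<longrightarrow> q = p" using * by blast
    then show "\<exists>U. open U \<and> p \<in> U \<and> U \<inter> {p \<in> S. \<nu> p \<in> zero_locus P} \<subseteq> {p}" by blast
  qed auto
qed

end

lemma poly_degree_le_sum: "degree p \<le> d \<Longrightarrow> poly p x = (\<Sum>k\<le>d. coeff p k * x ^ k)"
  for p :: "complex poly"
  unfolding poly_altdef by (rule sum.mono_neutral_left) (auto simp: coeff_eq_0)

text \<open>The uniqueness half of the implicit function theorem. The difference of the values at l
  and l' is (l - l') R (c, l, l') with R polynomial, and R at the origin is the derivative at the
  simple root. So R has no zero near the origin, and two small roots over the same c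
  coincide.\<close>

lemma simple_root_stable:
  assumes F: "homogeneous d F" and nz: "poly (pderiv (lineP F x v)) 0 \<noteq> 0"
  obtains \<epsilon> where "\<epsilon> > 0" "\<forall>c l l'. norm c < \<epsilon> \<longrightarrow> norm l < \<epsilon> \<longrightarrow> norm l' < \<epsilon> \<longrightarrow>
    eval3 F (x + c *s e + l *s v) = 0 \<longrightarrow> eval3 F (x + c *s e + l' *s v) = 0 \<longrightarrow> l = l'"
proof -
  define a where "a k c = coeff (lineP F (x + c *s e) v) k" for k c
  define R where "R q = (\<Sum>k\<le>d. a k (fst q) * (\<Sum>i<k. snd (snd q) ^ (k - Suc i) * fst (snd q) ^ i))"
    for q :: "complex \<times> complex \<times> complex"
  interpret R: function_ring "\<lambda>f :: complex \<times> complex \<times> complex \<Rightarrow> complex. continuous_on UNIV f"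
    by unfold_locales (auto intro: continuous_intros)
  have ca: "continuous_on UNIV (\<lambda>q :: complex \<times> complex \<times> complex. a k (fst q))" for k
    unfolding a_def by (rule R.coeff_lineP) (auto intro!: continuous_intros)
  have cR: "continuous_on UNIV R"
    unfolding R_def by (intro continuous_intros ca)
  have diff: "eval3 F (x + c *s e + l *s v) - eval3 F (x + c *s e + l' *s v) = (l - l') * R (c, l, l')" for c l l'
  proof -
    have deg: "degree (lineP F (x + c *s e) v) \<le> d" by (rule lineP_homogeneous(1)[OF F])
    have "eval3 F (x + c *s e + l *s v) - eval3 F (x + c *s e + l' *s v) = (\<Sum>k\<le>d. a k c * (l ^ k - l' ^ k))"
      unfolding poly_lineP[symmetric] poly_degree_le_sum[OF deg] a_def
      by (simp add: sum_subtractf right_diff_distrib)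
    also have "\<dots> = (\<Sum>k\<le>d. a k c * ((l - l') * (\<Sum>i<k. l' ^ (k - Suc i) * l ^ i)))"
      by (intro sum.cong refl arg_cong[where f = "\<lambda>t. a _ c * t"] power_diff_sumr2)
    also have "\<dots> = (l - l') * R (c, l, l')"
      unfolding R_def by (simp add: sum_distrib_left mult_ac)
    finally show ?thesis .
  qed
  have R0: "R 0 = a 1 0"
  proof -
    \<comment> \<open>With 0^0 = 1 the only surviving term is k = 1, i = 0.\<close>
    have "(\<Sum>i<k. (0::complex) ^ (k - Suc i) * 0 ^ i) = (if k = 1 then 1 else 0)" for k
    proof (cases "k = 1")
      case False
      then have "(0::complex) ^ (k - Suc i) * 0 ^ i = 0" if "i < k" for i using that by (auto simp: power_0_left)
      then show ?thesis using False by simp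
    qed simp
    then have "R 0 = (\<Sum>k\<le>d. a k 0 * (if k = 1 then 1 else 0))" by (simp add: R_def)
    also have "\<dots> = (\<Sum>k\<le>d. if k = 1 then a k 0 else 0)" by (intro sum.cong) auto
    also have "\<dots> = (if 1 \<le> d then a 1 0 else 0)" by (subst sum.delta) auto
    also have "\<dots> = a 1 0"
      using lineP_homogeneous(1)[OF F, of x v] by (auto simp: a_def coeff_eq_0)
    finally show ?thesis .
  qed
  moreover have "a 1 0 = poly (pderiv (lineP F x v)) 0"
    by (simp add: a_def poly_0_coeff_0 coeff_pderiv)
  ultimately have "R 0 \<noteq> 0" using nz by simp
  moreover have "isCont R 0" using cR continuous_on_eq_continuous_at[OF open_UNIV] by blast
  ultimately obtain \<eta> where \<eta>: "\<eta> > 0" "\<And>q. dist 0 q < \<eta> \<Longrightarrow> R q \<noteq> 0"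
    using continuous_at_avoid[of 0 R 0] by blast
  show ?thesis
  proof (rule that[of "\<eta> / 3"]; (intro allI impI)?)
    show "\<eta> / 3 > 0" using \<eta>(1) by simp
    fix c l l' assume n: "norm c < \<eta> / 3" "norm l < \<eta> / 3" "norm l' < \<eta> / 3"
      and z: "eval3 F (x + c *s e + l *s v) = 0" "eval3 F (x + c *s e + l' *s v) = 0"
    have "norm (c, l, l') \<le> norm c + (norm l + norm l')"
      by (rule order_trans[OF norm_Pair_le add_left_mono[OF norm_Pair_le]])
    then have "R (c, l, l') \<noteq> 0" using n by (intro \<eta>(2)) simp
    then show "l = l'" using diff[of c l l'] z by simp
  qed
qed

section \<open>Lines that meet the curve in the full number of points\<close>

context plane_curve
begin

definition line_points :: "complex^3 \<Rightarrow> proj2 set" where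
  "line_points b = {P \<in> C. incident P (pt b)}"

lemma in_C: "x \<noteq> 0 \<Longrightarrow> pt x \<in> C \<longleftrightarrow> eval3 F x = 0"
  unfolding C by (rule zero_locus_pt[OF hom])

text \<open>In the coordinates G the line is x1 = 0, and its point (0 : 1 : 0) is off the curve, so
  all points of the curve on it are affine.\<close>

lemma line_points_param:
  fixes G :: "complex^3^3"
  assumes G: "invertible G" and b: "G $ 1 = b"
    and v: "eval3 F (matrix_inv G *v vector [0, 1, 0]) \<noteq> 0"
  shows "bij_betw (\<lambda>l. pt (matrix_inv G *v vector [0, l, 1])) {l. eval3 F (matrix_inv G *v vector [0, l, 1]) = 0} (line_points b)"
proof -
  define f where "f l = matrix_inv G *v vector [0, l, 1]" for l
  have Gf: "G *v f l = vector [0, l, 1]" for l unfolding f_def by (rule matrix_inv(3)[OF G])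
  have f0: "f l \<noteq> 0" for l
    unfolding f_def using invertible_mult_0[OF matrix_inv(5)[OF G]] vector3_nz by simp
  have b0: "b \<noteq> 0" unfolding b[symmetric] row_vector_matrix[of G 1] vector_matrix_mult_0[OF G] by (simp add: axis_eq_0_iff)
  have bf: "bil b (f l) = 0" for l
    unfolding b[symmetric] matrix_vector_row[symmetric] Gf by simp
  have "inj_on (\<lambda>l. pt (f l)) {l. eval3 F (f l) = 0}"
  proof (rule inj_onI)
    fix l l' assume "pt (f l) = pt (f l')"
    then obtain c where c: "f l' = c *s f l" using pt_eq_iff[OF f0 f0] by blast
    have "vector [0, l', 1] = (c *s vector [0, l, 1] :: complex^3)"
      unfolding Gf[symmetric] c by (rule vector_scalar_commute)
    then have "l' = c * l \<and> 1 = c" by (simp add: vec_eq_iff forall_3)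
    then show "l = l'" by simp
  qed
  moreover have "(\<lambda>l. pt (f l)) ` {l. eval3 F (f l) = 0} = line_points b"
  proof (intro equalityI subsetI)
    fix P assume "P \<in> (\<lambda>l. pt (f l)) ` {l. eval3 F (f l) = 0}"
    then obtain l where l: "P = pt (f l)" "eval3 F (f l) = 0" by auto
    then show "P \<in> line_points b"
      using bf by (simp add: line_points_def in_C[OF f0] incident_pt[OF f0 b0])
  next
    fix P assume P: "P \<in> line_points b"
    obtain x where x: "x \<noteq> 0" "P = pt x" by (rule pt_cases)
    have ex: "eval3 F x = 0" and bx: "bil b x = 0"
      using P by (simp_all add: line_points_def x(2) in_C[OF x(1)] incident_pt[OF x(1) b0])
    define y where "y = G *v x"
    have y1: "y $ 1 = 0" using bx by (simp add: y_def matrix_vector_row b)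
    have xy: "x = matrix_inv G *v y" by (simp add: y_def matrix_inv(4)[OF G])
    have y3: "y $ 3 \<noteq> 0"
    proof
      assume "y $ 3 = 0"
      then have "y = y $ 2 *s vector [0, 1, 0]" using y1 by (simp add: vec_eq_iff forall_3)
      then have xe: "x = y $ 2 *s (matrix_inv G *v vector [0, 1, 0])"
        using xy by (metis vector_scalar_commute)
      then have "y $ 2 \<noteq> 0" using x(1) by auto
      then show False using ex v unfolding xe homogeneous_eval3[OF hom] by simp
    qed
    define l where "l = y $ 2 / y $ 3"
    have "vector [0, l, 1] = (1 / y $ 3) *s y" using y1 y3 by (simp add: vec_eq_iff forall_3 l_def)
    then have fl: "f l = (1 / y $ 3) *s x" unfolding f_def xy by (simp add: vector_scalar_commute)
    have "eval3 F (f l) = 0" unfolding fl homogeneous_eval3[OF hom] using ex by simp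
    moreover have "P = pt (f l)" unfolding fl x(2) using y3 by (simp add: pt_scale)
    ultimately show "P \<in> (\<lambda>l. pt (f l)) ` {l. eval3 F (f l) = 0}" by blast
  qed
  ultimately show ?thesis by (simp add: bij_betw_def f_def)
qed

text \<open>Among the infinitely many points (0 : 1 : k) of the line one is off C. A shear of the
  third row moves it to (0 : 1 : 0) and fixes x.\<close>

lemma line_frame:
  assumes b: "b \<noteq> 0" and x: "x \<noteq> 0" and bx: "bil b x = 0" and fin: "finite (line_points b)"
  obtains G :: "complex^3^3" where "invertible G" "G $ 1 = b" "G *v x = vector [0, 0, 1]"
    "eval3 F (matrix_inv G *v vector [0, 1, 0]) \<noteq> 0"
proof -
  obtain G1 :: "complex^3^3" where G1: "invertible G1" "G1 $ 1 = b" "G1 *v x = vector [0, 0, 1]"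
    by (rule adapted_matrix[OF b x bx])
  define w where "w k = matrix_inv G1 *v vector [0, 1, k]" for k
  have G1w: "G1 *v w k = vector [0, 1, k]" for k unfolding w_def by (rule matrix_inv(3)[OF G1(1)])
  have w0: "w k \<noteq> 0" for k
  proof
    assume "w k = 0"
    then have "vector [0, 1, k] = (0 :: complex^3)" using G1w[of k] by simp
    then show False by (simp add: vec_eq_iff forall_3)
  qed
  have wb: "bil b (w k) = 0" for k using G1w[of k] by (simp add: G1(2)[symmetric] matrix_vector_row[symmetric])
  have "inj (\<lambda>k. pt (w k))"
  proof (rule injI)
    fix k k' assume "pt (w k) = pt (w k')"
    then obtain c where c: "w k' = c *s w k" using pt_eq_iff[OF w0 w0] by blast
    have "vector [0, 1, k'] = (c *s vector [0, 1, k] :: complex^3)"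
      unfolding G1w[symmetric] c by (rule vector_scalar_commute)
    then show "k = k'" by (simp add: vec_eq_iff forall_3)
  qed
  then have "infinite (range (\<lambda>k. pt (w k)))" 
    using finite_imageD infinite_UNIV_char_0 by blast
  then obtain k where "pt (w k) \<notin> line_points b"
    using fin by (metis finite_subset image_subsetI)
  then have wk: "eval3 F (w k) \<noteq> 0"
    using wb by (simp add: line_points_def in_C[OF w0] incident_pt[OF w0 b])
  define G :: "complex^3^3" where "G = vector [b, G1 $ 2, G1 $ 3 - k *s G1 $ 2]"
  have "det G = det G1" by (simp add: G_def det_3 G1(2)[symmetric] algebra_simps)
  then have G: "invertible G" using G1(1) by (simp add: invertible_det_nz)
  have Gx: "G *v x = vector [0, 0, 1]"
  proof -
    have "bil (G1 $ 2) x = 0" "bil (G1 $ 3) x = 1" using G1(3) by (simp_all flip: matrix_vector_row)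
    then show ?thesis by (simp add: vec_eq_iff forall_3 matrix_vector_row G_def bx bil_linear)
  qed
  have Gw: "G *v w k = vector [0, 1, 0]"
  proof -
    have "bil (G1 $ 2) (w k) = 1" "bil (G1 $ 3) (w k) = k" using G1w[of k] by (simp_all flip: matrix_vector_row)
    then show ?thesis by (simp add: vec_eq_iff forall_3 matrix_vector_row G_def wb bil_linear)
  qed
  have "matrix_inv G *v vector [0, 1, 0] = w k" using matrix_inv(4)[OF G] Gw by metis
  then show ?thesis using that[OF G _ Gx] wk by (simp add: G_def)
qed

text \<open>On a line with d points every intersection is simple, so near x the curve has at most
  one point for each small value of the first coordinate.\<close>

lemma transversal_coords:
  assumes b: "b \<noteq> 0" and x: "x \<noteq> 0" and bx: "bil b x = 0" and xC: "pt x \<in> C" and card: "card (line_points b) = d"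
  obtains G :: "complex^3^3" and \<epsilon> where "invertible G" "G $ 1 = b" "G *v x = vector [0, 0, 1]" "\<epsilon> > 0"
    "\<forall>c l l'. norm c < \<epsilon> \<longrightarrow> norm l < \<epsilon> \<longrightarrow> norm l' < \<epsilon> \<longrightarrow>
      eval3 F (matrix_inv G *v vector [c, l, 1]) = 0 \<longrightarrow> eval3 F (matrix_inv G *v vector [c, l', 1]) = 0 \<longrightarrow> l = l'"
proof -
  have fin: "finite (line_points b)" using card d by (metis card.infinite not_one_le_zero)
  obtain G :: "complex^3^3" where G: "invertible G" and G1b: "G $ 1 = b" and Gx: "G *v x = vector [0, 0, 1]"
    and nz: "eval3 F (matrix_inv G *v vector [0, 1, 0]) \<noteq> 0"
    by (rule line_frame[OF b x bx fin])
  define v where "v = matrix_inv G *v vector [0, 1, 0]"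
  have iG: "matrix_inv G *v vector [0, 1, 0] = v" "matrix_inv G *v vector [0, 0, 1] = x"
    using matrix_inv(4)[OF G, of x] Gx by (simp_all add: v_def)
  have wk: "eval3 F v \<noteq> 0" using nz by (simp only: iG not_False_eq_True)
  define e where "e = matrix_inv G *v vector [1, 0, 0]"
  have iGv: "matrix_inv G *v vector [c, l, 1] = x + c *s e + l *s v" for c l
  proof -
    have "vector [c, l, 1] = (vector [0, 0, 1] + c *s vector [1, 0, 0] + l *s vector [0, 1, 0] :: complex^3)"
      by (simp add: vec_eq_iff forall_3)
    then show ?thesis
      by (simp only: matrix_vector_right_distrib vector_scalar_commute iG e_def)
  qed
  have iGv0: "matrix_inv G *v vector [0, l, 1] = x + l *s v" for l using iGv[of 0 l] by simp
  have "card {l. eval3 F (x + l *s v) = 0} = d"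
    using bij_betw_same_card[OF line_points_param[OF G G1b]] wk iG card by (simp add: iGv0)
  moreover have "eval3 F (x + 0 *s v) = 0" using xC by (simp add: in_C[OF x])
  ultimately have "poly (pderiv (lineP F x v)) 0 \<noteq> 0"
    by (rule card_line_eq_iff(4)[OF hom wk])
  from simple_root_stable[OF hom this, of e] obtain \<epsilon> where "\<epsilon> > 0" "\<forall>c l l'. norm c < \<epsilon> \<longrightarrow> norm l < \<epsilon> \<longrightarrow> norm l' < \<epsilon> \<longrightarrow>
    eval3 F (x + c *s e + l *s v) = 0 \<longrightarrow> eval3 F (x + c *s e + l' *s v) = 0 \<longrightarrow> l = l'" by blast
  then show ?thesis using that[OF G G1b Gx] by (simp add: iGv)
qed

text \<open>Along a line that meets the curve in \<open>d\<close> points the curve is locally a graph, so by generic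
  injectivity every such point has one preimage, at which the line has contact order one.\<close>

lemma transversal:
  assumes b: "b \<noteq> 0" and card: "card (line_points b) = d" and p: "incident (\<nu> p) (pt b)"
  shows "vord A \<nu> p b 1" "\<nu> p' = \<nu> p \<Longrightarrow> p' = p"
proof -
  obtain x where x: "x \<noteq> 0" "\<nu> p = pt x" by (rule pt_cases)
  have bx: "bil b x = 0" using p by (simp add: x(2) incident_pt[OF x(1) b])
  have xC: "pt x \<in> C" using range_\<nu> x(2) by (metis rangeI)
  obtain G :: "complex^3^3" and \<epsilon> where G: "invertible G" "G $ 1 = b" "G *v x = vector [0, 0, 1]" and \<epsilon>: "\<epsilon> > 0"
    and uniq: "\<forall>c l l'. norm c < \<epsilon> \<longrightarrow> norm l < \<epsilon> \<longrightarrow> norm l' < \<epsilon> \<longrightarrow>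
      eval3 F (matrix_inv G *v vector [c, l, 1]) = 0 \<longrightarrow> eval3 F (matrix_inv G *v vector [c, l', 1]) = 0 \<longrightarrow> l = l'"
    by (rule transversal_coords[OF b x(1) bx xC card])
  have off: "pt x \<in> offline (G $ 3)" using G(3) by (simp add: offline_pt[OF x(1)] matrix_vector_row[symmetric])
  obtain N where N: "closure (- \<nu> -` N) = UNIV" "\<forall>p q. \<nu> p \<notin> N \<longrightarrow> \<nu> q = \<nu> p \<longrightarrow> q = p"
    by (rule generic_injectivity)
  \<comment> \<open>The same coordinates G serve at every preimage of the point, not only at p; the
    discs are shrunk to the range in which \<open>uniq\<close> applies.\<close>
  have local: "\<exists>\<rho> \<psi> \<tau> u w. frm q \<rho> \<psi> \<tau> G u w \<and> u 0 = 0 \<and> (\<forall>z\<in>ball 0 \<rho>. norm (u z) < \<epsilon> \<and> norm (w z) < \<epsilon>)"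
    if q: "\<nu> q = pt x" for q
  proof -
    obtain \<rho>0 \<psi> \<tau> where d0: "disc A q \<rho>0 \<psi> \<tau>" by (rule disc_exists[OF A AU])
    have offq: "\<nu> q \<in> offline (G $ 3)" using off q by simp
    obtain \<rho> u w where f: "frm q \<rho> \<psi> \<tau> G u w" and u: "\<And>z. u z = ratio (G $ 1) (G $ 3) (\<nu> (\<psi> z))"
      and w: "\<And>z. w z = ratio (G $ 2) (G $ 3) (\<nu> (\<psi> z))" using frame_exists[OF d0 G(1) offq] by metis
    have rows: "bil (G $ 1) x = 0" "bil (G $ 2) x = 0" using G(3) by (simp_all flip: matrix_vector_row)
    have z0: "u 0 = 0" "w 0 = 0" using q discD(2)[OF d0] rows by (simp_all add: u w ratio_pt[OF x(1)])
    have \<rho>: "\<rho> > 0" by (rule discD(1)[OF frameD(1)[OF f]])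
    have "continuous_on (ball 0 \<rho>) (\<lambda>z. (u z, w z))"
      by (intro continuous_on_Pair holomorphic_on_imp_continuous_on frameD[OF f])
    then have c: "isCont (\<lambda>z. (u z, w z)) 0" using \<rho> by (simp add: continuous_on_eq_continuous_at)
    then obtain e where e: "e > 0" "\<And>z. dist z 0 < e \<Longrightarrow> dist (u z, w z) (u 0, w 0) < \<epsilon>"
      using \<epsilon> unfolding continuous_at_eps_delta by metis
    have "norm (u z) < \<epsilon> \<and> norm (w z) < \<epsilon>" if "z \<in> ball 0 (min e \<rho>)" for z
    proof -
      have "norm (u z, w z) < \<epsilon>" using e(2)[of z] that by (simp add: z0 zero_prod_def[symmetric])
      then show ?thesis using norm_fst_le[of "u z" "w z"] norm_snd_le[of "w z" "u z"] by simp
    qed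
    moreover have "frm q (min e \<rho>) \<psi> \<tau> G u w" by (rule frame_shrink[OF f]) (use e \<rho> in auto)
    ultimately show ?thesis using z0 by blast
  qed
  have ev: "eval3 F (matrix_inv G *v vector [u z, w z, 1]) = 0" if "frm q \<rho> \<psi> \<tau> G u w" "z \<in> ball 0 \<rho>" for q \<rho> \<psi> \<tau> u w z
    using range_\<nu> frameD(5)[OF that] in_C[OF frameD(6)[OF that(1)]] by (metis rangeI)
  \<comment> \<open>The curve is a graph here, so equal first coordinates mean equal points of C,
    even on different branches.\<close>
  have same: "\<nu> (\<psi> z) = \<nu> (\<psi>' z')"
    if f: "frm q \<rho> \<psi> \<tau> G u w" "\<forall>z\<in>ball 0 \<rho>. norm (u z) < \<epsilon> \<and> norm (w z) < \<epsilon>" "z \<in> ball 0 \<rho>"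
    and f': "frm q' \<rho>' \<psi>' \<tau>' G u' w'" "\<forall>z\<in>ball 0 \<rho>'. norm (u' z) < \<epsilon> \<and> norm (w' z) < \<epsilon>" "z' \<in> ball 0 \<rho>'"
    and eq: "u z = u' z'"
    for q \<rho> \<psi> \<tau> u w z q' \<rho>' \<psi>' \<tau>' u' w' z'
  proof -
    have "norm (u z) < \<epsilon>" "norm (w z) < \<epsilon>" "norm (w' z') < \<epsilon>" using f f' by auto
    then have "w z = w' z'"
      using uniq[rule_format, of "u z" "w z" "w' z'"] ev[OF f(1,3)] ev[OF f'(1,3)] eq by simp
    then show ?thesis using frameD(5)[OF f(1,3)] frameD(5)[OF f'(1,3)] eq by simp
  qed
  \<comment> \<open>If u vanished identically, a whole disc would map to one point, against the
    finiteness of the fibres.\<close>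
  have nonconst: "\<exists>n\<ge>1. hasord u n"
    if f: "frm q \<rho> \<psi> \<tau> G u w" "\<forall>z\<in>ball 0 \<rho>. norm (u z) < \<epsilon> \<and> norm (w z) < \<epsilon>" and u0: "u 0 = 0"
    for q \<rho> \<psi> \<tau> u w
  proof -
    have dq: "disc A q \<rho> \<psi> \<tau>" by (rule frameD(1)[OF f(1)])
    have \<rho>: "\<rho> > 0" by (rule discD(1)[OF dq])
    have "\<exists>z\<in>ball 0 \<rho>. u z \<noteq> 0"
    proof (rule ccontr)
      assume "\<not> ?thesis"
      then have "\<nu> (\<psi> z) = \<nu> q" if "z \<in> ball 0 \<rho>" for z
        using same[OF f that f, of 0] \<rho> u0 that discD(2)[OF dq] by simp
      then have "\<psi> ` ball 0 \<rho> \<subseteq> {p. \<nu> p = \<nu> q}" by auto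
      then have "finite (\<psi> ` ball 0 \<rho>)" using finite_fibre finite_subset by blast
      moreover have "q \<in> \<psi> ` ball 0 \<rho>" by (rule disc_centre[OF dq])
      ultimately show False using infinite_open[OF discD(3)[OF dq]] by blast
    qed
    then obtain n where n: "hasord u n" using hasord_exists[OF frameD(3)[OF f(1)] \<rho>] by blast
    have "n \<noteq> 0" using hasord_0D[OF _ holomorphic_isCont_0[OF frameD(3)[OF f(1)] \<rho>]] n u0 by metis
    then show ?thesis using n by (intro exI[of _ n]) auto
  qed
  obtain \<rho> \<psi> \<tau> u w where f: "frm p \<rho> \<psi> \<tau> G u w" and u0: "u 0 = 0"
    and small: "\<forall>z\<in>ball 0 \<rho>. norm (u z) < \<epsilon> \<and> norm (w z) < \<epsilon>" using local[OF x(2)] by blast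
  have dp: "disc A p \<rho> \<psi> \<tau>" by (rule frameD(1)[OF f])
  have \<rho>: "\<rho> > 0" by (rule discD(1)[OF dp])
  obtain n where n: "n \<ge> 1" "hasord u n" using nonconst[OF f small u0] by blast
  have "n = 1"
  proof (rule ccontr)
    assume "n \<noteq> 1"
    then have n2: "n > 1" using n(1) by simp
    obtain r2 k where r2: "r2 > 0" and hk: "k holomorphic_on ball 0 r2" and kinj: "inj_on k (ball 0 r2)"
      and kim: "k ` ball 0 r2 \<subseteq> ball 0 \<rho>" and uk: "\<forall>z\<in>ball 0 r2. u (k z) = z ^ n"
      by (rule power_coordinate[OF frameD(3)[OF f] \<rho> n(2,1)])
    \<comment> \<open>An n-th root of unity other than 1: the parameters z and \<zeta> z have the
      same first coordinate and hence the same image for all z. For generic z this contradicts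
      injectivity.\<close>
    define \<zeta> where "\<zeta> = cis (2 * pi / real n)"
    have "\<zeta> ^ n = cis (real n * (2 * pi / real n))" unfolding \<zeta>_def by (rule Complex.DeMoivre)
    then have \<zeta>n: "\<zeta> ^ n = 1" using n2 by simp
    have \<zeta>1: "\<zeta> \<noteq> 1"
    proof
      assume "\<zeta> = 1"
      then have "cos (2 * pi / real n) = 1" by (metis \<zeta>_def cis.simps(1) one_complex.simps(1))
      moreover have "0 < 2 * pi / real n" "2 * pi / real n \<le> pi" using n2 by (auto simp: field_simps)
      ultimately show False using cos_monotone_0_pi[of 0 "2 * pi / real n"] by simp
    qed
    define O' where "O' = \<psi> ` (k ` (ball 0 r2 - {0}))"
    have "open (k ` (ball 0 r2 - {0}))"
      by (rule open_mapping_thm3) (use hk kinj in \<open>auto intro: holomorphic_on_subset inj_on_subset\<close>)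
    then have "open O'" unfolding O'_def using kim by (intro disc_open_image[OF A AU dp]) auto
    moreover have "O' \<noteq> {}"
    proof -
      have "complex_of_real (r2 / 2) \<in> ball 0 r2 - {0}" using r2 by simp
      then show ?thesis unfolding O'_def by blast
    qed
    ultimately obtain q where q: "q \<in> O'" "\<nu> q \<notin> N" by (rule generic_in_open[OF N(1)])
    then obtain z where z: "z \<in> ball 0 r2" "z \<noteq> 0" "q = \<psi> (k z)" unfolding O'_def by blast
    have \<zeta>z: "\<zeta> * z \<in> ball 0 r2" using z(1) by (simp add: norm_mult \<zeta>_def)
    have kz: "k z \<in> ball 0 \<rho>" "k (\<zeta> * z) \<in> ball 0 \<rho>"
      by (rule subsetD[OF kim imageI[OF z(1)]], rule subsetD[OF kim imageI[OF \<zeta>z]])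
    have "u (k (\<zeta> * z)) = u (k z)" using uk z(1) \<zeta>z by (simp add: power_mult_distrib \<zeta>n)
    then have "\<nu> (\<psi> (k (\<zeta> * z))) = \<nu> (\<psi> (k z))" by (rule same[OF f small kz(2) f small kz(1)])
    then have "\<psi> (k (\<zeta> * z)) = \<psi> (k z)" using N(2) q(2) z(3) by metis
    then have "k (\<zeta> * z) = k z" using disc_inj[OF A AU dp] kz by (metis inj_onD)
    then have "\<zeta> * z = z" using kinj \<zeta>z z(1) by (metis inj_onD)
    then show False using \<zeta>1 z(2) by simp
  qed
  then have u1: "hasord u 1" using n(2) by simp
  show "vord A \<nu> p b 1" using u1 vord_row(1)[OF f] by (simp add: G(2))
  show "p' = p" if p': "\<nu> p' = \<nu> p"
  proof (rule ccontr)
    assume ne: "p' \<noteq> p"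
    have "\<nu> p' = pt x" using p' x(2) by simp
    then obtain \<rho>' \<psi>' \<tau>' u' w' where f': "frm p' \<rho>' \<psi>' \<tau>' G u' w'" and u0': "u' 0 = 0"
      and small': "\<forall>z\<in>ball 0 \<rho>'. norm (u' z) < \<epsilon> \<and> norm (w' z) < \<epsilon>" using local[of p'] by blast
    have dp': "disc A p' \<rho>' \<psi>' \<tau>'" by (rule frameD(1)[OF f'])
    have \<rho>': "\<rho>' > 0" by (rule discD(1)[OF dp'])
    obtain U V where UV: "open U" "open V" "p \<in> U" "p' \<in> V" "U \<inter> V = {}"
      using hausdorff[of p p'] ne by metis
    define S where "S = \<psi> -` U \<inter> ball 0 \<rho>"
    have S: "open S" "0 \<in> S" unfolding S_def
      using continuous_on_open_vimage[OF open_ball, of 0 \<rho> \<psi>] discD(2,4)[OF dp] UV \<rho> by auto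
    define S' where "S' = \<psi>' -` V \<inter> ball 0 \<rho>'"
    have S': "open S'" "0 \<in> S'" unfolding S'_def
      using continuous_on_open_vimage[OF open_ball, of 0 \<rho>' \<psi>'] discD(2,4)[OF dp'] UV \<rho>' by auto
    obtain n' where n': "n' \<ge> 1" "hasord u' n'" using nonconst[OF f' small' u0'] by blast
    obtain r' where r': "r' > 0" "ball (0::complex) r' \<subseteq> S'" using S' open_contains_ball by blast
    have r'\<rho>: "ball (0::complex) r' \<subseteq> ball 0 \<rho>'" using r' by (auto simp: S'_def)
    \<comment> \<open>The values of u' near p' fill a neighbourhood of 0, so every point close to p
      shares its image with a point close to p'. A generic such point gives the
      contradiction.\<close>
    have "open (u' ` ball 0 r')"
    proof (rule open_mapping_thm[of u' "ball 0 r'" "ball 0 r'"])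
      show "u' holomorphic_on ball 0 r'" using frameD(3)[OF f'] r'\<rho> by (rule holomorphic_on_subset)
      show "\<not> u' constant_on ball 0 r'"
      proof
        assume "u' constant_on ball 0 r'"
        then have "u' z = 0" if "z \<in> ball 0 r'" for z
          using that u0' r'(1) unfolding constant_on_def by (metis centre_in_ball)
        then have "eventually (\<lambda>z. u' z = 0) (at 0)" using r'(1) by (auto simp: eventually_at intro!: exI[of _ r'])
        with hasord_eventually_nonzero[OF n'(2)] have "eventually (\<lambda>z. False) (at (0::complex))" by eventually_elim simp
        then show False by simp
      qed
    qed auto
    moreover have "0 \<in> u' ` ball 0 r'" using u0' r'(1) by (metis centre_in_ball image_eqI)
    moreover define S1 where "S1 = u -` (u' ` ball 0 r') \<inter> ball 0 \<rho>"
    ultimately have "open S1" "0 \<in> S1" unfolding S1_def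
      using continuous_on_open_vimage[OF open_ball, of 0 \<rho> u] holomorphic_on_imp_continuous_on[OF frameD(3)[OF f]] \<rho> u0
      by auto
    then have "open (\<psi> ` (S \<inter> S1))" using S by (intro disc_open_image[OF A AU dp]) (auto simp: S_def)
    moreover have "\<psi> ` (S \<inter> S1) \<noteq> {}" using S \<open>0 \<in> S1\<close> by blast
    ultimately obtain q where q: "q \<in> \<psi> ` (S \<inter> S1)" "\<nu> q \<notin> N" by (rule generic_in_open[OF N(1)])
    then obtain z where z: "z \<in> S" "z \<in> S1" "q = \<psi> z" by auto
    then obtain z' where z': "z' \<in> ball 0 r'" "u z = u' z'" by (auto simp: S1_def)
    have "\<nu> (\<psi> z) = \<nu> (\<psi>' z')"
      by (rule same[OF f small _ f' small' _ z'(2)]) (use z z' r'\<rho> in \<open>auto simp: S_def\<close>)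
    then have "\<psi>' z' = q" using N(2) q(2) z(3) by metis
    moreover have "q \<in> U" using z by (auto simp: S_def)
    moreover have "\<psi>' z' \<in> V" using z'(1) r'(2) by (auto simp: S'_def)
    ultimately show False using UV(5) by auto
  qed
qed

end

section \<open>Irreducible components\<close>

text \<open>The coefficient at j is built from products of card J - j roots. This exponent later
  bounds the degree of the coefficient as a polynomial in x.\<close>

lemma coeff_prod_linear_bound:
  fixes J :: "complex set"
  assumes "finite J" "\<And>g. g \<in> J \<Longrightarrow> norm g \<le> R" "R \<ge> 1"
  shows "norm (coeff (\<Prod>g\<in>J. [:-g, 1:]) j) \<le> 2 ^ card J * R ^ (card J - j) \<and> (card J < j \<longrightarrow> coeff (\<Prod>g\<in>J. [:-g, 1:]) j = 0)"
  using assms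
proof (induction J arbitrary: j rule: finite_induct)
  case empty
  then show ?case by (simp del: One_nat_def)
next
  case (insert x J)
  define P where "P = (\<Prod>g\<in>J. [:-g, 1:])"
  define n where "n = card J"
  have IH: "norm (coeff P j) \<le> 2 ^ n * R ^ (n - j)" "n < j \<Longrightarrow> coeff P j = 0" for j
    using insert unfolding P_def n_def by auto
  have eq: "coeff (\<Prod>g\<in>insert x J. [:-g, 1:]) j = - x * coeff P j + (case j of 0 \<Rightarrow> 0 | Suc i \<Rightarrow> coeff P i)"
    using insert(1,2) by (simp add: P_def coeff_pCons split: nat.split)
  have x: "norm x \<le> R" using insert.prems by simp
  have R0: "R \<ge> 0" using insert.prems by simp
  have 1: "norm (x * coeff P j) \<le> 2 ^ n * R ^ (Suc n - j)"
  proof (cases "j \<le> n")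
    case True
    have "norm (x * coeff P j) \<le> R * (2 ^ n * R ^ (n - j))"
      unfolding norm_mult by (intro mult_mono x IH) (use R0 in auto)
    then show ?thesis using True by (simp add: Suc_diff_le mult_ac)
  next
    case False
    then show ?thesis using IH(2) R0 by simp
  qed
  have 2: "norm (case j of 0 \<Rightarrow> 0 | Suc i \<Rightarrow> coeff P i) \<le> 2 ^ n * R ^ (Suc n - j)"
    using IH(1) R0 by (auto split: nat.split)
  have "norm (coeff (\<Prod>g\<in>insert x J. [:-g, 1:]) j) \<le> 2 ^ Suc n * R ^ (Suc n - j)"
    unfolding eq using norm_triangle_ineq[of "- x * coeff P j" "case j of 0 \<Rightarrow> 0 | Suc i \<Rightarrow> coeff P i"] 1 2 by simp
  moreover have "coeff (\<Prod>g\<in>insert x J. [:-g, 1:]) j = 0" if "Suc n < j"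
    unfolding eq using IH(2) that by (auto split: nat.split)
  ultimately show ?case using insert(1,2) by (simp add: n_def)
qed

section \<open>Connected components of the normalization\<close>

context plane_curve
begin

lemma line_points_finite:
  assumes b: "b \<noteq> 0" and v: "bil b v = 0" "eval3 F v \<noteq> 0"
  shows "finite (line_points b)" "card (line_points b) \<le> d"
proof -
  have v0: "v \<noteq> 0" using v(2) homogeneous_eval3_0[OF hom d] by auto
  obtain G1 :: "complex^3^3" where G1: "invertible G1" "G1 $ 1 = b" "G1 *v v = vector [0, 0, 1]"
    by (rule adapted_matrix[OF b v0 v(1)])
  define G :: "complex^3^3" where "G = vector [b, G1 $ 3, G1 $ 2]"
  have "det G = - det G1" by (simp add: G_def det_3 G1(2)[symmetric] algebra_simps)
  then have G: "invertible G" using G1(1) by (simp add: invertible_det_nz)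
  have "G *v v = vector [0, 1, 0]"
    using G1(3) by (simp add: vec_eq_iff forall_3 G_def matrix_vector_row v)
  then have iv: "matrix_inv G *v vector [0, 1, 0] = v" using matrix_inv(4)[OF G] by metis
  define y0 where "y0 = matrix_inv G *v vector [0, 0, 1]"
  have iG: "matrix_inv G *v vector [0, l, 1] = y0 + l *s v" for l
  proof -
    have "vector [0, l, 1] = (vector [0, 0, 1] + l *s vector [0, 1, 0] :: complex^3)"
      by (simp add: vec_eq_iff forall_3)
    then show ?thesis by (simp only: matrix_vector_right_distrib vector_scalar_commute iv y0_def)
  qed
  have bij: "bij_betw (\<lambda>l. pt (y0 + l *s v)) {l. eval3 F (y0 + l *s v) = 0} (line_points b)"
  proof -
    have G1b: "G $ 1 = b" by (simp add: G_def)
    show ?thesis using line_points_param[OF G G1b] v(2) by (simp only: iv iG not_False_eq_True)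
  qed
  show "finite (line_points b)" using bij_betw_finite[OF bij] card_line_eq_iff(1)[OF hom v(2)] by blast
  show "card (line_points b) \<le> d" using bij_betw_same_card[OF bij] card_line_eq_iff(2)[OF hom v(2)] by metis
qed

lemma components_clopen:
  assumes "S \<in> components (UNIV :: 'a set)"
  shows "open S" "closed S" "connected S" "S \<noteq> {}"
proof -
  show "closed S" using closed_components[OF closed_UNIV assms] .
  show "connected S" using in_components_connected[OF assms] .
  show "S \<noteq> {}" using in_components_nonempty[OF assms] .
  obtain x where x: "S = connected_component_set UNIV x" using assms by (auto simp: components_iff)
  have "\<exists>T. open T \<and> y \<in> T \<and> T \<subseteq> S" if y: "y \<in> S" for y
  proof -
    obtain \<rho> \<psi> \<tau> where dy: "disc A y \<rho> \<psi> \<tau>" by (rule disc_exists[OF A AU])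
    have c: "connected (\<psi> ` ball 0 \<rho>)" by (rule connected_continuous_image[OF discD(4)[OF dy]]) simp
    have yb: "y \<in> \<psi> ` ball 0 \<rho>" by (rule disc_centre[OF dy])
    have "S = connected_component_set UNIV y" using y x by (metis connected_component_eq)
    then have "\<psi> ` ball 0 \<rho> \<subseteq> S" using connected_component_maximal[OF yb c] by simp
    then show ?thesis using discD(3)[OF dy] yb by blast
  qed
  then show "open S" unfolding open_subopen[of S] by simp
qed

lemma finite_components: "finite (components (UNIV :: 'a set))"
proof -
  have "UNIV \<subseteq> \<Union> (components (UNIV :: 'a set))" by simp
  then obtain T where T: "T \<subseteq> components (UNIV :: 'a set)" "finite T" "UNIV \<subseteq> \<Union> T"
    using compactE[OF compact_UNIV, of "components UNIV"] components_clopen(1) by metis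
  have sub: "S \<in> T" if S: "S \<in> components UNIV" for S
  proof -
    obtain x where "x \<in> S" using components_clopen(4)[OF S] by blast
    moreover obtain S' where "S' \<in> T" "x \<in> S'" using T(3) by blast
    ultimately have "S \<inter> S' \<noteq> {}" "S' \<in> T" by auto
    then have "S = S'" using components_nonoverlap[OF S subsetD[OF T(1)], of S'] by simp
    then show ?thesis using \<open>S' \<in> T\<close> by simp
  qed
  then show ?thesis by (intro finite_subset[OF _ T(2)] subsetI)
qed

end

text \<open>In the coordinates (g : x : 1) given by M, x indexes the lines through the apex (1 : 0 :
  0) and g is the position on the line. The apex is off the curve, so every point of C on the line
  over x has a finite g.\<close>

locale pencil = plane_curve +
  fixes M :: "complex^3^3" and D :: "complex set"
  assumes M: "invertible M" and D: "finite D" and apex: "eval3 F (M *v axis 1 1) \<noteq> 0"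
    and generic: "\<And>x. x \<notin> D \<Longrightarrow> card {g. eval3 F (M *v vector [g, x, 1]) = 0} = d"
begin

definition X :: "complex \<Rightarrow> complex \<Rightarrow> complex^3" where "X g x = M *v vector [g, x, 1]"

definition N :: "complex^3^3" where "N = matrix_inv M"

text \<open>Coordinates adapted to the pencil line over x: the first is the deviation from x and the
  second is g, as \<open>B_X\<close> shows.\<close>

definition B :: "complex \<Rightarrow> complex^3^3" where
  "B x = vector [N $ 2 - x *s N $ 3, N $ 1, N $ 3]"

lemma NX: "N *v X g x = vector [g, x, 1]"
  unfolding N_def X_def by (rule matrix_inv(4)[OF M])

lemma X_nz: "X g x \<noteq> 0"
  using invertible_mult_0[OF M] vector3_nz by (simp add: X_def)

lemma det_N: "det N \<noteq> 0"
  using matrix_inv(5)[OF M] by (simp add: N_def invertible_det_nz)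

lemma invertible_B: "invertible (B x)"
proof -
  have "det (B x) = - det N" by (simp add: B_def det_3 algebra_simps)
  then show ?thesis using det_N by (simp add: invertible_det_nz)
qed

lemma B_X: "B x *v X g (x + c) = vector [c, g, 1]"
proof -
  have "bil (N $ 1) (X g (x + c)) = g" "bil (N $ 2) (X g (x + c)) = x + c" "bil (N $ 3) (X g (x + c)) = 1"
    using NX[of g "x + c"] by (simp_all flip: matrix_vector_row)
  then show ?thesis by (simp add: vec_eq_iff forall_3 matrix_vector_row B_def bil_linear)
qed

lemma inv_B: "matrix_inv (B x) *v vector [c, g, 1] = X g (x + c)"
  using matrix_inv(4)[OF invertible_B] B_X by metis

lemma inv_B_apex: "matrix_inv (B x) *v vector [0, 1, 0] = M *v axis 1 1"
proof -
  have "N *v (M *v axis 1 1) = axis 1 1" unfolding N_def by (rule matrix_inv(4)[OF M])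
  then have "B x *v (M *v axis 1 1) = vector [0, 1, 0]"
    by (simp add: vec_eq_iff forall_3 matrix_vector_row[symmetric] B_def bil_linear)
       (simp add: matrix_vector_row B_def bil_linear, simp add: matrix_vector_row[symmetric] axis_def)
  then show ?thesis using matrix_inv(4)[OF invertible_B] by metis
qed

lemma card_line: "x \<notin> D \<Longrightarrow> card (line_points (B x $ 1)) = d"
  using bij_betw_same_card[OF line_points_param[OF invertible_B refl, of x]] apex generic[of x] inv_B[of x 0]
  by (simp add: inv_B_apex X_def)

lemma B1_nz: "B x $ 1 \<noteq> 0"
  unfolding row_vector_matrix[of "B x" 1] vector_matrix_mult_0[OF invertible_B] by (simp add: axis_eq_0_iff)

lemma on_line: "incident (pt (X g x)) (pt (B x $ 1))"
  using B_X[of x g 0] by (simp add: incident_pt[OF X_nz B1_nz] flip: matrix_vector_row)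

lemma unique_preimage: "x \<notin> D \<Longrightarrow> \<nu> p = pt (X g x) \<Longrightarrow> \<nu> q = pt (X g x) \<Longrightarrow> q = p"
  using transversal(2)[OF B1_nz card_line, of x p q] on_line[of g x] by simp

text \<open>A line with d points meets the branch with order 1, so the deviation from x0 serves as
  local parameter and the branch is the graph of \<gamma>.\<close>

lemma sheet:
  assumes x0: "x0 \<notin> D" and p: "incident (\<nu> p) (pt (B x0 $ 1))"
  obtains \<rho> \<psi> \<tau> \<gamma> where "disc A p \<rho> \<psi> \<tau>" "\<gamma> holomorphic_on ball 0 \<rho>"
    "\<forall>z\<in>ball 0 \<rho>. \<nu> (\<psi> z) = pt (X (\<gamma> z) (x0 + z))"
proof -
  define G where "G = B x0"
  have G: "invertible G" by (simp add: G_def invertible_B)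
  obtain y where y: "y \<noteq> 0" "\<nu> p = pt y" by (rule pt_cases)
  have yC: "eval3 F y = 0" using range_\<nu> y(2) in_C[OF y(1)] by (metis rangeI)
  have y1: "bil (G $ 1) y = 0" using p incident_pt[OF y(1) B1_nz] by (simp add: y(2) G_def)
  \<comment> \<open>The only point of the line with third coordinate 0 is the apex, which is off the
    curve.\<close>
  have y3: "bil (G $ 3) y \<noteq> 0"
  proof
    assume "bil (G $ 3) y = 0"
    then have "G *v y = bil (G $ 2) y *s vector [0, 1, 0]"
      by (simp add: vec_eq_iff forall_3 matrix_vector_row y1)
    then have ye: "y = bil (G $ 2) y *s (M *v axis 1 1)"
      using matrix_inv(4)[OF G, of y] inv_B_apex[of x0] by (metis vector_scalar_commute G_def)
    then have "bil (G $ 2) y \<noteq> 0" using y(1) by (metis vector_smult_lzero)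
    moreover have "eval3 F y = bil (G $ 2) y ^ d * eval3 F (M *v axis 1 1)"
      by (subst ye) (rule homogeneous_eval3[OF hom])
    ultimately show False using yC apex by simp
  qed
  have off: "\<nu> p \<in> offline (G $ 3)" using y3 by (simp add: y(2) offline_pt[OF y(1)])
  obtain \<rho>0 \<psi>0 \<tau>0 where d0: "disc A p \<rho>0 \<psi>0 \<tau>0" by (rule disc_exists[OF A AU])
  obtain \<rho>1 u w where f: "frm p \<rho>1 \<psi>0 \<tau>0 G u w" by (rule frame_exists[OF d0 G off])
  have "vord A \<nu> p (G $ 1) 1" unfolding G_def by (rule transversal(1)[OF B1_nz card_line[OF x0] p])
  then have u1: "hasord u 1" by (simp only: vord_row(1)[OF f])
  obtain \<rho> k where \<rho>: "\<rho> > 0" and k: "k holomorphic_on ball 0 \<rho>" "inj_on k (ball 0 \<rho>)" "k ` ball 0 \<rho> \<subseteq> ball 0 \<rho>1" "k 0 = 0"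
    and uk: "\<forall>z\<in>ball 0 \<rho>. u (k z) = z ^ 1"
    by (rule power_coordinate[OF frameD(3)[OF f] discD(1)[OF frameD(1)[OF f]] u1]) auto
  have kp: "\<psi>0 (k 0) = p" using k(4) discD(2)[OF d0] by simp
  obtain \<tau> where f': "frm p \<rho> (\<lambda>z. \<psi>0 (k z)) \<tau> G (\<lambda>z. u (k z)) (\<lambda>z. w (k z))"
    using frame_reparam[OF f k(1,2,3) \<rho>, unfolded kp] by blast
  have "\<forall>z\<in>ball 0 \<rho>. \<nu> (\<psi>0 (k z)) = pt (X (w (k z)) (x0 + z))"
  proof
    fix z :: complex assume z: "z \<in> ball 0 \<rho>"
    show "\<nu> (\<psi>0 (k z)) = pt (X (w (k z)) (x0 + z))"
      using frameD(5)[OF f' z] uk z by (simp add: inv_B G_def)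
  qed
  then show ?thesis by (rule that[OF frameD(1)[OF f'] frameD(4)[OF f']])
qed

definition J :: "'a set \<Rightarrow> complex \<Rightarrow> complex set" where
  "J S x = {g. \<exists>p\<in>S. \<nu> p = pt (X g x)}"

definition PP :: "complex \<Rightarrow> 'a set" where
  "PP x = {p. incident (\<nu> p) (pt (B x $ 1))}"

lemma PP:
  assumes "x \<notin> D" shows "finite (PP x)" "card (PP x) = d"
proof -
  have inj: "inj_on \<nu> (PP x)"
    using transversal(2)[OF B1_nz card_line[OF assms]] by (auto simp: inj_on_def PP_def)
  have "\<nu> ` PP x = line_points (B x $ 1)"
    using range_\<nu> by (auto simp: PP_def line_points_def)
  then have b: "bij_betw \<nu> (PP x) (line_points (B x $ 1))" using inj by (simp add: bij_betw_def)
  show "card (PP x) = d" using bij_betw_same_card[OF b] card_line[OF assms] by simp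
  then show "finite (PP x)" using d by (metis card.infinite not_one_le_zero)
qed

lemma J_root: "g \<in> J S x \<Longrightarrow> eval3 F (X g x) = 0"
  unfolding J_def mem_Collect_eq using range_\<nu> in_C[OF X_nz] by (metis rangeI)

lemma finite_J: "finite (J S x)"
proof -
  have "X g x = X 0 x + g *s (M *v axis 1 1)" for g
  proof -
    have "vector [g, x, 1] = (vector [0, x, 1] + g *s axis 1 1 :: complex^3)"
      by (simp add: vec_eq_iff forall_3 axis_def)
    then show ?thesis by (simp only: X_def matrix_vector_right_distrib vector_scalar_commute)
  qed
  note X0 = this
  have "J S x \<subseteq> {g. eval3 F (X 0 x + g *s (M *v axis 1 1)) = 0}"
  proof
    fix g assume "g \<in> J S x"
    from J_root[OF this] show "g \<in> {g. eval3 F (X 0 x + g *s (M *v axis 1 1)) = 0}"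
      unfolding X0[of g] by simp
  qed
  then show ?thesis by (rule finite_subset) (rule card_line_eq_iff(1)[OF hom apex])
qed

text \<open>The branches through the d points over x0 give d graphs. They stay distinct near x0 and
  solve an equation with only d roots, so they are all the roots. A connected disc cannot leave a
  clopen S, so the division into sheets inside and outside S persists.\<close>

lemma sheets:
  assumes x0: "x0 \<notin> D"
  obtains \<gamma> U where "open U" "x0 \<in> U" "U \<inter> D = {}" "\<forall>p\<in>PP x0. \<gamma> p holomorphic_on U"
    "\<forall>x\<in>U. inj_on (\<lambda>p. \<gamma> p x) (PP x0)"
    "\<forall>x\<in>U. \<forall>S. open S \<longrightarrow> closed S \<longrightarrow> J S x = (\<lambda>p. \<gamma> p x) ` (PP x0 \<inter> S)"
proof -
  note fin = PP(1)[OF x0]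
  let ?P = "\<lambda>p \<rho> \<psi> \<gamma>. \<rho> > 0 \<and> continuous_on (ball 0 \<rho>) \<psi> \<and> \<psi> 0 = p \<and> \<gamma> holomorphic_on ball 0 \<rho> \<and>
      (\<forall>z\<in>ball 0 \<rho>. \<nu> (\<psi> z) = pt (X (\<gamma> z) (x0 + z)))"
  have "\<forall>p\<in>PP x0. \<exists>\<rho> \<psi> \<gamma>. ?P p \<rho> \<psi> \<gamma>"
  proof
    fix p assume "p \<in> PP x0"
    then have p: "incident (\<nu> p) (pt (B x0 $ 1))" by (simp add: PP_def)
    obtain \<rho> \<psi> \<tau> \<gamma> where s: "disc A p \<rho> \<psi> \<tau>" "\<gamma> holomorphic_on ball 0 \<rho>"
      "\<forall>z\<in>ball 0 \<rho>. \<nu> (\<psi> z) = pt (X (\<gamma> z) (x0 + z))" by (rule sheet[OF x0 p])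
    show "\<exists>\<rho> \<psi> \<gamma>. ?P p \<rho> \<psi> \<gamma>"
      using s discD(1,2,4)[OF s(1)] by blast
  qed
  from bchoice[OF this] obtain \<rho> where "\<forall>p\<in>PP x0. \<exists>\<psi> \<gamma>. ?P p (\<rho> p) \<psi> \<gamma>" ..
  from bchoice[OF this] obtain \<psi> where "\<forall>p\<in>PP x0. \<exists>\<gamma>. ?P p (\<rho> p) (\<psi> p) \<gamma>" ..
  from bchoice[OF this] obtain \<gamma> where s: "\<forall>p\<in>PP x0. ?P p (\<rho> p) (\<psi> p) (\<gamma> p)" ..
  define \<delta> where "\<delta> p x = \<gamma> p (x - x0)" for p x
  define V where "V = (\<Inter>p\<in>PP x0. ball x0 (\<rho> p)) - D"
  have V: "open V" "x0 \<in> V" unfolding V_def using fin D x0 s by (auto intro!: open_Diff finite_imp_closed)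
  have Vb: "x - x0 \<in> ball 0 (\<rho> p)" if "x \<in> V" "p \<in> PP x0" for x p
    using that by (auto simp: V_def dist_norm norm_minus_commute)
  have h\<delta>: "\<delta> p holomorphic_on V" if p: "p \<in> PP x0" for p
    unfolding \<delta>_def
    by (rule holomorphic_on_compose_gen[of "\<lambda>x. x - x0" V "\<gamma> p" "ball 0 (\<rho> p)", unfolded o_def])
       (use s p Vb in \<open>auto intro!: holomorphic_intros\<close>)
  have \<nu>\<psi>: "\<nu> (\<psi> p (x - x0)) = pt (X (\<delta> p x) x)" if "x \<in> V" "p \<in> PP x0" for x p
    using s Vb[OF that] that(2) by (simp add: \<delta>_def)
  have ne0: "\<delta> p x0 \<noteq> \<delta> q x0" if "p \<in> PP x0" "q \<in> PP x0" "p \<noteq> q" for p q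
  proof
    assume "\<delta> p x0 = \<delta> q x0"
    then have "\<nu> (\<psi> p 0) = \<nu> (\<psi> q 0)" using \<nu>\<psi>[OF V(2)] that by (metis diff_self)
    then have "\<nu> q = \<nu> p" using s that by simp
    moreover have "incident (\<nu> p) (pt (B x0 $ 1))" using that(1) by (simp only: PP_def mem_Collect_eq)
    ultimately have "q = p" by (intro transversal(2)[OF B1_nz card_line[OF x0]])
    then show False using that(3) by simp
  qed
  have "eventually (\<lambda>x. \<forall>p\<in>PP x0. \<forall>q\<in>PP x0. p \<noteq> q \<longrightarrow> \<delta> p x \<noteq> \<delta> q x) (nhds x0)"
  proof (intro eventually_ball_finite ballI fin)
    fix p q assume pq: "p \<in> PP x0" "q \<in> PP x0"
    show "eventually (\<lambda>x. p \<noteq> q \<longrightarrow> \<delta> p x \<noteq> \<delta> q x) (nhds x0)"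
    proof (cases "p = q")
      case False
      have "isCont (\<lambda>x. \<delta> p x - \<delta> q x) x0"
        using h\<delta>[OF pq(1)] h\<delta>[OF pq(2)] V
        by (intro continuous_intros) (auto dest!: holomorphic_on_imp_continuous_on simp: continuous_on_eq_continuous_at)
      from continuous_at_avoid[OF this, of 0] obtain e where "e > 0" "\<forall>y. dist x0 y < e \<longrightarrow> \<delta> p y - \<delta> q y \<noteq> 0"
        using ne0[OF pq False] by auto
      then have "eventually (\<lambda>x. \<delta> p x - \<delta> q x \<noteq> 0) (nhds x0)"
        by (auto simp: eventually_nhds_metric dist_commute)
      then show ?thesis by eventually_elim simp
    qed simp
  qed
  then obtain W where W: "open W" "x0 \<in> W" "\<forall>x\<in>W. \<forall>p\<in>PP x0. \<forall>q\<in>PP x0. p \<noteq> q \<longrightarrow> \<delta> p x \<noteq> \<delta> q x"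
    by (auto simp: eventually_nhds)
  define U where "U = V \<inter> W"
  have inj: "inj_on (\<lambda>p. \<delta> p x) (PP x0)" if "x \<in> U" for x
    using W(3) that by (auto simp: U_def inj_on_def)
  \<comment> \<open>An inclusion between finite sets of the same size d.\<close>
  have roots: "{g. eval3 F (X g x) = 0} = (\<lambda>p. \<delta> p x) ` PP x0" if x: "x \<in> U" for x
  proof (rule sym, rule card_subset_eq)
    have xD: "x \<notin> D" and xV: "x \<in> V" using x by (auto simp: U_def V_def)
    have c: "card {g. eval3 F (X g x) = 0} = d" using generic[OF xD] by (simp add: X_def)
    then show "finite {g. eval3 F (X g x) = 0}" using d by (metis card.infinite not_one_le_zero)
    show "(\<lambda>p. \<delta> p x) ` PP x0 \<subseteq> {g. eval3 F (X g x) = 0}"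
    proof clarify
      fix p assume "p \<in> PP x0"
      then have "pt (X (\<delta> p x) x) \<in> C" using \<nu>\<psi>[OF xV] range_\<nu> by (metis rangeI)
      then show "eval3 F (X (\<delta> p x) x) = 0" using in_C[OF X_nz] by simp
    qed
    show "card ((\<lambda>p. \<delta> p x) ` PP x0) = card {g. eval3 F (X g x) = 0}"
      using card_image[OF inj[OF x]] PP(2)[OF x0] c by simp
  qed
  have side: "\<psi> p z \<in> S \<longleftrightarrow> p \<in> S" if "open S" "closed S" "p \<in> PP x0" "z \<in> ball 0 (\<rho> p)" for S p z
  proof -
    have "connected (\<psi> p ` ball 0 (\<rho> p))" using s that(3) by (intro connected_continuous_image) auto
    moreover have "p \<in> \<psi> p ` ball 0 (\<rho> p)" using s that(3) by (auto intro!: image_eqI[of _ _ 0])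
    moreover have "\<psi> p z \<in> \<psi> p ` ball 0 (\<rho> p)" using that(4) by blast
    moreover have "open (- S)" using that(2) by (simp add: open_Compl)
    ultimately show ?thesis using connectedD[of "\<psi> p ` ball 0 (\<rho> p)" S "- S"] that(1) by blast
  qed
  have J_eq: "J S x = (\<lambda>p. \<delta> p x) ` (PP x0 \<inter> S)" if x: "x \<in> U" and S: "open S" "closed S" for x S
  proof (intro equalityI subsetI)
    have xV: "x \<in> V" and xD: "x \<notin> D" using x by (auto simp: U_def V_def)
    fix g
    {
      assume g: "g \<in> J S x"
      then obtain q where q: "q \<in> S" "\<nu> q = pt (X g x)" by (auto simp: J_def)
      have "g \<in> (\<lambda>p. \<delta> p x) ` PP x0" using roots[OF x] J_root[OF g] by blast
      then obtain p where p: "p \<in> PP x0" "g = \<delta> p x" by blast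
      have "\<nu> (\<psi> p (x - x0)) = pt (X g x)" using \<nu>\<psi>[OF xV p(1)] p(2) by simp
      from unique_preimage[OF xD this q(2)] have "q = \<psi> p (x - x0)" .
      then have "p \<in> S" using side[OF S p(1) Vb[OF xV p(1)]] q by simp
      then show "g \<in> (\<lambda>p. \<delta> p x) ` (PP x0 \<inter> S)" using p by blast
    next
      assume "g \<in> (\<lambda>p. \<delta> p x) ` (PP x0 \<inter> S)"
      then obtain p where p: "p \<in> PP x0" "p \<in> S" "g = \<delta> p x" by blast
      then have "\<psi> p (x - x0) \<in> S" using side[OF S p(1) Vb[OF xV p(1)]] by simp
      then show "g \<in> J S x" using \<nu>\<psi>[OF xV p(1)] p(3) by (auto simp: J_def)
    }
  qed
  have h\<delta>U: "\<forall>p\<in>PP x0. \<delta> p holomorphic_on U" using h\<delta> by (auto simp: U_def intro: holomorphic_on_subset)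
  show ?thesis
    by (rule that[of U \<delta>]) (use V W h\<delta>U inj J_eq in \<open>auto simp: U_def V_def\<close>)
qed

end

section \<open>Equations for unions of components\<close>

context pencil
begin

text \<open>The sheets can be labelled only locally; the coefficients of this product are symmetric
  in them, so they are defined on the whole complement of D.\<close>

definition Q :: "'a set \<Rightarrow> complex \<Rightarrow> complex poly" where "Q S x = (\<Prod>g\<in>J S x. [:-g, 1:])"

lemma holomorphic_coeff_prod:
  assumes "finite I" "\<And>p. p \<in> I \<Longrightarrow> \<gamma> p holomorphic_on U"
  shows "(\<lambda>x. coeff (\<Prod>p\<in>I. [:- \<gamma> p x, 1:]) j) holomorphic_on U"
  using assms
proof (induction I arbitrary: j rule: finite_induct)
  case empty
  show ?case by simp
next
  case (insert p I)
  have IH: "(\<lambda>x. coeff (\<Prod>p\<in>I. [:- \<gamma> p x, 1:]) j) holomorphic_on U" for j using insert by simp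
  have h: "\<gamma> p holomorphic_on U" using insert.prems by simp
  show ?case
  proof (cases j)
    case 0
    then show ?thesis using IH[of 0] h insert(1,2) by (simp add: holomorphic_intros)
  next
    case (Suc i)
    have "(\<lambda>x. coeff (\<Prod>p\<in>I. [:- \<gamma> p x, 1:]) i - \<gamma> p x * coeff (\<Prod>p\<in>I. [:- \<gamma> p x, 1:]) (Suc i)) holomorphic_on U"
      by (intro holomorphic_intros IH h)
    then show ?thesis using insert(1,2) by (simp add: Suc coeff_pCons)
  qed
qed

text \<open>If g is large compared with 1 + |x|, the point (1 : x/g : 1/g) is close to the apex,
  near which the equation does not vanish.\<close>

lemma root_bound:
  obtains K :: real where "K \<ge> 1" "\<And>g x. eval3 F (X g x) = 0 \<Longrightarrow> norm g \<le> K * (1 + norm x)"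
proof -
  have "isCont (\<lambda>v. eval3 F (M *v v)) (axis 1 1)"
  proof -
    interpret function_ring "\<lambda>f. isCont f (axis 1 1 :: complex^3)"
      by unfold_locales (auto intro: continuous_intros)
    have "isCont (\<lambda>v. (M *v v) $ i) (axis 1 1 :: complex^3)" for i
      unfolding matrix_vector_mult_def by (simp add: sum_3)
    from eval3[of "\<lambda>v. M *v v", OF this] show ?thesis .
  qed
  from continuous_at_avoid[OF this apex] obtain e where e: "e > 0"
    "\<forall>v. dist (axis 1 1) v < e \<longrightarrow> eval3 F (M *v v) \<noteq> 0" by blast
  define K where "K = max 1 (1 / e)"
  have "norm g \<le> K * (1 + norm x)" if r: "eval3 F (X g x) = 0" for g x
  proof (cases "g = 0")
    case False
    have v: "vector [g, x, 1] = (g *s vector [1, x / g, 1 / g] :: complex^3)"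
      using False by (simp add: vec_eq_iff forall_3)
    have "eval3 F (X g x) = g ^ d * eval3 F (M *v vector [1, x / g, 1 / g])"
      unfolding X_def v vector_scalar_commute by (rule homogeneous_eval3[OF hom])
    then have "eval3 F (M *v vector [1, x / g, 1 / g]) = 0" using r False by simp
    then have "e \<le> dist (axis 1 1) (vector [1, x / g, 1 / g] :: complex^3)" using e(2) by force
    also have "\<dots> = norm (axis 1 1 - vector [1, x / g, 1 / g] :: complex^3)" by (simp add: dist_norm)
    also have "\<dots> \<le> (\<Sum>i\<in>UNIV. norm ((axis 1 1 - vector [1, x / g, 1 / g] :: complex^3) $ i))"
      unfolding norm_vec_def by (rule L2_set_le_sum) simp
    also have "\<dots> = (1 + norm x) / norm g"
      by (simp add: sum_3 axis_def norm_divide add_divide_distrib)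
    finally have "e * norm g \<le> 1 + norm x" using False by (simp add: field_simps)
    then have "norm g \<le> 1 / e * (1 + norm x)" using e(1) by (simp add: field_simps)
    also have "\<dots> \<le> K * (1 + norm x)" by (intro mult_right_mono) (auto simp: K_def)
    finally show ?thesis .
  next
    case True
    have "0 \<le> K * (1 + norm x)" by (intro mult_nonneg_nonneg) (auto simp: K_def)
    then show ?thesis using True by simp
  qed
  then show ?thesis using that[of K] by (auto simp: K_def)
qed

lemma coeff_Q_holomorphic:
  assumes S: "open S" "closed S"
  shows "(\<lambda>x. coeff (Q S x) j) holomorphic_on - D" "x0 \<notin> D \<Longrightarrow> eventually (\<lambda>x. card (J S x) = card (J S x0)) (nhds x0)"
proof -
  have main: "\<exists>U. open U \<and> x0 \<in> U \<and> U \<inter> D = {} \<and> (\<lambda>x. coeff (Q S x) j) holomorphic_on U \<and> (\<forall>x\<in>U. card (J S x) = card (PP x0 \<inter> S))"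
    if x0: "x0 \<notin> D" for x0
  proof -
    obtain \<gamma> U where U: "open U" "x0 \<in> U" "U \<inter> D = {}" "\<forall>p\<in>PP x0. \<gamma> p holomorphic_on U"
      and inj: "\<forall>x\<in>U. inj_on (\<lambda>p. \<gamma> p x) (PP x0)"
      and J: "\<forall>x\<in>U. \<forall>S. open S \<longrightarrow> closed S \<longrightarrow> J S x = (\<lambda>p. \<gamma> p x) ` (PP x0 \<inter> S)"
      by (rule sheets[OF x0])
    have inj': "inj_on (\<lambda>p. \<gamma> p x) (PP x0 \<inter> S)" if "x \<in> U" for x
      using inj that by (meson Int_lower1 inj_on_subset)
    have "Q S x = (\<Prod>p\<in>PP x0 \<inter> S. [:- \<gamma> p x, 1:])" if "x \<in> U" for x
      unfolding Q_def using J S that prod.reindex[OF inj'[OF that]] by (simp add: o_def)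
    then have "(\<lambda>x. coeff (Q S x) j) holomorphic_on U \<longleftrightarrow> (\<lambda>x. coeff (\<Prod>p\<in>PP x0 \<inter> S. [:- \<gamma> p x, 1:]) j) holomorphic_on U"
      by (intro holomorphic_cong) auto
    then have "(\<lambda>x. coeff (Q S x) j) holomorphic_on U"
      using holomorphic_coeff_prod[of "PP x0 \<inter> S" \<gamma> U j] PP(1)[OF x0] U(4) by simp
    moreover have "\<forall>x\<in>U. card (J S x) = card (PP x0 \<inter> S)" using J S inj' by (simp add: card_image)
    ultimately show ?thesis using U(1,2,3) by blast
  qed
  show "(\<lambda>x. coeff (Q S x) j) holomorphic_on - D"
    unfolding holomorphic_on_def
  proof
    fix x0 assume "x0 \<in> - D"
    then have "x0 \<notin> D" by simp
    from main[OF this] obtain U where U: "open U" "x0 \<in> U" "(\<lambda>x. coeff (Q S x) j) holomorphic_on U" by blast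
    then have "(\<lambda>x. coeff (Q S x) j) field_differentiable (at x0)" by (auto simp: holomorphic_on_open field_differentiable_def)
    then show "(\<lambda>x. coeff (Q S x) j) field_differentiable (at x0 within - D)" by (rule field_differentiable_at_within)
  qed
  assume "x0 \<notin> D"
  from main[OF this] obtain U where U: "open U" "x0 \<in> U" "\<forall>x\<in>U. card (J S x) = card (PP x0 \<inter> S)" by blast
  then have "\<forall>x\<in>U. card (J S x) = card (J S x0)" by simp
  then show "eventually (\<lambda>x. card (J S x) = card (J S x0)) (nhds x0)" using U(1,2) unfolding eventually_nhds by blast
qed

text \<open>The number of sheets in S is locally constant, and the complex plane stays connected
  when the finite set D is removed.\<close>

lemma card_J:
  assumes S: "open S" "closed S"
  obtains e where "\<And>x. x \<notin> D \<Longrightarrow> card (J S x) = e"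
proof -
  have con: "connected (- D)"
    using connected_open_diff_countable[of "UNIV :: complex set" D] D connected_UNIV by (simp add: countable_finite Compl_eq_Diff_UNIV)
  have "\<forall>x0\<in>-D. eventually (\<lambda>x. card (J S x0) = card (J S x)) (at x0 within - D)"
  proof
    fix x0 assume "x0 \<in> - D"
    then have "eventually (\<lambda>x. card (J S x) = card (J S x0)) (nhds x0)" using coeff_Q_holomorphic(2)[OF S] by simp
    then have "eventually (\<lambda>x. card (J S x0) = card (J S x)) (nhds x0)" by eventually_elim simp
    then show "eventually (\<lambda>x. card (J S x0) = card (J S x)) (at x0 within - D)"
      unfolding eventually_at_filter by eventually_elim simp
  qed
  note const = connected_local_const[OF con _ _ this]
  obtain x1 where "x1 \<in> - D"
    using ex_new_if_finite[OF infinite_UNIV_char_0 D] by auto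
  then show ?thesis using that[of "card (J S x1)"] const[of x1] by (simp flip: Compl_iff)
qed

text \<open>The bound on the roots makes the coefficient bounded near D, so these singularities are
  removable, and it gives growth of order e - j at infinity. Liouville's theorem leaves a polynomial
  of degree at most e - j.\<close>

lemma coeff_Q_polynomial:
  assumes S: "open S" "closed S" and e: "\<And>x. x \<notin> D \<Longrightarrow> card (J S x) = e"
  obtains a :: "complex poly" where "degree a \<le> e - j" "\<forall>x. x \<notin> D \<longrightarrow> coeff (Q S x) j = poly a x"
proof -
  obtain K :: real where K: "K \<ge> 1" "\<And>g x. eval3 F (X g x) = 0 \<Longrightarrow> norm g \<le> K * (1 + norm x)" by (rule root_bound) blast
  have bd: "norm (coeff (Q S x) j) \<le> 2 ^ e * (K * (1 + norm x)) ^ (e - j)" if x: "x \<notin> D" for x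
  proof -
    have "K * 1 \<le> K * (1 + norm x)" using K(1) by (intro mult_left_mono) auto
    then have "K * (1 + norm x) \<ge> 1" using K(1) by linarith
    then show ?thesis
      using coeff_prod_linear_bound[OF finite_J[of S x], of "K * (1 + norm x)" j] K(2)[OF J_root] e[OF x] by (simp add: Q_def)
  qed
  have O: "(\<lambda>x. coeff (Q S x) j) \<in> O[at z](\<lambda>_. 1)" if z: "z \<in> D" for z
  proof (rule bigoI)
    have "eventually (\<lambda>x. x \<notin> D) (at z)"
      using islimpt_finite[OF D, of z] by (simp add: islimpt_iff_eventually)
    moreover have "eventually (\<lambda>x. norm x < norm z + 1) (at z)"
      by (rule order_tendstoD) (auto intro!: tendsto_intros)
    ultimately show "eventually (\<lambda>x. norm (coeff (Q S x) j) \<le> 2 ^ e * (K * (2 + norm z)) ^ (e - j) * norm (1::complex)) (at z)"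
    proof eventually_elim
      case (elim x)
      have "(K * (1 + norm x)) ^ (e - j) \<le> (K * (2 + norm z)) ^ (e - j)"
        using K(1) elim(2) by (intro power_mono mult_left_mono) auto
      then have "2 ^ e * (K * (1 + norm x)) ^ (e - j) \<le> 2 ^ e * (K * (2 + norm z)) ^ (e - j)" by simp
      then show ?case using order_trans[OF bd[OF elim(1)]] by simp
    qed
  qed
  have hol: "(\<lambda>x. coeff (Q S x) j) holomorphic_on UNIV - D"
    using coeff_Q_holomorphic(1)[OF S] by (simp add: Compl_eq_Diff_UNIV)
  obtain f where f: "f holomorphic_on UNIV" "\<forall>x\<in>UNIV - D. f x = coeff (Q S x) j"
    using removable_singularities[OF D _ hol O] by auto
  obtain R where R: "\<forall>x\<in>D. norm x < R" using D finite_imp_bounded[OF D] unfolding bounded_iff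
    by (metis gt_ex order.strict_trans1)
  have growth: "norm (f z) \<le> 2 ^ e * (2 * K) ^ (e - j) * norm z ^ (e - j)" if z: "max 1 R \<le> norm z" for z
  proof -
    have zD: "z \<notin> D" using R z by force
    have "norm (f z) \<le> 2 ^ e * (K * (1 + norm z)) ^ (e - j)" using bd[OF zD] f(2) zD by simp
    also have "\<dots> \<le> 2 ^ e * (2 * K * norm z) ^ (e - j)"
    proof -
      have "K * (1 + norm z) \<le> K * (2 * norm z)" using K(1) z by (intro mult_left_mono) auto
      then have "(K * (1 + norm z)) ^ (e - j) \<le> (2 * K * norm z) ^ (e - j)"
        using K(1) by (intro power_mono) (auto simp: mult_ac)
      then show ?thesis by simp
    qed
    finally show ?thesis by (simp add: power_mult_distrib)
  qed
  define a where "a = (\<Sum>k\<le>e - j. monom ((deriv ^^ k) f 0 / fact k) k)"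
  have "poly a x = f x" for x
    using Liouville_polynomial[where A="max 1 R", OF f(1) growth, where \<xi>=x] by (simp add: a_def poly_sum poly_monom)
  moreover have "degree a \<le> e - j"
    unfolding a_def by (intro degree_sum_le) (auto intro: order_trans[OF degree_monom_le])
  ultimately show ?thesis using that[of a] f(2) by simp
qed

lemma pencil_polynomial:
  assumes S: "open S" "closed S"
  obtains G e where "homogeneous e G" "\<And>g x. x \<notin> D \<Longrightarrow> eval3 G (X g x) = (\<Prod>h\<in>J S x. g - h)"
proof -
  obtain e where e: "\<And>x. x \<notin> D \<Longrightarrow> card (J S x) = e" by (rule card_J[OF S]) blast
  have "\<forall>j. \<exists>a. degree a \<le> e - j \<and> (\<forall>x. x \<notin> D \<longrightarrow> coeff (Q S x) j = poly a x)"
  proof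
    fix j
    obtain a where "degree a \<le> e - j" "\<forall>x. x \<notin> D \<longrightarrow> coeff (Q S x) j = poly a x"
      by (rule coeff_Q_polynomial[OF S e, of j])
    then show "\<exists>a. degree a \<le> e - j \<and> (\<forall>x. x \<notin> D \<longrightarrow> coeff (Q S x) j = poly a x)" by blast
  qed
  from choice[OF this] obtain a where a: "\<forall>j. degree (a j) \<le> e - j \<and> (\<forall>x. x \<notin> D \<longrightarrow> coeff (Q S x) j = poly (a j) x)" ..
  \<comment> \<open>Homogenization: the j-th coefficient has degree at most e - j in x, so the
    remaining exponent e - j - i can go to the third variable.\<close>
  define G0 where "G0 = (\<Sum>j\<le>e. \<Sum>i\<le>e - j. monom3 (coeff (a j) i) j i (e - j - i))"
  have G0: "eval3 G0 y = (\<Sum>j\<le>e. \<Sum>i\<le>e - j. coeff (a j) i * y $ 1 ^ j * y $ 2 ^ i * y $ 3 ^ (e - j - i))" for y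
    by (simp add: G0_def eval3_sum eval3_monom3)
  have h0: "homogeneous e G0"
  proof (rule homogeneousI)
    fix c :: complex and y :: "complex^3"
    have "coeff (a j) i * (c * y $ 1) ^ j * (c * y $ 2) ^ i * (c * y $ 3) ^ (e - j - i)
        = c ^ e * (coeff (a j) i * y $ 1 ^ j * y $ 2 ^ i * y $ 3 ^ (e - j - i))" if "j \<in> {..e}" "i \<in> {..e - j}" for i j
    proof -
      have "c ^ e = c ^ j * c ^ i * c ^ (e - j - i)" using that by (simp flip: power_add)
      then show ?thesis by (simp add: power_mult_distrib mult_ac)
    qed
    then show "eval3 G0 (c *s y) = c ^ e * eval3 G0 y"
      unfolding G0 sum_distrib_left vector_smult_component by (intro sum.cong) simp_all
  qed
  have "eval3 (subst3 N G0) (X g x) = (\<Prod>h\<in>J S x. g - h)" if x: "x \<notin> D" for g x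
  proof -
    have dQ: "degree (Q S x) \<le> e"
    proof (rule degree_le, intro allI impI)
      fix j assume "e < j"
      have "R \<ge> 1 \<Longrightarrow> (\<And>g. g \<in> J S x \<Longrightarrow> norm g \<le> R) \<Longrightarrow> coeff (Q S x) j = 0" for R
        using coeff_prod_linear_bound[OF finite_J[of S x], of R j] \<open>e < j\<close> e[OF x] by (simp add: Q_def)
      moreover obtain R where "\<forall>g\<in>J S x. norm g \<le> R" using finite_imp_bounded[OF finite_J[of S x]] unfolding bounded_iff by blast
      ultimately show "coeff (Q S x) j = 0" by (meson max.cobounded1 max.coboundedI2)
    qed
    have "poly (a j) x = (\<Sum>i\<le>e - j. coeff (a j) i * x ^ i)" for j
      using poly_degree_le_sum[of "a j" "e - j" x] a by simp
    then have "eval3 (subst3 N G0) (X g x) = (\<Sum>j\<le>e. poly (a j) x * g ^ j)"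
      unfolding eval3_subst3 NX G0 by (simp add: sum_distrib_left mult_ac)
    also have "\<dots> = (\<Sum>j\<le>e. coeff (Q S x) j * g ^ j)" using a x by simp
    also have "\<dots> = poly (Q S x) g" using poly_degree_le_sum[OF dQ] by simp
    also have "\<dots> = (\<Prod>h\<in>J S x. g - h)" by (simp add: Q_def poly_prod)
    finally show ?thesis .
  qed
  then show ?thesis using that[OF homogeneous_subst3[OF h0]] by blast
qed

text \<open>The finitely many points that the pencil does not control: those on the line at infinity
  \<open>N $ 3\<close> and those over D.\<close>

definition bad :: "'a set" where
  "bad = {p. incident (\<nu> p) (pt (N $ 3))} \<union> (\<Union>x\<in>D. PP x)"

lemma finite_line_preimage:
  assumes b: "b \<noteq> 0" and v: "bil b v = 0" "eval3 F v \<noteq> 0"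
  shows "finite {p. incident (\<nu> p) (pt b)}"
proof -
  have "{p. incident (\<nu> p) (pt b)} = (\<Union>P\<in>line_points b. {p. \<nu> p = P})"
    using range_\<nu> by (auto simp: line_points_def)
  then show ?thesis using line_points_finite(1)[OF b v] finite_fibre by auto
qed

lemma finite_bad: "finite bad"
proof -
  have "N *v (M *v axis 1 1) = axis 1 1" unfolding N_def by (rule matrix_inv(4)[OF M])
  then have n: "bil (N $ 3) (M *v axis 1 1) = 0" "bil (N $ 2) (M *v axis 1 1) = 0"
    by (simp_all flip: matrix_vector_row add: axis_def)
  have N3: "N $ 3 \<noteq> 0"
    using det_N by (auto simp: det_3)
  have "finite (PP x)" for x
    unfolding PP_def by (rule finite_line_preimage[OF B1_nz _ apex]) (simp add: B_def bil_linear n)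
  then show ?thesis
    unfolding bad_def using D finite_line_preimage[OF N3 n(1) apex] by simp
qed

lemma not_bad:
  assumes "p \<notin> bad" obtains g x where "x \<notin> D" "\<nu> p = pt (X g x)"
proof -
  obtain y where y: "y \<noteq> 0" "\<nu> p = pt y" by (rule pt_cases)
  have N3: "N $ 3 \<noteq> 0" using det_N by (auto simp: det_3)
  have "\<not> incident (\<nu> p) (pt (N $ 3))" using assms by (simp add: bad_def)
  then have c: "(N *v y) $ 3 \<noteq> 0" by (simp add: y(2) incident_pt[OF y(1) N3] matrix_vector_row)
  define g x where "g = (N *v y) $ 1 / (N *v y) $ 3" and "x = (N *v y) $ 2 / (N *v y) $ 3"
  have "N *v y = (N *v y) $ 3 *s vector [g, x, 1]" using c by (simp add: vec_eq_iff forall_3 g_def x_def)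
  then have "M *v (N *v y) = (N *v y) $ 3 *s X g x" by (metis X_def vector_scalar_commute)
  moreover have "M *v (N *v y) = y" unfolding N_def by (rule matrix_inv(3)[OF M])
  ultimately have "y = (N *v y) $ 3 *s X g x" by simp
  then have p: "\<nu> p = pt (X g x)" using y(2) pt_scale[OF c] by metis
  moreover have "x \<notin> D"
  proof
    assume "x \<in> D"
    moreover have "p \<in> PP x" using on_line[of g x] by (simp add: PP_def p)
    ultimately show False using assms by (auto simp: bad_def)
  qed
  ultimately show ?thesis using that by blast
qed

text \<open>Away from \<open>bad\<close> the polynomial vanishes at a point exactly if the point is
  in S, because images over generic x have only one preimage. Around any point of S there are
  further points of S off \<open>bad\<close>, so the dichotomy leaves only identical vanishing near
  it.\<close>

lemma component_polynomial_pencil: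
  assumes S: "open S" "closed S"
  obtains G e where "homogeneous e G" "\<And>p. p \<in> S \<Longrightarrow> \<nu> p \<in> zero_locus G" "finite {p. p \<notin> S \<and> \<nu> p \<in> zero_locus G}"
proof -
  obtain G e where G: "homogeneous e G" and eq: "\<And>g x. x \<notin> D \<Longrightarrow> eval3 G (X g x) = (\<Prod>h\<in>J S x. g - h)"
    by (rule pencil_polynomial[OF S]) blast
  have on: "\<nu> p \<in> zero_locus G \<longleftrightarrow> p \<in> S" if pb: "p \<notin> bad" for p
  proof -
    obtain g x where x: "x \<notin> D" "\<nu> p = pt (X g x)" by (rule not_bad[OF pb])
    have "\<nu> p \<in> zero_locus G \<longleftrightarrow> g \<in> J S x"
      unfolding x(2) zero_locus_pt[OF G X_nz] eq[OF x(1)] using finite_J[of S x] by (auto simp: prod_zero_iff)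
    also have "\<dots> \<longleftrightarrow> p \<in> S"
      using x unique_preimage[OF x(1)] unfolding J_def mem_Collect_eq by metis
    finally show ?thesis .
  qed
  have "\<nu> p \<in> zero_locus G" if p: "p \<in> S" for p
  proof -
    obtain U where U: "open U" "p \<in> U" "(\<forall>q\<in>U. \<nu> q \<in> zero_locus G) \<or> (\<forall>q\<in>U. \<nu> q \<in> zero_locus G \<longrightarrow> q = p)"
      by (rule vanishing_dichotomy[OF G])
    have "infinite (U \<inter> S)" using infinite_open[of "U \<inter> S" p] U(1,2) S p by auto
    then have "infinite (U \<inter> S - bad - {p})" using finite_bad by (simp add: Diff_infinite_finite)
    then obtain q where "q \<in> U \<inter> S - bad - {p}" by (metis ex_in_conv infinite_imp_nonempty)
    then show ?thesis using U on[of q] by auto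
  qed
  moreover have "finite {p. p \<notin> S \<and> \<nu> p \<in> zero_locus G}"
    by (rule finite_subset[OF _ finite_bad]) (use on in blast)
  ultimately show ?thesis using that[OF G] by blast
qed

end

lemma (in plane_curve) component_polynomial:
  assumes S: "open S" "closed S"
  obtains G e where "homogeneous e G" "\<And>p. p \<in> S \<Longrightarrow> \<nu> p \<in> zero_locus G" "finite {p. p \<notin> S \<and> \<nu> p \<in> zero_locus G}"
proof -
  obtain M :: "complex^3^3" and D where MD: "invertible M" "finite D" "eval3 F (M *v axis 1 1) \<noteq> 0"
    "\<And>x. x \<notin> D \<Longrightarrow> card {g. eval3 F (M *v vector [g, x, 1]) = 0} = d" by (rule generic_pencil[OF hom sq d]) blast
  interpret pencil A \<nu> C d F M D by unfold_locales (use MD in auto)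
  show ?thesis by (rule component_polynomial_pencil[OF S]) (use that in blast)
qed

section \<open>Irreducible decompositions and the Zariski topology\<close>

lemma irreducible_set_family:
  assumes cl: "cl {}" "\<And>A B. cl A \<Longrightarrow> cl B \<Longrightarrow> cl (A \<inter> B)" "\<And>A B. cl A \<Longrightarrow> cl B \<Longrightarrow> cl (A \<union> B)"
    and T: "irreducible_set cl T" and I: "finite I" "\<And>i. i \<in> I \<Longrightarrow> cl (V i)" "T \<subseteq> (\<Union>i\<in>I. V i)"
  shows "\<exists>i\<in>I. T \<subseteq> V i"
  using I
proof (induction I rule: finite_induct)
  case empty
  then show ?case using T by (simp add: irreducible_set_def)
next
  case (insert j J)
  have "cl (\<Union>i\<in>J. V i)" using insert.hyps(1) insert.prems(1)
    by (induction J rule: finite_induct) (auto intro: cl)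
  then have c: "cl (T \<inter> V j)" "cl (T \<inter> (\<Union>i\<in>J. V i))"
    using T insert.prems(1) by (auto intro!: cl(2) simp: irreducible_set_def)
  have "T = (T \<inter> V j) \<union> (T \<inter> (\<Union>i\<in>J. V i))" using insert.prems(2) by auto
  then have "T = T \<inter> V j \<or> T = T \<inter> (\<Union>i\<in>J. V i)" using T c unfolding irreducible_set_def by blast
  then show ?case
  proof
    assume "T = T \<inter> V j"
    then have "T \<subseteq> V j" by (simp add: inf.absorb_iff1)
    then show ?thesis by simp
  next
    assume "T = T \<inter> (\<Union>i\<in>J. V i)"
    then have "T \<subseteq> (\<Union>i\<in>J. V i)" by (simp only: inf.absorb_iff1)
    then have "\<exists>i\<in>J. T \<subseteq> V i" using insert.IH insert.prems(1) by simp
    then show ?thesis by simp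
  qed
qed

text \<open>Used for Zariski closed sets in the plane and for analytic sets in the surface. An
  irreducible set inside a finite union of closed sets lies in one of them, so irreducible members
  without mutual inclusions are exactly the maximal ones.\<close>

lemma irr_components_family:
  assumes cl: "cl {}" "\<And>A B. cl A \<Longrightarrow> cl B \<Longrightarrow> cl (A \<inter> B)" "\<And>A B. cl A \<Longrightarrow> cl B \<Longrightarrow> cl (A \<union> B)"
    and I: "finite I" "\<And>i. i \<in> I \<Longrightarrow> irreducible_set cl (V i)" "(\<Union>i\<in>I. V i) = X"
    and ne: "\<And>i j. i \<in> I \<Longrightarrow> j \<in> I \<Longrightarrow> V i \<subseteq> V j \<Longrightarrow> i = j"
  shows "irr_components cl X = V ` I" "card (irr_components cl X) = card I"
proof -
  have clV: "\<And>i. i \<in> I \<Longrightarrow> cl (V i)" using I(2) by (simp add: irreducible_set_def)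
  note fam = irreducible_set_family[of cl, OF cl _ I(1) clV]
  show eq: "irr_components cl X = V ` I"
  proof (intro equalityI subsetI)
    fix T assume T: "T \<in> irr_components cl X"
    then have "irreducible_set cl T" "T \<subseteq> X" by (simp_all add: irr_components_def)
    then have "\<exists>i\<in>I. T \<subseteq> V i" by (intro fam) (simp_all add: I(3))
    then obtain i where i: "i \<in> I" "T \<subseteq> V i" by (elim bexE)
    have "V i \<subseteq> X" using I(3) i(1) by blast
    then have "V i = T" using T i I(2)[OF i(1)] by (simp add: irr_components_def)
    then show "T \<in> V ` I" using i(1) by blast
  next
    fix T assume "T \<in> V ` I"
    then obtain i where i: "i \<in> I" "T = V i" by blast
    have "T' = V i" if T': "irreducible_set cl T'" "V i \<subseteq> T'" "T' \<subseteq> X" for T'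
    proof -
      have "\<exists>i\<in>I. T' \<subseteq> V i" using T'(1,3) by (intro fam) (simp_all add: I(3))
      then obtain j where j: "j \<in> I" "T' \<subseteq> V j" by (elim bexE)
      then have "i = j" using ne[OF i(1) j(1)] T'(2) by blast
      then show ?thesis using j T'(2) by blast
    qed
    then show "T \<in> irr_components cl X" using I(2,3) i by (auto simp: irr_components_def)
  qed
  have "inj_on V I" by (rule inj_onI) (use ne in auto)
  then show "card (irr_components cl X) = card I" by (simp add: eq card_image)
qed

lemma zero_locus_mult:
  assumes "homogeneous m F" "homogeneous n G"
  shows "zero_locus (F * G) = zero_locus F \<union> zero_locus G"
proof (rule Set.set_eqI)
  fix P
  obtain y where y: "y \<noteq> 0" "P = pt y" by (rule pt_cases)
  show "P \<in> zero_locus (F * G) \<longleftrightarrow> P \<in> zero_locus F \<union> zero_locus G"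
    by (simp add: y(2) zero_locus_pt[OF homogeneous_mult[OF assms] y(1)] zero_locus_pt[OF assms(1) y(1)]
        zero_locus_pt[OF assms(2) y(1)] eval3_mult)
qed

lemma zariski_closed_zero_locus: "homogeneous n F \<Longrightarrow> zariski_closed (zero_locus F)"
  unfolding zariski_closed_def by (rule exI[of _ "{F}"]) auto

lemma zariski_closed_empty: "zariski_closed {}"
proof -
  have h: "homogeneous 0 1" by (rule homogeneousI) simp
  have "P \<notin> zero_locus 1" for P
  proof -
    obtain y where y: "y \<noteq> 0" "P = pt y" by (rule pt_cases)
    show ?thesis by (simp add: y(2) zero_locus_pt[OF h y(1)])
  qed
  then have "zero_locus 1 = {}" by blast
  then show ?thesis using zariski_closed_zero_locus[OF h] by simp
qed

lemma zariski_closed_Int: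
  assumes "zariski_closed A" "zariski_closed B" shows "zariski_closed (A \<inter> B)"
proof -
  obtain \<F> \<G> where FG: "\<forall>F\<in>\<F>. \<exists>n. homogeneous n F" "A = (\<Inter>F\<in>\<F>. zero_locus F)"
    "\<forall>F\<in>\<G>. \<exists>n. homogeneous n F" "B = (\<Inter>F\<in>\<G>. zero_locus F)"
    using assms by (auto simp: zariski_closed_def)
  then have "(\<forall>F\<in>\<F> \<union> \<G>. \<exists>n. homogeneous n F) \<and> A \<inter> B = (\<Inter>F\<in>\<F> \<union> \<G>. zero_locus F)" by blast
  then show ?thesis unfolding zariski_closed_def by blast
qed

lemma zariski_closed_Un:
  assumes "zariski_closed A" "zariski_closed B" shows "zariski_closed (A \<union> B)"
proof -
  obtain \<F> \<G> where FG: "\<forall>F\<in>\<F>. \<exists>n. homogeneous n F" "A = (\<Inter>F\<in>\<F>. zero_locus F)"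
    "\<forall>F\<in>\<G>. \<exists>n. homogeneous n F" "B = (\<Inter>F\<in>\<G>. zero_locus F)"
    using assms by (auto simp: zariski_closed_def)
  define \<H> where "\<H> = {F * G | F G. F \<in> \<F> \<and> G \<in> \<G>}"
  have m: "zero_locus (F * G) = zero_locus F \<union> zero_locus G" if "F \<in> \<F>" "G \<in> \<G>" for F G
    using FG(1,3) that zero_locus_mult by blast
  have "\<forall>F\<in>\<H>. \<exists>n. homogeneous n F"
    using FG(1,3) homogeneous_mult unfolding \<H>_def by blast
  moreover have "A \<union> B = (\<Inter>F\<in>\<H>. zero_locus F)"
  proof (intro equalityI subsetI)
    fix P assume "P \<in> A \<union> B"
    then show "P \<in> (\<Inter>F\<in>\<H>. zero_locus F)" using FG(2,4) m unfolding \<H>_def by auto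
  next
    fix P assume P: "P \<in> (\<Inter>F\<in>\<H>. zero_locus F)"
    show "P \<in> A \<union> B"
    proof (rule ccontr)
      assume "P \<notin> A \<union> B"
      then obtain F G where "F \<in> \<F>" "P \<notin> zero_locus F" "G \<in> \<G>" "P \<notin> zero_locus G" using FG(2,4) by auto
      then show False using P m[of F G] unfolding \<H>_def by blast
    qed
  qed
  ultimately show ?thesis unfolding zariski_closed_def by blast
qed

definition line3 :: "complex^3 \<Rightarrow> poly3" where
  "line3 b = monom3 (b $ 1) 1 0 0 + monom3 (b $ 2) 0 1 0 + monom3 (b $ 3) 0 0 1"

lemma eval3_line3: "eval3 (line3 b) x = bil b x"
  by (simp add: line3_def eval3_add eval3_monom3 bil_3)

lemma homogeneous_line3: "homogeneous 1 (line3 b)"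
  by (rule homogeneousI) (simp add: eval3_line3 bil_linear)

lemma zero_locus_line3: "b \<noteq> 0 \<Longrightarrow> P \<in> zero_locus (line3 b) \<longleftrightarrow> incident P (pt b)"
  by (rule pt_cases[of P]) (simp add: zero_locus_pt[OF homogeneous_line3] incident_pt eval3_line3)

text \<open>On a generic pencil line V has at least two points with the same x and different g, so a
  linear form vanishing on them has no g term. Two different values of x then remove the remaining
  terms.\<close>

lemma reduced_curve_not_in_line:
  assumes V: "reduced_plane_curve V n" "n \<ge> 2" and b: "b \<noteq> 0"
  shows "\<not> V \<subseteq> zero_locus (line3 b)"
proof
  assume sub: "V \<subseteq> zero_locus (line3 b)"
  obtain F where F: "homogeneous n F" "squarefree F" "V = zero_locus F" using V(1) by (auto simp: reduced_plane_curve_def)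
  obtain M :: "complex^3^3" and D where M: "invertible M" and D: "finite D"
    and card: "\<And>x. x \<notin> D \<Longrightarrow> card {g. eval3 F (M *v vector [g, x, 1]) = 0} = n"
    by (rule generic_pencil[OF F(1,2)]) (use V(2) in auto)
  define c where "c = b v* M"
  have c: "bil b (M *v y) = bil c y" for y by (simp add: c_def bil_vector_matrix)
  have zero: "c $ 1 = 0 \<and> c $ 2 * x + c $ 3 = 0" if x: "x \<notin> D" for x
  proof -
    have z: "c $ 1 * g + c $ 2 * x + c $ 3 = 0" if "eval3 F (M *v vector [g, x, 1]) = 0" for g
    proof -
      have ne: "M *v vector [g, x, 1] \<noteq> 0" using invertible_mult_0[OF M] vector3_nz by simp
      then have "pt (M *v vector [g, x, 1]) \<in> V" using that by (simp add: F(3) zero_locus_pt[OF F(1) ne])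
      then have "bil b (M *v vector [g, x, 1]) = 0"
        using sub zero_locus_pt[OF homogeneous_line3 ne] by (auto simp: eval3_line3)
      then show ?thesis unfolding c by (simp add: bil_3)
    qed
    define R where "R = {g. eval3 F (M *v vector [g, x, 1]) = 0}"
    have "card R \<ge> 2" using card[OF x] V(2) by (simp add: R_def)
    then have "finite R" "\<not> card R \<le> Suc 0" by (auto intro: ccontr)
    then obtain g h where "g \<in> R" "h \<in> R" "g \<noteq> h" using card_le_Suc0_iff_eq[of R] by blast
    then have gh: "g \<noteq> h" "eval3 F (M *v vector [g, x, 1]) = 0" "eval3 F (M *v vector [h, x, 1]) = 0"
      by (simp_all add: R_def)
    have "c $ 1 * (g - h) = (c $ 1 * g + c $ 2 * x + c $ 3) - (c $ 1 * h + c $ 2 * x + c $ 3)" by (simp add: algebra_simps)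
    also have "\<dots> = 0" by (simp only: z[OF gh(2)] z[OF gh(3)] diff_self)
    finally have "c $ 1 * (g - h) = 0" .
    then have "c $ 1 = 0" using gh(1) by simp
    then show ?thesis using z[OF gh(2)] by simp
  qed
  obtain x where x: "x \<notin> D" using ex_new_if_finite[OF infinite_UNIV_char_0 D] by auto
  obtain y where y: "y \<notin> insert x D" using ex_new_if_finite[OF infinite_UNIV_char_0, of "insert x D"] D by auto
  have "c $ 2 * (x - y) = (c $ 2 * x + c $ 3) - (c $ 2 * y + c $ 3)" by (simp add: algebra_simps)
  also have "\<dots> = 0" using zero[of x] zero[of y] x y by simp
  finally have "c $ 2 * (x - y) = 0" .
  then have "c $ 2 = 0" using y by auto
  then have "c = 0" using zero[OF x] by (simp add: vec_eq_iff forall_3)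
  then show False using b vector_matrix_mult_0[OF M] by (simp add: c_def)
qed

section \<open>Components of the curve as closures of images\<close>

context plane_curve
begin

text \<open>The Zariski closure of the image of S.\<close>

definition zcl :: "'a set \<Rightarrow> proj2 set" where
  "zcl S = (\<Inter>G\<in>{G. (\<exists>n. homogeneous n G) \<and> \<nu> ` S \<subseteq> zero_locus G}. zero_locus G)"

lemma zariski_closed_zcl: "zariski_closed (zcl S)"
  unfolding zariski_closed_def zcl_def
  by (rule exI[of _ "{G. (\<exists>n. homogeneous n G) \<and> \<nu> ` S \<subseteq> zero_locus G}"]) simp

lemma zcl_subset: "\<nu> ` S \<subseteq> zcl S" by (auto simp: zcl_def)

lemma zcl_zero_locus: "homogeneous n G \<Longrightarrow> \<nu> ` S \<subseteq> zero_locus G \<Longrightarrow> zcl S \<subseteq> zero_locus G"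
  unfolding zcl_def by blast

lemma zcl_least: "zariski_closed V \<Longrightarrow> \<nu> ` S \<subseteq> V \<Longrightarrow> zcl S \<subseteq> V"
  unfolding zariski_closed_def using zcl_zero_locus by blast

lemma component_vanishing:
  assumes S: "S \<in> components UNIV" and G: "homogeneous n G" and inf: "infinite {p \<in> S. \<nu> p \<in> zero_locus G}"
  shows "\<nu> ` S \<subseteq> zero_locus G"
  using vanishing_finite[OF G components_clopen(3,2)[OF S]] inf by blast

lemma infinite_component: "(S :: 'a set) \<in> components UNIV \<Longrightarrow> infinite S"
  using infinite_open[OF components_clopen(1)] components_clopen(4)[of S] by (metis ex_in_conv)

text \<open>A closed set that does not contain \<nu>(S) has only finitely many preimages in the
  connected set S, while S is infinite. So two closed sets that cover the image cannot both miss a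
  part of it.\<close>

lemma irreducible_zcl:
  assumes S: "S \<in> components UNIV" shows "irreducible_set zariski_closed (zcl S)"
  unfolding irreducible_set_def
proof (intro conjI allI impI)
  show "zariski_closed (zcl S)" by (rule zariski_closed_zcl)
  show "zcl S \<noteq> {}" using zcl_subset[of S] components_clopen(4)[OF S] by blast
  fix A B assume AB: "zariski_closed A \<and> zariski_closed B \<and> zcl S = A \<union> B"
  have fin: "finite {p \<in> S. \<nu> p \<in> V}" if V: "zariski_closed V" "\<not> \<nu> ` S \<subseteq> V" for V
  proof -
    obtain G n where G: "homogeneous n G" "V \<subseteq> zero_locus G" "\<not> \<nu> ` S \<subseteq> zero_locus G"
      using V unfolding zariski_closed_def by blast
    then have "finite {p \<in> S. \<nu> p \<in> zero_locus G}" using component_vanishing[OF S G(1)] by blast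
    then show ?thesis by (rule finite_subset[rotated]) (use G(2) in auto)
  qed
  have "S = {p \<in> S. \<nu> p \<in> A} \<union> {p \<in> S. \<nu> p \<in> B}" using zcl_subset[of S] AB by auto
  then have "\<nu> ` S \<subseteq> A \<or> \<nu> ` S \<subseteq> B" using fin AB infinite_component[OF S] by (metis finite_UnI)
  then have "zcl S \<subseteq> A \<or> zcl S \<subseteq> B" using zcl_least AB by meson
  then show "zcl S = A \<or> zcl S = B" using AB by blast
qed

text \<open>The finitely many closures cover C, and none contains another: the polynomial belonging
  to S' vanishes at only finitely many points outside S', whereas S is infinite.\<close>

lemma irr_components_C:
  "irr_components zariski_closed C = zcl ` components UNIV"
  "card (irr_components zariski_closed C) = card (components (UNIV :: 'a set))"
proof -
  have un: "(\<Union>S\<in>components UNIV. zcl S) = C"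
  proof
    have "zcl S \<subseteq> C" for S
      unfolding C by (rule zcl_zero_locus[OF hom]) (use range_\<nu> C in auto)
    then show "(\<Union>S\<in>components UNIV. zcl S) \<subseteq> C" by blast
    show "C \<subseteq> (\<Union>S\<in>components UNIV. zcl S)"
    proof
      fix P assume "P \<in> C"
      then obtain p where p: "P = \<nu> p" using range_\<nu> by blast
      have "p \<in> \<Union> (components UNIV)" by simp
      then obtain S where "S \<in> components UNIV" "p \<in> S" by (elim UnionE)
      then show "P \<in> (\<Union>S\<in>components UNIV. zcl S)" using zcl_subset[of S] p by blast
    qed
  qed
  have ne: "S = S'" if S: "S \<in> components UNIV" "S' \<in> components UNIV" "zcl S \<subseteq> zcl S'" for S S'
  proof (rule ccontr)
    assume "S \<noteq> S'"
    then have disj: "S \<inter> S' = {}" using components_nonoverlap[OF S(1,2)] by simp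
    obtain G e where G: "homogeneous e G" "\<And>p. p \<in> S' \<Longrightarrow> \<nu> p \<in> zero_locus G" "finite {p. p \<notin> S' \<and> \<nu> p \<in> zero_locus G}"
      by (rule component_polynomial[OF components_clopen(1,2)[OF S(2)]]) blast
    have "zcl S' \<subseteq> zero_locus G" by (rule zcl_zero_locus[OF G(1)]) (use G(2) in blast)
    then have "S \<subseteq> {p. p \<notin> S' \<and> \<nu> p \<in> zero_locus G}" using S(3) zcl_subset[of S] disj by blast
    then show False using G(3) infinite_component[OF S(1)] finite_subset by blast
  qed
  note fam = irr_components_family[of zariski_closed, OF zariski_closed_empty zariski_closed_Int zariski_closed_Un finite_components irreducible_zcl un ne]
  show "irr_components zariski_closed C = zcl ` components UNIV"
    "card (irr_components zariski_closed C) = card (components (UNIV :: 'a set))"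
    by (rule fam; simp)+
qed

end

locale dualizable_curve = plane_curve +
  assumes component_degree: "V \<in> irr_components zariski_closed C \<Longrightarrow> \<exists>n\<ge>2. reduced_plane_curve V n"
begin

lemma component_not_in_line:
  assumes S: "S \<in> components UNIV" and b: "b \<noteq> 0"
  shows "finite {p \<in> S. incident (\<nu> p) (pt b)}"
proof (rule ccontr)
  assume inf: "infinite {p \<in> S. incident (\<nu> p) (pt b)}"
  have "\<nu> ` S \<subseteq> zero_locus (line3 b)"
    by (rule component_vanishing[OF S homogeneous_line3]) (use inf in \<open>simp add: zero_locus_line3[OF b]\<close>)
  then have "zcl S \<subseteq> zero_locus (line3 b)" by (rule zcl_zero_locus[OF homogeneous_line3])
  moreover have "zcl S \<in> irr_components zariski_closed C" using irr_components_C(1) S by blast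
  ultimately show False using component_degree reduced_curve_not_in_line[OF _ _ b] by blast
qed

lemma finite_on_line: "b \<noteq> 0 \<Longrightarrow> finite {p. incident (\<nu> p) (pt b)}"
proof -
  assume b: "b \<noteq> 0"
  have "{p. incident (\<nu> p) (pt b)} = {p \<in> \<Union> (components UNIV). incident (\<nu> p) (pt b)}" by simp
  also have "\<dots> = (\<Union>S\<in>components UNIV. {p \<in> S. incident (\<nu> p) (pt b)})" by blast
  finally have "{p. incident (\<nu> p) (pt b)} = (\<Union>S\<in>components UNIV. {p \<in> S. incident (\<nu> p) (pt b)})" .
  then show ?thesis using finite_components component_not_in_line[OF _ b] by simp
qed

text \<open>Only finitely many points of the normalization map to a given line, so a linear form
  cannot vanish on a whole disc and therefore has an order at its centre.\<close>

sublocale ndcurve A \<nu>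
proof
  fix b :: "complex^3" and p assume b: "b \<noteq> 0"
  obtain G \<rho> \<psi> \<tau> u w where f: "frm p \<rho> \<psi> \<tau> G u w" by (rule frame_at)
  define c where "c = b v* matrix_inv G"
  have bc: "b = c v* G" unfolding c_def using vector_matrix_inv[OF frameD(2)[OF f]] by simp
  have c0: "c \<noteq> 0" using bc b vector_matrix_mult_0[OF frameD(2)[OF f]] by metis
  note disc = frameD(1)[OF f]
  have h: "(\<lambda>z. c $ 1 * u z + c $ 2 * w z + c $ 3) holomorphic_on ball 0 \<rho>"
    using frameD(3,4)[OF f] by (intro holomorphic_intros)
  have "\<exists>z\<in>ball 0 \<rho>. c $ 1 * u z + c $ 2 * w z + c $ 3 \<noteq> 0"
  proof (rule ccontr)
    assume "\<not> (\<exists>z\<in>ball 0 \<rho>. c $ 1 * u z + c $ 2 * w z + c $ 3 \<noteq> 0)"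
    then have "\<psi> ` ball 0 \<rho> \<subseteq> {q. incident (\<nu> q) (pt b)}"
      using frame_incident[OF f _ c0] unfolding bc by blast
    then have "finite (\<psi> ` ball 0 \<rho>)" using finite_on_line[OF b] finite_subset by blast
    then show False using infinite_open[OF discD(3)[OF disc], of p] discD(1,2)[OF disc] by force
  qed
  then obtain n where "hasord (\<lambda>z. c $ 1 * u z + c $ 2 * w z + c $ 3) n"
    using hasord_exists[OF h discD(1)[OF disc]] by blast
  then show "\<exists>n. vord A \<nu> p b n" using vord_frame[OF f, of c] unfolding bc by blast
qed

end

section \<open>Analytic subsets\<close>

lemma continuous_on_affine: "continuous_on S (\<lambda>s. y + s *s (v :: complex^'n))"
  by (rule continuous_on_vecI) (auto intro!: continuous_intros)

text \<open>Restriction to the complex line joining y and z: the preimage of the ball is convex, the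
  restricted function vanishes on a nonempty open set, and the identity theorem in one variable
  applies.\<close>

lemma cdiff_identity:
  fixes f :: "complex^'n \<Rightarrow> complex"
  assumes f: "\<And>x. x \<in> ball c r \<Longrightarrow> cdiff f x" and S: "open S" "S \<subseteq> ball c r" "y \<in> S" "\<And>x. x \<in> S \<Longrightarrow> f x = 0"
    and z: "z \<in> ball c r"
  shows "f z = 0"
proof -
  define e where "e s = y + s *s (z - y)" for s
  have ce: "continuous_on UNIV e" unfolding e_def by (rule continuous_on_affine)
  have cv: "convex (e -` ball c r)"
  proof (rule convexI)
    fix s t :: complex and a b :: real
    assume st: "s \<in> e -` ball c r" "t \<in> e -` ball c r" "0 \<le> a" "0 \<le> b" "a + b = 1"
    have "e (a *\<^sub>R s + b *\<^sub>R t) = a *\<^sub>R e s + b *\<^sub>R e t"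
    proof -
      have "complex_of_real a + complex_of_real b = 1" using st(5) by (metis of_real_1 of_real_add)
      then have ab: "complex_of_real a = 1 - complex_of_real b" by (simp add: algebra_simps)
      show ?thesis unfolding vec_eq_iff e_def
        by (simp only: vector_add_component vector_scaleR_component vector_smult_component)
          (simp add: scaleR_conv_of_real ab algebra_simps)
    qed
    then show "a *\<^sub>R s + b *\<^sub>R t \<in> e -` ball c r"
      using convexD[OF convex_ball, of "e s" c r "e t" a b] st by simp
  qed
  have hol: "(\<lambda>s. f (e s)) holomorphic_on e -` ball c r"
    unfolding holomorphic_on_def
  proof
    fix s assume "s \<in> e -` ball c r"
    then have fe: "cdiff f (e s)" using f by simp
    have "(\<lambda>s. e s $ j) field_differentiable at s" for j
      unfolding e_def vector_add_component vector_smult_component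
      by (intro field_differentiable_add field_differentiable_mult field_differentiable_const field_differentiable_ident)
    then have "(\<lambda>s. f (e s)) field_differentiable at s" by (rule field_differentiable_curve[where c=e and g=f]) (rule fe)
    then show "(\<lambda>s. f (e s)) field_differentiable at s within e -` ball c r" by (rule field_differentiable_at_within)
  qed
  have e01: "e 0 = y" "e 1 = z" by (simp_all add: e_def)
  have "f (e 1) = 0"
  proof (rule analytic_continuation_open[where s="e -` S" and s'="e -` ball c r" and f="\<lambda>s. f (e s)" and g="\<lambda>_. 0" and z=1])
    show "open (e -` S)" "open (e -` ball c r)" using ce S(1) by (auto intro: open_vimage)
    show "e -` S \<noteq> {}" using e01(1) S(3) by auto
    show "connected (e -` ball c r)" by (rule convex_connected[OF cv])
    show "e -` S \<subseteq> e -` ball c r" using S(2) by auto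
    show "1 \<in> e -` ball c r" using e01(2) z by simp
  qed (use hol S(4) in auto)
  then show ?thesis by (simp add: e01)
qed

lemma analytic_subsetE:
  assumes "analytic_subset A W N" "x \<in> W"
  obtains U H where "mopen A U" "x \<in> U" "U \<subseteq> W" "finite H" "\<forall>h\<in>H. hol_fun A U h" "N \<inter> U = {y \<in> U. \<forall>h\<in>H. h y = 0}"
proof -
  have "\<exists>U H. mopen A U \<and> x \<in> U \<and> U \<subseteq> W \<and> finite H \<and> (\<forall>h\<in>H. hol_fun A U h) \<and> N \<inter> U = {y \<in> U. \<forall>h\<in>H. h y = 0}"
    using assms unfolding analytic_subset_def by (elim conjE bspec)
  then show ?thesis using that by (elim exE conjE)
qed

lemma analytic_subsetI:
  assumes "mopen A W" "N \<subseteq> W"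
    and "\<And>x. x \<in> W \<Longrightarrow> \<exists>U H. mopen A U \<and> x \<in> U \<and> U \<subseteq> W \<and> finite H \<and> (\<forall>h\<in>H. hol_fun A U h) \<and> N \<inter> U = {y \<in> U. \<forall>h\<in>H. h y = 0}"
  shows "analytic_subset A W N"
  unfolding analytic_subset_def by (intro conjI ballI assms)

lemma mopen_Union: "(\<And>S. S \<in> \<S> \<Longrightarrow> mopen A S) \<Longrightarrow> mopen A (\<Union>\<S>)"
  unfolding mopen_def by (rule openin_Union)

lemma mopen_Int: "mopen A S \<Longrightarrow> mopen A T \<Longrightarrow> mopen A (S \<inter> T)"
  unfolding mopen_def by (rule openin_Int)

lemma analytic_subset_restrict:
  assumes N: "analytic_subset A W N" and W': "mopen A W'" "W' \<subseteq> W"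
  shows "analytic_subset A W' (N \<inter> W')"
  unfolding analytic_subset_def
proof (intro conjI ballI W'(1))
  show "N \<inter> W' \<subseteq> W'" by blast
  fix x assume x: "x \<in> W'"
  then obtain U H where U: "mopen A U" "x \<in> U" "U \<subseteq> W" "finite H" "\<forall>h\<in>H. hol_fun A U h" "N \<inter> U = {y \<in> U. \<forall>h\<in>H. h y = 0}"
    by (rule analytic_subsetE[OF N subsetD[OF W'(2)]])
  have "mopen A (U \<inter> W')" by (rule mopen_Int[OF U(1) W'(1)])
  moreover have "\<forall>h\<in>H. hol_fun A (U \<inter> W') h" using U(5) by (simp add: hol_fun_iff)
  moreover have "N \<inter> W' \<inter> (U \<inter> W') = {y \<in> U \<inter> W'. \<forall>h\<in>H. h y = 0}" using U(6) by blast
  ultimately show "\<exists>U H. mopen A U \<and> x \<in> U \<and> U \<subseteq> W' \<and> finite H \<and> (\<forall>h\<in>H. hol_fun A U h) \<and>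
      N \<inter> W' \<inter> U = {y \<in> U. \<forall>h\<in>H. h y = 0}" using U(2,4) x by blast
qed

lemma analytic_subset_empty:
  assumes W: "mopen A W" shows "analytic_subset A W {}"
proof (rule analytic_subsetI[OF W])
  fix x assume x: "x \<in> W"
  have "hol_fun A W (\<lambda>_. 1)" by (simp add: hol_fun_iff function_ring.const[OF holat_ring])
  then show "\<exists>U H. mopen A U \<and> x \<in> U \<and> U \<subseteq> W \<and> finite H \<and> (\<forall>h\<in>H. hol_fun A U h) \<and> {} \<inter> U = {y \<in> U. \<forall>h\<in>H. h y = 0}"
    using W x by (intro exI[of _ W] exI[of _ "{\<lambda>_. 1}"]) simp
qed simp

lemma analytic_subset_Int:
  assumes M: "analytic_subset A W M" and N: "analytic_subset A W N"
  shows "analytic_subset A W (M \<inter> N)"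
  unfolding analytic_subset_def
proof (intro conjI ballI)
  show "mopen A W" "M \<inter> N \<subseteq> W" using M by (auto simp: analytic_subset_def)
  fix x assume x: "x \<in> W"
  obtain U H where U: "mopen A U" "x \<in> U" "U \<subseteq> W" "finite H" "\<forall>h\<in>H. hol_fun A U h" "M \<inter> U = {y \<in> U. \<forall>h\<in>H. h y = 0}"
    by (rule analytic_subsetE[OF M x])
  obtain V K where V: "mopen A V" "x \<in> V" "V \<subseteq> W" "finite K" "\<forall>h\<in>K. hol_fun A V h" "N \<inter> V = {y \<in> V. \<forall>h\<in>K. h y = 0}"
    by (rule analytic_subsetE[OF N x])
  have "mopen A (U \<inter> V)" by (rule mopen_Int[OF U(1) V(1)])
  moreover have "\<forall>h\<in>H \<union> K. hol_fun A (U \<inter> V) h" using U(5) V(5) by (auto simp: hol_fun_iff)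
  moreover have "M \<inter> N \<inter> (U \<inter> V) = {y \<in> U \<inter> V. \<forall>h\<in>H \<union> K. h y = 0}" using U(6) V(6) by blast
  ultimately show "\<exists>U H. mopen A U \<and> x \<in> U \<and> U \<subseteq> W \<and> finite H \<and> (\<forall>h\<in>H. hol_fun A U h) \<and>
      M \<inter> N \<inter> U = {y \<in> U. \<forall>h\<in>H. h y = 0}"
    using U(2,3,4) V(2,4) by (intro exI[of _ "U \<inter> V"] exI[of _ "H \<union> K"]) auto
qed

lemma analytic_subset_Un:
  assumes M: "analytic_subset A W M" and N: "analytic_subset A W N"
  shows "analytic_subset A W (M \<union> N)"
  unfolding analytic_subset_def
proof (intro conjI ballI)
  show "mopen A W" "M \<union> N \<subseteq> W" using M N by (auto simp: analytic_subset_def)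
  fix x assume x: "x \<in> W"
  obtain U H where U: "mopen A U" "x \<in> U" "U \<subseteq> W" "finite H" "\<forall>h\<in>H. hol_fun A U h" "M \<inter> U = {y \<in> U. \<forall>h\<in>H. h y = 0}"
    by (rule analytic_subsetE[OF M x])
  obtain V K where V: "mopen A V" "x \<in> V" "V \<subseteq> W" "finite K" "\<forall>h\<in>K. hol_fun A V h" "N \<inter> V = {y \<in> V. \<forall>h\<in>K. h y = 0}"
    by (rule analytic_subsetE[OF N x])
  define L where "L = (\<lambda>(h, k) y. h y * k y) ` (H \<times> K)"
  have "mopen A (U \<inter> V)" by (rule mopen_Int[OF U(1) V(1)])
  moreover have "\<forall>h\<in>L. hol_fun A (U \<inter> V) h"
    using U(5) V(5) by (auto simp: hol_fun_iff L_def intro!: function_ring.mult[OF holat_ring])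
  moreover have "(M \<union> N) \<inter> (U \<inter> V) = {y \<in> U \<inter> V. \<forall>h\<in>L. h y = 0}"
  proof (rule Set.set_eqI)
    fix y
    have "(\<forall>h\<in>L. h y = 0) \<longleftrightarrow> (\<forall>h\<in>H. h y = 0) \<or> (\<forall>k\<in>K. k y = 0)" by (auto simp: L_def)
    then show "y \<in> (M \<union> N) \<inter> (U \<inter> V) \<longleftrightarrow> y \<in> {y \<in> U \<inter> V. \<forall>h\<in>L. h y = 0}"
      using U(6) V(6) by blast
  qed
  moreover have "finite L" using U(4) V(4) by (simp add: L_def)
  ultimately show "\<exists>U H. mopen A U \<and> x \<in> U \<and> U \<subseteq> W \<and> finite H \<and> (\<forall>h\<in>H. hol_fun A U h) \<and>
      (M \<union> N) \<inter> U = {y \<in> U. \<forall>h\<in>H. h y = 0}"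
    using U(2,3) V(2) by (intro exI[of _ "U \<inter> V"] exI[of _ L]) auto
qed

context
  fixes A :: "('a::t2_space, 'n::finite) atlas"
  assumes A: "complex_manifold A"
begin

text \<open>B is a ball in a chart on which N has finitely many equations. If N contains an open
  piece of it, every equation vanishes on the whole ball.\<close>

lemma analytic_subset_local_identity:
  assumes N: "analytic_subset A W N" and x: "x \<in> W"
  obtains B where "mopen A B" "x \<in> B" "B \<subseteq> W" "\<forall>S. mopen A S \<longrightarrow> S \<noteq> {} \<longrightarrow> S \<subseteq> N \<inter> B \<longrightarrow> B \<subseteq> N"
proof -
  obtain U H where U: "mopen A U" "x \<in> U" "U \<subseteq> W" "finite H" "\<forall>h\<in>H. hol_fun A U h" "N \<inter> U = {y \<in> U. \<forall>h\<in>H. h y = 0}"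
    by (rule analytic_subsetE[OF N x])
  have "x \<in> mfd_points A" using U(1,2) openin_imp_subset unfolding mopen_def by blast
  then obtain V \<phi> where V: "(V, \<phi>) \<in> A" "x \<in> V" by (rule chart_ex[OF A])
  note c = chartD[OF A V(1)]
  have "open (\<phi> ` (V \<inter> U))" by (rule chart_image_open[OF A V(1) U(1)])
  moreover have "\<phi> x \<in> \<phi> ` (V \<inter> U)" using V(2) U(2) by blast
  ultimately obtain r where r: "r > 0" "ball (\<phi> x) r \<subseteq> \<phi> ` (V \<inter> U)" unfolding open_contains_ball by blast
  define B where "B = V \<inter> \<phi> -` ball (\<phi> x) r"
  have "continuous_on V \<phi>" using c(3) by (simp add: homeomorphism_def)
  then have "openin (top_of_set V) B" unfolding B_def by (intro continuous_openin_preimage_gen) auto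
  then have B: "mopen A B" using openin_trans c(1) unfolding mopen_def by blast
  have inv: "inv_into V \<phi> (\<phi> y) = y" if "y \<in> V" for y by (rule chart_inv[OF A V(1) that])
  have BU: "B \<subseteq> U"
  proof
    fix y assume y: "y \<in> B"
    then obtain y' where "y' \<in> V \<inter> U" "\<phi> y = \<phi> y'" using r(2) unfolding B_def by auto
    then show "y \<in> U" using inv y unfolding B_def by (metis Int_iff)
  qed
  have "B \<subseteq> N" if S: "mopen A S" "S \<noteq> {}" "S \<subseteq> N \<inter> B" for S
  proof
    fix y assume y: "y \<in> B"
    have "h y = 0" if h: "h \<in> H" for h
    proof -
      have cd: "cdiff (\<lambda>z. h (inv_into V \<phi> z)) z" if z: "z \<in> ball (\<phi> x) r" for z
      proof -
        obtain q where q: "q \<in> V" "q \<in> U" "z = \<phi> q" using r(2) z by auto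
        have "holat A h q" using U(5) h q(2) by (simp add: hol_fun_iff)
        then show ?thesis using V(1) q(1) unfolding holat_def q(3) by blast
      qed
      obtain s where s: "s \<in> S" using S(2) by blast
      have SV: "S \<subseteq> V" using S(3) by (auto simp: B_def)
      have "h (inv_into V \<phi> (\<phi> y)) = 0"
      proof (rule cdiff_identity[where c="\<phi> x" and r=r and S="\<phi> ` (V \<inter> S)" and f="\<lambda>z. h (inv_into V \<phi> z)" and y="\<phi> s"])
        show "open (\<phi> ` (V \<inter> S))" by (rule chart_image_open[OF A V(1) S(1)])
        show "\<phi> ` (V \<inter> S) \<subseteq> ball (\<phi> x) r" using S(3) by (auto simp: B_def)
        show "\<phi> s \<in> \<phi> ` (V \<inter> S)" using s SV by blast
        show "h (inv_into V \<phi> z) = 0" if z: "z \<in> \<phi> ` (V \<inter> S)" for z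
        proof -
          obtain q where q: "q \<in> V" "q \<in> S" "z = \<phi> q" using z by auto
          have "q \<in> N \<inter> U" using q(2) S(3) BU by auto
          then show ?thesis using U(6) h inv[OF q(1)] q(3) by auto
        qed
        show "\<phi> y \<in> ball (\<phi> x) r" using y by (simp add: B_def)
      qed (rule cd)
      then show ?thesis using inv y by (simp add: B_def)
    qed
    then show "y \<in> N" using U(6) BU y by blast
  qed
  moreover have "x \<in> B" using V(2) r(1) by (simp add: B_def)
  ultimately show ?thesis using that[OF B] BU U(3) by blast
qed

text \<open>The union I of the open sets inside N is also closed in W: the neighbourhood from the
  local identity theorem would lie in N as soon as it met I.\<close>

lemma analytic_subset_identity:
  assumes W: "connected W" and N: "analytic_subset A W N" and S: "mopen A S" "S \<noteq> {}" "S \<subseteq> N"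
  shows "N = W"
proof -
  define I where "I = \<Union>{S. mopen A S \<and> S \<subseteq> N}"
  have mW: "mopen A W" and NW: "N \<subseteq> W" using N by (simp_all add: analytic_subset_def)
  have I: "mopen A I" unfolding I_def by (rule mopen_Union) simp
  have IN: "I \<subseteq> N" by (auto simp: I_def)
  have "\<exists>B. mopen A B \<and> x \<in> B \<and> B \<subseteq> W - I" if x: "x \<in> W - I" for x
  proof -
    have xW: "x \<in> W" using x by simp
    obtain B where B: "mopen A B" "x \<in> B" "B \<subseteq> W" "\<forall>S. mopen A S \<longrightarrow> S \<noteq> {} \<longrightarrow> S \<subseteq> N \<inter> B \<longrightarrow> B \<subseteq> N"
      by (rule analytic_subset_local_identity[OF N xW])
    have "B \<inter> I = {}"
    proof (rule ccontr)
      assume "B \<inter> I \<noteq> {}"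
      moreover have "mopen A (B \<inter> I)" by (rule mopen_Int[OF B(1) I])
      moreover have "B \<inter> I \<subseteq> N \<inter> B" using IN by blast
      ultimately have "B \<subseteq> N" using B(4) by blast
      then have "x \<in> I" using B(1,2) by (auto simp: I_def)
      then show False using x by simp
    qed
    then show ?thesis using B by blast
  qed
  then have "W - I = \<Union>{B. mopen A B \<and> B \<subseteq> W - I}" by blast
  moreover have "mopen A (\<Union>{B. mopen A B \<and> B \<subseteq> W - I})" by (rule mopen_Union) simp
  ultimately have m: "mopen A (W - I)" by simp
  have WM: "W \<subseteq> mfd_points A" using mW openin_imp_subset unfolding mopen_def by blast
  have IW: "I \<subseteq> W" using IN NW by blast
  have "openin (top_of_set W) I" using I IW WM unfolding mopen_def by (metis openin_subset_trans)
  moreover have "openin (top_of_set W) (W - I)" using m WM unfolding mopen_def by (metis Diff_subset openin_subset_trans)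
  then have "closedin (top_of_set W) I" using IW by (simp add: closedin_def)
  ultimately have "I = {} \<or> I = W" using W unfolding connected_clopen by blast
  moreover have "I \<noteq> {}" using S by (auto simp: I_def)
  ultimately show ?thesis using IN NW by blast
qed

text \<open>A proper analytic subset of a connected set contains no nonempty open set. This supplies
  the density of the generic lines.\<close>

lemma analytic_subset_thin:
  assumes W: "connected W" and N: "analytic_subset A W N" "N \<noteq> W" and W': "mopen A W'" "W' \<subseteq> W"
  shows "W' \<subseteq> closure (W' - N)"
proof
  fix x assume x: "x \<in> W'"
  show "x \<in> closure (W' - N)"
    unfolding closure_iff_nhds_not_empty
  proof (intro allI impI notI)
    fix S V assume V: "V \<subseteq> S" "open V" "x \<in> V" "(W' - N) \<inter> S = {}"
    have "mopen A (W' \<inter> V)" using W'(1) V(2) by (auto simp: mopen_def openin_open)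
    moreover have "W' \<inter> V \<noteq> {}" "W' \<inter> V \<subseteq> N" using x V by auto
    ultimately show False using analytic_subset_identity[OF W N(1)] N(2) by blast
  qed
qed

lemma analytic_subset_Diff_open:
  assumes N: "analytic_subset A W N" shows "mopen A (W - N)"
proof -
  have "\<exists>B. mopen A B \<and> x \<in> B \<and> B \<subseteq> W - N" if x: "x \<in> W - N" for x
  proof -
    have xW: "x \<in> W" using x by simp
    obtain U H where U: "mopen A U" "x \<in> U" "U \<subseteq> W" "finite H" "\<forall>h\<in>H. hol_fun A U h" "N \<inter> U = {y \<in> U. \<forall>h\<in>H. h y = 0}"
      by (rule analytic_subsetE[OF N xW])
    have "x \<in> U - N" using U(2) x by simp
    then have "\<not> (\<forall>h\<in>H. h x = 0)" using U(2,6) by blast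
    then obtain h where h: "h \<in> H" "h x \<noteq> 0" by blast
    have "continuous_on U h" using U(1,5) h(1) by (intro holat_continuous_on[OF A]) (auto simp: hol_fun_iff)
    then have "openin (top_of_set U) (U \<inter> h -` (-{0}))" by (intro continuous_openin_preimage_gen) auto
    then have "mopen A (U \<inter> h -` (-{0}))" using U(1) openin_trans unfolding mopen_def by blast
    moreover have "U \<inter> h -` (-{0}) \<subseteq> W - N" using U(3,6) h(1) by auto
    ultimately show ?thesis using U(2) h(2) by (intro exI[of _ "U \<inter> h -` (-{0})"]) simp
  qed
  then have "W - N = \<Union>{B. mopen A B \<and> B \<subseteq> W - N}" by blast
  moreover have "mopen A (\<Union>{B. mopen A B \<and> B \<subseteq> W - N})" by (rule mopen_Union) simp
  ultimately show ?thesis by simp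
qed

end

section \<open>The product of the plane with its dual and the incidence relation\<close>

lemma connected_UNIV_proj2: "connected (UNIV :: proj2 set)"
proof -
  have "connected (- {0 :: complex^3})" by (rule connected_punctured_universe) simp
  then have "connected (pt ` (- {0}))" by (rule connected_continuous_image[OF continuous_on_pt])
  moreover have "pt ` (- {0}) = UNIV" using pt_cases by blast
  ultimately show ?thesis by simp
qed

abbreviation (input) PP2 :: "(proj2 \<times> proj2, 2 + 2) atlas" where "PP2 \<equiv> prod_atlas proj2_atlas proj2_atlas"

lemma PP2: "complex_manifold PP2" "mfd_points PP2 = UNIV"
  by (simp_all add: complex_manifold_prod[OF complex_manifold_proj2 complex_manifold_proj2] mfd_points_prod)

lemma mopen_PP2 [simp]: "mopen PP2 W \<longleftrightarrow> open W" by (simp add: mopen_def PP2(2))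

lemma pdom_ex: "\<exists>i. P \<in> pdom i"
proof -
  obtain x where x: "x \<noteq> 0" "P = pt x" by (rule pt_cases)
  then obtain i where "x $ i \<noteq> 0" by (auto simp: vec_eq_iff)
  then show ?thesis using x pdom_pt by blast
qed

lemma holat_psec:
  assumes P: "P \<in> pdom i" shows "holat proj2_atlas (\<lambda>P. psec i (pchart i P) $ k) P"
proof -
  have c: "(pdom i, pchart i) \<in> proj2_atlas" by (auto simp: proj2_atlas_eq)
  note h = holat_chart_coord[OF complex_manifold_proj2 c P]
  have "k = i \<or> k = i + 1 \<or> k = i + 2" using index3(4) by blast
  then show ?thesis using h function_ring.const[OF holat_ring] by auto
qed

lemma hol_map_PP2_fst: "hol_map PP2 proj2_atlas UNIV fst" "hol_map PP2 proj2_atlas UNIV snd"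
  using hol_map_fst[OF complex_manifold_proj2 complex_manifold_proj2] hol_map_snd[OF complex_manifold_proj2 complex_manifold_proj2]
  by (simp_all add: PP2(2))

lemma holat_PP2:
  shows "holat proj2_atlas h (fst q) \<Longrightarrow> holat PP2 (\<lambda>q. h (fst q)) q" "holat proj2_atlas h (snd q) \<Longrightarrow> holat PP2 (\<lambda>q. h (snd q)) q"
  by (rule holat_compose[OF PP2(1) complex_manifold_proj2 _ _ hol_map_PP2_fst(1)]; simp)
     (rule holat_compose[OF PP2(1) complex_manifold_proj2 _ _ hol_map_PP2_fst(2)]; simp)

lemma incident_iff_bil: "P \<in> pdom i \<Longrightarrow> l \<in> pdom j \<Longrightarrow> incident P l \<longleftrightarrow> bil (psec j (pchart j l)) (psec i (pchart i P)) = 0"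
  using incident_pt[OF psec_nz psec_nz, of i "pchart i P" j "pchart j l"] by (simp add: pt_psec_pchart)

lemma analytic_incidence: "analytic_subset PP2 UNIV {(P, l). incident P l}"
proof (rule analytic_subsetI)
  fix q :: "proj2 \<times> proj2"
  obtain i j where ij: "fst q \<in> pdom i" "snd q \<in> pdom j" using pdom_ex by blast
  define h where "h q = bil (psec j (pchart j (snd q))) (psec i (pchart i (fst q)))" for q
  have "holat PP2 h q" if "q \<in> pdom i \<times> pdom j" for q
  proof -
    interpret function_ring "\<lambda>f. holat PP2 f q" by (rule holat_ring)
    show ?thesis
      unfolding h_def bil_3
      by (intro add mult holat_PP2(1)[where h="\<lambda>P. psec i (pchart i P) $ k" for k]
        holat_PP2(2)[where h="\<lambda>P. psec j (pchart j P) $ k" for k] holat_psec) (use that in auto)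
  qed
  moreover have "{(P, l). incident P l} \<inter> pdom i \<times> pdom j = {q \<in> pdom i \<times> pdom j. h q = 0}"
    by (auto simp: h_def incident_iff_bil)
  ultimately show "\<exists>U H. mopen PP2 U \<and> q \<in> U \<and> U \<subseteq> UNIV \<and> finite H \<and> (\<forall>h\<in>H. hol_fun PP2 U h) \<and>
      {(P, l). incident P l} \<inter> U = {y \<in> U. \<forall>h\<in>H. h y = 0}"
    using ij by (intro exI[of _ "pdom i \<times> pdom j"] exI[of _ "{h}"]) (auto simp: hol_fun_iff open_Times open_pdom mem_Times_iff)
qed simp_all

lemma closed_incidence: "closed {(P, l). incident P l}"
  using analytic_subset_Diff_open[OF PP2(1) analytic_incidence] by (simp add: closed_def Compl_eq_Diff_UNIV)

section \<open>Coordinates on the dual plane\<close>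

text \<open>Columns of the inverse matrix. As forms on lines they read off coordinates,
  \<open>bil (lcol G i) (b v* G) = b $ i\<close>, so that \<open>lc G 2\<close> and
  \<open>lc G 3\<close> are affine coordinates on the lines with nonzero first coefficient.\<close>

definition lcol :: "complex^3^3 \<Rightarrow> 3 \<Rightarrow> complex^3" where "lcol G i = matrix_inv G *v axis i 1"

definition ldom :: "complex^3^3 \<Rightarrow> proj2 set" where "ldom G = offline (lcol G 1)"

definition lc :: "complex^3^3 \<Rightarrow> 3 \<Rightarrow> proj2 \<Rightarrow> complex" where "lc G i = ratio (lcol G i) (lcol G 1)"

definition lin :: "complex^3^3 \<Rightarrow> complex \<Rightarrow> complex \<Rightarrow> proj2" where "lin G m k = pt (vector [1, m, k] v* G)"

lemma lin_row: "lin G 0 0 = pt (G $ 1)"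
proof -
  have "axis 1 1 = (vector [1, 0, 0] :: complex^3)" by (simp add: vec_eq_iff forall_3 axis_def)
  then show ?thesis using row_vector_matrix[of G 1] by (simp add: lin_def)
qed

lemma bil_commute: "bil a b = bil b a"
  by (simp add: bil_3 mult.commute)

lemma bil_axis: "bil b (axis i 1) = b $ i"
  unfolding bil_def axis_def by (simp add: if_distrib cong: if_cong)

lemma bil_lcol: "invertible G \<Longrightarrow> bil (lcol G i) (b v* G) = b $ i"
  by (subst bil_commute, subst bil_vector_matrix) (simp add: lcol_def matrix_inv(3) bil_axis)

lemma vector_1_nz: "vector [1, m, k] \<noteq> (0 :: complex^3)"
  by (simp add: vec_eq_iff forall_3)

lemma lin_nz: "invertible G \<Longrightarrow> vector [1, m, k] v* (G :: complex^3^3) \<noteq> 0"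
  by (simp add: vector_matrix_mult_0 vector_1_nz)

lemma ldom_pt:
  assumes G: "invertible G" and b: "b \<noteq> 0"
  shows "pt (b v* G) \<in> ldom G \<longleftrightarrow> b $ 1 \<noteq> 0" "lc G i (pt (b v* G)) = b $ i / b $ 1"
proof -
  have nz: "b v* G \<noteq> 0" using b by (simp add: vector_matrix_mult_0[OF G])
  show "pt (b v* G) \<in> ldom G \<longleftrightarrow> b $ 1 \<noteq> 0" unfolding ldom_def offline_pt[OF nz] bil_lcol[OF G] ..
  show "lc G i (pt (b v* G)) = b $ i / b $ 1" unfolding lc_def ratio_pt[OF nz] bil_lcol[OF G] ..
qed

lemma lin_coords [simp]:
  assumes G: "invertible G"
  shows "lin G m k \<in> ldom G" "lc G 2 (lin G m k) = m" "lc G 3 (lin G m k) = k"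
  unfolding lin_def by (simp_all add: ldom_pt[OF G vector_1_nz])

lemma scaleC_vector_matrix: "(c *s b) v* G = c *s (b v* (G :: complex^3^3))"
  by (simp add: vec_eq_iff vector_matrix_mult_def sum_distrib_left mult_ac)

lemma pt_row_cases:
  assumes G: "invertible (G :: complex^3^3)"
  obtains b where "b \<noteq> 0" "l = pt (b v* G)"
proof -
  obtain a where a: "a \<noteq> 0" "l = pt a" by (rule pt_cases)
  show ?thesis
    by (rule that[of "a v* matrix_inv G"]) (simp_all add: vector_matrix_mult_0[OF matrix_inv(5)[OF G]] vector_matrix_inv[OF G] a)
qed

lemma lin_lc:
  assumes G: "invertible G" and l: "l \<in> ldom G"
  shows "lin G (lc G 2 l) (lc G 3 l) = l"
proof -
  obtain b where b: "b \<noteq> 0" "l = pt (b v* G)" by (rule pt_row_cases[OF G])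
  have b1: "b $ 1 \<noteq> 0" using l ldom_pt(1)[OF G b(1)] b(2) by simp
  have "vector [1, b $ 2 / b $ 1, b $ 3 / b $ 1] = (1 / b $ 1) *s b" using b1 by (simp add: vec_eq_iff forall_3)
  then show ?thesis
    unfolding lin_def b(2) ldom_pt(2)[OF G b(1)] using b1 by (simp add: scaleC_vector_matrix pt_scale)
qed

lemma open_ldom: "open (ldom G)" by (simp add: ldom_def open_offline)

lemma holat_lc: "l \<in> ldom G \<Longrightarrow> holat proj2_atlas (lc G i) l"
  unfolding ldom_def lc_def by (rule holat_ratio)

lemma continuous_lc: "continuous_on (ldom G) (lc G i)"
  using holat_continuous_on[OF complex_manifold_proj2, of "ldom G" "lc G i"] holat_lc open_ldom by simp

lemma frame_incident_lin:
  assumes f: "frame A \<nu> p \<rho> \<psi> \<tau> G u w" and z: "z \<in> ball 0 \<rho>"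
  shows "incident (\<nu> (\<psi> z)) (lin G m k) \<longleftrightarrow> u z + m * w z + k = 0"
  unfolding lin_def frame_incident[OF f z vector_1_nz] by simp

section \<open>Exceptional lines in the dual plane\<close>

context dualizable_curve
begin

lemma finite_curve_line: "finite {P \<in> C. incident P l}"
proof -
  obtain b where b: "b \<noteq> 0" "l = pt b" by (rule pt_cases)
  have "{P \<in> C. incident P l} = \<nu> ` {p. incident (\<nu> p) (pt b)}" using range_\<nu> b(2) by auto
  then show ?thesis using finite_on_line[OF b(1)] by simp
qed

lemma line_frame_ex:
  assumes b: "b \<noteq> 0"
  obtains G :: "complex^3^3" where "invertible G" "G $ 1 = b" "eval3 F (matrix_inv G *v vector [0, 1, 0]) \<noteq> 0"
proof -
  define v where "v = (if b $ 1 = 0 \<and> b $ 2 = 0 then axis 1 1 else vector [- b $ 2, b $ 1, 0] :: complex^3)"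
  have v: "v \<noteq> 0" "bil b v = 0" by (auto simp: v_def bil_3 vec_eq_iff forall_3 axis_def)
  have "finite (line_points b)" using finite_curve_line by (simp add: line_points_def)
  then show ?thesis by (rule line_frame[OF b v]) (rule that)
qed

text \<open>The set removed in the generic statements about f: the same thin set serves for the
  covering and for all local degrees.\<close>

definition Tset :: "proj2 set" where "Tset = {l. card {P \<in> C. incident P l} \<noteq> d}"

text \<open>In the coordinates G the line (1 : m : k) passes through (-k, 0, 1) with direction (-m,
  1, 0). The hypothesis keeps its point at infinity off C, so the discriminant of nominal degree d
  decides the number of points.\<close>

lemma card_line_lin:
  assumes G: "invertible G" and m: "eval3 F (matrix_inv G *v vector [-m, 1, 0]) \<noteq> 0"
  shows "lin G m k \<in> Tset \<longleftrightarrow> discr d (lineP F (matrix_inv G *v vector [-k, 0, 1]) (matrix_inv G *v vector [-m, 1, 0])) = 0"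
proof -
  define b where "b = vector [1, m, k] v* G"
  define x v where "x = matrix_inv G *v vector [-k, 0, 1]" and "v = matrix_inv G *v vector [-m, 1, 0]"
  \<comment> \<open>Replacing the first row by the line itself does not change the determinant and
    brings the line into the form required by \<open>line_points_param\<close>.\<close>
  define E :: "complex^3^3" where "E = vector [b, G $ 2, G $ 3]"
  have E1: "E $ 1 = b" by (simp add: E_def)
  have "det E = det G"
    by (simp add: E_def det_3 b_def vector_matrix_mult_def sum_3 algebra_simps)
  then have E: "invertible E" using G by (simp add: invertible_det_nz)
  have Gx: "G *v x = vector [-k, 0, 1]" "G *v v = vector [-m, 1, 0]"
    unfolding x_def v_def by (rule matrix_inv(3)[OF G])+
  have g: "bil (G $ i) (x + t *s v) = (vector [-k, 0, 1] :: complex^3) $ i + t * (vector [-m, 1, 0] :: complex^3) $ i" for t i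
    unfolding bil_linear matrix_vector_row[symmetric] Gx by simp
  have "G *v (x + t *s v) = vector [-k, 0, 1] + t *s vector [-m, 1, 0]" for t
    by (simp only: matrix_vector_right_distrib vector_scalar_commute Gx)
  then have b': "bil b (x + t *s v) = 0" for t
    unfolding b_def bil_vector_matrix by (simp add: bil_3)
  have "E *v (x + t *s v) = vector [0, t, 1]" for t
    by (simp add: vec_eq_iff forall_3 matrix_vector_row E_def b' g)
  then have iE: "matrix_inv E *v vector [0, t, 1] = x + t *s v" for t using matrix_inv(4)[OF E] by metis
  have "bil b v = 0" unfolding b_def bil_vector_matrix Gx by (simp add: bil_3)
  then have "E *v v = vector [0, 1, 0]"
    by (simp add: vec_eq_iff forall_3 matrix_vector_row E_def) (simp add: matrix_vector_row[symmetric] Gx)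
  then have iEv: "matrix_inv E *v vector [0, 1, 0] = v" using matrix_inv(4)[OF E] by metis
  have v: "eval3 F v \<noteq> 0" using m by (simp add: v_def)
  have "eval3 F (matrix_inv E *v vector [0, 1, 0]) \<noteq> 0" unfolding iEv by (rule v)
  from line_points_param[OF E E1 this]
  have "card {t. eval3 F (x + t *s v) = 0} = card (line_points b)" unfolding iE by (rule bij_betw_same_card)
  then have "card (line_points b) = d \<longleftrightarrow> discr d (lineP F x v) \<noteq> 0" using card_line_eq_iff(3)[OF hom v] by metis
  then show ?thesis by (simp add: Tset_def lin_def line_points_def b_def x_def v_def)
qed

text \<open>Around a given line a frame is chosen whose point at infinity on that line is off C.
  This persists for nearby lines, on which the discriminant is a single holomorphic
  equation.\<close>

lemma analytic_Tset: "analytic_subset proj2_atlas UNIV Tset"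
proof (rule analytic_subsetI)
  fix l0 :: proj2
  obtain b where b: "b \<noteq> 0" "l0 = pt b" by (rule pt_cases)
  obtain G :: "complex^3^3" where G: "invertible G" "G $ 1 = b" "eval3 F (matrix_inv G *v vector [0, 1, 0]) \<noteq> 0"
    by (rule line_frame_ex[OF b(1)])
  have l0: "l0 = lin G 0 0" by (simp add: lin_row b(2) G(2))
  define x v where "x l = matrix_inv G *v vector [- lc G 3 l, 0, 1]" and "v l = matrix_inv G *v vector [- lc G 2 l, 1, 0]" for l
  have comp: "(matrix_inv G *v vector [- a, s, t]) $ i = matrix_inv G $ i $ 1 * - a + matrix_inv G $ i $ 2 * s + matrix_inv G $ i $ 3 * t" for a s t i
    by (simp add: matrix_vector_mult_def sum_3)
  have h: "holat proj2_atlas (\<lambda>l. x l $ i) l" "holat proj2_atlas (\<lambda>l. v l $ i) l" if l: "l \<in> ldom G" for l i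
  proof -
    interpret function_ring "\<lambda>f. holat proj2_atlas f l" by (rule holat_ring)
    show "holat proj2_atlas (\<lambda>l. x l $ i) l" "holat proj2_atlas (\<lambda>l. v l $ i) l"
      unfolding x_def v_def comp by (intro add mult const uminus holat_lc[OF l])+
  qed
  have hF: "holat proj2_atlas (\<lambda>l. eval3 F (v l)) l" and hD: "holat proj2_atlas (\<lambda>l. discr d (lineP F (x l) (v l))) l" if l: "l \<in> ldom G" for l
  proof -
    interpret function_ring "\<lambda>f. holat proj2_atlas f l" by (rule holat_ring)
    show "holat proj2_atlas (\<lambda>l. eval3 F (v l)) l" by (rule eval3) (rule h(2)[OF l])
    show "holat proj2_atlas (\<lambda>l. discr d (lineP F (x l) (v l))) l"
      by (rule discr, rule coeff_lineP) (rule h[OF l])+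
  qed
  define U where "U = ldom G \<inter> (\<lambda>l. eval3 F (v l)) -` (- {0})"
  have "continuous_on (ldom G) (\<lambda>l. eval3 F (v l))"
    using holat_continuous_on[OF complex_manifold_proj2, of "ldom G"] hF open_ldom by simp
  then have U: "open U" unfolding U_def by (intro continuous_open_preimage open_ldom) auto
  have "l0 \<in> U" using G(1,3) by (simp add: U_def l0 v_def)
  moreover have "hol_fun proj2_atlas U (\<lambda>l. discr d (lineP F (x l) (v l)))" using hD by (auto simp: hol_fun_iff U_def)
  moreover have "l \<in> Tset \<longleftrightarrow> discr d (lineP F (x l) (v l)) = 0" if l: "l \<in> U" for l
  proof -
    have "l \<in> ldom G" and "eval3 F (matrix_inv G *v vector [- lc G 2 l, 1, 0]) \<noteq> 0" using l by (simp_all add: U_def v_def)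
    then show ?thesis using card_line_lin[OF G(1), of "lc G 2 l" "lc G 3 l"] lin_lc[OF G(1)] by (simp add: x_def v_def)
  qed
  ultimately show "\<exists>U H. mopen proj2_atlas U \<and> l0 \<in> U \<and> U \<subseteq> UNIV \<and> finite H \<and> (\<forall>h\<in>H. hol_fun proj2_atlas U h) \<and>
      Tset \<inter> U = {y \<in> U. \<forall>h\<in>H. h y = 0}"
    using U by (intro exI[of _ U] exI[of _ "{\<lambda>l. discr d (lineP F (x l) (v l))}"]) auto
qed (simp_all add: mopen_def)

lemma Tset_not_UNIV: "Tset \<noteq> UNIV"
proof -
  obtain M :: "complex^3^3" and D where MD: "invertible M" "finite D" "eval3 F (M *v axis 1 1) \<noteq> 0"
    "\<And>x. x \<notin> D \<Longrightarrow> card {g. eval3 F (M *v vector [g, x, 1]) = 0} = d" by (rule generic_pencil[OF hom sq d]) blast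
  interpret pencil A \<nu> C d F M D by unfold_locales (use MD in auto)
  obtain x where "x \<notin> D" using ex_new_if_finite[OF infinite_UNIV_char_0 D] by auto
  then have "pt (B x $ 1) \<notin> Tset" using card_line[of x] by (simp add: Tset_def line_points_def)
  then show ?thesis by blast
qed

lemma Tset_thin: "open W \<Longrightarrow> W \<subseteq> closure (W - Tset)"
  using analytic_subset_thin[OF complex_manifold_proj2 connected_UNIV_proj2 analytic_Tset Tset_not_UNIV] by simp

lemma off_Tset:
  assumes l: "pt b \<notin> Tset" "b \<noteq> 0" and p: "incident (\<nu> p) (pt b)"
  shows "vord A \<nu> p b 1" "\<nu> p' = \<nu> p \<Longrightarrow> p' = p"
proof -
  have "card (line_points b) = d" using l by (simp add: Tset_def line_points_def)
  then show "vord A \<nu> p b 1" "\<nu> p' = \<nu> p \<Longrightarrow> p' = p" using transversal[OF l(2) _ p] by simp_all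
qed

lemma card_preimage_line:
  assumes "l \<notin> Tset" shows "card {p. incident (\<nu> p) l} = d"
proof -
  obtain b where b: "b \<noteq> 0" "l = pt b" by (rule pt_cases)
  have "inj_on \<nu> {p. incident (\<nu> p) l}" using off_Tset(2)[of b] assms b by (auto simp: inj_on_def)
  moreover have "\<nu> ` {p. incident (\<nu> p) l} = {P \<in> C. incident P l}" using range_\<nu> by auto
  ultimately have "card {p. incident (\<nu> p) l} = card {P \<in> C. incident P l}" using card_image by metis
  then show ?thesis using assms by (simp add: Tset_def)
qed

end

section \<open>The ruled surface\<close>

lemma hol_map_cong:
  assumes A: "complex_manifold A" and W: "mopen A W" and f: "hol_map A B W f" and eq: "\<And>x. x \<in> W \<Longrightarrow> f x = g x"
  shows "hol_map A B W g"
  unfolding hol_map_iff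
proof (intro conjI ballI allI impI)
  show "continuous_on W g" using f eq continuous_on_cong[of W W f g] by (simp add: hol_map_def)
  show "g ` W \<subseteq> mfd_points B" using f eq by (auto simp: hol_map_def)
  fix x V \<psi> j assume x: "x \<in> W" and V: "(V, \<psi>) \<in> B" "g x \<in> V"
  have "holat A (\<lambda>y. \<psi> (f y) $ j) x" using f x V eq[OF x] unfolding hol_map_iff by metis
  then show "holat A (\<lambda>y. \<psi> (g y) $ j) x" by (rule holat_cong[OF A W x, rotated]) (simp add: eq)
qed

lemma vector_2_eq: "vector [x $ 1, x $ 2] = (x :: complex^2)"
  by (simp add: vec_eq_iff forall_2)

lemma norm_lt_2:
  fixes x :: "complex^2"
  assumes "norm (x $ 1) < e / 2" "norm (x $ 2) < e / 2" shows "norm x < e"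
proof -
  have "norm x \<le> (\<Sum>i\<in>UNIV. norm (x $ i))" unfolding norm_vec_def by (rule L2_set_le_sum) simp
  then show ?thesis using assms by (simp add: sum_2)
qed

text \<open>Exchanges the roles of u and w. Lines whose first coefficient vanishes have no slope m
  in the frame G; those with nonzero second coefficient have one in the swapped frame.\<close>

definition swap_rows :: "complex^3^3 \<Rightarrow> complex^3^3" where "swap_rows G = vector [G $ 2, G $ 1, G $ 3]"

lemma swap_rows:
  assumes G: "invertible G"
  shows "invertible (swap_rows G)" "matrix_inv (swap_rows G) *v vector [b, a, c] = matrix_inv G *v vector [a, b, c]"
    "vector [b, a, c] v* swap_rows G = vector [a, b, c] v* G"
proof -
  have "det (swap_rows G) = - det G" by (simp add: swap_rows_def det_3 algebra_simps)
  then show S: "invertible (swap_rows G)" using G by (simp add: invertible_det_nz)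
  define y where "y = matrix_inv G *v vector [a, b, c]"
  have y: "G *v y = vector [a, b, c]" unfolding y_def by (rule matrix_inv(3)[OF G])
  have "swap_rows G *v y = vector [b, a, c]"
    by (simp add: vec_eq_iff forall_3 swap_rows_def matrix_vector_row) (simp add: matrix_vector_row[symmetric] y)
  then show "matrix_inv (swap_rows G) *v vector [b, a, c] = matrix_inv G *v vector [a, b, c]"
    unfolding y_def[symmetric] using matrix_inv(4)[OF S] by metis
  show "vector [b, a, c] v* swap_rows G = vector [a, b, c] v* G"
    by (simp add: vec_eq_iff forall_3 swap_rows_def vector_matrix_mult_def sum_3)
qed

lemma frame_swap: "frame A \<nu> p \<rho> \<psi> \<tau> G u w \<Longrightarrow> frame A \<nu> p \<rho> \<psi> \<tau> (swap_rows G) w u"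
  unfolding frame_def by (auto simp: swap_rows)

section \<open>Charts of the ruled surface\<close>

context rcurve
begin

abbreviation AP :: "('a \<times> proj2, 1 + 2) atlas" where "AP \<equiv> prod_atlas A proj2_atlas"
abbreviation Z :: "('a \<times> proj2) set" where "Z \<equiv> dc_space \<nu>"
abbreviation ZA :: "('a \<times> proj2, 2) atlas" where "ZA \<equiv> dc_atlas A \<nu>"

lemma in_Z: "(p, l) \<in> Z \<longleftrightarrow> incident (\<nu> p) l" by (simp add: dc_space_def)

lemma AP: "complex_manifold AP" "mfd_points AP = UNIV"
  by (simp_all add: complex_manifold_prod[OF A complex_manifold_proj2] mfd_points_prod AU)

lemma mopen_AP [simp]: "mopen AP W \<longleftrightarrow> open W" by (simp add: mopen_def AP(2))

definition zdom :: "real \<Rightarrow> (complex \<Rightarrow> 'a) \<Rightarrow> complex^3^3 \<Rightarrow> ('a \<times> proj2) set" where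
  "zdom \<rho> \<psi> G = Z \<inter> (\<psi> ` ball 0 \<rho>) \<times> ldom G"

definition zchart :: "('a \<Rightarrow> complex) \<Rightarrow> complex^3^3 \<Rightarrow> 'a \<times> proj2 \<Rightarrow> complex^2" where
  "zchart \<tau> G q = vector [\<tau> (fst q), lc G 2 (snd q)]"

definition zpar :: "(complex \<Rightarrow> 'a) \<Rightarrow> complex^3^3 \<Rightarrow> (complex \<Rightarrow> complex) \<Rightarrow> (complex \<Rightarrow> complex) \<Rightarrow> complex^2 \<Rightarrow> 'a \<times> proj2" where
  "zpar \<psi> G u w x = (\<psi> (x $ 1), lin G (x $ 2) (- (u (x $ 1) + x $ 2 * w (x $ 1))))"

definition strip :: "real \<Rightarrow> (complex^2) set" where "strip \<rho> = {x. x $ 1 \<in> ball 0 \<rho>}"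

lemma open_strip: "open (strip \<rho>)"
proof -
  have "strip \<rho> = (\<lambda>x. x $ 1) -` ball 0 \<rho>" by (auto simp: strip_def)
  then show ?thesis by (simp add: open_vimage continuous_on_component)
qed

context
  fixes p \<rho> \<psi> \<tau> G u w
  assumes f: "frm p \<rho> \<psi> \<tau> G u w"
begin

lemma zpar:
  assumes "x \<in> strip \<rho>"
  shows "zpar \<psi> G u w x \<in> zdom \<rho> \<psi> G" "zchart \<tau> G (zpar \<psi> G u w x) = x"
proof -
  have x: "x $ 1 \<in> ball 0 \<rho>" using assms by (simp add: strip_def)
  have "incident (\<nu> (\<psi> (x $ 1))) (snd (zpar \<psi> G u w x))"
    unfolding zpar_def snd_conv frame_incident_lin[OF f x] by simp
  then show "zpar \<psi> G u w x \<in> zdom \<rho> \<psi> G"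
    using x frameD(2)[OF f] by (simp add: zdom_def zpar_def in_Z)
  show "zchart \<tau> G (zpar \<psi> G u w x) = x"
    using discD(5)[OF frameD(1)[OF f] x] frameD(2)[OF f] by (simp add: zchart_def zpar_def vector_2_eq)
qed

lemma zchart:
  assumes "q \<in> zdom \<rho> \<psi> G"
  shows "zchart \<tau> G q \<in> strip \<rho>" "zpar \<psi> G u w (zchart \<tau> G q) = q"
proof -
  obtain z l where q: "z \<in> ball 0 \<rho>" "q = (\<psi> z, l)" "incident (\<nu> (\<psi> z)) l" "l \<in> ldom G"
    using assms by (auto simp: zdom_def in_Z)
  have \<tau>: "\<tau> (\<psi> z) = z" by (rule discD(5)[OF frameD(1)[OF f] q(1)])
  then show "zchart \<tau> G q \<in> strip \<rho>" using q by (simp add: strip_def zchart_def)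
  have l: "lin G (lc G 2 l) (lc G 3 l) = l" by (rule lin_lc[OF frameD(2)[OF f] q(4)])
  have "incident (\<nu> (\<psi> z)) (lin G (lc G 2 l) (lc G 3 l))" unfolding l by (rule q(3))
  then have "u z + lc G 2 l * w z + lc G 3 l = 0" unfolding frame_incident_lin[OF f q(1)] .
  then have "lc G 3 l = - (u z + lc G 2 l * w z)" by (simp add: add_eq_0_iff)
  then show "zpar \<psi> G u w (zchart \<tau> G q) = q"
    using \<tau> l by (simp add: zpar_def zchart_def q(2))
qed

lemma zdom_open: "openin (top_of_set Z) (zdom \<rho> \<psi> G)"
  unfolding zdom_def by (intro openin_open_Int open_Times open_ldom discD(3)[OF frameD(1)[OF f]])

lemma zchart_image: "zchart \<tau> G ` zdom \<rho> \<psi> G = strip \<rho>"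
  using zpar zchart by (metis (no_types, lifting) image_iff subsetI subset_antisym)

lemma zchart_inj: "inj_on (zchart \<tau> G) (zdom \<rho> \<psi> G)"
  by (rule inj_on_inverseI) (rule zchart(2))

lemma zchart_inv: "x \<in> strip \<rho> \<Longrightarrow> inv_into (zdom \<rho> \<psi> G) (zchart \<tau> G) x = zpar \<psi> G u w x"
  using inv_into_f_f[OF zchart_inj zpar(1), of x] zpar(2)[of x] by simp

lemma cdiff_compose_fst:
  assumes g: "g field_differentiable at (x $ 1)" shows "cdiff (\<lambda>x. g (x $ 1)) (x :: complex^2)"
proof -
  obtain g' where "(g has_field_derivative g') (at (x $ 1))" using g by (auto simp: field_differentiable_def)
  from cdiff_field[OF cdiff_component[of 1 x] this] show ?thesis .
qed

lemma hol_map_zpar: "hol_map std_atlas AP (strip \<rho>) (zpar \<psi> G u w)"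
proof -
  have m: "mopen std_atlas (strip \<rho>)" using open_strip by (simp add: mopen_def)
  note d = frameD(1)[OF f]
  have 1: "hol_map std_atlas A (strip \<rho>) (\<lambda>x. \<psi> (x $ 1))"
  proof (rule hol_mapI[OF complex_manifold_std A m])
    show "continuous_on (strip \<rho>) (\<lambda>x. \<psi> (x $ 1))"
      by (rule continuous_on_compose2[OF discD(4)[OF d]]) (auto simp: strip_def intro: continuous_on_component)
    fix x :: "complex^2" assume "x \<in> strip \<rho>"
    then have x: "x $ 1 \<in> ball 0 \<rho>" by (simp add: strip_def)
    have "\<psi> (x $ 1) \<in> mfd_points A" by (simp add: AU)
    then obtain V \<phi> where V: "(V, \<phi>) \<in> A" "\<psi> (x $ 1) \<in> V" by (rule chart_ex[OF A])
    have "holat std_atlas (\<lambda>y. \<phi> (\<psi> (y $ 1)) $ j) x" for j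
      unfolding holat_std
      by (rule cdiff_compose_fst[where g="\<lambda>t. \<phi> (\<psi> t) $ j"]) (rule discD(7)[OF d x holat_chart_coord[OF A V]])
    then show "\<exists>V \<phi>. (V, \<phi>) \<in> A \<and> \<psi> (x $ 1) \<in> V \<and> (\<forall>j. holat std_atlas (\<lambda>y. \<phi> (\<psi> (y $ 1)) $ j) x)"
      using V by blast
  qed
  have 2: "hol_map std_atlas proj2_atlas (strip \<rho>) (\<lambda>x. lin G (x $ 2) (- (u (x $ 1) + x $ 2 * w (x $ 1))))"
    unfolding lin_def
  proof (rule hol_map_pt[OF complex_manifold_std m])
    fix x :: "complex^2" and i :: 3 assume "x \<in> strip \<rho>"
    then have x: "x $ 1 \<in> ball 0 \<rho>" by (simp add: strip_def)
    interpret function_ring "\<lambda>f. cdiff f x" by (rule cdiff_ring)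
    have uw: "cdiff (\<lambda>x. u (x $ 1)) x" "cdiff (\<lambda>x. w (x $ 1)) x"
      using frameD(3,4)[OF f] x by (auto intro!: cdiff_compose_fst simp: holomorphic_on_imp_differentiable_at)
    show "holat std_atlas (\<lambda>x. (vector [1, x $ 2, - (u (x $ 1) + x $ 2 * w (x $ 1))] v* G) $ i) x"
      unfolding holat_std vector_matrix_mult_def
      by (simp add: sum_3) (intro add mult const diff uminus uw cdiff_component)
    show "vector [1, x $ 2, - (u (x $ 1) + x $ 2 * w (x $ 1))] v* G \<noteq> 0" by (rule lin_nz[OF frameD(2)[OF f]])
  qed
  show ?thesis
    unfolding zpar_def by (rule hol_map_Pair[OF A complex_manifold_proj2 complex_manifold_std m 1 2])
qed

lemma zpar_nbhd:
  assumes V: "open V" "zpar \<psi> G u w (vector [0, m]) \<in> V"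
  obtains e where "e > 0" "e \<le> \<rho>" "\<And>x. norm (x $ 1) < e \<Longrightarrow> norm (x $ 2 - m) < e \<Longrightarrow> zpar \<psi> G u w x \<in> V"
proof -
  define x0 where "x0 = (vector [0, m] :: complex^2)"
  have \<rho>: "\<rho> > 0" by (rule discD(1)[OF frameD(1)[OF f]])
  have "continuous_on (strip \<rho>) (zpar \<psi> G u w)" using hol_map_zpar by (simp add: hol_map_def)
  then have "open (strip \<rho> \<inter> zpar \<psi> G u w -` V)" by (rule continuous_open_preimage[OF _ open_strip V(1)])
  moreover have "x0 \<in> strip \<rho> \<inter> zpar \<psi> G u w -` V" using \<rho> V(2) by (simp add: strip_def x0_def)
  ultimately obtain e where e: "e > 0" "ball x0 e \<subseteq> strip \<rho> \<inter> zpar \<psi> G u w -` V" unfolding open_contains_ball by blast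
  have "zpar \<psi> G u w x \<in> V" if "norm (x $ 1) < min (e / 2) \<rho>" "norm (x $ 2 - m) < min (e / 2) \<rho>" for x
  proof -
    have "norm (x - x0) < e" by (rule norm_lt_2) (use that in \<open>simp_all add: x0_def\<close>)
    then have "x \<in> ball x0 e" by (simp add: dist_norm norm_minus_commute)
    then show ?thesis using e(2) by blast
  qed
  then show ?thesis using that[of "min (e / 2) \<rho>"] e(1) \<rho> by simp
qed

lemma hol_map_zchart: "hol_map AP std_atlas ((\<psi> ` ball 0 \<rho>) \<times> ldom G) (zchart \<tau> G)"
proof -
  note d = frameD(1)[OF f]
  have o: "open ((\<psi> ` ball 0 \<rho>) \<times> ldom G)" by (intro open_Times open_ldom discD(3)[OF d])
  have h: "holat AP (\<lambda>q. zchart \<tau> G q $ j) q" if q: "q \<in> (\<psi> ` ball 0 \<rho>) \<times> ldom G" for q j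
  proof -
    obtain z where z: "z \<in> ball 0 \<rho>" "fst q = \<psi> z" and l: "snd q \<in> ldom G" using q by auto
    have t: "holat A \<tau> (fst q)" unfolding z(2) by (rule discD(6)[OF d z(1)])
    have "holat AP (\<lambda>q. \<tau> (fst q)) q"
      by (rule holat_compose[OF AP(1) A _ _ hol_map_fst[OF A complex_manifold_proj2] t]) (simp_all add: AP(2))
    moreover have "holat AP (\<lambda>q. lc G 2 (snd q)) q"
      by (rule holat_compose[OF AP(1) complex_manifold_proj2 _ _ hol_map_snd[OF A complex_manifold_proj2] holat_lc[OF l]]) (simp_all add: AP(2))
    ultimately show ?thesis using exhaust_2[of j] by (auto simp: zchart_def)
  qed
  have "continuous_on ((\<psi> ` ball 0 \<rho>) \<times> ldom G) (\<lambda>q. zchart \<tau> G q $ j)" for j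
    using o h by (intro holat_continuous_on[OF AP(1)]) simp_all
  then show ?thesis unfolding hol_map_std_iff using h by (auto intro: continuous_on_vecI)
qed

lemma zchart_in_atlas: "(zdom \<rho> \<psi> G, zchart \<tau> G) \<in> ZA"
  unfolding dc_atlas_def induced_atlas_def mem_Collect_eq prod.case
proof (intro conjI ballI)
  show "openin (top_of_set Z) (zdom \<rho> \<psi> G)" by (rule zdom_open)
  show "open (zchart \<tau> G ` zdom \<rho> \<psi> G)" unfolding zchart_image by (rule open_strip)
  show "inj_on (zchart \<tau> G) (zdom \<rho> \<psi> G)" by (rule zchart_inj)
  have m: "mopen std_atlas (strip \<rho>)" using open_strip by (simp add: mopen_def)
  show "hol_map std_atlas AP (zchart \<tau> G ` zdom \<rho> \<psi> G) (inv_into (zdom \<rho> \<psi> G) (zchart \<tau> G))"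
    unfolding zchart_image by (rule hol_map_cong[OF complex_manifold_std m hol_map_zpar]) (simp add: zchart_inv)
  fix q assume q: "q \<in> zdom \<rho> \<psi> G"
  have "open ((\<psi> ` ball 0 \<rho>) \<times> ldom G)" by (intro open_Times open_ldom discD(3)[OF frameD(1)[OF f]])
  then show "\<exists>W h. mopen AP W \<and> q \<in> W \<and> hol_map AP std_atlas W h \<and> (\<forall>y\<in>W \<inter> zdom \<rho> \<psi> G. zchart \<tau> G y = h y)"
    using q hol_map_zchart unfolding zdom_def
    by (intro exI[of _ "(\<psi> ` ball 0 \<rho>) \<times> ldom G"] exI[of _ "zchart \<tau> G"]) simp
qed

end

text \<open>If the first two coefficients of a line through the point vanished, the incidence
  equation would make the third one vanish too.\<close>

lemma zdom_cover:
  assumes f: "frm p \<rho> \<psi> \<tau> G u w" and q: "(p, l) \<in> Z" and l: "l = pt (b v* G)" "b \<noteq> 0"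
  shows "b $ 1 \<noteq> 0 \<and> (p, l) \<in> zdom \<rho> \<psi> G \<or> b $ 2 \<noteq> 0 \<and> (p, l) \<in> zdom \<rho> \<psi> (swap_rows G)"
proof -
  note d = frameD(1)[OF f] note G = frameD(2)[OF f]
  have p: "p \<in> \<psi> ` ball 0 \<rho>" by (rule disc_centre[OF d])
  have "incident (\<nu> (\<psi> 0)) (pt (b v* G))" using q discD(2)[OF d] l(1) by (simp add: in_Z)
  then have inc: "b $ 1 * u 0 + b $ 2 * w 0 + b $ 3 = 0" using frame_incident[OF f _ l(2), of 0] discD(1)[OF d] by simp
  show ?thesis
  proof (cases "b $ 1 = 0")
    case False
    then show ?thesis using ldom_pt(1)[OF G l(2)] q p l(1) by (simp add: zdom_def)
  next
    case True
    then have b2: "b $ 2 \<noteq> 0" using inc l(2) by (auto simp: vec_eq_iff forall_3)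
    have b': "vector [b $ 2, b $ 1, b $ 3] \<noteq> (0 :: complex^3)" using b2 by (simp add: vec_eq_iff forall_3)
    have "b = vector [b $ 1, b $ 2, b $ 3]" by (simp add: vec_eq_iff forall_3)
    then have "l = pt (vector [b $ 2, b $ 1, b $ 3] v* swap_rows G)" using l(1) swap_rows(3)[OF G] by metis
    then have "l \<in> ldom (swap_rows G)" using ldom_pt(1)[OF swap_rows(1)[OF G] b'] b2 by simp
    then show ?thesis using b2 q p by (simp add: zdom_def)
  qed
qed

lemma mfd_points_ZA: "mfd_points ZA = Z"
proof
  show "mfd_points ZA \<subseteq> Z"
    unfolding mfd_points_def dc_atlas_def induced_atlas_def using openin_imp_subset by fastforce
  show "Z \<subseteq> mfd_points ZA"
  proof
    fix q assume q: "q \<in> Z"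
    obtain p l where pl: "q = (p, l)" by (cases q)
    obtain G \<rho> \<psi> \<tau> u w where f: "frm p \<rho> \<psi> \<tau> G u w" by (rule frame_at)
    obtain b where b: "b \<noteq> 0" "l = pt (b v* G)" by (rule pt_row_cases[OF frameD(2)[OF f]])
    have "(p, l) \<in> zdom \<rho> \<psi> G \<or> (p, l) \<in> zdom \<rho> \<psi> (swap_rows G)"
      using zdom_cover[OF f _ b(2,1)] q pl by blast
    then show "q \<in> mfd_points ZA"
      using zchart_in_atlas[OF f] zchart_in_atlas[OF frame_swap[OF f]] unfolding mfd_points_def pl by force
  qed
qed

lemma complex_manifold_ZA: "complex_manifold ZA"
  by (rule complex_manifold_induced[OF AP dc_atlas_def mfd_points_ZA])

lemma dualizing_covering_eq: "dualizing_covering \<nu> = snd"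
  by (simp add: dualizing_covering_def dc_normalization_def fun_eq_iff)

lemma hol_map_f: "hol_map ZA proj2_atlas Z snd"
proof -
  have "hol_map AP proj2_atlas UNIV snd" using hol_map_snd[OF A complex_manifold_proj2] by (simp add: AP(2))
  from hol_map_from_induced[OF AP dc_atlas_def mfd_points_ZA complex_manifold_proj2 _ this] show ?thesis by simp
qed

end

section \<open>Where the covering is a local isomorphism\<close>

context rcurve
begin

text \<open>If the derivative of u + m w vanished at 0, the image of the curve t \<mapsto> (t, m)
  would have velocity 0 in homogeneous coordinates. A holomorphic local inverse recovers t from the
  image, so t itself would have derivative 0.\<close>

lemma local_iso_imp:
  assumes f: "frm p \<rho> \<psi> \<tau> G u w"
    and iso: "local_isomorphism_at ZA proj2_atlas snd (zpar \<psi> G u w (vector [0, m]))"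
  shows "deriv u 0 + m * deriv w 0 \<noteq> 0"
proof
  assume D: "deriv u 0 + m * deriv w 0 = 0"
  note d = frameD(1)[OF f] note G = frameD(2)[OF f] note \<rho> = discD(1)[OF d]
  define Q where "Q t = zpar \<psi> G u w (vector [t, m])" for t
  define y where "y t = vector [1, m, - (u t + m * w t)] v* G" for t
  have Qy: "snd (Q t) = pt (y t)" for t by (simp add: Q_def zpar_def y_def lin_def)
  obtain U V where q0: "Q 0 \<in> U" and bi: "biholomorphic ZA proj2_atlas U V snd"
    using iso unfolding local_isomorphism_at_def Q_def by blast
  define g where "g = inv_into U snd"
  have U: "mopen ZA U" and bij: "bij_betw snd U V" and g: "hol_map proj2_atlas ZA V g"
    using bi by (simp_all add: biholomorphic_def g_def)
  have gs: "g (snd q) = q" if "q \<in> U" for q unfolding g_def by (rule bij_betw_inv_into_left[OF bij that])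
  obtain O' where O': "open O'" "U = Z \<inter> O'" using U by (auto simp: mopen_def mfd_points_ZA openin_open)
  have str: "vector [t, m] \<in> strip \<rho>" if "t \<in> ball 0 \<rho>" for t using that by (simp add: strip_def)
  obtain e where e: "e > 0" "e \<le> \<rho>" "\<And>x. norm (x $ 1) < e \<Longrightarrow> norm (x $ 2 - m) < e \<Longrightarrow> zpar \<psi> G u w x \<in> O'"
    by (rule zpar_nbhd[OF f O'(1), of m]) (use q0 O'(2) in \<open>auto simp: Q_def\<close>)
  have QU: "Q t \<in> U" if "t \<in> ball 0 e" for t
    using zpar(1)[OF f str, of t] e(2,3) that e(1) O'(2) by (simp add: Q_def zdom_def)
  define h where "h l = zchart \<tau> G (g l) $ 1" for l
  have hQ: "h (pt (y t)) = t" if t: "t \<in> ball 0 e" for t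
    unfolding h_def Qy[symmetric] gs[OF QU[OF t]] using zpar(2)[OF f str, of t] t e(2) by (simp add: Q_def)
  have l0: "pt (y 0) \<in> V" unfolding Qy[symmetric] using bij q0 by (auto simp: bij_betw_def)
  have g0: "g (pt (y 0)) \<in> zdom \<rho> \<psi> G"
    unfolding Qy[symmetric] gs[OF q0] using zpar(1)[OF f str, of 0] \<rho> by (simp add: Q_def)
  have "holat proj2_atlas h (pt (y 0))"
    unfolding h_def using g l0 g0 zchart_in_atlas[OF f] unfolding hol_map_iff by blast
  then have cd: "cdiff (\<lambda>v. h (pt v)) (y 0)" by (rule holat_proj2_cdiff) (simp add: y_def lin_nz[OF G])
  have du: "(u has_field_derivative deriv u 0) (at 0)" "(w has_field_derivative deriv w 0) (at 0)"
    using holomorphic_derivI[OF frameD(3)[OF f]] holomorphic_derivI[OF frameD(4)[OF f]] \<rho> by auto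
  have yj: "((\<lambda>t. y t $ j) has_field_derivative (0 :: complex^3) $ j) (at 0)" for j
  proof -
    have "y t $ j = G $ 1 $ j + m * G $ 2 $ j - (u t + m * w t) * G $ 3 $ j" for t
      by (simp add: y_def vector_matrix_mult_def sum_3) (simp add: algebra_simps)
    moreover have "((\<lambda>t. G $ 1 $ j + m * G $ 2 $ j - (u t + m * w t) * G $ 3 $ j) has_field_derivative
        0 - (deriv u 0 + m * deriv w 0) * G $ 3 $ j) (at 0)"
      by (rule derivative_eq_intros du refl | simp)+
    ultimately show ?thesis using D by simp
  qed
  have "((\<lambda>t. h (pt (y t))) has_field_derivative 0) (at 0)"
  proof (rule cdiff_curve[OF yj cd])
    fix g' :: "complex^3 \<Rightarrow> complex"
    assume g': "\<And>a v. g' (a *s v) = a * g' v" "((\<lambda>t. h (pt (y t))) has_field_derivative g' 0) (at 0)"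
    have "g' 0 = 0" using g'(1)[of 0 0] by simp
    then show ?thesis using g'(2) by simp
  qed
  then have "((\<lambda>t. t) has_field_derivative (0::complex)) (at 0)"
    by (rule has_field_derivative_transform_within_open[OF _ open_ball[of 0 e]]) (use hQ e(1) in auto)
  then show False using DERIV_unique[OF _ DERIV_ident] by (metis zero_neq_one)
qed

text \<open>In the coordinates (t, m) on the surface and \<open>lc G 2\<close>,
  \<open>lc G 3\<close> on lines the map is H (t, m) = (m, -(u + m w)). Injectivity on a box comes
  from a mean value estimate, openness from invariance of domain, and the derivative of the inverse
  is explicit.\<close>

lemma local_iso:
  assumes f: "frm p \<rho> \<psi> \<tau> G u w" and D: "deriv u 0 + m * deriv w 0 \<noteq> 0"
  shows "local_isomorphism_at ZA proj2_atlas snd (zpar \<psi> G u w (vector [0, m]))"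
proof -
  note d = frameD(1)[OF f] note G = frameD(2)[OF f] note \<rho> = discD(1)[OF d]
  define c where "c = deriv u 0 + m * deriv w 0"
  define Dt where "Dt x = deriv u (x $ 1) + x $ 2 * deriv w (x $ 1)" for x :: "complex^2"
  define k where "k x = u (x $ 1) + x $ 2 * w (x $ 1)" for x :: "complex^2"
  define H where "H x = (vector [x $ 2, - k x] :: complex^2)" for x :: "complex^2"
  define x0 where "x0 = (vector [0, m] :: complex^2)"
  have du: "(u has_field_derivative deriv u z) (at z)" "(w has_field_derivative deriv w z) (at z)" if "z \<in> ball 0 \<rho>" for z
    using holomorphic_derivI[OF frameD(3)[OF f] _ that] holomorphic_derivI[OF frameD(4)[OF f] _ that] by auto
  have cu: "continuous_on (ball 0 \<rho>) (deriv u)" "continuous_on (ball 0 \<rho>) (deriv w)"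
    using holomorphic_deriv[OF frameD(3)[OF f]] holomorphic_deriv[OF frameD(4)[OF f]] holomorphic_on_imp_continuous_on by auto
  have "continuous_on (strip \<rho>) Dt"
    unfolding Dt_def
    by (intro continuous_intros continuous_on_component continuous_on_compose2[OF cu(1)] continuous_on_compose2[OF cu(2)])
       (auto simp: strip_def)
  \<comment> \<open>Within norm c / 2 of c the derivative in t stays nonzero, and the bound is
    strong enough for the estimate that proves injectivity.\<close>
  then have "open (strip \<rho> \<inter> Dt -` ball c (norm c / 2))"
    by (intro continuous_open_preimage open_strip) auto
  moreover have "x0 \<in> strip \<rho> \<inter> Dt -` ball c (norm c / 2)"
    using \<rho> D by (simp add: strip_def x0_def Dt_def c_def)
  ultimately obtain e where e: "e > 0" "ball x0 e \<subseteq> strip \<rho> \<inter> Dt -` ball c (norm c / 2)"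
    unfolding open_contains_ball by blast
  define N where "N = {x :: complex^2. x $ 1 \<in> ball 0 (e / 2) \<and> x $ 2 \<in> ball m (e / 2)}"
  have oN: "open N"
  proof -
    have "N = (\<lambda>x. x $ 1) -` ball 0 (e / 2) \<inter> (\<lambda>x. x $ 2) -` ball m (e / 2)" by (auto simp: N_def)
    then show ?thesis by (simp add: open_Int open_vimage continuous_on_component)
  qed
  have N: "x \<in> strip \<rho>" "norm (Dt x - c) < norm c / 2" if x: "x \<in> N" for x
  proof -
    have "norm (x - x0) < e" by (rule norm_lt_2) (use x in \<open>simp_all add: x0_def N_def dist_norm norm_minus_commute\<close>)
    then have "x \<in> ball x0 e" by (simp add: dist_norm norm_minus_commute)
    then show "x \<in> strip \<rho>" "norm (Dt x - c) < norm c / 2" using e(2) by (auto simp: dist_norm norm_minus_commute)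
  qed
  have x0N: "x0 \<in> N" using e(1) by (simp add: N_def x0_def)
  have Dt0: "Dt x \<noteq> 0" if "x \<in> N" for x
  proof
    assume "Dt x = 0"
    then have "norm c < norm c / 2" using N(2)[OF that] by simp
    then show False using norm_ge_zero[of c] by linarith
  qed
  have inj: "inj_on H N"
  proof (rule inj_onI)
    fix x y assume xy: "x \<in> N" "y \<in> N" "H x = H y"
    then have m: "x $ 2 = y $ 2" and kk: "k x = k y" by (simp_all add: H_def vec_eq_iff forall_2)
    \<comment> \<open>Removing the linear part c t leaves a function with Lipschitz constant norm c
      / 2. Equal values of k make its difference equal to -c times the difference of the arguments,
      which is therefore 0.\<close>
    define \<phi> where "\<phi> t = u t + x $ 2 * w t - c * t" for t
    have "norm (\<phi> (x $ 1) - \<phi> (y $ 1)) \<le> norm c / 2 * norm (x $ 1 - y $ 1)"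
    proof (rule field_differentiable_bound[where S="ball 0 (e / 2)" and f'="\<lambda>t. deriv u t + x $ 2 * deriv w t - c"])
      fix t :: complex assume "t \<in> ball 0 (e / 2)"
      then have tN: "vector [t, x $ 2] \<in> N" using xy(1) by (simp add: N_def)
      then have "t \<in> ball 0 \<rho>" using N(1)[OF tN] by (simp add: strip_def)
      note dt = du[OF this]
      have "(\<phi> has_field_derivative deriv u t + x $ 2 * deriv w t - c) (at t)"
        unfolding \<phi>_def by (rule derivative_eq_intros dt refl | simp)+
      then show "(\<phi> has_field_derivative deriv u t + x $ 2 * deriv w t - c) (at t within ball 0 (e / 2))"
        by (rule has_field_derivative_at_within)
      show "norm (deriv u t + x $ 2 * deriv w t - c) \<le> norm c / 2" using N(2)[OF tN] by (simp add: Dt_def)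
    qed (use xy in \<open>auto simp: N_def\<close>)
    moreover have "\<phi> (x $ 1) - \<phi> (y $ 1) = - (c * (x $ 1 - y $ 1))"
    proof -
      have "\<phi> (x $ 1) - \<phi> (y $ 1) = k x - k y - c * (x $ 1 - y $ 1)" by (simp add: \<phi>_def k_def m algebra_simps)
      then show ?thesis using kk by simp
    qed
    ultimately have "norm c * norm (x $ 1 - y $ 1) \<le> norm c / 2 * norm (x $ 1 - y $ 1)" by (simp add: norm_mult)
    then have "norm c * norm (x $ 1 - y $ 1) \<le> 0" by simp
    then have "norm (x $ 1 - y $ 1) \<le> 0" using D unfolding c_def[symmetric] by (simp add: mult_le_0_iff)
    then show "x = y" using m by (simp add: vec_eq_iff forall_2)
  qed
  define H' where "H' x v = (vector [v $ 2, - (Dt x * v $ 1 + w (x $ 1) * v $ 2)] :: complex^2)" for x v :: "complex^2"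
  have dH: "(H has_derivative H' x) (at x)" if x: "x \<in> N" for x
  proof (rule has_derivative_vecI)
    have x1: "x $ 1 \<in> ball 0 \<rho>" using N(1)[OF x] by (simp add: strip_def)
    have comp: "((\<lambda>x :: complex^2. x $ i) has_derivative (\<lambda>v. v $ i)) (at x)" for i
      by (rule bounded_linear.has_derivative[OF bounded_linear_vec_nth has_derivative_ident])
    have 1: "((\<lambda>x :: complex^2. u (x $ 1)) has_derivative (\<lambda>v. deriv u (x $ 1) * v $ 1)) (at x)"
      "((\<lambda>x :: complex^2. w (x $ 1)) has_derivative (\<lambda>v. deriv w (x $ 1) * v $ 1)) (at x)"
      using has_derivative_compose[OF comp du(1)[OF x1, unfolded has_field_derivative_def]]
        has_derivative_compose[OF comp du(2)[OF x1, unfolded has_field_derivative_def]] by auto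
    have 2: "(k has_derivative (\<lambda>v. Dt x * v $ 1 + w (x $ 1) * v $ 2)) (at x)"
      unfolding k_def Dt_def
      by (rule has_derivative_eq_rhs[OF has_derivative_add[OF 1(1) has_derivative_mult[OF comp 1(2)]]]) (simp add: fun_eq_iff algebra_simps)
    fix i :: 2
    have "i = 1 \<or> i = 2" by (rule exhaust_2)
    then show "((\<lambda>x. H x $ i) has_derivative (\<lambda>v. H' x v $ i)) (at x)"
      using comp[of 2] has_derivative_minus[OF 2] by (auto simp: H_def H'_def)
  qed
  have cH: "continuous_on N H"
    by (rule continuous_at_imp_continuous_on) (use dH has_derivative_continuous in blast)
  define K where "K = inv_into N H"
  have KH: "K (H x) = x" if "x \<in> N" for x unfolding K_def by (rule inv_into_f_f[OF inj that])
  have oHN: "open (H ` N)" by (rule invariance_of_domain[OF cH oN inj])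
  have cK: "cdiff (\<lambda>z. K z $ i) y" if y: "y \<in> H ` N" for y i
  proof -
    obtain x where x: "x \<in> N" "y = H x" using y by blast
    define K' where "K' v = (vector [(- v $ 2 - w (x $ 1) * v $ 1) / Dt x, v $ 1] :: complex^2)" for v :: "complex^2"
    have id: "H' x \<circ> K' = id" using Dt0[OF x(1)] by (simp add: fun_eq_iff H'_def K'_def vec_eq_iff forall_2)
    have "(K has_derivative K') (at (H x))"
      by (rule has_derivative_inverse_strong[OF oN x(1) cH KH dH[OF x(1)] id])
    then have "((\<lambda>z. K z $ i) has_derivative (\<lambda>v. K' v $ i)) (at y)"
      unfolding x(2) by (rule bounded_linear.has_derivative[OF bounded_linear_vec_nth])
    moreover have "K' (a *s v) $ i = a * K' v $ i" for a v
      using exhaust_2[of i] by (auto simp: K'_def field_simps)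
    ultimately show ?thesis unfolding cdiff_def by blast
  qed
  have cK': "continuous_on (H ` N) K"
    by (intro continuous_on_vecI continuous_at_imp_continuous_on ballI cdiff_isCont cK)
  define P where "P = zpar \<psi> G u w"
  define U where "U = P ` N"
  define L where "L l = (vector [lc G 2 l, lc G 3 l] :: complex^2)" for l
  define V where "V = ldom G \<inter> L -` (H ` N)"
  have sndP: "snd (P x) = lin G (H x $ 1) (H x $ 2)" for x by (simp add: P_def zpar_def H_def k_def)
  have LP: "L (snd (P x)) = H x" for x by (simp add: sndP L_def G vector_2_eq)
  have cL: "continuous_on (ldom G) L"
    unfolding L_def by (intro continuous_on_vector_2 continuous_lc)
  have oV: "open V" unfolding V_def by (rule continuous_open_preimage[OF cL open_ldom oHN])
  have sub: "N \<subseteq> strip \<rho>" using N(1) by blast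
  have "U = zdom \<rho> \<psi> G \<inter> zchart \<tau> G -` N"
    unfolding U_def P_def using zpar[OF f] zchart[OF f] sub by force
  moreover have "openin (top_of_set (zdom \<rho> \<psi> G)) (zdom \<rho> \<psi> G \<inter> zchart \<tau> G -` N)"
  proof (rule continuous_openin_preimage_gen[OF _ oN])
    show "continuous_on (zdom \<rho> \<psi> G) (zchart \<tau> G)"
      using hol_map_zchart[OF f] by (auto simp: hol_map_def zdom_def intro: continuous_on_subset)
  qed
  ultimately have mU: "mopen ZA U"
    unfolding mopen_def mfd_points_ZA using zdom_open[OF f] openin_trans by metis
  have UZ: "U \<subseteq> Z" using mU openin_imp_subset unfolding mopen_def mfd_points_ZA by blast
  have Vl: "l = snd (P (K (L l)))" "K (L l) \<in> N" if l: "l \<in> V" for l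
  proof -
    obtain x where x: "x \<in> N" "L l = H x" "l \<in> ldom G" using l by (auto simp: V_def)
    then have "l = lin G (H x $ 1) (H x $ 2)" using lin_lc[OF G x(3)] by (simp add: x(2)[symmetric] L_def)
    then show "l = snd (P (K (L l)))" "K (L l) \<in> N" using KH[OF x(1)] x by (simp_all add: sndP)
  qed
  have inv: "P (K (L (snd q))) = q" "snd q \<in> V" if q: "q \<in> U" for q
  proof -
    obtain x where x: "x \<in> N" "q = P x" using q by (auto simp: U_def)
    show "P (K (L (snd q))) = q" by (simp add: x(2) LP KH[OF x(1)])
    have "snd q \<in> ldom G" using G by (simp add: x(2) sndP)
    then show "snd q \<in> V" using x by (simp add: V_def LP)
  qed
  have PKL: "P (K (L l)) \<in> U" if "l \<in> V" for l using Vl(2)[OF that] by (simp add: U_def)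
  have injU: "inj_on snd U" by (rule inj_onI) (metis inv(1))
  have bij: "bij_betw snd U V"
    using injU inv(2) Vl(1) PKL by (auto simp: bij_betw_def) (metis image_eqI)
  have m: "mopen proj2_atlas V" using oV by simp
  have hL: "hol_map proj2_atlas std_atlas V (\<lambda>l. K (L l))"
    unfolding hol_map_std_iff
  proof (intro conjI ballI allI)
    show "continuous_on V (\<lambda>l. K (L l))"
      by (rule continuous_on_compose2[OF cK' continuous_on_subset[OF cL]]) (auto simp: V_def)
    fix l j assume l: "l \<in> V"
    have lG: "l \<in> ldom G" and HN: "L l \<in> H ` N" using l by (auto simp: V_def)
    have hl: "hol_map proj2_atlas std_atlas (ldom G) L"
      unfolding hol_map_std_iff
    proof (intro conjI ballI allI cL)
      fix l j assume "l \<in> ldom G"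
      then show "holat proj2_atlas (\<lambda>l. L l $ j) l" using holat_lc exhaust_2[of j] by (auto simp: L_def)
    qed
    have hK: "holat std_atlas (\<lambda>z. K z $ j) (L l)" unfolding holat_std by (rule cK[OF HN])
    show "holat proj2_atlas (\<lambda>y. K (L y) $ j) l"
      by (rule holat_compose[OF complex_manifold_proj2 complex_manifold_std _ lG hl hK]) (simp add: open_ldom)
  qed
  have "hol_map proj2_atlas AP V (\<lambda>l. P (K (L l)))"
    unfolding P_def
    by (rule hol_map_compose[OF complex_manifold_proj2 complex_manifold_std m hL hol_map_zpar[OF f]]) (use Vl(2) sub in blast)
  then have hg: "hol_map proj2_atlas ZA V (\<lambda>l. P (K (L l)))"
    by (rule hol_map_into_induced[OF AP dc_atlas_def mfd_points_ZA complex_manifold_proj2 m]) (use PKL UZ in blast)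
  have "hol_map proj2_atlas ZA V (inv_into U snd)"
  proof (rule hol_map_cong[OF complex_manifold_proj2 m hg])
    fix l assume l: "l \<in> V"
    have "inv_into U snd (snd (P (K (L l)))) = P (K (L l))" by (rule inv_into_f_f[OF injU PKL[OF l]])
    then show "P (K (L l)) = inv_into U snd l" using Vl(1)[OF l] by simp
  qed
  then have "biholomorphic ZA proj2_atlas U V snd"
    unfolding biholomorphic_def using mU m bij hol_map_subset[OF hol_map_f UZ] by blast
  moreover have "zpar \<psi> G u w (vector [0, m]) \<in> U" using x0N by (simp add: U_def P_def x0_def)
  ultimately show ?thesis unfolding local_isomorphism_at_def by blast
qed

end

section \<open>Local degrees\<close>

lemma hasord_zorder:
  assumes g: "g holomorphic_on ball 0 \<rho>" "\<rho> > 0" "hasord g n" shows "zorder g 0 = int n"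
proof -
  obtain r k where k: "0 < r" "r \<le> \<rho>" "k holomorphic_on ball 0 r"
    "\<And>z. z \<in> ball 0 r \<Longrightarrow> g z = z ^ n * k z" "\<And>z. z \<in> ball 0 r \<Longrightarrow> k z \<noteq> 0"
    by (rule hasord_factor[OF g]) blast
  show ?thesis
    by (rule zorder_eqI[of "ball 0 r" 0 k]) (use k in \<open>auto simp: mult.commute\<close>)
qed

text \<open>Rouche's theorem on the circle of radius \<epsilon>, inside which g has the single zero
  0, of order n. If the zeros of the sum inside are simple, the count with multiplicity is a count
  of points.\<close>

lemma rouche_count:
  assumes g: "g holomorphic_on ball 0 \<rho>" "\<forall>z\<in>ball 0 \<rho>. g z = 0 \<longrightarrow> z = 0" "hasord g n" "n \<ge> 1"
    and h: "h holomorphic_on ball 0 \<rho>" and \<epsilon>: "0 < \<epsilon>" "\<epsilon> < \<rho>" and less: "\<And>z. norm z = \<epsilon> \<Longrightarrow> norm (h z) < norm (g z)"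
  shows "\<exists>z\<in>ball 0 \<epsilon>. g z + h z = 0"
    "(\<And>z. z \<in> ball 0 \<epsilon> \<Longrightarrow> g z + h z = 0 \<Longrightarrow> deriv (\<lambda>z. g z + h z) z \<noteq> 0) \<Longrightarrow> card {z \<in> ball 0 \<epsilon>. g z + h z = 0} = n"
proof -
  \<comment> \<open>The theorem works on an open set around the circle that contains only finitely
    many zeros; a radius between \<epsilon> and \<rho> provides a ball whose closure lies in the
    domain.\<close>
  define r where "r = (\<epsilon> + \<rho>) / 2"
  have r: "\<epsilon> < r" "r < \<rho>" using \<epsilon> by (simp_all add: r_def)
  define k where "k z = g z + h z" for z
  have k: "k holomorphic_on ball 0 \<rho>" unfolding k_def by (intro holomorphic_intros g h)
  have kz: "k z \<noteq> 0" if "norm z = \<epsilon>" for z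
  proof
    assume "k z = 0"
    then have "h z = - g z" by (simp add: k_def add_eq_0_iff)
    then show False using less[OF that] by simp
  qed
  define J where "J = {z \<in> ball 0 r. k z = 0}"
  define I where "I = {z \<in> ball 0 \<epsilon>. k z = 0}"
  have finJ: "finite J"
  proof -
    have "\<not> k constant_on ball 0 \<rho> \<or> J = {}"
    proof (rule ccontr)
      assume "\<not> (\<not> k constant_on ball 0 \<rho> \<or> J = {})"
      then obtain c z where "\<forall>z\<in>ball 0 \<rho>. k z = c" "z \<in> ball 0 r" "k z = 0" unfolding constant_on_def J_def by blast
      moreover have "complex_of_real \<epsilon> \<in> ball 0 \<rho>" using \<epsilon> by simp
      ultimately have "k (complex_of_real \<epsilon>) = 0" using r by auto
      then show False using kz[of "complex_of_real \<epsilon>"] \<epsilon> by simp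
    qed
    then show ?thesis
    proof
      assume "\<not> k constant_on ball 0 \<rho>"
      then have "finite {z \<in> cball 0 r. k z = 0}"
        by (intro holomorphic_compact_finite_zeros[OF k]) (use r in auto)
      then show ?thesis by (rule finite_subset[rotated]) (auto simp: J_def)
    qed simp
  qed
  have IJ: "I \<subseteq> J" using r by (auto simp: I_def J_def)
  have "g field_differentiable at 0" using g(1) \<epsilon> by (intro holomorphic_on_imp_differentiable_at[of g "ball 0 \<rho>"]) auto
  then have g0: "g 0 = 0" by (intro hasord_pos_0[OF g(3,4)] field_differentiable_imp_continuous_at)
  have J0: "{z \<in> ball 0 r. g z = 0} = {0}" using g(2) g0 r \<epsilon> by auto
  have wn1: "winding_number (circlepath 0 \<epsilon>) z = 1" if "z \<in> ball 0 \<epsilon>" for z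
    using that by (intro winding_number_circlepath) simp
  have wn0: "winding_number (circlepath 0 \<epsilon>) z = 0" if "z \<notin> cball 0 \<epsilon>" for z
    by (rule winding_number_zero_outside[of _ "cball 0 \<epsilon>"]) (use that \<epsilon> in auto)
  have "(\<Sum>z\<in>J. winding_number (circlepath 0 \<epsilon>) z * zorder (\<lambda>z. g z + h z) z)
      = (\<Sum>z\<in>{z \<in> ball 0 r. g z = 0}. winding_number (circlepath 0 \<epsilon>) z * zorder g z)"
    unfolding J_def k_def
  proof (rule Rouche_theorem)
    show "finite {z \<in> ball 0 r. g z + h z = 0}" using finJ by (simp add: J_def k_def)
    show "finite {z \<in> ball 0 r. g z = 0}" unfolding J0 by simp
    show "g holomorphic_on ball 0 r" "h holomorphic_on ball 0 r" using g(1) h r by (auto intro: holomorphic_on_subset)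
    show "\<forall>z. z \<notin> ball 0 r \<longrightarrow> winding_number (circlepath 0 \<epsilon>) z = 0" using wn0 r by auto
  qed (use \<epsilon> r less in \<open>auto simp: path_image_circlepath\<close>)
  also have "\<dots> = of_nat n" unfolding J0 using wn1[of 0] \<epsilon> hasord_zorder[OF g(1) _ g(3)] by simp
  also have "(\<Sum>z\<in>J. winding_number (circlepath 0 \<epsilon>) z * zorder (\<lambda>z. g z + h z) z)
      = (\<Sum>z\<in>I. winding_number (circlepath 0 \<epsilon>) z * zorder (\<lambda>z. g z + h z) z)"
  proof (rule sum.mono_neutral_right[OF finJ IJ], rule ballI)
    fix z assume z: "z \<in> J - I"
    then have "norm z \<noteq> \<epsilon>" "\<not> norm z < \<epsilon>" using kz by (auto simp: I_def J_def)
    then show "winding_number (circlepath 0 \<epsilon>) z * zorder (\<lambda>z. g z + h z) z = 0" using wn0[of z] by simp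
  qed
  also have "\<dots> = (\<Sum>z\<in>I. of_int (zorder (\<lambda>z. g z + h z) z))"
    by (rule sum.cong) (use wn1 in \<open>auto simp: I_def\<close>)
  finally have total: "(\<Sum>z\<in>I. complex_of_int (zorder (\<lambda>z. g z + h z) z)) = of_nat n" .
  have "I \<noteq> {}"
  proof
    assume "I = {}"
    then show False using total g(4) by simp
  qed
  then show "\<exists>z\<in>ball 0 \<epsilon>. g z + h z = 0" by (auto simp: I_def k_def)
  assume simple: "\<And>z. z \<in> ball 0 \<epsilon> \<Longrightarrow> g z + h z = 0 \<Longrightarrow> deriv (\<lambda>z. g z + h z) z \<noteq> 0"
  have "zorder (\<lambda>z. g z + h z) z = 1" if z: "z \<in> I" for z
  proof -
    have "z \<in> ball 0 \<rho>" using z r by (auto simp: I_def)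
    moreover have "(\<lambda>z. g z + h z) holomorphic_on ball 0 \<rho>" using k by (simp add: k_def[abs_def])
    moreover have "g z + h z = 0" "deriv (\<lambda>z. g z + h z) z \<noteq> 0" using z simple[of z] by (auto simp: I_def k_def)
    ultimately show ?thesis
      by (intro zorder_zero_eqI[where S="ball 0 \<rho>"]) auto
  qed
  then have "complex_of_nat (card I) = of_nat n" using total by simp
  then show "card {z \<in> ball 0 \<epsilon>. g z + h z = 0} = n" by (simp add: I_def k_def)
qed

context rcurve
begin

lemma frame_recentre:
  assumes f: "frm p \<rho> \<psi> \<tau> G u w" and t: "t \<in> ball 0 \<rho>"
  obtains r \<tau>' where "0 < r" "frm (\<psi> t) r (\<lambda>z. \<psi> (t + z)) \<tau>' G (\<lambda>z. u (t + z)) (\<lambda>z. w (t + z))"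
proof -
  define r where "r = \<rho> - norm t"
  have r: "r > 0" using t by (simp add: r_def)
  have sub: "(\<lambda>z. t + z) ` ball 0 r \<subseteq> ball 0 \<rho>"
  proof clarify
    fix z :: complex assume "z \<in> ball 0 r"
    then show "t + z \<in> ball 0 \<rho>" using norm_triangle_ineq[of t z] by (simp add: r_def)
  qed
  have h: "(\<lambda>z. t + z) holomorphic_on ball 0 r" "inj_on (\<lambda>z. t + z) (ball 0 r)"
    by (auto intro!: holomorphic_intros)
  obtain \<tau>' where "frm (\<psi> (t + 0)) r (\<lambda>z. \<psi> (t + z)) \<tau>' G (\<lambda>z. u (t + z)) (\<lambda>z. w (t + z))"
    by (rule frame_reparam[OF f h sub r])
  then show ?thesis using that[OF r] by simp
qed

end

context dualizable_curve
begin

text \<open>A line off \<open>Tset\<close> meets every branch at its points with order 1; recentring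
  the frame at t turns this into a nonzero derivative.\<close>

lemma frame_simple_zero:
  assumes f: "frm p \<rho> \<psi> \<tau> G u w" and t: "t \<in> ball 0 \<rho>" and l: "lin G m k \<notin> Tset" and z: "u t + m * w t + k = 0"
  shows "deriv (\<lambda>z. u z + m * w z + k) t \<noteq> 0"
proof -
  define b where "b = (vector [1, m, k] :: complex^3)"
  have b: "b v* G \<noteq> 0" unfolding b_def by (rule lin_nz[OF frameD(2)[OF f]])
  have "incident (\<nu> (\<psi> t)) (pt (b v* G))"
    using frame_incident_lin[OF f t, of m k] z by (simp add: lin_def b_def)
  then have v: "vord A \<nu> (\<psi> t) (b v* G) 1" using off_Tset(1)[OF _ b] l by (simp add: lin_def b_def)
  obtain r \<tau>' where r: "0 < r" and f': "frm (\<psi> t) r (\<lambda>z. \<psi> (t + z)) \<tau>' G (\<lambda>z. u (t + z)) (\<lambda>z. w (t + z))"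
    by (rule frame_recentre[OF f t])
  have o: "hasord (\<lambda>z. u (t + z) + m * w (t + z) + k) 1" using v unfolding vord_frame[OF f'] by (simp add: b_def)
  have hol: "(\<lambda>z. u z + m * w z + k) holomorphic_on ball 0 \<rho>" by (intro holomorphic_intros frameD[OF f])
  have dd: "((\<lambda>z. u z + m * w z + k) has_field_derivative deriv (\<lambda>z. u z + m * w z + k) t) (at (t + 0))"
    using holomorphic_derivI[OF hol _ t] by simp
  have "((\<lambda>z. u (t + z) + m * w (t + z) + k) has_field_derivative deriv (\<lambda>z. u z + m * w z + k) t) (at 0)"
    using DERIV_shift_left[OF dd] .
  then have "(\<lambda>z. u (t + z) + m * w (t + z) + k) field_differentiable at 0"
    "deriv (\<lambda>z. u (t + z) + m * w (t + z) + k) 0 = deriv (\<lambda>z. u z + m * w z + k) t"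
    by (auto simp: field_differentiable_def DERIV_imp_deriv)
  then show ?thesis using hasord_1D(2)[OF o] by simp
qed

text \<open>On the circle of radius \<epsilon> the function g = u + m w is bounded below; W consists
  of lines whose equation differs from g by less than this bound there. Rouche's theorem gives zeros
  inside and none on the circle, and exactly n distinct ones for lines off
  \<open>Tset\<close>.\<close>

lemma local_fibre:
  assumes f: "frm p \<rho> \<psi> \<tau> G u w" and o: "hasord (\<lambda>z. u z + m * w z) n" "n \<ge> 1" and \<delta>: "\<delta> > 0"
  obtains \<epsilon> W where "0 < \<epsilon>" "\<epsilon> < \<rho>" "\<epsilon> < \<delta>" "open W" "W \<subseteq> ldom G" "lin G m 0 \<in> W"
    "\<forall>l\<in>W. norm (lc G 2 l - m) < \<delta>"
    "\<forall>l\<in>W. \<forall>t. norm t = \<epsilon> \<longrightarrow> \<not> incident (\<nu> (\<psi> t)) l"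
    "\<forall>l\<in>W. \<exists>t\<in>ball 0 \<epsilon>. incident (\<nu> (\<psi> t)) l"
    "\<forall>l\<in>W - Tset. card {t \<in> ball 0 \<epsilon>. incident (\<nu> (\<psi> t)) l} = n"
    "\<forall>t\<in>cball 0 \<epsilon>. incident (\<nu> (\<psi> t)) (lin G m 0) \<longrightarrow> t = 0"
proof -
  note d = frameD(1)[OF f] note G = frameD(2)[OF f] note \<rho> = discD(1)[OF d]
  define g where "g z = u z + m * w z" for z
  have o: "hasord g n" using o(1) by (simp add: g_def[abs_def])
  have "eventually (\<lambda>z. g z \<noteq> 0) (at 0)" by (rule hasord_eventually_nonzero[OF o])
  then obtain r0 where r0: "r0 > 0" "\<And>z. z \<noteq> 0 \<Longrightarrow> dist z 0 < r0 \<Longrightarrow> g z \<noteq> 0" unfolding eventually_at by blast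
  define \<rho>' where "\<rho>' = min \<rho> r0"
  have \<rho>': "0 < \<rho>'" "\<rho>' \<le> \<rho>" using \<rho> r0(1) by (auto simp: \<rho>'_def)
  \<comment> \<open>Half of the minimum keeps the closed disc inside \<open>ball 0 \<rho>'\<close>
    and \<epsilon> below the tolerance \<delta> of the caller.\<close>
  define \<epsilon> where "\<epsilon> = min \<rho>' \<delta> / 2"
  have \<epsilon>: "0 < \<epsilon>" "\<epsilon> < \<rho>'" "\<epsilon> < \<delta>" using \<rho>' \<delta> by (auto simp: \<epsilon>_def)
  have hol: "g holomorphic_on ball 0 \<rho>'" "w holomorphic_on ball 0 \<rho>'"
    unfolding g_def using frameD(3,4)[OF f] \<rho>' by (auto intro!: holomorphic_intros intro: holomorphic_on_subset)
  have gz: "\<forall>z\<in>ball 0 \<rho>'. g z = 0 \<longrightarrow> z = 0" 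
  proof (intro ballI impI)
    fix z assume "z \<in> ball 0 \<rho>'" "g z = 0"
    then show "z = 0" using r0(2)[of z] by (auto simp: \<rho>'_def)
  qed
  have sub: "sphere 0 \<epsilon> \<subseteq> ball 0 \<rho>'" using \<epsilon> by auto
  have cg: "continuous_on (sphere 0 \<epsilon>) g" "continuous_on (sphere 0 \<epsilon>) w"
    using hol holomorphic_on_imp_continuous_on continuous_on_subset[OF _ sub] by blast+
  have ne: "sphere (0::complex) \<epsilon> \<noteq> {}" using \<epsilon>(1) by simp
  obtain z1 where z1: "z1 \<in> sphere 0 \<epsilon>" "\<forall>z\<in>sphere 0 \<epsilon>. norm (g z1) \<le> norm (g z)"
    using continuous_attains_inf[OF compact_sphere ne continuous_on_norm[OF cg(1)]] by blast
  obtain z2 where z2: "z2 \<in> sphere 0 \<epsilon>" "\<forall>z\<in>sphere 0 \<epsilon>. norm (w z) \<le> norm (w z2)"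
    using continuous_attains_sup[OF compact_sphere ne continuous_on_norm[OF cg(2)]] by blast
  have pos: "norm (g z1) > 0" 
  proof -
    have "z1 \<in> ball 0 \<rho>'" "z1 \<noteq> 0" using subsetD[OF sub z1(1)] z1(1) \<epsilon>(1) by auto
    then show ?thesis using gz by auto
  qed
  \<comment> \<open>A bound for the perturbation \<open>(lc G 2 l - m) * w z + lc G 3 l\<close>,
    uniform on the circle through the maximum of |w|.\<close>
  define L where "L l = norm (lc G 2 l - m) * norm (w z2) + norm (lc G 3 l)" for l
  define W where "W = (ldom G \<inter> L -` {..< norm (g z1)}) \<inter> (ldom G \<inter> (\<lambda>l. norm (lc G 2 l - m)) -` {..< \<delta>})"
  have "continuous_on (ldom G) L" "continuous_on (ldom G) (\<lambda>l. norm (lc G 2 l - m))"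
    unfolding L_def by (intro continuous_intros continuous_lc)+
  then have "open W"
    unfolding W_def by (intro open_Int continuous_open_preimage open_ldom open_lessThan)
  moreover have "lin G m 0 \<in> W" using G pos \<delta> by (simp add: W_def L_def)
  moreover have less: "norm ((lc G 2 l - m) * w z + lc G 3 l) < norm (g z)" if l: "l \<in> W" and z: "norm z = \<epsilon>" for l z
  proof -
    have zs: "z \<in> sphere 0 \<epsilon>" using z by simp
    have "norm ((lc G 2 l - m) * w z + lc G 3 l) \<le> norm (lc G 2 l - m) * norm (w z) + norm (lc G 3 l)"
      using norm_triangle_ineq[of "(lc G 2 l - m) * w z" "lc G 3 l"] by (simp add: norm_mult)
    also have "\<dots> \<le> L l" unfolding L_def using z2(2) zs by (simp add: mult_left_mono)
    also have "\<dots> < norm (g z1)" using l by (simp add: W_def)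
    also have "\<dots> \<le> norm (g z)" using z1(2) zs by simp
    finally show ?thesis .
  qed
  have inc: "incident (\<nu> (\<psi> z)) l \<longleftrightarrow> g z + ((lc G 2 l - m) * w z + lc G 3 l) = 0" if l: "l \<in> ldom G" and z: "z \<in> ball 0 \<rho>'" for l z
  proof -
    have "z \<in> ball 0 \<rho>" using z \<rho>'(2) by simp
    then have "incident (\<nu> (\<psi> z)) (lin G (lc G 2 l) (lc G 3 l)) \<longleftrightarrow> u z + lc G 2 l * w z + lc G 3 l = 0"
      by (rule frame_incident_lin[OF f])
    then show ?thesis unfolding lin_lc[OF G l] by (simp add: g_def algebra_simps)
  qed
  have WG: "W \<subseteq> ldom G" by (auto simp: W_def)
  have hh: "(\<lambda>z. (lc G 2 l - m) * w z + lc G 3 l) holomorphic_on ball 0 \<rho>'" for l by (intro holomorphic_intros hol)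
  note rc = rouche_count[OF hol(1) gz o assms(3) hh \<epsilon>(1,2) less]
  have "\<forall>l\<in>W. \<forall>t. norm t = \<epsilon> \<longrightarrow> \<not> incident (\<nu> (\<psi> t)) l"
  proof (intro ballI allI impI notI)
    fix l t assume l: "l \<in> W" and t: "norm t = \<epsilon>" and i: "incident (\<nu> (\<psi> t)) l"
    have "g t + ((lc G 2 l - m) * w t + lc G 3 l) = 0" using inc[OF subsetD[OF WG l], of t] i t \<epsilon>(2) by simp
    then have "(lc G 2 l - m) * w t + lc G 3 l = - g t" by (simp add: add_eq_0_iff)
    then show False using less[OF l t] by simp
  qed
  moreover have "\<forall>l\<in>W. \<exists>t\<in>ball 0 \<epsilon>. incident (\<nu> (\<psi> t)) l"
  proof
    fix l assume l: "l \<in> W"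
    obtain t where "t \<in> ball 0 \<epsilon>" "g t + ((lc G 2 l - m) * w t + lc G 3 l) = 0" using rc(1)[OF l] by blast
    moreover have "t \<in> ball 0 \<rho>'" using \<open>t \<in> ball 0 \<epsilon>\<close> \<epsilon>(2) by simp
    ultimately show "\<exists>t\<in>ball 0 \<epsilon>. incident (\<nu> (\<psi> t)) l" using inc[OF subsetD[OF WG l], of t] by blast
  qed
  moreover have "\<forall>l\<in>W - Tset. card {t \<in> ball 0 \<epsilon>. incident (\<nu> (\<psi> t)) l} = n"
  proof
    fix l assume l: "l \<in> W - Tset"
    have lG: "l \<in> ldom G" using l WG by blast
    have eq: "g z + ((lc G 2 l - m) * w z + lc G 3 l) = u z + lc G 2 l * w z + lc G 3 l" for z
      by (simp add: g_def algebra_simps)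
    have "card {t \<in> ball 0 \<epsilon>. g t + ((lc G 2 l - m) * w t + lc G 3 l) = 0} = n"
    proof (rule rc(2))
      fix z assume z: "z \<in> ball 0 \<epsilon>" "g z + ((lc G 2 l - m) * w z + lc G 3 l) = 0"
      have "z \<in> ball 0 \<rho>" using z(1) \<epsilon>(2) \<rho>'(2) by simp
      then show "deriv (\<lambda>z. g z + ((lc G 2 l - m) * w z + lc G 3 l)) z \<noteq> 0"
        unfolding eq using frame_simple_zero[OF f, of z "lc G 2 l" "lc G 3 l"] z(2) l unfolding eq lin_lc[OF G lG] by simp
    qed (use l in auto)
    moreover have "{t \<in> ball 0 \<epsilon>. incident (\<nu> (\<psi> t)) l} = {t \<in> ball 0 \<epsilon>. g t + ((lc G 2 l - m) * w t + lc G 3 l) = 0}"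
      using inc[OF lG] \<epsilon>(2) by auto
    ultimately show "card {t \<in> ball 0 \<epsilon>. incident (\<nu> (\<psi> t)) l} = n" by simp
  qed
  moreover have "\<forall>t\<in>cball 0 \<epsilon>. incident (\<nu> (\<psi> t)) (lin G m 0) \<longrightarrow> t = 0"
  proof (intro ballI impI)
    fix t assume t: "t \<in> cball 0 \<epsilon>" "incident (\<nu> (\<psi> t)) (lin G m 0)"
    have "t \<in> ball 0 \<rho>'" using t(1) \<epsilon>(2) by simp
    then show "t = 0" using inc[OF lin_coords(1)[OF G], of t m 0] t(2) gz G by simp
  qed
  moreover have "\<forall>l\<in>W. norm (lc G 2 l - m) < \<delta>" by (auto simp: W_def)
  moreover have "\<epsilon> < \<rho>" using \<epsilon>(2) \<rho>'(2) by simp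
  ultimately show ?thesis using that \<epsilon>(1,3) WG by blast
qed

text \<open>A normal frame at the base point gives the order of contact with the chosen line. A line
  with nonzero first coefficient has a slope m, and m = 0 singles out the tangent line; the one
  remaining line is reached by swapping rows.\<close>

lemma centred_frame:
  assumes q: "q \<in> Z"
  obtains \<rho> \<psi> \<tau> G u w m n where "frm (fst q) \<rho> \<psi> \<tau> G u w" "u 0 = 0" "w 0 = 0" "hasord (\<lambda>z. u z + m * w z) n" "n \<ge> 1"
    "snd q = lin G m 0" "n = (if snd q = tangent_line A \<nu> (fst q) then tangent_mult A \<nu> (fst q) else branch_mult A \<nu> (fst q))"
    "n = 1 \<longleftrightarrow> snd q \<noteq> tangent_line A \<nu> (fst q) \<and> branch_mult A \<nu> (fst q) = 1"
proof -
  define p l where "p = fst q" and "l = snd q"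
  define r s where "r = branch_mult A \<nu> p" and "s = tangent_mult A \<nu> p"
  obtain \<rho> \<psi> \<tau> G u where nf: "nframe A \<nu> p \<rho> \<psi> \<tau> G u r s" and tl: "tangent_line A \<nu> p = pt (G $ 1)"
    unfolding r_def s_def by (rule nframe_at)
  have f: "frm p \<rho> \<psi> \<tau> G u (\<lambda>z. z ^ r)" and rs: "1 \<le> r" "r < s" and os: "hasord u s" using nf by (auto simp: nframe_def)
  note d = frameD(1)[OF f] note G = frameD(2)[OF f] note \<rho> = discD(1)[OF d]
  note u0 = nframe_0(1)[OF nf] and w0 = nframe_0(2)[OF nf]
  obtain b where b: "b \<noteq> 0" "l = pt (b v* G)" by (rule pt_row_cases[OF G])
  have "incident (\<nu> (\<psi> 0)) (pt (b v* G))" using q b(2) discD(2)[OF d] by (simp add: dc_space_def case_prod_unfold p_def l_def)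
  then have b3: "b $ 3 = 0" using frame_incident[OF f _ b(1), of 0] \<rho> u0 w0 by simp
  have tl': "tangent_line A \<nu> p = lin G 0 0" by (simp add: lin_row tl)
  show ?thesis
  proof (cases "b $ 1 = 0")
    case False
    define m where "m = b $ 2 / b $ 1"
    have "l \<in> ldom G" "lc G 2 l = m" "lc G 3 l = 0" using ldom_pt[OF G b(1)] False b3 by (simp_all add: b(2) m_def)
    then have l: "l = lin G m 0" using lin_lc[OF G] by metis
    have lt: "l = tangent_line A \<nu> p \<longleftrightarrow> m = 0" unfolding l tl' using lin_coords(2)[OF G] by metis
    have o: "hasord (\<lambda>z. u z + m * z ^ r) (if l = tangent_line A \<nu> p then s else r)"
    proof (cases "m = 0")
      case True
      then show ?thesis using os lt by simp
    next
      case False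
      have "hasord (\<lambda>z. m * z ^ r + u z) r" by (rule hasord_add[OF hasord_cmult[OF hasord_power False] os rs(2)])
      then show ?thesis using lt False by (simp add: add.commute)
    qed
    show ?thesis
      by (rule that[OF f[unfolded p_def] u0 w0 o]) (use rs l in \<open>auto simp: p_def l_def r_def s_def\<close>)
  next
    case True
    have b2: "b $ 2 \<noteq> 0" using True b3 b(1) by (auto simp: vec_eq_iff forall_3)
    have f': "frm p \<rho> \<psi> \<tau> (swap_rows G) (\<lambda>z. z ^ r) u" by (rule frame_swap[OF f])
    note G' = swap_rows(1)[OF G]
    have bb: "b = b $ 2 *s vector [0, 1, 0]" using True b3 by (simp add: vec_eq_iff forall_3)
    have "l = pt (vector [0, 1, 0] v* G)" unfolding b(2) by (subst bb) (simp add: scaleC_vector_matrix pt_scale[OF b2])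
    then have l: "l = lin (swap_rows G) 0 0" unfolding lin_def by (simp add: swap_rows(3)[OF G])
    have "l \<noteq> tangent_line A \<nu> p" using ldom_pt(1)[OF G b(1)] True lin_coords(1)[OF G, of 0 0] b(2) tl' by metis
    moreover have "hasord (\<lambda>z. z ^ r + 0 * u z) r" using hasord_power by simp
    ultimately show ?thesis
      by (intro that[OF f'[unfolded p_def] w0 u0, of 0 r]) (use rs l in \<open>auto simp: p_def l_def r_def s_def\<close>)
  qed
qed

end

section \<open>Openness, properness and local degrees of the covering\<close>

context dualizable_curve
begin

lemma closed_Z: "closed Z"
proof -
  have "continuous_on UNIV (\<lambda>q. (\<nu> (fst q), snd q) :: proj2 \<times> proj2)"
    by (intro continuous_intros continuous_on_compose2[OF continuous_\<nu>]) auto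
  then have "closed ((\<lambda>q. (\<nu> (fst q), snd q)) -` {(P, l). incident P l})"
    using closed_incidence by (intro closed_vimage)
  moreover have "(\<lambda>q. (\<nu> (fst q), snd q)) -` {(P, l). incident P l} = Z" by (auto simp: dc_space_def)
  ultimately show ?thesis by simp
qed

lemma compact_UNIV_AP: "compact (UNIV :: ('a \<times> proj2) set)"
  using compact_Times[OF compact_UNIV compact_UNIV_proj2] by simp

lemma compact_Z_Int:
  assumes "closed E" shows "compact (Z \<inter> E)"
proof -
  have "compact (UNIV \<inter> (Z \<inter> E))" by (rule compact_Int_closed[OF compact_UNIV_AP closed_Int[OF closed_Z assms]])
  then show ?thesis by (simp only: Int_UNIV_left)
qed

lemma compact_snd: "compact K \<Longrightarrow> compact (snd ` K)" for K :: "('a \<times> proj2) set"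
  by (intro compact_continuous_image continuous_on_snd continuous_on_id)

lemma closed_snd_image: "closed E \<Longrightarrow> closed (snd ` (Z \<inter> E))"
  by (rule compact_imp_closed, rule compact_snd, rule compact_Z_Int)

text \<open>By the existence part of Rouche's theorem every line near \<open>snd q\<close> meets the
  image of a small disc around the base point. The resulting point of the surface is close to q
  because both its parameter and its slope are within e.\<close>

lemma snd_open:
  assumes q: "q \<in> Z" "q \<in> O'" "open O'"
  obtains W where "open W" "snd q \<in> W" "W \<subseteq> snd ` (Z \<inter> O')"
proof -
  obtain \<rho> \<psi> \<tau> G u w m n where f: "frm (fst q) \<rho> \<psi> \<tau> G u w" and u0: "u 0 = 0" "w 0 = 0"
    and o: "hasord (\<lambda>z. u z + m * w z) n" "n \<ge> 1" and l: "snd q = lin G m 0"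
    by (rule centred_frame[OF q(1)])
  note d = frameD(1)[OF f] note G = frameD(2)[OF f] note \<rho> = discD(1)[OF d]
  have qx: "zpar \<psi> G u w (vector [0, m]) = q" using discD(2)[OF d] l u0 by (simp add: zpar_def prod_eq_iff)
  obtain e where e: "e > 0" "e \<le> \<rho>" "\<And>x. norm (x $ 1) < e \<Longrightarrow> norm (x $ 2 - m) < e \<Longrightarrow> zpar \<psi> G u w x \<in> O'"
    by (rule zpar_nbhd[OF f q(3), of m]) (use q(2) qx in auto)
  obtain \<epsilon> W where W: "0 < \<epsilon>" "\<epsilon> < \<rho>" "\<epsilon> < e" "open W" "W \<subseteq> ldom G" "lin G m 0 \<in> W"
    "\<forall>l\<in>W. norm (lc G 2 l - m) < e"
    "\<forall>l\<in>W. \<forall>t. norm t = \<epsilon> \<longrightarrow> \<not> incident (\<nu> (\<psi> t)) l"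
    "\<forall>l\<in>W. \<exists>t\<in>ball 0 \<epsilon>. incident (\<nu> (\<psi> t)) l"
    "\<forall>l\<in>W - Tset. card {t \<in> ball 0 \<epsilon>. incident (\<nu> (\<psi> t)) l} = n"
    "\<forall>t\<in>cball 0 \<epsilon>. incident (\<nu> (\<psi> t)) (lin G m 0) \<longrightarrow> t = 0"
    by (rule local_fibre[OF f o e(1)])
  have "W \<subseteq> snd ` (Z \<inter> O')"
  proof
    fix l' assume l': "l' \<in> W"
    obtain t where t: "t \<in> ball 0 \<epsilon>" "incident (\<nu> (\<psi> t)) l'" using W(9) l' by blast
    have q': "(\<psi> t, l') \<in> zdom \<rho> \<psi> G" using t W(2,5) l' by (auto simp: zdom_def in_Z)
    have "t \<in> ball 0 \<rho>" using t(1) W(2) by simp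
    then have x: "zchart \<tau> G (\<psi> t, l') = vector [t, lc G 2 l']" using discD(5)[OF d] by (simp add: zchart_def)
    have "zpar \<psi> G u w (zchart \<tau> G (\<psi> t, l')) \<in> O'" unfolding x by (rule e(3)) (use t(1) W(3,7) l' in auto)
    then have "(\<psi> t, l') \<in> O'" unfolding zchart(2)[OF f q'] .
    moreover have "(\<psi> t, l') \<in> Z" using q' by (simp add: zdom_def)
    ultimately show "l' \<in> snd ` (Z \<inter> O')" by force
  qed
  then show ?thesis using that[OF W(4)] W(6) l by simp
qed

text \<open>The image is open because the projection is open, and closed in W because the surface is
  compact; W is connected.\<close>

lemma snd_image_clopen:
  assumes W: "open W" "connected W" and S: "openin (top_of_set (Z \<inter> snd -` W)) S" "closedin (top_of_set (Z \<inter> snd -` W)) S" "S \<noteq> {}"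
  shows "snd ` S = W"
proof -
  have SW: "snd ` S \<subseteq> W" using openin_imp_subset[OF S(1)] by auto
  obtain O' where O': "open O'" "S = (Z \<inter> snd -` W) \<inter> O'" using S(1) by (auto simp: openin_open)
  obtain E where E: "closed E" "S = (Z \<inter> snd -` W) \<inter> E" using S(2) by (auto simp: closedin_closed)
  have oO: "open (snd -` W \<inter> O')" using O'(1) W(1) by (intro open_Int open_vimage continuous_on_snd continuous_on_id)
  have S_eq: "S = Z \<inter> (snd -` W \<inter> O')" using O'(2) by blast
  have "open (snd ` S)"
    unfolding open_subopen[of "snd ` S"]
  proof
    fix l assume "l \<in> snd ` S"
    then obtain q where q: "q \<in> Z" "q \<in> snd -` W \<inter> O'" "l = snd q" unfolding S_eq by blast
    obtain W' where "open W'" "snd q \<in> W'" "W' \<subseteq> snd ` (Z \<inter> (snd -` W \<inter> O'))" by (rule snd_open[OF q(1,2) oO])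
    then show "\<exists>T. open T \<and> l \<in> T \<and> T \<subseteq> snd ` S" unfolding S_eq q(3) by blast
  qed
  then have "openin (top_of_set W) (snd ` S)" using SW W(1) by (simp add: openin_open_eq)
  moreover have "snd ` S = W \<inter> snd ` (Z \<inter> E)" using E(2) by auto
  then have "closedin (top_of_set W) (snd ` S)" using closed_snd_image[OF E(1)] by (metis closedin_closed_Int)
  ultimately show ?thesis using W(2) S(3) unfolding connected_clopen by (metis image_is_empty)
qed

text \<open>The part K0 of the preimage of W over the small disc is clopen, since no line of W meets
  the boundary circle. Each nonempty clopen subset of K0 maps onto W and so contains q, the only
  point of K0 over \<open>snd q\<close>. Hence K0 is connected and is the component of q, and its
  fibres were counted in \<open>local_fibre\<close>.\<close>

lemma local_degree:
  assumes f: "frm p \<rho> \<psi> \<tau> G u w" and o: "hasord (\<lambda>z. u z + m * w z) n" "n \<ge> 1"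
    and q: "q = (p, lin G m 0)"
  shows "has_local_degree ZA proj2_atlas snd q n"
proof -
  note d = frameD(1)[OF f]
  obtain \<epsilon> W\<^sub>0 where W0: "0 < \<epsilon>" "\<epsilon> < \<rho>" "\<epsilon> < 1" "open W\<^sub>0" "W\<^sub>0 \<subseteq> ldom G" "lin G m 0 \<in> W\<^sub>0"
    "\<forall>l\<in>W\<^sub>0. norm (lc G 2 l - m) < 1"
    "\<forall>l\<in>W\<^sub>0. \<forall>t. norm t = \<epsilon> \<longrightarrow> \<not> incident (\<nu> (\<psi> t)) l"
    "\<forall>l\<in>W\<^sub>0. \<exists>t\<in>ball 0 \<epsilon>. incident (\<nu> (\<psi> t)) l"
    "\<forall>l\<in>W\<^sub>0 - Tset. card {t \<in> ball 0 \<epsilon>. incident (\<nu> (\<psi> t)) l} = n"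
    "\<forall>t\<in>cball 0 \<epsilon>. incident (\<nu> (\<psi> t)) (lin G m 0) \<longrightarrow> t = 0"
    by (rule local_fibre[OF f o, of 1]) simp
  have sub: "ball (0::complex) \<epsilon> \<subseteq> ball 0 \<rho>" "cball (0::complex) \<epsilon> \<subseteq> ball 0 \<rho>" using W0(2) by auto
  have oB: "open (\<psi> ` ball 0 \<epsilon>)" by (rule disc_open_image[OF A AU d open_ball sub(1)])
  have cB: "closed (\<psi> ` cball 0 \<epsilon>)"
    by (intro compact_imp_closed compact_continuous_image compact_cball continuous_on_subset[OF discD(4)[OF d] sub(2)])
  have inj: "inj_on \<psi> (ball 0 \<epsilon>)" using disc_inj[OF A AU d] sub(1) by (rule inj_on_subset)
  have main: "card {x \<in> connected_component_set (Z \<inter> snd -` W) q. snd x = y} = n"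
    if W: "open W" "connected W" "lin G m 0 \<in> W" "W \<subseteq> W\<^sub>0" and y: "y \<in> W" "y \<notin> Tset" for W y
  proof -
    define K where "K = Z \<inter> snd -` W"
    define K0 where "K0 = K \<inter> (\<psi> ` ball 0 \<epsilon>) \<times> UNIV"
    \<comment> \<open>The open and the closed disc cut out the same set, which is therefore open and
      closed at once.\<close>
    have "K0 = K \<inter> (\<psi> ` cball 0 \<epsilon>) \<times> UNIV"
    proof
      show "K0 \<subseteq> K \<inter> (\<psi> ` cball 0 \<epsilon>) \<times> UNIV" unfolding K0_def using ball_subset_cball by fastforce
      show "K \<inter> (\<psi> ` cball 0 \<epsilon>) \<times> UNIV \<subseteq> K0"
      proof
        fix x assume x: "x \<in> K \<inter> (\<psi> ` cball 0 \<epsilon>) \<times> UNIV"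
        then obtain t l where t: "x = (\<psi> t, l)" "t \<in> cball 0 \<epsilon>" "l \<in> W" "incident (\<nu> (\<psi> t)) l"
          by (auto simp: K_def in_Z)
        then have "norm t \<noteq> \<epsilon>" using W0(8) W(4) by blast
        then show "x \<in> K0" using x t by (simp add: K0_def)
      qed
    qed
    then have K0: "openin (top_of_set K) K0" "closedin (top_of_set K) K0"
      using openin_open_Int[OF open_Times[OF oB open_UNIV], of K] closedin_closed_Int[OF closed_Times[OF cB closed_UNIV], of K]
      by (simp_all only: K0_def)
    have qK0: "q \<in> K0"
    proof -
      have "\<psi> 0 = p" by (rule discD(2)[OF d])
      obtain t where t: "t \<in> ball 0 \<epsilon>" "incident (\<nu> (\<psi> t)) (lin G m 0)" using W0(6,9) by blast
      then have "t = 0" using W0(11) by simp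
      then show ?thesis using t \<open>\<psi> 0 = p\<close> W(3) by (auto simp: K0_def K_def q in_Z intro!: image_eqI[of _ _ 0])
    qed
    have only: "x = q" if x: "x \<in> K0" "snd x = lin G m 0" for x
    proof -
      obtain t l where t: "x = (\<psi> t, l)" "t \<in> ball 0 \<epsilon>" "incident (\<nu> (\<psi> t)) l"
        using x(1) by (auto simp: K0_def K_def in_Z)
      then have "t = 0" using W0(11) x(2) by simp
      then show ?thesis using t(1) x(2) discD(2)[OF d] by (simp add: q)
    qed
    have qS: "q \<in> S" if S: "openin (top_of_set K0) S" "closedin (top_of_set K0) S" "S \<noteq> {}" for S
    proof -
      have S': "openin (top_of_set K) S" "closedin (top_of_set K) S"
        using openin_trans[OF S(1) K0(1)] closedin_trans[OF S(2) K0(2)] .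
      have "snd ` S = W" using snd_image_clopen[OF W(1,2)] S' S(3) unfolding K_def by blast
      then obtain x where x: "x \<in> S" "snd x = lin G m 0" using W(3) by (metis imageE)
      then have "x = q" using only openin_imp_subset[OF S(1)] by blast
      then show ?thesis using x(1) by simp
    qed
    have con: "connected K0"
      unfolding connected_clopen
    proof (intro allI impI)
      fix S assume S: "openin (top_of_set K0) S \<and> closedin (top_of_set K0) S"
      show "S = {} \<or> S = K0"
      proof (rule ccontr)
        assume n: "\<not> (S = {} \<or> S = K0)"
        then have "q \<in> S" using qS S by blast
        have "K0 - S \<noteq> {}" using n openin_imp_subset S by blast
        moreover have "openin (top_of_set K0) (K0 - S)" "closedin (top_of_set K0) (K0 - S)"
          using S by (auto intro: openin_diff closedin_diff)
        ultimately have "q \<in> K0 - S" using qS by blast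
        then show False using \<open>q \<in> S\<close> by blast
      qed
    qed
    have "connected_component_set K q = K0"
    proof
      have K0K: "K0 \<subseteq> K" by (auto simp: K0_def)
      show "K0 \<subseteq> connected_component_set K q" by (rule connected_component_maximal[OF qK0 con K0K])
      define Q where "Q = connected_component_set K q"
      have Q: "connected Q" "Q \<subseteq> K" "q \<in> Q"
        using qK0 K0K by (auto simp: Q_def connected_connected_component connected_component_subset connected_component_refl)
      have "openin (top_of_set Q) (Q \<inter> K0)" "closedin (top_of_set Q) (Q \<inter> K0)"
      proof -
        obtain O' where "open O'" "K0 = K \<inter> O'" using K0(1) by (auto simp: openin_open)
        moreover obtain E where "closed E" "K0 = K \<inter> E" using K0(2) by (auto simp: closedin_closed)
        moreover have "Q \<inter> (K \<inter> T) = Q \<inter> T" for T using Q(2) by blast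
        ultimately show "openin (top_of_set Q) (Q \<inter> K0)" "closedin (top_of_set Q) (Q \<inter> K0)"
          by (metis openin_open_Int, metis closedin_closed_Int)
      qed
      then have "Q \<inter> K0 = {} \<or> Q \<inter> K0 = Q" using Q(1) unfolding connected_clopen by blast
      then show "connected_component_set K q \<subseteq> K0" using Q(3) qK0 unfolding Q_def by blast
    qed
    then have "{x \<in> connected_component_set (Z \<inter> snd -` W) q. snd x = y} = {x \<in> K0. snd x = y}" by (simp add: K_def)
    also have "\<dots> = (\<lambda>t. (\<psi> t, y)) ` {t \<in> ball 0 \<epsilon>. incident (\<nu> (\<psi> t)) y}"
      using y(1) by (auto simp: K0_def K_def in_Z)
    also have "card \<dots> = card {t \<in> ball 0 \<epsilon>. incident (\<nu> (\<psi> t)) y}"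
      by (rule card_image) (use inj in \<open>auto simp: inj_on_def\<close>)
    also have "\<dots> = n" using W0(10) W(4) y by blast
    finally show ?thesis .
  qed
  show ?thesis
    unfolding has_local_degree_def mfd_points_ZA mopen_proj2
  proof (rule exI[of _ W\<^sub>0], intro conjI allI impI)
    show "open W\<^sub>0" "snd q \<in> W\<^sub>0" using W0(4,6) by (simp_all add: q)
    fix W assume W: "open W \<and> connected W \<and> snd q \<in> W \<and> W \<subseteq> W\<^sub>0"
    have an: "analytic_subset proj2_atlas W (Tset \<inter> W)" by (rule analytic_subset_restrict[OF analytic_Tset]) (use W in auto)
    have "W \<subseteq> closure (W - Tset)" using Tset_thin W by blast
    moreover have "W - Tset = W - (Tset \<inter> W)" by blast
    moreover have "\<forall>y\<in>W - (Tset \<inter> W). card {x \<in> connected_component_set (Z \<inter> snd -` W) q. snd x = y} = n"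
      using main[of W] W by (auto simp: q)
    ultimately show "\<exists>T. analytic_subset proj2_atlas W T \<and> W \<subseteq> closure (W - T) \<and>
        (\<forall>y\<in>W - T. card {x \<in> connected_component_set (Z \<inter> snd -` W) q. snd x = y} = n)"
      using an by (intro exI[of _ "Tset \<inter> W"]) simp
  qed
qed

text \<open>The order n of u + m w is 1 exactly when its derivative at 0 is nonzero; along the
  tangent line n = s > 1, along the other lines n = r.\<close>

lemma local_iso_iff:
  assumes q: "q \<in> Z"
  shows "local_isomorphism_at ZA proj2_atlas snd q \<longleftrightarrow> snd q \<noteq> tangent_line A \<nu> (fst q) \<and> branch_mult A \<nu> (fst q) = 1"
proof -
  obtain \<rho> \<psi> \<tau> G u w m n where f: "frm (fst q) \<rho> \<psi> \<tau> G u w" and u0: "u 0 = 0" "w 0 = 0"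
    and o: "hasord (\<lambda>z. u z + m * w z) n" "n \<ge> 1" and l: "snd q = lin G m 0"
    and n: "n = 1 \<longleftrightarrow> snd q \<noteq> tangent_line A \<nu> (fst q) \<and> branch_mult A \<nu> (fst q) = 1"
    by (rule centred_frame[OF q])
  note d = frameD(1)[OF f] note \<rho> = discD(1)[OF d]
  have qz: "zpar \<psi> G u w (vector [0, m]) = q" using discD(2)[OF d] l u0 by (simp add: zpar_def prod_eq_iff)
  have du: "(u has_field_derivative deriv u 0) (at 0)" "(w has_field_derivative deriv w 0) (at 0)"
    using holomorphic_derivI[OF frameD(3)[OF f]] holomorphic_derivI[OF frameD(4)[OF f]] \<rho> by auto
  have dg: "((\<lambda>z. u z + m * w z) has_field_derivative deriv u 0 + m * deriv w 0) (at 0)"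
    by (rule derivative_eq_intros du refl | simp)+
  have "deriv u 0 + m * deriv w 0 \<noteq> 0 \<longleftrightarrow> n = 1"
  proof
    assume "deriv u 0 + m * deriv w 0 \<noteq> 0"
    then have "hasord (\<lambda>z. u z + m * w z) 1" using hasord_derivI[OF dg] u0 by simp
    then show "n = 1" using hasord_unique[OF o(1)] by blast
  next
    assume "n = 1"
    then have "hasord (\<lambda>z. u z + m * w z) 1" using o(1) by simp
    from hasord_1D(2)[OF this] show "deriv u 0 + m * deriv w 0 \<noteq> 0"
      using dg by (auto simp: field_differentiable_def DERIV_imp_deriv)
  qed
  then show ?thesis using local_iso[OF f, of m] local_iso_imp[OF f, of m] n unfolding qz by blast
qed

text \<open>The image is closed and contains the dense set of lines off \<open>Tset\<close>.\<close>

lemma surj_f: "snd ` Z = UNIV"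
proof -
  have "closed (snd ` (Z \<inter> UNIV))" by (rule closed_snd_image) simp
  moreover have "UNIV - Tset \<subseteq> snd ` (Z \<inter> UNIV)"
  proof
    fix l assume "l \<in> UNIV - Tset"
    then have "card {p. incident (\<nu> p) l} = d" using card_preimage_line by blast
    then have "{p. incident (\<nu> p) l} \<noteq> {}" using d by (metis card.empty not_one_le_zero)
    then show "l \<in> snd ` (Z \<inter> UNIV)" by (force simp: dc_space_def)
  qed
  ultimately have "closure (UNIV - Tset) \<subseteq> snd ` (Z \<inter> UNIV)" by (rule closure_minimal[rotated])
  then show ?thesis using Tset_thin[OF open_UNIV] by auto
qed

lemma fibre_f: "{q \<in> Z. snd q = l} = (\<lambda>p. (p, l)) ` {p. incident (\<nu> p) l}"
  by (auto simp: dc_space_def)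

lemma proper_snd: "proper_map (top_of_set Z) (top_of_set UNIV) (snd :: 'a \<times> proj2 \<Rightarrow> proj2)"
  unfolding proper_map_def
proof (intro conjI ballI)
  show "closed_map (top_of_set Z) (top_of_set UNIV) (snd :: 'a \<times> proj2 \<Rightarrow> proj2)"
    unfolding closed_map_def
  proof (intro allI impI)
    fix S assume "closedin (top_of_set Z) S"
    then obtain E where "closed E" "S = Z \<inter> E" by (auto simp: closedin_closed)
    then show "closedin (top_of_set UNIV) (snd ` S)" using closed_snd_image by simp
  qed
  fix l :: proj2
  have "{q \<in> Z. snd q = l} = Z \<inter> (snd -` {l})" by auto
  moreover have "closed (snd -` {l} :: ('a \<times> proj2) set)" by (intro closed_vimage closed_singleton continuous_on_snd continuous_on_id)
  ultimately have "compact {q \<in> Z. snd q = l}" using compact_Z_Int by simp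
  then show "compactin (top_of_set Z) {q \<in> topspace (top_of_set Z). snd q = l}" by (simp add: compactin_subtopology)
qed

lemma finite_covering_f: "finite_covering ZA proj2_atlas snd d"
  unfolding finite_covering_def mfd_points_ZA mfd_points_proj2
proof (intro conjI exI[of _ Tset] ballI)
  show "hol_map ZA proj2_atlas Z snd" by (rule hol_map_f)
  show "snd ` Z = UNIV" by (rule surj_f)
  show "finite_map Z UNIV (snd :: 'a \<times> proj2 \<Rightarrow> proj2)"
    unfolding finite_map_def
  proof (intro conjI ballI proper_snd)
    fix l :: proj2
    obtain b where b: "b \<noteq> 0" "l = pt b" by (rule pt_cases)
    show "finite {q \<in> Z. snd q = l}" unfolding fibre_f using finite_on_line[OF b(1)] by (simp add: b(2))
  qed
  show "analytic_subset proj2_atlas UNIV Tset" by (rule analytic_Tset)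
  show "UNIV \<subseteq> closure (UNIV - Tset)" by (rule Tset_thin[OF open_UNIV])
  show "Z \<subseteq> closure (Z - snd -` Tset)"
  proof
    fix q assume q: "q \<in> Z"
    show "q \<in> closure (Z - snd -` Tset)"
      unfolding closure_iff_nhds_not_empty
    proof (intro allI impI notI)
      fix S V assume V: "V \<subseteq> S" "open V" "q \<in> V" "(Z - snd -` Tset) \<inter> S = {}"
      obtain W where W: "open W" "snd q \<in> W" "W \<subseteq> snd ` (Z \<inter> V)" by (rule snd_open[OF q V(3,2)])
      then have "W \<subseteq> Tset" using V(1,4) by auto
      then have "W - Tset = {}" by blast
      then have "W \<subseteq> {}" using Tset_thin[OF W(1)] by (simp only: closure_empty)
      then show False using W(2) by blast
    qed
  qed
  fix q assume q: "q \<in> Z - snd -` Tset"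
  obtain p b where pb: "b \<noteq> 0" "q = (p, pt b)" by (metis pt_cases surj_pair)
  have inc: "incident (\<nu> p) (pt b)" and T: "pt b \<notin> Tset" using q by (simp_all add: pb(2) in_Z)
  have v1: "vord A \<nu> p b 1" by (rule off_Tset(1)[OF T pb(1) inc])
  obtain \<rho> \<psi> \<tau> G u w m n where f: "frm (fst q) \<rho> \<psi> \<tau> G u w"
    and o: "hasord (\<lambda>z. u z + m * w z) n" and l: "snd q = lin G m 0"
    and n: "n = 1 \<longleftrightarrow> snd q \<noteq> tangent_line A \<nu> (fst q) \<and> branch_mult A \<nu> (fst q) = 1"
    by (rule centred_frame[of q]) (use q in auto)
  \<comment> \<open>The frame represents the same line by (1, m, 0) up to a scalar, so the order 1
    along b is the order of u + m w.\<close>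
  have "pt b = pt (vector [1, m, 0] v* G)" using l by (simp add: pb(2) lin_def)
  then obtain c where c: "c \<noteq> 0" "vector [1, m, 0] v* G = c *s b"
    using pt_eq_iff[OF pb(1) lin_nz[OF frameD(2)[OF f]]] by blast
  then have "(1 / c) *s vector [1, m, 0] v* G = b" by (simp add: scaleC_vector_matrix)
  then have "vord A \<nu> (fst q) ((1 / c) *s vector [1, m, 0] v* G) 1" using v1 by (simp add: pb(2))
  then have "hasord (\<lambda>z. 1 / c * u z + m / c * w z) 1" unfolding vord_frame[OF f] by simp
  from hasord_cmult[OF this c(1)] have "hasord (\<lambda>z. u z + m * w z) 1" using c(1) by (simp add: field_simps)
  then have "n = 1" using hasord_unique[OF o] by blast
  then show "local_isomorphism_at ZA proj2_atlas snd q" using local_iso_iff[of q] n q by blast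
next
  fix y :: proj2 assume "y \<in> UNIV - Tset"
  then have "card {p. incident (\<nu> p) y} = d" using card_preimage_line by blast
  then show "card {q \<in> Z. snd q = y} = d" unfolding fibre_f by (subst card_image) (auto simp: inj_on_def)
qed

end

section \<open>The normalization of the incidence surface\<close>

lemma analytic_subset_fst:
  assumes N: "analytic_subset proj2_atlas UNIV N" shows "analytic_subset PP2 UNIV (fst -` N)"
proof (rule analytic_subsetI)
  fix q :: "proj2 \<times> proj2"
  obtain U H where U: "mopen proj2_atlas U" "fst q \<in> U" "U \<subseteq> UNIV" "finite H" "\<forall>h\<in>H. hol_fun proj2_atlas U h" "N \<inter> U = {y \<in> U. \<forall>h\<in>H. h y = 0}"
    by (rule analytic_subsetE[OF N UNIV_I])
  have "\<forall>h\<in>(\<lambda>h q. h (fst q)) ` H. hol_fun PP2 (U \<times> UNIV) h"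
    using U(5) by (auto simp: hol_fun_iff intro!: holat_PP2(1))
  moreover have "fst -` N \<inter> U \<times> UNIV = {q \<in> U \<times> UNIV. \<forall>h\<in>(\<lambda>h q. h (fst q)) ` H. h q = 0}" using U(6) by auto
  ultimately show "\<exists>V H. mopen PP2 V \<and> q \<in> V \<and> V \<subseteq> UNIV \<and> finite H \<and> (\<forall>h\<in>H. hol_fun PP2 V h) \<and>
      fst -` N \<inter> V = {y \<in> V. \<forall>h\<in>H. h y = 0}"
    using U(1,2,4) by (intro exI[of _ "U \<times> UNIV"] exI[of _ "(\<lambda>h q. h (fst q)) ` H"]) (auto simp: open_Times mem_Times_iff)
qed simp_all

context dualizable_curve
begin

abbreviation X :: "(proj2 \<times> proj2) set" where "X \<equiv> incidence_surface C"

lemma dcn: "dc_normalization \<nu> q = (\<nu> (fst q), snd q)"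
  by (simp add: dc_normalization_def case_prod_unfold)

lemma continuous_dcn: "continuous_on UNIV (dc_normalization \<nu>)"
proof -
  have "continuous_on UNIV (\<lambda>q. (\<nu> (fst q), snd q) :: proj2 \<times> proj2)"
    by (intro continuous_intros continuous_on_compose2[OF continuous_\<nu>]) auto
  moreover have "dc_normalization \<nu> = (\<lambda>q. (\<nu> (fst q), snd q))" by (rule ext) (rule dcn)
  ultimately show ?thesis by simp
qed

lemma dcn_image: "dc_normalization \<nu> ` Z = X"
proof
  show "dc_normalization \<nu> ` Z \<subseteq> X" using range_\<nu> by (auto simp: dcn incidence_surface_def dc_space_def)
  show "X \<subseteq> dc_normalization \<nu> ` Z"
  proof
    fix x assume "x \<in> X"
    then obtain P l where x: "x = (P, l)" "P \<in> C" "incident P l" by (auto simp: incidence_surface_def)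
    then obtain p where "P = \<nu> p" using range_\<nu> by blast
    then show "x \<in> dc_normalization \<nu> ` Z" using x by (auto simp: dcn in_Z intro!: image_eqI[of _ _ "(p, l)"])
  qed
qed

lemma hol_map_dcn: "hol_map ZA PP2 Z (dc_normalization \<nu>)"
proof -
  have m: "mopen AP UNIV" by simp
  have f: "hol_map AP A UNIV fst" using hol_map_fst[OF A complex_manifold_proj2] by (simp add: AP(2))
  have s: "hol_map AP proj2_atlas UNIV snd" using hol_map_snd[OF A complex_manifold_proj2] by (simp add: AP(2))
  have "hol_map AP proj2_atlas UNIV (\<lambda>q. \<nu> (fst q))" by (rule hol_map_compose[OF AP(1) A m f hol_\<nu>]) simp
  from hol_map_Pair[OF complex_manifold_proj2 complex_manifold_proj2 AP(1) m this s]
  have "hol_map AP PP2 UNIV (dc_normalization \<nu>)" by (rule hol_map_cong[OF AP(1) m]) (simp add: dcn)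
  from hol_map_from_induced[OF AP dc_atlas_def mfd_points_ZA PP2(1) m this] show ?thesis by simp
qed

lemma finite_map_dcn: "finite_map Z X (dc_normalization \<nu>)"
  unfolding finite_map_def proper_map_def
proof (intro conjI ballI)
  show "closed_map (top_of_set Z) (top_of_set X) (dc_normalization \<nu>)"
    unfolding closed_map_def
  proof (intro allI impI)
    fix S assume "closedin (top_of_set Z) S"
    then obtain E where E: "closed E" "S = Z \<inter> E" by (auto simp: closedin_closed)
    have "compact (dc_normalization \<nu> ` S)"
      unfolding E(2) by (intro compact_continuous_image compact_Z_Int E(1) continuous_on_subset[OF continuous_dcn]) simp
    then have "closed (dc_normalization \<nu> ` S)" by (rule compact_imp_closed)
    moreover have "dc_normalization \<nu> ` S \<subseteq> X" using dcn_image E(2) by blast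
    ultimately show "closedin (top_of_set X) (dc_normalization \<nu> ` S)" by (simp add: closed_subset)
  qed
  fix x
  have "closed (dc_normalization \<nu> -` {x})" by (intro closed_vimage closed_singleton continuous_dcn)
  then have "compact (Z \<inter> dc_normalization \<nu> -` {x})" by (rule compact_Z_Int)
  moreover have "Z \<inter> dc_normalization \<nu> -` {x} = {q \<in> Z. dc_normalization \<nu> q = x}" by auto
  ultimately show "compactin (top_of_set Z) {q \<in> topspace (top_of_set Z). dc_normalization \<nu> q = x}"
    by (simp add: compactin_subtopology)
next
  fix x
  have "{q \<in> Z. dc_normalization \<nu> q = x} \<subseteq> {p. \<nu> p = fst x} \<times> {snd x}" by (auto simp: dcn)
  then show "finite {q \<in> Z. dc_normalization \<nu> q = x}" using finite_fibre finite_subset by blast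
qed

text \<open>The slope m is kept fixed while the base point moves along the disc, in which generic
  points are dense.\<close>

lemma dense_preimage:
  assumes N: "UNIV \<subseteq> closure (UNIV - \<nu> -` N)" and q: "q \<in> Z" and V: "open V" "q \<in> V"
  obtains q' where "q' \<in> Z" "q' \<in> V" "\<nu> (fst q') \<notin> N"
proof -
  obtain \<rho> \<psi> \<tau> G u w m n where f: "frm (fst q) \<rho> \<psi> \<tau> G u w" and u0: "u 0 = 0" "w 0 = 0" and l: "snd q = lin G m 0"
    by (rule centred_frame[OF q])
  note d = frameD(1)[OF f] note \<rho> = discD(1)[OF d]
  define Q where "Q t = zpar \<psi> G u w (vector [t, m])" for t
  have Q0: "Q 0 = q" using discD(2)[OF d] l u0 by (simp add: Q_def zpar_def prod_eq_iff)
  have str: "vector [t, m] \<in> strip \<rho>" if "t \<in> ball 0 \<rho>" for t using that by (simp add: strip_def)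
  obtain e where e: "e > 0" "e \<le> \<rho>" "\<And>x. norm (x $ 1) < e \<Longrightarrow> norm (x $ 2 - m) < e \<Longrightarrow> zpar \<psi> G u w x \<in> V"
    by (rule zpar_nbhd[OF f V(1), of m]) (use V(2) Q0 in \<open>auto simp: Q_def\<close>)
  define T :: "complex set" where "T = ball 0 e"
  have oT: "open (\<psi> ` T)" by (rule disc_open_image[OF A AU d]) (use e(2) in \<open>auto simp: T_def\<close>)
  have "fst q \<in> \<psi> ` T" using e(1) discD(2)[OF d] by (auto simp: T_def intro!: image_eqI[of _ _ 0])
  then obtain p' where p': "p' \<in> \<psi> ` T" "p' \<in> UNIV - \<nu> -` N"
    using N oT closure_iff_nhds_not_empty[of "fst q" "UNIV - \<nu> -` N"] by blast
  then obtain t where t: "t \<in> T" "p' = \<psi> t" by blast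
  have "fst (Q t) = \<psi> t" by (simp add: Q_def zpar_def)
  moreover have "Q t \<in> Z" using zpar(1)[OF f str, of t] t(1) e(2) by (simp add: Q_def T_def zdom_def)
  moreover have "Q t \<in> V" unfolding Q_def by (rule e(3)) (use t(1) e(1) in \<open>simp_all add: T_def\<close>)
  ultimately show ?thesis using that[of "Q t"] p'(2) t(2) by auto
qed

text \<open>The inverse must be holomorphic on an open set of pairs (P, l), incident or not, and
  take values in the surface. The point is recovered by \<open>g\<^sub>0\<close>; the line l is
  replaced by the combination c of l and a fixed line b missing the centre, chosen so that c passes
  through the recovered point. For incident pairs c is a multiple of l.\<close>

lemma local_inverse:
  assumes W0: "open W\<^sub>0" "P0 \<in> W\<^sub>0" and g0: "hol_map proj2_atlas A W\<^sub>0 g\<^sub>0" and inv: "\<forall>q\<in>UNIV - \<nu> -` N. \<nu> q \<in> W\<^sub>0 \<longrightarrow> g\<^sub>0 (\<nu> q) = q"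
    and p: "\<nu> p = P0" "P0 \<notin> N" and l: "incident P0 l0"
  obtains W g where "open W" "(P0, l0) \<in> W" "hol_map PP2 ZA W g"
    "\<forall>q\<in>Z - dc_normalization \<nu> -` {(P, l). P \<in> N \<and> incident P l}. dc_normalization \<nu> q \<in> W \<longrightarrow> g (dc_normalization \<nu> q) = q"
proof -
  have gp: "g\<^sub>0 P0 = p" using inv p W0(2) by auto
  obtain G \<rho> \<psi> \<tau> u w where f: "frm p \<rho> \<psi> \<tau> G u w" by (rule frame_at)
  note d = frameD(1)[OF f] note \<rho> = discD(1)[OF d]
  define y where "y z = matrix_inv G *v vector [u z, w z, 1]" for z
  have y: "y z \<noteq> 0" for z unfolding y_def by (rule frameD(6)[OF f])
  have \<nu>y: "\<nu> (\<psi> z) = pt (y z)" if "z \<in> ball 0 \<rho>" for z unfolding y_def by (rule frameD(5)[OF f that])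
  obtain b where b: "bil b (y 0) \<noteq> 0"
    using bil_nondegenerate[of "y 0"] y[of 0] by (auto simp: bil_commute)
  obtain j where j: "l0 \<in> pdom j" using pdom_ex by blast
  define a where "a l = psec j (pchart j l)" for l
  have a: "a l \<noteq> 0" "l \<in> pdom j \<Longrightarrow> pt (a l) = l" for l by (simp_all add: a_def psec_nz pt_psec_pchart)
  define t where "t q = \<tau> (g\<^sub>0 (fst q))" for q :: "proj2 \<times> proj2"
  define c where "c q = bil b (y (t q)) *s a (snd q) - bil (a (snd q)) (y (t q)) *s b" for q
  have cg0: "continuous_on W\<^sub>0 g\<^sub>0" using g0 by (simp add: hol_map_def)
  define W1 where "W1 = (W\<^sub>0 \<inter> g\<^sub>0 -` (\<psi> ` ball 0 \<rho>)) \<times> pdom j"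
  have oW1: "open W1"
    unfolding W1_def by (intro open_Times open_pdom continuous_open_preimage[OF cg0 W0(1) discD(3)[OF d]])
  have hg: "hol_map PP2 A W1 (\<lambda>q. g\<^sub>0 (fst q))"
  proof (rule hol_map_compose[OF PP2(1) complex_manifold_proj2 _ _ g0])
    show "mopen PP2 W1" using oW1 by simp
    show "hol_map PP2 proj2_atlas W1 fst" by (rule hol_map_subset[OF hol_map_PP2_fst(1)]) simp
    show "fst ` W1 \<subseteq> W\<^sub>0" by (auto simp: W1_def)
  qed
  have tW: "t q \<in> ball 0 \<rho>" "\<psi> (t q) = g\<^sub>0 (fst q)" if q: "q \<in> W1" for q
  proof -
    obtain z where z: "z \<in> ball 0 \<rho>" "g\<^sub>0 (fst q) = \<psi> z" using q by (auto simp: W1_def)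
    then show "t q \<in> ball 0 \<rho>" "\<psi> (t q) = g\<^sub>0 (fst q)" using discD(5)[OF d z(1)] by (simp_all add: t_def)
  qed
  have hc: "holat PP2 (\<lambda>q. c q $ i) q" if q: "q \<in> W1" for q i
  proof -
    interpret function_ring "\<lambda>f. holat PP2 f q" by (rule holat_ring)
    have "holat A \<tau> (g\<^sub>0 (fst q))" using discD(6)[OF d tW(1)[OF q]] tW(2)[OF q] by simp
    then have ht: "holat PP2 t q"
      unfolding t_def using holat_compose[OF PP2(1) A _ q hg] oW1 by simp
    have hy: "holat PP2 (\<lambda>q. y (t q) $ k) q" for k
    proof -
      have "(\<lambda>z. y z $ k) holomorphic_on ball 0 \<rho>"
        unfolding y_def by (rule holomorphic_on_vector_3[OF frameD(3,4)[OF f]])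
      from holat_field[OF PP2(1) ht holomorphic_derivI[OF this open_ball tW(1)[OF q]]] show ?thesis .
    qed
    have ha: "holat PP2 (\<lambda>q. a (snd q) $ k) q" for k
      unfolding a_def by (rule holat_PP2(2)[where h="\<lambda>l. psec j (pchart j l) $ k"], rule holat_psec) (use q in \<open>auto simp: W1_def\<close>)
    show ?thesis
      unfolding c_def bil_3 vector_minus_component vector_smult_component by (intro add diff mult const hy ha)
  qed
  define W where "W = W1 \<inter> c -` (- {0})"
  have "continuous_on W1 (\<lambda>q. c q $ i)" for i
    using hc oW1 by (intro holat_continuous_on[OF PP2(1)]) auto
  then have "continuous_on W1 c" by (rule continuous_on_vecI)
  then have oW: "open W" unfolding W_def by (intro continuous_open_preimage oW1) auto
  have mW: "mopen PP2 W" using oW by simp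
  define g where "g q = (g\<^sub>0 (fst q), pt (c q))" for q
  have bc: "bil (c q) (y (t q)) = 0" for q by (simp add: c_def bil_linear)
  have gZ: "g ` W \<subseteq> Z"
  proof (rule image_subsetI)
    fix q assume q: "q \<in> W"
    have 1: "q \<in> W1" and 2: "c q \<noteq> 0" using q by (simp_all add: W_def)
    have "\<nu> (g\<^sub>0 (fst q)) = pt (y (t q))" using \<nu>y[OF tW(1)[OF 1]] unfolding tW(2)[OF 1] .
    then show "g q \<in> Z" using incident_pt[OF y 2] bc by (simp add: g_def in_Z)
  qed
  have "hol_map PP2 AP W g"
    unfolding g_def
  proof (rule hol_map_Pair[OF A complex_manifold_proj2 PP2(1) mW])
    show "hol_map PP2 A W (\<lambda>q. g\<^sub>0 (fst q))" by (rule hol_map_subset[OF hg]) (auto simp: W_def)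
    show "hol_map PP2 proj2_atlas W (\<lambda>q. pt (c q))"
      by (rule hol_map_pt[OF PP2(1) mW]) (use hc in \<open>auto simp: W_def\<close>)
  qed
  then have hgZ: "hol_map PP2 ZA W g"
    by (rule hol_map_into_induced[OF AP dc_atlas_def mfd_points_ZA PP2(1) mW]) (rule gZ)
  have "(P0, l0) \<in> W"
  proof -
    have t0: "t (P0, l0) = 0" using discD(2)[OF d] discD(5)[OF d, of 0] \<rho> gp by (simp add: t_def)
    have "P0 = pt (y 0)" using \<nu>y[of 0] \<rho> discD(2)[OF d] p(1) by simp
    then have "bil (a l0) (y 0) = 0" using l incident_pt[OF y a(1)] a(2)[OF j] by metis
    then have "c (P0, l0) = bil b (y 0) *s a l0" by (simp add: c_def t0)
    then have "c (P0, l0) \<noteq> 0" using b a(1)[of l0] by (auto simp: vec_eq_iff)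
    moreover have "p \<in> \<psi> ` ball 0 \<rho>" by (rule disc_centre[OF d])
    ultimately show ?thesis using W0(2) gp j by (simp add: W_def W1_def)
  qed
  moreover have "g (dc_normalization \<nu> q) = q"
    if q: "q \<in> Z - dc_normalization \<nu> -` {(P, l). P \<in> N \<and> incident P l}" "dc_normalization \<nu> q \<in> W" for q
  proof -
    obtain p' l' where pl: "q = (p', l')" by (cases q)
    have inc: "incident (\<nu> p') l'" and pN: "\<nu> p' \<notin> N" using q(1) by (auto simp: pl in_Z dcn)
    have W': "(\<nu> p', l') \<in> W" using q(2) by (simp add: pl dcn)
    then have 1: "(\<nu> p', l') \<in> W1" and 2: "c (\<nu> p', l') \<noteq> 0" by (simp_all add: W_def)
    have g0p: "g\<^sub>0 (\<nu> p') = p'" using inv pN 1 by (simp add: W1_def)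
    define s where "s = t (\<nu> p', l')"
    have "\<nu> p' = pt (y s)" using \<nu>y[OF tW(1)[OF 1]] tW(2)[OF 1] g0p by (simp add: s_def)
    moreover have l': "pt (a l') = l'" using a(2) 1 by (simp add: W1_def)
    ultimately have "bil (a l') (y s) = 0" using inc incident_pt[OF y a(1)] by metis
    then have c: "c (\<nu> p', l') = bil b (y s) *s a l'" by (simp add: c_def s_def)
    then have "bil b (y s) \<noteq> 0" using 2 by auto
    then have "pt (c (\<nu> p', l')) = l'" unfolding c pt_scale by (rule pt_scale[THEN trans, OF _ l'])
    then show ?thesis using g0p by (simp add: g_def pl dcn)
  qed
  ultimately show ?thesis using that[OF oW _ hgZ] by blast
qed

text \<open>The exceptional set N of \<nu> is replaced by the incident pairs over it, outside which
  \<open>local_inverse\<close> applies.\<close>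

lemma is_normalization_dcn: "is_normalization ZA PP2 X (dc_normalization \<nu>)"
proof -
  obtain N where N: "analytic_subset proj2_atlas UNIV N" "N \<subseteq> C" "UNIV \<subseteq> closure (UNIV - \<nu> -` N)"
    and inv: "\<forall>x\<in>C - N. \<exists>W g. mopen proj2_atlas W \<and> x \<in> W \<and> hol_map proj2_atlas A W g \<and> (\<forall>q\<in>UNIV - \<nu> -` N. \<nu> q \<in> W \<longrightarrow> g (\<nu> q) = q)"
    using norm unfolding is_normalization_def AU mfd_points_proj2 by (elim conjE exE) blast
  define N' where "N' = {(P, l). P \<in> N \<and> incident P l}"
  have "N' = fst -` N \<inter> {(P, l). incident P l}" by (auto simp: N'_def)
  then have an: "analytic_subset PP2 UNIV N'"
    using analytic_subset_Int[OF analytic_subset_fst[OF N(1)] analytic_incidence] by simp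
  have Zd: "Z \<subseteq> closure (Z - dc_normalization \<nu> -` N')"
  proof
    fix q assume q: "q \<in> Z"
    show "q \<in> closure (Z - dc_normalization \<nu> -` N')"
      unfolding closure_iff_nhds_not_empty
    proof (intro allI impI notI)
      fix S V assume V: "V \<subseteq> S" "open V" "q \<in> V" "(Z - dc_normalization \<nu> -` N') \<inter> S = {}"
      obtain q' where "q' \<in> Z" "q' \<in> V" "\<nu> (fst q') \<notin> N" by (rule dense_preimage[OF N(3) q V(2,3)])
      then show False using V(1,4) by (auto simp: dcn N'_def)
    qed
  qed
  have "dc_normalization \<nu> ` closure (Z - dc_normalization \<nu> -` N') \<subseteq> closure (X - N')"
  proof (rule image_closure_subset)
    show "dc_normalization \<nu> ` (Z - dc_normalization \<nu> -` N') \<subseteq> closure (X - N')"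
      using dcn_image closure_subset by blast
  qed (auto intro: continuous_on_subset[OF continuous_dcn])
  then have Xd: "X \<subseteq> closure (X - N')" using dcn_image Zd by blast
  have loc: "\<exists>W g. mopen PP2 W \<and> x \<in> W \<and> hol_map PP2 ZA W g \<and>
      (\<forall>q\<in>Z - dc_normalization \<nu> -` N'. dc_normalization \<nu> q \<in> W \<longrightarrow> g (dc_normalization \<nu> q) = q)" if x: "x \<in> X - N'" for x
  proof -
    obtain P l where pl: "x = (P, l)" by (cases x)
    have P: "P \<in> C - N" and l: "incident P l" using x by (auto simp: pl N'_def incidence_surface_def)
    obtain W0 g0 where W0: "mopen proj2_atlas W0" "P \<in> W0" "hol_map proj2_atlas A W0 g0" "\<forall>q\<in>UNIV - \<nu> -` N. \<nu> q \<in> W0 \<longrightarrow> g0 (\<nu> q) = q"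
      using bspec[OF inv P] by (elim exE conjE)
    obtain p where p: "\<nu> p = P" using P range_\<nu> by blast
    obtain W g where "open W" "(P, l) \<in> W" "hol_map PP2 ZA W g"
      "\<forall>q\<in>Z - dc_normalization \<nu> -` {(P, l). P \<in> N \<and> incident P l}. dc_normalization \<nu> q \<in> W \<longrightarrow> g (dc_normalization \<nu> q) = q"
      by (rule local_inverse[OF W0(1)[simplified] W0(2-4) p _ l]) (use P in auto)
    then show ?thesis unfolding N'_def pl by (intro exI[of _ W] exI[of _ g]) simp
  qed
  have "N' \<subseteq> X" using N(2) by (auto simp: N'_def incidence_surface_def)
  then show ?thesis
    unfolding is_normalization_def mfd_points_ZA PP2(2)
    by (intro conjI complex_manifold_ZA hol_map_dcn dcn_image finite_map_dcn exI[where x=N'] an Xd Zd) (assumption, rule ballI, rule loc)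
qed

end

section \<open>Irreducible components and inflection points\<close>

lemma hasord_deriv:
  assumes f: "f holomorphic_on ball 0 \<rho>" "\<rho> > 0" "hasord f n" and n: "n \<ge> 1"
  shows "hasord (deriv f) (n - 1)"
proof -
  obtain r g where g: "0 < r" "r \<le> \<rho>" "g holomorphic_on ball 0 r" "\<And>z. z \<in> ball 0 r \<Longrightarrow> f z = z ^ n * g z" "\<And>z. z \<in> ball 0 r \<Longrightarrow> g z \<noteq> 0"
    by (rule hasord_factor[OF f]) blast
  have d: "deriv f z = z ^ (n - 1) * (of_nat n * g z + z * deriv g z)" if z: "z \<in> ball 0 r" for z
  proof -
    have "((\<lambda>z. z ^ n * g z) has_field_derivative of_nat n * z ^ (n - 1) * g z + z ^ n * deriv g z) (at z)"
      by (rule derivative_eq_intros holomorphic_derivI[OF g(3) open_ball z] refl | simp)+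
    then have "(f has_field_derivative of_nat n * z ^ (n - 1) * g z + z ^ n * deriv g z) (at z)"
      by (rule has_field_derivative_transform_within_open[OF _ open_ball z]) (simp add: g(4))
    moreover have "z ^ n = z ^ (n - 1) * z" using n power_minus_mult[of n z] by simp
    ultimately show ?thesis by (simp add: DERIV_imp_deriv algebra_simps)
  qed
  show ?thesis
    by (rule hasord_factorI[where g="\<lambda>z. of_nat n * g z + z * deriv g z", OF g(1) _ d])
       (use g n in \<open>auto intro!: holomorphic_intros holomorphic_deriv\<close>)
qed

section \<open>Irreducible components of the surface\<close>

context dualizable_curve
begin

text \<open>The lines through a point are the image of the punctured plane of their first two
  coefficients, the third being determined by incidence.\<close>

lemma fibre_connected: "connected {l. incident (\<nu> p) l}" "{l. incident (\<nu> p) l} \<noteq> {}"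
proof -
  obtain G \<rho> \<psi> \<tau> u w where f: "frm p \<rho> \<psi> \<tau> G u w" by (rule frame_at)
  note d = frameD(1)[OF f] note G = frameD(2)[OF f]
  define b where "b x = (vector [x $ 1, x $ 2, - (x $ 1 * u 0 + x $ 2 * w 0)] :: complex^3)" for x :: "complex^2"
  have b0: "b x \<noteq> 0" if "x \<noteq> 0" for x using that by (auto simp: b_def vec_eq_iff forall_2 forall_3)
  have inc: "incident (\<nu> p) (pt (c v* G)) \<longleftrightarrow> c $ 1 * u 0 + c $ 2 * w 0 + c $ 3 = 0" if "c \<noteq> 0" for c
    using frame_incident[OF f _ that, of 0] discD(1,2)[OF d] by simp
  have "{l. incident (\<nu> p) l} = (\<lambda>x. pt (b x v* G)) ` (- {0})"
  proof
    show "(\<lambda>x. pt (b x v* G)) ` (- {0}) \<subseteq> {l. incident (\<nu> p) l}" using inc[OF b0] by (auto simp: b_def)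
    show "{l. incident (\<nu> p) l} \<subseteq> (\<lambda>x. pt (b x v* G)) ` (- {0})"
    proof
      fix l assume l: "l \<in> {l. incident (\<nu> p) l}"
      obtain c where c: "c \<noteq> 0" "l = pt (c v* G)" by (rule pt_row_cases[OF G])
      then have c3: "c $ 3 = - (c $ 1 * u 0 + c $ 2 * w 0)" using l inc[OF c(1)] by (simp add: add_eq_0_iff add.commute)
      have cb: "c = b (vector [c $ 1, c $ 2])" using c3 by (simp add: b_def vec_eq_iff forall_3)
      have "l = pt (b (vector [c $ 1, c $ 2]) v* G)" by (subst cb[symmetric]) (rule c(2))
      moreover have "vector [c $ 1, c $ 2] \<in> - {0 :: complex^2}" using c(1) c3 by (auto simp: vec_eq_iff forall_2 forall_3)
      ultimately show "l \<in> (\<lambda>x. pt (b x v* G)) ` (- {0})" by (rule image_eqI)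
    qed
  qed
  moreover have "connected ((\<lambda>x. pt (b x v* G)) ` (- {0}))"
  proof (rule connected_continuous_image)
    have "continuous_on (- {0}) (\<lambda>x. b x v* G)"
      unfolding vector_matrix_mult_def b_def
      by (rule continuous_on_vecI) (auto simp: sum_3 intro!: continuous_intros continuous_on_component)
    then show "continuous_on (- {0}) (\<lambda>x. pt (b x v* G))"
      by (rule continuous_on_compose2[OF continuous_on_pt], intro image_subsetI) (use b0 in \<open>simp add: vector_matrix_mult_0[OF G]\<close>)
    show "connected (- {0 :: complex^2})" by (rule connected_punctured_universe) simp
  qed
  ultimately show "connected {l. incident (\<nu> p) l}" by simp
  have "axis 1 1 \<in> - {0 :: complex^2}" by (simp add: axis_eq_0_iff)
  then show "{l. incident (\<nu> p) l} \<noteq> {}" using \<open>{l. incident (\<nu> p) l} = _\<close> by blast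
qed

definition zcomp :: "'a set \<Rightarrow> ('a \<times> proj2) set" where "zcomp S = Z \<inter> S \<times> UNIV"

lemma zcomp_nonempty:
  assumes "p \<in> S" obtains l where "(p, l) \<in> zcomp S"
  using fibre_connected(2)[of p] assms by (auto simp: zcomp_def in_Z)

text \<open>The projection to S has connected fibres, and by compactness it maps closed sets to
  closed sets. A splitting of the total space would put each fibre on one side and so split
  S.\<close>

lemma connected_zcomp:
  assumes S: "S \<in> components UNIV" shows "connected (zcomp S)"
  unfolding connected_closed
proof (rule notI, elim exE conjE)
  fix T T' assume T: "closed T" "closed T'" "zcomp S \<subseteq> T \<union> T'" "T \<inter> T' \<inter> zcomp S = {}" "T \<inter> zcomp S \<noteq> {}" "T' \<inter> zcomp S \<noteq> {}"
  have cl: "closed (fst ` (E \<inter> zcomp S))" if "closed E" for E :: "('a \<times> proj2) set"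
  proof -
    have "closed (E \<inter> S \<times> UNIV)" using that components_clopen(2)[OF S] by (intro closed_Int closed_Times closed_UNIV)
    then have "compact (Z \<inter> (E \<inter> S \<times> UNIV))" by (rule compact_Z_Int)
    then have "compact (fst ` (Z \<inter> (E \<inter> S \<times> UNIV)))"
      by (intro compact_continuous_image continuous_on_fst continuous_on_id)
    moreover have "Z \<inter> (E \<inter> S \<times> UNIV) = E \<inter> zcomp S" by (auto simp: zcomp_def)
    ultimately show ?thesis by (simp add: compact_imp_closed)
  qed
  have "S \<subseteq> fst ` (T \<inter> zcomp S) \<union> fst ` (T' \<inter> zcomp S)"
  proof
    fix p assume "p \<in> S"
    then obtain l where l: "(p, l) \<in> zcomp S" by (rule zcomp_nonempty)
    then have "(p, l) \<in> T \<or> (p, l) \<in> T'" using T(3) by blast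
    then show "p \<in> fst ` (T \<inter> zcomp S) \<union> fst ` (T' \<inter> zcomp S)" using l by force
  qed
  moreover have "fst ` (T \<inter> zcomp S) \<inter> fst ` (T' \<inter> zcomp S) \<inter> S = {}"
  proof (rule ccontr)
    assume "fst ` (T \<inter> zcomp S) \<inter> fst ` (T' \<inter> zcomp S) \<inter> S \<noteq> {}"
    then obtain p l l' where p: "(p, l) \<in> T" "(p, l) \<in> zcomp S" "(p, l') \<in> T'" "(p, l') \<in> zcomp S" by force
    define E where "E = (\<lambda>l. (p, l)) ` {l. incident (\<nu> p) l}"
    have "connected E" unfolding E_def by (intro connected_continuous_image fibre_connected continuous_intros)
    moreover have ES: "E \<subseteq> zcomp S" using p(2) by (auto simp: E_def zcomp_def in_Z)
    moreover have "(p, l) \<in> E" "(p, l') \<in> E" using p(2,4) by (auto simp: E_def zcomp_def in_Z)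
    ultimately show False using connected_closedD[of E T T'] T(1-4) p(1,3) by blast
  qed
  ultimately have "fst ` (T \<inter> zcomp S) \<inter> S = {} \<or> fst ` (T' \<inter> zcomp S) \<inter> S = {}"
    by (intro connected_closedD components_clopen(3)[OF S] cl T(1,2))
  then show False using T(5,6) by (force simp: zcomp_def)
qed

lemma mopen_zcomp: "open S \<Longrightarrow> mopen ZA (zcomp S)"
  unfolding mopen_def mfd_points_ZA zcomp_def by (intro openin_open_Int open_Times open_UNIV)

lemma mopen_Z: "mopen ZA Z"
  by (simp add: mopen_def mfd_points_ZA)

lemma analytic_zcomp:
  assumes S: "open S" "closed S" shows "analytic_subset ZA Z (zcomp S)"
proof (rule analytic_subsetI[OF mopen_Z])
  show "zcomp S \<subseteq> Z" by (simp add: zcomp_def)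
  fix q assume q: "q \<in> Z"
  show "\<exists>U H. mopen ZA U \<and> q \<in> U \<and> U \<subseteq> Z \<and> finite H \<and> (\<forall>h\<in>H. hol_fun ZA U h) \<and> zcomp S \<inter> U = {y \<in> U. \<forall>h\<in>H. h y = 0}"
  proof (cases "fst q \<in> S")
    case True
    then show ?thesis using q mopen_zcomp[OF S(1)] by (intro exI[of _ "zcomp S"] exI[of _ "{}"]) (auto simp: zcomp_def mem_Times_iff)
  next
    case False
    have "mopen ZA (zcomp (- S))" by (rule mopen_zcomp[OF open_Compl[OF S(2)]])
    moreover have "hol_fun ZA (zcomp (- S)) (\<lambda>_. 1)" by (simp add: hol_fun_iff function_ring.const[OF holat_ring])
    ultimately show ?thesis
      using q False by (intro exI[of _ "zcomp (- S)"] exI[of _ "{\<lambda>_. 1}"]) (auto simp: zcomp_def mem_Times_iff)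
  qed
qed

text \<open>If M is not the whole set, N contains the nonempty open complement of M, and the
  identity theorem on the connected set makes N the whole set.\<close>

lemma irreducible_zcomp:
  assumes S: "S \<in> components UNIV" shows "irreducible_set (analytic_subset ZA Z) (zcomp S)"
  unfolding irreducible_set_def
proof (intro conjI allI impI)
  note c = components_clopen[OF S]
  show "analytic_subset ZA Z (zcomp S)" by (rule analytic_zcomp[OF c(1,2)])
  obtain p where "p \<in> S" using c(4) by blast
  then show "zcomp S \<noteq> {}" by (rule zcomp_nonempty) blast
  fix M N assume MN: "analytic_subset ZA Z M \<and> analytic_subset ZA Z N \<and> zcomp S = M \<union> N"
  note m = mopen_zcomp[OF c(1)]
  have sub: "zcomp S \<subseteq> Z" by (simp add: zcomp_def)
  have "M \<inter> zcomp S = M" "N \<inter> zcomp S = N" using MN by blast+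
  then have an: "analytic_subset ZA (zcomp S) M" "analytic_subset ZA (zcomp S) N"
    using analytic_subset_restrict[OF _ m sub] MN by metis+
  have "mopen ZA (zcomp S - M)" by (rule analytic_subset_Diff_open[OF complex_manifold_ZA an(1)])
  moreover have "zcomp S - M \<subseteq> N" using MN by blast
  ultimately have "zcomp S - M = {} \<or> N = zcomp S"
    using analytic_subset_identity[OF complex_manifold_ZA connected_zcomp[OF S] an(2)] by blast
  then show "zcomp S = M \<or> zcomp S = N" using MN by blast
qed

lemma irr_components_Z:
  "irr_components (analytic_subset ZA Z) Z = zcomp ` components UNIV"
  "card (irr_components (analytic_subset ZA Z) Z) = card (components (UNIV :: 'a set))"
proof -
  have "(\<Union>S\<in>components UNIV. zcomp S) = Z \<inter> (\<Union> (components UNIV)) \<times> UNIV" unfolding zcomp_def by blast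
  also have "\<Union> (components (UNIV :: 'a set)) = UNIV" by simp
  finally have un: "(\<Union>S\<in>components UNIV. zcomp S) = Z" by simp
  have ne: "S = S'" if S: "S \<in> components UNIV" "S' \<in> components UNIV" "zcomp S \<subseteq> zcomp S'" for S S'
  proof -
    obtain p where p: "p \<in> S" using components_clopen(4)[OF S(1)] by blast
    then obtain l where "(p, l) \<in> zcomp S" by (rule zcomp_nonempty)
    then have "p \<in> S \<inter> S'" using S(3) p by (auto simp: zcomp_def)
    then show ?thesis using components_nonoverlap[OF S(1,2)] by blast
  qed
  note fam = irr_components_family[of "analytic_subset ZA Z", OF analytic_subset_empty[OF mopen_Z] analytic_subset_Int analytic_subset_Un
      finite_components irreducible_zcomp un ne]
  show "irr_components (analytic_subset ZA Z) Z = zcomp ` components UNIV"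
    "card (irr_components (analytic_subset ZA Z) Z) = card (components (UNIV :: 'a set))"
    by (rule fam; assumption)+
qed

section \<open>Inflection points\<close>

lemma branch_orders: "1 \<le> branch_mult A \<nu> p" "branch_mult A \<nu> p < tangent_mult A \<nu> p" "incident (\<nu> p) (tangent_line A \<nu> p)"
proof -
  obtain \<rho> \<psi> \<tau> G u where nf: "nframe A \<nu> p \<rho> \<psi> \<tau> G u (branch_mult A \<nu> p) (tangent_mult A \<nu> p)" and tl: "tangent_line A \<nu> p = pt (G $ 1)"
    by (rule nframe_at)
  then show rs: "1 \<le> branch_mult A \<nu> p" "branch_mult A \<nu> p < tangent_mult A \<nu> p" by (simp_all add: nframe_def)
  have f: "frm p \<rho> \<psi> \<tau> G u (\<lambda>z. z ^ branch_mult A \<nu> p)" using nf by (simp add: nframe_def)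
  show "incident (\<nu> p) (tangent_line A \<nu> p)"
    using frame_incident_lin[OF f, of 0 0 0] nframe_0[OF nf] discD(1,2)[OF frameD(1)[OF f]] by (simp add: tl lin_row)
qed

lemma vord_values:
  assumes b: "b \<noteq> 0" and v: "vord A \<nu> p b n"
  shows "n = 0 \<or> n = branch_mult A \<nu> p \<or> n = tangent_mult A \<nu> p"
proof -
  obtain \<rho> \<psi> \<tau> G u where nf: "nframe A \<nu> p \<rho> \<psi> \<tau> G u (branch_mult A \<nu> p) (tangent_mult A \<nu> p)" by (rule nframe_at)
  show ?thesis using nframe_vord_values[OF nf b v] by simp
qed

text \<open>In a normal frame v = u' / z^(r - 1) is r times the slope du/dw of the tangent. Its
  derivative has no zero near 0 except possibly 0 itself, and where it is nonzero the contact orders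
  1 and 2 both occur, so that s = 2.\<close>

lemma inflection_isolated:
  obtains U where "open U" "p \<in> U" "U \<inter> inflection_points A \<nu> \<subseteq> {p}"
proof -
  define r s where "r = branch_mult A \<nu> p" and "s = tangent_mult A \<nu> p"
  obtain \<rho> \<psi> \<tau> G u where nf: "nframe A \<nu> p \<rho> \<psi> \<tau> G u r s" unfolding r_def s_def by (rule nframe_at)
  have f: "frm p \<rho> \<psi> \<tau> G u (\<lambda>z. z ^ r)" and rs: "1 \<le> r" "r < s" and os: "hasord u s" using nf by (auto simp: nframe_def)
  note d = frameD(1)[OF f] note G = frameD(2)[OF f] note \<rho> = discD(1)[OF d] note hu = frameD(3)[OF f]
  have "hasord (deriv u) (s - 1)" by (rule hasord_deriv[OF hu \<rho> os]) (use rs in simp)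
  then obtain r1 k where k: "0 < r1" "r1 \<le> \<rho>" "k holomorphic_on ball 0 r1"
    "\<And>z. z \<in> ball 0 r1 \<Longrightarrow> deriv u z = z ^ (s - 1) * k z" "\<And>z. z \<in> ball 0 r1 \<Longrightarrow> k z \<noteq> 0"
    using hasord_factor[OF holomorphic_deriv[OF hu open_ball] \<rho>] by metis
  define v where "v z = z ^ (s - r) * k z" for z
  have hv: "v holomorphic_on ball 0 r1" unfolding v_def by (intro holomorphic_intros k(3))
  have uv: "deriv u z = z ^ (r - 1) * v z" if "z \<in> ball 0 r1" for z
    using k(4)[OF that] rs by (simp add: v_def flip: power_add mult.assoc)
  have "hasord v (s - r)" by (rule hasord_factorI[OF k(1,3)]) (use k in \<open>auto simp: v_def\<close>)
  then have "hasord (deriv v) (s - r - 1)" by (rule hasord_deriv[OF hv k(1)]) (use rs in simp)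
  from hasord_eventually_nonzero[OF this] obtain r2 where r2: "r2 > 0" "\<And>z. z \<noteq> 0 \<Longrightarrow> dist z 0 < r2 \<Longrightarrow> deriv v z \<noteq> 0"
    unfolding eventually_at by blast
  define e where "e = min r1 r2"
  have e: "0 < e" "e \<le> r1" "e \<le> r2" "e \<le> \<rho>" using k(1,2) r2(1) by (auto simp: e_def)
  have main: "\<psi> t \<notin> inflection_points A \<nu>" if t: "t \<in> ball 0 e" "t \<noteq> 0" for t
  proof -
    have t\<rho>: "t \<in> ball 0 \<rho>" and t1: "t \<in> ball 0 r1" using t(1) e by auto
    obtain r' \<tau>' where r': "0 < r'" and f': "frm (\<psi> t) r' (\<lambda>z. \<psi> (t + z)) \<tau>' G (\<lambda>z. u (t + z)) (\<lambda>z. (t + z) ^ r)"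
      by (rule frame_recentre[OF f t\<rho>])
    have shift: "((\<lambda>z. h (t + z)) has_field_derivative D) (at 0)" if "(h has_field_derivative D) (at t)" for h D
      using DERIV_shift_left[of h D t 0] that by simp
    \<comment> \<open>The line w = t^r through the nearby point; it has contact order 1 because t is
      nonzero.\<close>
    define b1 where "b1 = (vector [0, 1, - (t ^ r)] :: complex^3)"
    have b1: "b1 \<noteq> 0" by (simp add: b1_def vec_eq_iff forall_3)
    have "((\<lambda>z. z ^ r - t ^ r) has_field_derivative of_nat r * t ^ (r - 1)) (at t)"
      by (rule derivative_eq_intros refl | simp)+
    from shift[OF this] have "hasord (\<lambda>z. (t + z) ^ r - t ^ r) 1"
      by (rule hasord_derivI) (use rs t(2) in auto)
    then have v1: "vord A \<nu> (\<psi> t) (b1 v* G) 1" unfolding vord_frame[OF f'] by (simp add: b1_def)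
    \<comment> \<open>The slope du/dw at t. Then \<open>b2\<close> is the tangent line there and
      \<phi> its equation along the branch.\<close>
    define c where "c = v t / of_nat r"
    define b2 where "b2 = (vector [1, - c, c * t ^ r - u t] :: complex^3)"
    have b2: "b2 \<noteq> 0" by (simp add: b2_def vec_eq_iff forall_3)
    define \<phi> where "\<phi> z = u (t + z) - c * (t + z) ^ r + (c * t ^ r - u t)" for z
    obtain n where n: "vord A \<nu> (\<psi> t) (b2 v* G) n" using vord_ex[of "b2 v* G" "\<psi> t"] b2 vector_matrix_mult_0[OF G] by blast
    then have o\<phi>: "hasord \<phi> n" unfolding vord_frame[OF f'] by (simp add: b2_def \<phi>_def[abs_def])
    define e' where "e' = min r' (r1 - norm t)"
    have e': "e' > 0" using r' t1 by (simp add: e'_def)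
    have in1: "t + z \<in> ball 0 r1" if "z \<in> ball 0 e'" for z using that norm_triangle_ineq[of t z] by (simp add: e'_def)
    have "(\<lambda>z. u (t + z)) holomorphic_on ball 0 e'" by (rule holomorphic_on_subset[OF frameD(3)[OF f']]) (auto simp: e'_def)
    then have h\<phi>: "\<phi> holomorphic_on ball 0 e'" unfolding \<phi>_def by (intro holomorphic_intros)
    have "n \<noteq> 0" using hasord_0D[of \<phi>, OF _ holomorphic_isCont_0[OF h\<phi> e']] o\<phi> by (cases "n = 0") (simp_all add: \<phi>_def)
    then have n1: "n \<ge> 1" by simp
    have d\<phi>: "deriv \<phi> z = (t + z) ^ (r - 1) * (v (t + z) - v t)" if z: "z \<in> ball 0 e'" for z
    proof -
      have du: "(u has_field_derivative deriv u (t + z)) (at (t + z))"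
        using holomorphic_derivI[OF hu open_ball] in1[OF z] k(2) by auto
      have du': "((\<lambda>z. u (t + z)) has_field_derivative deriv u (t + z)) (at z)"
        using DERIV_shift_left[OF du] .
      have "((\<lambda>z. c * (t + z) ^ r) has_field_derivative c * (of_nat r * (t + z) ^ (r - 1))) (at z)"
        by (rule derivative_eq_intros refl | simp)+
      from DERIV_add[OF DERIV_diff[OF du' this] DERIV_const[where k="c * t ^ r - u t"]]
      have "(\<phi> has_field_derivative deriv u (t + z) - c * (of_nat r * (t + z) ^ (r - 1))) (at z)"
        by (simp add: \<phi>_def[abs_def])
      then have "deriv \<phi> z = deriv u (t + z) - c * (of_nat r * (t + z) ^ (r - 1))" by (rule DERIV_imp_deriv)
      also have "\<dots> = (t + z) ^ (r - 1) * (v (t + z) - v t)"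
        using rs by (simp add: uv[OF in1[OF z]] c_def algebra_simps)
      finally show ?thesis .
    qed
    have "t \<in> ball 0 r2" using t(1) e(3) by simp
    then have "deriv v t \<noteq> 0" using r2(2) t(2) by simp
    moreover have "((\<lambda>z. v z - v t) has_field_derivative deriv v t) (at t)"
      by (rule derivative_eq_intros holomorphic_derivI[OF hv open_ball t1] refl | simp)+
    ultimately have "hasord (\<lambda>z. v (t + z) - v t) 1" using hasord_derivI[OF shift, of "\<lambda>z. v z - v t" "deriv v t"] by simp
    moreover have "hasord (\<lambda>z. (t + z) ^ (r - 1)) 0"
      by (rule hasord_0I) (use t(2) in \<open>auto intro!: continuous_intros\<close>)
    ultimately have "hasord (\<lambda>z. (t + z) ^ (r - 1) * (v (t + z) - v t)) 1" using hasord_mult[of "\<lambda>z. (t + z) ^ (r - 1)" 0 "\<lambda>z. v (t + z) - v t" 1] by simp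
    moreover have "eventually (\<lambda>z. deriv \<phi> z = (t + z) ^ (r - 1) * (v (t + z) - v t)) (at 0)"
      unfolding eventually_at using d\<phi> e' by (intro exI[of _ e']) auto
    ultimately have "hasord (deriv \<phi>) 1" by (simp only: hasord_cong)
    then have "n - 1 = 1" using hasord_unique[OF hasord_deriv[OF h\<phi> e' o\<phi> n1]] by simp
    then have "n = 2" by simp
    then have v2: "vord A \<nu> (\<psi> t) (b2 v* G) 2" using n by simp
    have "b1 v* G \<noteq> 0" "b2 v* G \<noteq> 0" using b1 b2 by (simp_all add: vector_matrix_mult_0[OF G])
    \<comment> \<open>Both 1 and 2 lie in {0, r, s}, and 1 \<le> r < s leaves r = 1 and s =
      2.\<close>
    then have "1 = branch_mult A \<nu> (\<psi> t) \<or> 1 = tangent_mult A \<nu> (\<psi> t)" "2 = branch_mult A \<nu> (\<psi> t) \<or> 2 = tangent_mult A \<nu> (\<psi> t)"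
      using vord_values[OF _ v1] vord_values[OF _ v2] by auto
    then have "tangent_mult A \<nu> (\<psi> t) = 2" using branch_orders(1,2)[of "\<psi> t"] by linarith
    then show ?thesis by (simp add: inflection_points_def)
  qed
  have "open (\<psi> ` ball 0 e)" by (rule disc_open_image[OF A AU d open_ball]) (use e in auto)
  moreover have "p \<in> \<psi> ` ball 0 e" using discD(2)[OF d] e(1) by (auto intro!: image_eqI[of _ _ 0])
  moreover have "\<psi> ` ball 0 e \<inter> inflection_points A \<nu> \<subseteq> {p}"
  proof
    fix q assume "q \<in> \<psi> ` ball 0 e \<inter> inflection_points A \<nu>"
    then obtain t where "t \<in> ball 0 e" "q = \<psi> t" "\<psi> t \<in> inflection_points A \<nu>" by blast
    then show "q \<in> {p}" using main discD(2)[OF d] by (cases "t = 0") auto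
  qed
  ultimately show ?thesis using that by blast
qed

lemma finite_inflection_points: "finite (inflection_points A \<nu>)"
proof -
  have "\<exists>U. open U \<and> p \<in> U \<and> U \<inter> inflection_points A \<nu> \<subseteq> {p}" for p
    by (rule inflection_isolated[of p]) blast
  then show ?thesis by (intro finite_isolated[OF compact_UNIV]) auto
qed

section \<open>Loci and local degrees in terms of the section and the singular fibres\<close>

lemma section_eq: "q \<in> dc_section A \<nu> \<longleftrightarrow> snd q = tangent_line A \<nu> (fst q)"
  by (cases q) (auto simp: dc_section_def)

lemma section_subset: "dc_section A \<nu> \<subseteq> Z"
  using branch_orders(3) by (auto simp: dc_section_def in_Z)

lemma singular_fibres_eq: "singular_fibres A \<nu> = {q \<in> Z. branch_mult A \<nu> (fst q) \<ge> 2}"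
  by (auto simp: singular_fibres_def dc_fibre_def)

lemma ramification: "ramification_locus ZA proj2_atlas snd = dc_section A \<nu> \<union> singular_fibres A \<nu>"
proof (rule Set.set_eqI)
  fix q :: "'a \<times> proj2"
  have "branch_mult A \<nu> (fst q) = 1 \<longleftrightarrow> \<not> branch_mult A \<nu> (fst q) \<ge> 2" using branch_orders(1)[of "fst q"] by linarith
  then show "q \<in> ramification_locus ZA proj2_atlas snd \<longleftrightarrow> q \<in> dc_section A \<nu> \<union> singular_fibres A \<nu>"
    using local_iso_iff[of q] section_eq[of q] section_subset
    by (auto simp: ramification_locus_def mfd_points_ZA singular_fibres_eq)
qed

lemma branch: "branch_locus ZA proj2_atlas snd = dual_curve A \<nu> \<union> singular_dual_lines A \<nu>"
proof -
  have "snd ` dc_section A \<nu> = dual_curve A \<nu>" by (auto simp: dc_section_def dual_curve_def image_image)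
  moreover have "snd ` dc_fibre \<nu> p = dual_line \<nu> p" for p
    by (force simp: dc_fibre_def dual_line_def dc_space_def)
  then have "snd ` singular_fibres A \<nu> = singular_dual_lines A \<nu>"
    by (simp add: singular_fibres_def singular_dual_lines_def image_UN)
  ultimately show ?thesis by (simp add: branch_locus_def ramification image_Un)
qed

lemma degree_at:
  assumes q: "q \<in> Z"
  shows "has_local_degree ZA proj2_atlas snd q (if q \<in> dc_section A \<nu> then tangent_mult A \<nu> (fst q) else branch_mult A \<nu> (fst q))"
proof -
  obtain \<rho> \<psi> \<tau> G u w m n where f: "frm (fst q) \<rho> \<psi> \<tau> G u w" and o: "hasord (\<lambda>z. u z + m * w z) n" "n \<ge> 1"
    and l: "snd q = lin G m 0" and n: "n = (if snd q = tangent_line A \<nu> (fst q) then tangent_mult A \<nu> (fst q) else branch_mult A \<nu> (fst q))"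
    by (rule centred_frame[OF q])
  have "q = (fst q, lin G m 0)" using l by (metis prod.collapse)
  from local_degree[OF f o this] show ?thesis by (simp add: section_eq n)
qed

end

theorem theorem2:
  fixes C :: "proj2 set" and d k :: nat
    and Ci :: "nat \<Rightarrow> proj2 set" and di :: "nat \<Rightarrow> nat"
    and A :: "('a::t2_space, 1) atlas" and \<nu> :: "'a \<Rightarrow> proj2"
  assumes "reduced_plane_curve C d"
    and "bij_betw Ci {1..k} (irr_components zariski_closed C)"
    and "\<And>i. i \<in> {1..k} \<Longrightarrow> reduced_plane_curve (Ci i) (di i)"
    and "\<And>i. i \<in> {1..k} \<Longrightarrow> di i \<ge> 2"
    and "mfd_points A = UNIV"
    and "is_normalization A proj2_atlas C \<nu>"
  shows
    "let Z = dc_space \<nu>;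
         ZA = dc_atlas A \<nu>;
         f = dualizing_covering \<nu>;
         local_degree = has_local_degree ZA proj2_atlas f
     in
       (complex_manifold ZA \<and> mfd_points ZA = Z \<and>
        is_normalization ZA (prod_atlas proj2_atlas proj2_atlas)
          (incidence_surface C) (dc_normalization \<nu>) \<and>
        finite (irr_components (analytic_subset ZA Z) Z) \<and>
        card (irr_components (analytic_subset ZA Z) Z) = k \<and>
        finite_covering ZA proj2_atlas f d) \<and>
       branch_locus ZA proj2_atlas f = dual_curve A \<nu> \<union> singular_dual_lines A \<nu> \<and>
       ramification_locus ZA proj2_atlas f = dc_section A \<nu> \<union> singular_fibres A \<nu> \<and>
       (\<forall>p. \<forall>q \<in> dc_fibre \<nu> p \<inter> dc_section A \<nu>. local_degree q (tangent_mult A \<nu> p)) \<and>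
       (\<forall>p. \<forall>q \<in> dc_fibre \<nu> p - dc_section A \<nu>. local_degree q (branch_mult A \<nu> p)) \<and>
       finite (inflection_points A \<nu>) \<and>
       (\<forall>q \<in> dc_section A \<nu> - singular_fibres A \<nu>.
          fst q \<notin> inflection_points A \<nu> \<longrightarrow> local_degree q 2)"
proof -
  obtain F where F: "homogeneous d F" "squarefree F" "C = zero_locus F" "d \<ge> 1"
    using assms(1) by (auto simp: reduced_plane_curve_def)
  interpret dualizable_curve A \<nu> C d F
  proof
    show "complex_manifold A" "hol_map A proj2_atlas UNIV \<nu>" using assms(5,6) by (simp_all add: is_normalization_def)
    fix V assume "V \<in> irr_components zariski_closed C"
    then have "V \<in> Ci ` {1..k}" using assms(2) by (simp only: bij_betw_def)
    then obtain i where i: "i \<in> {1..k}" "V = Ci i" by blast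
    then show "\<exists>n\<ge>2. reduced_plane_curve V n" using assms(3,4)[OF i(1)] by blast
  qed (use assms F in auto)
  \<comment> \<open>The components of C and those of the surface are both counted by the connected
    components of the normalization.\<close>
  have k: "card (irr_components (analytic_subset ZA Z) Z) = k"
    using bij_betw_same_card[OF assms(2)] irr_components_C(2) irr_components_Z(2) by simp
  have fin: "finite (irr_components (analytic_subset ZA Z) Z)" using irr_components_Z(1) finite_components by simp
  have deg: "has_local_degree ZA proj2_atlas snd q (if q \<in> dc_section A \<nu> then tangent_mult A \<nu> p else branch_mult A \<nu> p)"
    if q: "q \<in> dc_fibre \<nu> p" for p q
  proof -
    have qZ: "q \<in> Z" and p: "fst q = p" using q by (simp_all add: dc_fibre_def)
    show ?thesis using degree_at[OF qZ] unfolding p .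
  qed
  have last: "has_local_degree ZA proj2_atlas snd q 2"
    if q: "q \<in> dc_section A \<nu> - singular_fibres A \<nu>" "fst q \<notin> inflection_points A \<nu>" for q
  proof -
    have qZ: "q \<in> Z" using q(1) section_subset by blast
    \<comment> \<open>Off the singular fibres r = 1, so s \<ge> 2, and s \<ge> 3 would make the
      point an inflection point.\<close>
    have "tangent_mult A \<nu> (fst q) = 2"
      using q qZ branch_orders(1,2)[of "fst q"] by (auto simp: singular_fibres_eq inflection_points_def)
    then show ?thesis using degree_at[OF qZ] q(1) by simp
  qed
  show ?thesis
    unfolding Let_def dualizing_covering_eq
  proof (intro conjI allI ballI impI)
    show "complex_manifold ZA" by (rule complex_manifold_ZA)
    show "mfd_points ZA = Z" by (rule mfd_points_ZA)
    show "is_normalization ZA PP2 X (dc_normalization \<nu>)" by (rule is_normalization_dcn)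
    show "finite_covering ZA proj2_atlas snd d" by (rule finite_covering_f)
    show "branch_locus ZA proj2_atlas snd = dual_curve A \<nu> \<union> singular_dual_lines A \<nu>" by (rule branch)
    show "ramification_locus ZA proj2_atlas snd = dc_section A \<nu> \<union> singular_fibres A \<nu>" by (rule ramification)
    show "finite (inflection_points A \<nu>)" by (rule finite_inflection_points)
    show "has_local_degree ZA proj2_atlas snd q (tangent_mult A \<nu> p)" if "q \<in> dc_fibre \<nu> p \<inter> dc_section A \<nu>" for p q
      using deg[of q p] that by simp
    show "has_local_degree ZA proj2_atlas snd q (branch_mult A \<nu> p)" if "q \<in> dc_fibre \<nu> p - dc_section A \<nu>" for p q
      using deg[of q p] that by simp
    show "has_local_degree ZA proj2_atlas snd q 2"
      if "q \<in> dc_section A \<nu> - singular_fibres A \<nu>" "fst q \<notin> inflection_points A \<nu>" for q by (rule last[OF that])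
  qed (rule fin k)+
qed

end
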